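(* Let $M$ be a smooth manifold of dimension $n\ge2$ and $k\in\mathbb{N}$. For $p\in\{0,n\}$ let $\mathcal{I}^k_{p,p}$ be the vector space of $\mathit{Vect}(M)$-invariant linear operators from $\mathcal{D}^k_p(M)$ to $\mathcal{D}_p(M)$. The space $\mathcal{I}^0_{0,0}$ (resp. $\mathcal{I}^0_{n,n}$) is generated by $\mathrm{id}$. If $k\ne0$, then $\mathcal{I}^k_{0,0}$ is generated by $\mathrm{id}$ and $I_0$, and $\mathcal{I}^k_{n,n}$ is generated by $\mathrm{id}$ and the conjugation operator $\mathscr{C}$.
   Context: Manifolds are second-countable, smooth, Hausdorff and connected. $\mathcal{D}^k_p=\mathcal{D}^k_p(M)$ is the space of linear differential operators of order at most $k$ from $p$-forms $\Omega^p(M)$ to $C^\infty(M)$, and $\mathcal{D}_p=\bigcup_k\mathcal{D}^k_p$. A vector field $X$ acts by $\mathcal{L}_XD=L_X\circ D-D\circ L_X$ ($L_X$ the usual Lie derivative). $\mathcal{I}^k_{p,q}$ is the space of linear maps $T:\mathcal{D}^k_p(M)\to\mathcal{D}_q(M)$ with $T(\mathcal{L}_XD)=\mathcal{L}_XT(D)$ for all $X\in\mathit{Vect}(M)$, $D\in\mathcal{D}^k_p(M)$ (no continuity or locality is assumed). The inclusion $\mathcal{D}^k_p\subset\mathcal{D}_p$ is denoted $\mathrm{id}$. $I_0:\mathcal{D}_0\to\mathcal{D}^0_0$ is $D\mapsto D(1)$, where the function $D(1)$ is regarded as the order-zero operator of multiplication by it. The conjugation operator $\mathscr{C}:\mathcal{D}^k_n\to\mathcal{D}^k_n$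 is the (globally well-defined, $\mathit{Vect}(M)$-invariant) operator characterized locally, over each chart domain $U$, by $\int_U D(f)\,g=\int_U f\,\mathscr{C}(D)(g)$ for all compactly supported $n$-forms $f,g$ on $U$ and all $D\in\mathcal{D}^k_n$ with compact support in $U$. *)

theory Defs
  imports "HOL-Analysis.Analysis" "HOL-Library.Function_Algebras"
begin

section \<open>Pointwise real vector space structure on functions\<close>

instantiation "fun" :: (type, real_vector) real_vector
begin

definition scaleR_fun_def: "scaleR c f = (\<lambda>x. c *\<^sub>R f x)"

instance
  by standard (simp_all add: scaleR_fun_def fun_eq_iff scaleR_add_right scaleR_add_left)

end

lemma scaleR_fun_apply [simp]: "(c *\<^sub>R f) x = c *\<^sub>R f x"
  by (simp add: scaleR_fun_def)


section \<open>Smooth maps between open subsets of Euclidean spaces\<close>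

primrec higher_differentiable_on ::
    "'e::euclidean_space set \<Rightarrow> ('e \<Rightarrow> 'f::euclidean_space) \<Rightarrow> nat \<Rightarrow> bool" where
  "higher_differentiable_on S f 0 \<longleftrightarrow> continuous_on S f"
| "higher_differentiable_on S f (Suc m) \<longleftrightarrow>
     (\<forall>x\<in>S. f differentiable (at x)) \<and>
     (\<forall>v. higher_differentiable_on S (\<lambda>x. frechet_derivative f (at x) v) m)"

text \<open>Only used for open \<open>S\<close>.\<close>

definition smooth_on :: "'e::euclidean_space set \<Rightarrow> ('e \<Rightarrow> 'f::euclidean_space) \<Rightarrow> bool" where
  "smooth_on S f \<longleftrightarrow> (\<forall>m. higher_differentiable_on S f m)"

text \<open>\<open>iter_deriv [v\<^sub>1, \<dots>, v\<^sub>r] f = \<partial>\<^sub>v\<^sub>1 \<cdots> \<partial>\<^sub>v\<^sub>r f\<close>\<close>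

primrec iter_deriv :: "'e::euclidean_space list \<Rightarrow> ('e \<Rightarrow> real) \<Rightarrow> 'e \<Rightarrow> real" where
  "iter_deriv [] f = f"
| "iter_deriv (v # vs) f = (\<lambda>y. frechet_derivative (iter_deriv vs f) (at y) v)"


section \<open>Smooth manifolds\<close>

text \<open>
  A manifold is a topological space given as a type \<open>'a\<close>, modelled on the Euclidean space \<open>'e\<close>
  (of dimension \<open>DIM('e)\<close>), with a maximal atlas. A chart is a pair of its domain and a
  map, whose values outside the domain are irrelevant. The Hausdorff and
  second-countability conditions are type class constraints on \<open>'a\<close>.
\<close>

type_synonym ('a, 'e) chart = "'a set \<times> ('a \<Rightarrow> 'e)"

abbreviation chart_dom :: "('a, 'e) chart \<Rightarrow> 'a set" where "chart_dom c \<equiv> fst c"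
abbreviation chart_map :: "('a, 'e) chart \<Rightarrow> 'a \<Rightarrow> 'e" where "chart_map c \<equiv> snd c"
abbreviation chart_img :: "('a, 'e) chart \<Rightarrow> 'e set" where
  "chart_img c \<equiv> chart_map c ` chart_dom c"
abbreviation chart_inv :: "('a, 'e) chart \<Rightarrow> 'e \<Rightarrow> 'a" where
  "chart_inv c \<equiv> inv_into (chart_dom c) (chart_map c)"

definition is_chart :: "('a::topological_space, 'e::euclidean_space) chart \<Rightarrow> bool" where
  "is_chart c \<longleftrightarrow> open (chart_dom c) \<and> open (chart_img c) \<and>
     homeomorphism (chart_dom c) (chart_img c) (chart_map c) (chart_inv c)"

definition smooth_compatible ::
    "('a, 'e::euclidean_space) chart \<Rightarrow> ('a, 'e) chart \<Rightarrow> bool" where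
  "smooth_compatible c c' \<longleftrightarrow>
     smooth_on (chart_map c ` (chart_dom c \<inter> chart_dom c')) (chart_map c' \<circ> chart_inv c) \<and>
     smooth_on (chart_map c' ` (chart_dom c \<inter> chart_dom c')) (chart_map c \<circ> chart_inv c')"

definition smooth_manifold ::
    "('a::{second_countable_topology, t2_space}, 'e::euclidean_space) chart set \<Rightarrow> bool" where
  "smooth_manifold A \<longleftrightarrow>
     connected (UNIV :: 'a set) \<and>
     (\<forall>c\<in>A. is_chart c) \<and>
     (\<Union>c\<in>A. chart_dom c) = UNIV \<and>
     (\<forall>c\<in>A. \<forall>c'\<in>A. smooth_compatible c c') \<and>
     (\<forall>c. is_chart c \<and> (\<forall>c'\<in>A. smooth_compatible c c') \<longrightarrow> c \<in> A)"

text \<open>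
  Each tangent space \<open>T\<^sub>xM\<close> is identified with \<open>'e\<close> by means of one chosen chart
  \<open>chart_at A x\<close> around \<open>x\<close>. Thus a vector field is a function \<open>'a \<Rightarrow> 'e\<close>, and the value at \<open>x\<close>
  of a \<open>p\<close>-form is an alternating \<open>p\<close>-linear function on \<open>'e\<close>. Smoothness is a condition on the
  components of these objects in every chart.
\<close>

definition chart_at :: "('a, 'e) chart set \<Rightarrow> 'a \<Rightarrow> ('a, 'e) chart" where
  "chart_at A x = (SOME c. c \<in> A \<and> x \<in> chart_dom c)"


section \<open>Functions, vector fields and differential forms\<close>

type_synonym ('a, 'e) form = "'a \<Rightarrow> 'e list \<Rightarrow> real"

definition smooth_functions :: "('a, 'e::euclidean_space) chart set \<Rightarrow> ('a \<Rightarrow> real) set" where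
  "smooth_functions A = {f. \<forall>c\<in>A. smooth_on (chart_img c) (f \<circ> chart_inv c)}"

definition vf_in_chart ::
    "('a, 'e::euclidean_space) chart set \<Rightarrow> ('a, 'e) chart \<Rightarrow> ('a \<Rightarrow> 'e) \<Rightarrow> 'e \<Rightarrow> 'e" where
  "vf_in_chart A c X y =
     (let x = chart_inv c y; b = chart_at A x in
      frechet_derivative (chart_map c \<circ> chart_inv b) (at (chart_map b x)) (X x))"

definition vector_fields :: "('a, 'e::euclidean_space) chart set \<Rightarrow> ('a \<Rightarrow> 'e) set" where
  "vector_fields A = {X. \<forall>c\<in>A. smooth_on (chart_img c) (vf_in_chart A c X)}"

text \<open>
  \<open>form_in_chart A c \<omega>\<close> is the pullback of \<open>\<omega>\<close> by \<open>chart_inv c\<close>, a form on \<open>chart_img c\<close>.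
\<close>

definition form_in_chart ::
    "('a, 'e::euclidean_space) chart set \<Rightarrow> ('a, 'e) chart \<Rightarrow> ('a, 'e) form \<Rightarrow> ('e, 'e) form" where
  "form_in_chart A c \<omega> y vs =
     (let x = chart_inv c y; b = chart_at A x in
      \<omega> x (map (frechet_derivative (chart_map b \<circ> chart_inv c) (at y)) vs))"

definition alternating_multilinear :: "nat \<Rightarrow> ('e::euclidean_space list \<Rightarrow> real) \<Rightarrow> bool" where
  "alternating_multilinear p \<phi> \<longleftrightarrow>
     (\<forall>vs. length vs \<noteq> p \<longrightarrow> \<phi> vs = 0) \<and>
     (\<forall>vs i. length vs = p \<and> i < p \<longrightarrow> linear (\<lambda>v. \<phi> (vs[i := v]))) \<and>
     (\<forall>vs i j. length vs = p \<and> i < j \<and> j < p \<and> vs ! i = vs ! j \<longrightarrow> \<phi> vs = 0)"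

definition forms :: "('a, 'e::euclidean_space) chart set \<Rightarrow> nat \<Rightarrow> ('a, 'e) form set" where
  "forms A p = {\<omega>. (\<forall>x. alternating_multilinear p (\<omega> x)) \<and>
     (\<forall>c\<in>A. \<forall>vs. smooth_on (chart_img c) (\<lambda>y. form_in_chart A c \<omega> y vs))}"

text \<open>A function \<open>f\<close> corresponds to the \<open>0\<close>-form \<open>\<omega>\<close> with \<open>\<omega> x [] = f x\<close>.\<close>

definition one_form0 :: "('a, 'e) form" where
  "one_form0 = (\<lambda>x vs. if vs = [] then 1 else 0)"

definition lie_function ::
    "('a, 'e::euclidean_space) chart set \<Rightarrow> ('a \<Rightarrow> 'e) \<Rightarrow> ('a \<Rightarrow> real) \<Rightarrow> 'a \<Rightarrow> real" where
  "lie_function A X f x =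
     (let c = chart_at A x in
      frechet_derivative (f \<circ> chart_inv c) (at (chart_map c x)) (X x))"

text \<open>
  In coordinates around \<open>x\<close>,
  \<open>(L\<^sub>X \<omega>)(v\<^sub>1,\<dots>,v\<^sub>p) = X (\<omega>(v\<^sub>1,\<dots>,v\<^sub>p)) - (\<Sum>i. \<omega>(v\<^sub>1,\<dots>,[X,v\<^sub>i],\<dots>,v\<^sub>p))\<close> for constant fields \<open>v\<^sub>i\<close>,
  where \<open>[X,v] = - (dX) v\<close>.
\<close>

definition lie_form ::
    "('a, 'e::euclidean_space) chart set \<Rightarrow> ('a \<Rightarrow> 'e) \<Rightarrow> ('a, 'e) form \<Rightarrow> ('a, 'e) form" where
  "lie_form A X \<omega> x vs =
     (let c = chart_at A x; y = chart_map c x in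
      frechet_derivative (\<lambda>z. form_in_chart A c \<omega> z vs) (at y) (X x) +
      (\<Sum>i<length vs. \<omega> x (vs[i := frechet_derivative (vf_in_chart A c X) (at y) (vs ! i)])))"


section \<open>Differential operators and invariant maps between them\<close>

type_synonym ('a, 'e) diffop = "('a, 'e) form \<Rightarrow> 'a \<Rightarrow> real"

text \<open>
  Operators are extended by \<open>0\<close> outside \<open>forms A p\<close>, so that equality of operators is equality on
  \<open>p\<close>-forms. The lists \<open>\<alpha>\<close> and \<open>\<beta>\<close> of basis vectors are indices of partial derivatives and of
  components of \<open>p\<close>-forms. All orderings of an index occur, so the coefficients are not unique,
  but the class of operators is the usual one. Linearity of \<open>D\<close> follows from the local formula.
\<close>

definition diff_ops ::
    "('a, 'e::euclidean_space) chart set \<Rightarrow> nat \<Rightarrow> nat \<Rightarrow> ('a, 'e) diffop set" where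
  "diff_ops A k p = {D.
     (\<forall>\<omega>\<in>forms A p. D \<omega> \<in> smooth_functions A) \<and>
     (\<forall>\<omega>. \<omega> \<notin> forms A p \<longrightarrow> D \<omega> = 0) \<and>
     (\<forall>c\<in>A. \<exists>a. (\<forall>\<alpha> \<beta>. smooth_on (chart_img c) (a \<alpha> \<beta>)) \<and>
        (\<forall>\<omega>\<in>forms A p. \<forall>y\<in>chart_img c. D \<omega> (chart_inv c y) =
           (\<Sum>\<alpha>\<in>{\<alpha>. set \<alpha> \<subseteq> Basis \<and> length \<alpha> \<le> k}. \<Sum>\<beta>\<in>{\<beta>. set \<beta> \<subseteq> Basis \<and> length \<beta> = p}.
              a \<alpha> \<beta> y * iter_deriv \<alpha> (\<lambda>z. form_in_chart A c \<omega> z \<beta>) y)))}"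

definition all_diff_ops ::
    "('a, 'e::euclidean_space) chart set \<Rightarrow> nat \<Rightarrow> ('a, 'e) diffop set" where
  "all_diff_ops A p = (\<Union>k. diff_ops A k p)"

definition lie_op ::
    "('a, 'e::euclidean_space) chart set \<Rightarrow> nat \<Rightarrow> ('a \<Rightarrow> 'e) \<Rightarrow> ('a, 'e) diffop \<Rightarrow> ('a, 'e) diffop" where
  "lie_op A p X D = (\<lambda>\<omega>. if \<omega> \<in> forms A p
     then lie_function A X (D \<omega>) - D (lie_form A X \<omega>) else 0)"

text \<open>Maps defined on \<open>diff_ops A k p\<close> are likewise extended by \<open>0\<close>.\<close>

definition invariant_maps ::
    "('a, 'e::euclidean_space) chart set \<Rightarrow> nat \<Rightarrow> nat \<Rightarrow> nat \<Rightarrow>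
      (('a, 'e) diffop \<Rightarrow> ('a, 'e) diffop) set" where
  "invariant_maps A k p q = {T.
     (\<forall>D\<in>diff_ops A k p. T D \<in> all_diff_ops A q) \<and>
     (\<forall>D. D \<notin> diff_ops A k p \<longrightarrow> T D = 0) \<and>
     (\<forall>D\<in>diff_ops A k p. \<forall>E\<in>diff_ops A k p. T (D + E) = T D + T E) \<and>
     (\<forall>r. \<forall>D\<in>diff_ops A k p. T (r *\<^sub>R D) = r *\<^sub>R T D) \<and>
     (\<forall>X\<in>vector_fields A. \<forall>D\<in>diff_ops A k p. T (lie_op A p X D) = lie_op A q X (T D))}"

definition id_map ::
    "('a, 'e::euclidean_space) chart set \<Rightarrow> nat \<Rightarrow> nat \<Rightarrow> ('a, 'e) diffop \<Rightarrow> ('a, 'e) diffop" where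
  "id_map A k p = (\<lambda>D. if D \<in> diff_ops A k p then D else 0)"

definition I0_map ::
    "('a, 'e::euclidean_space) chart set \<Rightarrow> nat \<Rightarrow> ('a, 'e) diffop \<Rightarrow> ('a, 'e) diffop" where
  "I0_map A k = (\<lambda>D. if D \<in> diff_ops A k 0
     then (\<lambda>\<omega>. if \<omega> \<in> forms A 0 then (\<lambda>x. D one_form0 x * \<omega> x []) else 0) else 0)"


section \<open>Conjugation\<close>

text \<open>
  The integral over a chart domain \<open>U\<close> of a top degree form supported in \<open>U\<close>, for one of the two
  orientations of \<open>U\<close>. The choice of the orientation affects both sides of the equation defining
  the conjugate by the same sign.
\<close>

definition basis_frame :: "'e::euclidean_space list" where
  "basis_frame = (SOME bs. distinct bs \<and> set bs = Basis)"

definition chart_integral ::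
    "('a, 'e::euclidean_space) chart set \<Rightarrow> ('a, 'e) chart \<Rightarrow> ('a, 'e) form \<Rightarrow> real" where
  "chart_integral A c \<omega> = (LINT y:chart_img c|lborel. form_in_chart A c \<omega> y basis_frame)"

definition forms_compact_in ::
    "('a::topological_space, 'e::euclidean_space) chart set \<Rightarrow> nat \<Rightarrow> 'a set \<Rightarrow> ('a, 'e) form set" where
  "forms_compact_in A p U = {\<omega> \<in> forms A p.
     compact (closure {x. \<omega> x \<noteq> 0}) \<and> closure {x. \<omega> x \<noteq> 0} \<subseteq> U}"

text \<open>
  The operator \<open>D\<close> itself need not be compactly supported in \<open>U\<close>: since \<open>f\<close> and \<open>g\<close> are, both
  integrals are unchanged if \<open>D\<close> and its conjugate are cut off outside a neighbourhood of their
  supports. Quantifying over all \<open>D\<close> says that conjugation is computed locally.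
\<close>

definition is_conjugate ::
    "('a::topological_space, 'e::euclidean_space) chart set \<Rightarrow> ('a, 'e) diffop \<Rightarrow> ('a, 'e) diffop \<Rightarrow> bool" where
  "is_conjugate A D E \<longleftrightarrow>
     (\<forall>c\<in>A. \<forall>f\<in>forms_compact_in A DIM('e) (chart_dom c).
        \<forall>g\<in>forms_compact_in A DIM('e) (chart_dom c).
        chart_integral A c (\<lambda>x. D f x *\<^sub>R g x) = chart_integral A c (\<lambda>x. E g x *\<^sub>R f x))"

definition conj_map ::
    "('a::topological_space, 'e::euclidean_space) chart set \<Rightarrow> nat \<Rightarrow> ('a, 'e) diffop \<Rightarrow> ('a, 'e) diffop" where
  "conj_map A k = (\<lambda>D. if D \<in> diff_ops A k DIM('e)
     then (THE E. E \<in> diff_ops A k DIM('e) \<and> is_conjugate A D E) else 0)"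

end

theory Submission
  imports Defs "HOL-Combinatorics.Permutations"
begin

text \<open>
  Near a point, an invariant map that is local is determined by its effect on operators on a ball.
  Invariance under \<open>\<partial>\<^sub>j\<close> and \<open>x\<^sub>j \<partial>\<^sub>i\<close> forces \<open>T (\<partial>\<^sub>i\<^sup>m) = b \<partial>\<^sub>i\<^sup>m\<close>; a map that vanishes on \<open>1\<close> and on
  \<open>\<partial>\<^sub>i\<close> vanishes on all operators, since quadratic and cubic fields force \<open>b = 0\<close> in each higher order.
  On \<open>1\<close> and \<open>\<partial>\<^sub>i\<close> the identity has the eigenvalues \<open>(1, 1)\<close>, whereas \<open>I\<^sub>0\<close> has \<open>(1, 0)\<close> and the
  conjugation has \<open>(1, -1)\<close>, so a combination of two maps can be subtracted. Its coefficients do not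
  depend on the point, because the manifold is connected.

  For locality, let \<open>D\<close> vanish near \<open>x\<close>. Then all fields supported near \<open>x\<close> annihilate \<open>T D\<close>, which is
  therefore zero near \<open>x\<close> on top degree forms and a constant \<open>c(D)\<close> on functions. The functional \<open>c\<close>
  vanishes on all \<open>L\<^sub>X D\<close>, and \<open>L\<^sub>X (g G) - L\<^sub>g\<^sub>X G = X(g) G + [G, g] X\<close> implies \<open>c (X(g)\<^sup>m D) = 0\<close> for
  large \<open>m\<close>. Two functions without common critical points yield two functions \<open>X(g)\<close> without common zeros,
  hence \<open>c = 0\<close>.

  The conjugate is the formal adjoint in each chart. That the charts agree is tested against bump forms, as
  \<open>\<integral> X(\<phi>) f = - \<integral> \<phi> L\<^sub>X f\<close> holds in every chart.
\<close>

section \<open>Calculus of smooth functions\<close>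

text \<open>The obstacle is that T is not assumed to be local. The functional c of the overview may
  a priori depend on D far away, even on its behaviour at infinity, and without continuity D cannot
  be cut into infinitely many small pieces. A finite decomposition is needed: if r = X(g) and r' =
  X'(g') are nonnegative without common zeros, then s = r^m + r'^m' has no zeros, and D is the sum
  of r^m D/s and r'^m' D/s, which still vanish near x and on which c is zero. One function does not
  suffice, since a function on a compact manifold has critical points. The other recurring device is
  the commutator with x_i. It lowers the order, so its powers vanish in the end, and a relation
  [E, x_i] \<partial>_i = r E forces E = 0 unless r is a natural number. Principal symbols are
  thereby avoided; the coefficients of operators, indexed by lists of directions, are not unique and
  would not define them directly.\<close>

abbreviation "fd f y \<equiv> frechet_derivative f (at y)"

abbreviation "hdo \<equiv> higher_differentiable_on"

lemma fd_eqI: "(f has_derivative f') (at x) ==> fd f x = f'"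
  by (metis frechet_derivative_at)

text \<open>\<open>frechet_derivative\<close> is chosen among the derivatives at \<open>x\<close>.
  Functions that agree near \<open>x\<close> have the same derivatives there, so the choices
  coincide even where no derivative exists.\<close>

lemma fd_cong:
  assumes "open S" "x \<in> S" "\<And>y. y \<in> S ==> f y = g y"
  shows "fd f x = fd g x"
proof -
  have "(f has_derivative f') (at x) \<longleftrightarrow> (g has_derivative f') (at x)" for f'
    using assms has_derivative_transform_within_open[of f f' x UNIV S g]
      has_derivative_transform_within_open[of g f' x UNIV S f] by auto
  then show ?thesis by (simp add: frechet_derivative_def)
qed

lemma differentiable_cong_open:
  assumes "open S" "x \<in> S" "\<And>y. y \<in> S ==> f y = g y" "f differentiable (at x)"
  shows "g differentiable (at x)"
  using assms has_derivative_transform_within_open[of f _ x UNIV S g]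
  unfolding differentiable_def by blast

section \<open>Closure properties of smoothness\<close>

lemma hdo_cong:
  assumes "open S" "\<And>x. x \<in> S ==> f x = g x" "hdo S f m"
  shows "hdo S g m"
  using assms(2,3)
proof (induction m arbitrary: f g)
  case 0
  then show ?case by (auto intro: continuous_on_eq)
next
  case (Suc m)
  have "fd f x v = fd g x v" if "x \<in> S" for x v
    using fd_cong[OF assms(1) that, of f g] Suc.prems by simp
  then have "hdo S (\<lambda>x. fd g x v) m" for v
    using Suc.IH[of "\<lambda>x. fd f x v"] Suc.prems by simp
  moreover have "g differentiable (at x)" if "x \<in> S" for x
    using differentiable_cong_open[OF assms(1) that, of f g] Suc.prems that by simp
  ultimately show ?case by simp
qed

lemma hdo_SucD: "hdo S f (Suc m) ==> hdo S f m"
proof (induction m arbitrary: f)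
  case 0
  then show ?case
    by (auto intro!: continuous_at_imp_continuous_on simp: differentiable_imp_continuous_within)
qed auto

lemma hdo_subset: "T \<subseteq> S ==> hdo S f m ==> hdo T f m"
  by (induction m arbitrary: f) (auto intro: continuous_on_subset)

lemma hdo_local:
  "(\<And>x. x \<in> S ==> \<exists>N. open N \<and> x \<in> N \<and> hdo N f m) ==> hdo S f m"
proof (induction m arbitrary: f)
  case 0
  then show ?case
    by (metis continuous_at_imp_continuous_on continuous_on_eq_continuous_at higher_differentiable_on.simps(1))
next
  case (Suc m)
  have "hdo S (\<lambda>x. fd f x v) m" for v
    by (rule Suc.IH) (use Suc.prems in force)
  then show ?case using Suc.prems by force
qed

lemma hdo_const: "hdo S (\<lambda>x. c) m"
proof (induction m arbitrary: c)
  case (Suc m)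
  have "fd (\<lambda>x. c) x = (\<lambda>v. 0)" for x
    by (rule fd_eqI) auto
  then show ?case using Suc by simp
qed simp

lemma hdo_linear: "bounded_linear f ==> hdo S f m"
proof (cases m)
  case (Suc k)
  assume *: "bounded_linear f"
  have "fd f x = f" for x
    by (rule fd_eqI) (simp add: * bounded_linear_imp_has_derivative)
  then show ?thesis using Suc * by (auto simp: hdo_const bounded_linear_imp_differentiable)
qed (auto simp: linear_continuous_on)

text \<open>Lets the closure properties work with an explicit derivative \<open>F\<close> in place
  of the chosen \<open>frechet_derivative\<close>, which agrees with it on the open set.\<close>

lemma hdo_SucI:
  assumes "open S" "\<And>x. x \<in> S ==> (f has_derivative F x) (at x)" "\<And>v. hdo S (\<lambda>x. F x v) m"
  shows "hdo S f (Suc m)"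
proof -
  have "hdo S (\<lambda>x. fd f x v) m" for v
    by (rule hdo_cong[OF assms(1) _ assms(3)[of v]]) (simp add: fd_eqI[OF assms(2)])
  then show ?thesis using assms(2) by (auto simp: differentiable_def)
qed

lemma hdo_bounded_linear:
  assumes "open S" "bounded_linear L" "hdo S f m"
  shows "hdo S (\<lambda>x. L (f x)) m"
  using assms(3)
proof (induction m arbitrary: f)
  case 0
  then show ?case using assms bounded_linear.continuous_on by auto
next
  case (Suc m)
  have d: "((\<lambda>x. L (f x)) has_derivative (\<lambda>v. L (fd f x v))) (at x)" if "x \<in> S" for x
    using Suc.prems that assms(2) by (auto simp: frechet_derivative_works intro: bounded_linear.has_derivative)
  show ?case by (rule hdo_SucI[OF assms(1) d Suc.IH]) (use Suc.prems in auto)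
qed

lemma hdo_add:
  assumes "open S" "hdo S f m" "hdo S g m"
  shows "hdo S (\<lambda>x. f x + g x) m"
  using assms(2,3)
proof (induction m arbitrary: f g)
  case 0
  then show ?case by (auto intro: continuous_intros)
next
  case (Suc m)
  have d: "((\<lambda>x. f x + g x) has_derivative
      (\<lambda>v. fd f x v + fd g x v)) (at x)" if "x \<in> S" for x
    using Suc.prems that by (auto simp: frechet_derivative_works intro: has_derivative_add)
  show ?case by (rule hdo_SucI[OF assms(1) d Suc.IH]) (use Suc.prems in auto)
qed

lemma hdo_bilinear:
  fixes f :: "'e::euclidean_space => 'f::euclidean_space" and g :: "'e => 'g::euclidean_space"
    and P :: "'f => 'g => 'h::euclidean_space"
  assumes "open S" "bounded_bilinear P" "hdo S f m" "hdo S g m"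
  shows "hdo S (\<lambda>x. P (f x) (g x)) m"
  using assms(3,4)
proof (induction m arbitrary: f g)
  case 0
  then show ?case using bounded_bilinear.continuous_on[OF assms(2)] by auto
next
  case (Suc m)
  have d: "((\<lambda>x. P (f x) (g x)) has_derivative
      (\<lambda>v. P (f x) (fd g x v) + P (fd f x v) (g x))) (at x)" if "x \<in> S" for x
    using Suc.prems that by (auto simp: frechet_derivative_works intro: bounded_bilinear.FDERIV[OF assms(2)])
  have "hdo S (\<lambda>x. P (f x) (fd g x v) + P (fd f x v) (g x)) m" for v
    using Suc.prems hdo_SucD[OF Suc.prems(1)] hdo_SucD[OF Suc.prems(2)]
    by (intro hdo_add assms Suc.IH) auto
  from hdo_SucI[OF assms(1) d this] show ?case .
qed

lemma hdo_sum:
  "open S ==> (\<And>i. i \<in> I ==> hdo S (f i) m) ==> hdo S (\<lambda>x. \<Sum>i\<in>I. f i x) m"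
  by (induction I rule: infinite_finite_induct) (auto simp: hdo_const hdo_add)

lemma hdo_compose:
  assumes "open S" "open T" "\<And>x. x \<in> S ==> g x \<in> T" "hdo T f m" "hdo S g m"
  shows "hdo S (\<lambda>x. f (g x)) m"
  using assms(4,5)
proof (induction m arbitrary: f)
  case 0
  then show ?case using assms(3) by (auto intro: continuous_on_compose2)
next
  case (Suc m)
  let ?D = "\<lambda>f x v. fd f x v"
  have d: "((\<lambda>x. f (g x)) has_derivative (\<lambda>v. ?D f (g x) (?D g x v))) (at x)" if "x \<in> S" for x
    using Suc.prems that assms(3)[OF that]
    by (auto simp: frechet_derivative_works intro: has_derivative_compose[of g _ x UNIV f])
  \<comment> \<open>The direction \<open>?D g x v\<close> varies with \<open>x\<close>, whereas the
    induction hypothesis covers derivatives in fixed directions only; hence the expansion in basis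
    directions.\<close>
  have e: "?D f (g x) (?D g x v) = (\<Sum>b\<in>Basis. (?D g x v \<bullet> b) *\<^sub>R ?D f (g x) b)" if "x \<in> S" for x v
  proof -
    have "linear (?D f (g x))"
      using Suc.prems assms(3)[OF that] by (auto intro: linear_frechet_derivative)
    then have "?D f (g x) (\<Sum>b\<in>Basis. (?D g x v \<bullet> b) *\<^sub>R b) = (\<Sum>b\<in>Basis. (?D g x v \<bullet> b) *\<^sub>R ?D f (g x) b)"
      by (simp add: linear_sum linear_scale)
    then show ?thesis by (simp add: euclidean_representation)
  qed
  have "hdo S (\<lambda>x. \<Sum>b\<in>Basis. (?D g x v \<bullet> b) *\<^sub>R ?D f (g x) b) m" for v
    using Suc.prems hdo_SucD[OF Suc.prems(1)] hdo_SucD[OF Suc.prems(2)]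
    by (intro hdo_sum hdo_bilinear[OF _ bounded_bilinear_scaleR] hdo_bounded_linear[OF _ bounded_linear_inner_left] assms Suc.IH) auto
  from hdo_cong[OF assms(1) e[symmetric] this] have "hdo S (\<lambda>x. ?D f (g x) (?D g x v)) m" for v .
  from hdo_SucI[OF assms(1) d this] show ?case .
qed

lemma hdo_inverse:
  fixes f :: "'e::euclidean_space => real"
  assumes "open S" "\<And>x. x \<in> S ==> f x \<noteq> 0" "hdo S f m"
  shows "hdo S (\<lambda>x. inverse (f x)) m"
  using assms(3)
proof (induction m)
  case 0
  then show ?case using assms(2) by (auto intro: continuous_intros)
next
  case (Suc m)
  let ?D = "\<lambda>f x v. fd f x v"
  have d: "((\<lambda>x. inverse (f x)) has_derivative (\<lambda>v. - (inverse (f x) * ?D f x v * inverse (f x)))) (at x)" if "x \<in> S" for x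
    using Suc.prems that assms(2) by (auto simp: frechet_derivative_works intro!: derivative_eq_intros)
  have "hdo S (\<lambda>x. - (inverse (f x) * ?D f x v * inverse (f x))) m" for v
    using Suc hdo_SucD[OF Suc.prems]
    by (intro hdo_bounded_linear[OF _ bounded_linear_minus[OF bounded_linear_ident]]
          hdo_bilinear[OF _ bounded_bilinear_mult] assms) auto
  from hdo_SucI[OF assms(1) d this] show ?case .
qed

lemma smooth_on_cong:
  "open S ==> (\<And>x. x \<in> S ==> f x = g x) ==> smooth_on S f ==> smooth_on S g"
  unfolding smooth_on_def by (metis hdo_cong)

lemma smooth_on_subset: "smooth_on S f ==> T \<subseteq> S ==> smooth_on T f"
  unfolding smooth_on_def by (metis hdo_subset)

lemma smooth_on_local:
  "(\<And>x. x \<in> S ==> \<exists>N. open N \<and> x \<in> N \<and> smooth_on N f) ==> smooth_on S f"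
  unfolding smooth_on_def by (metis hdo_local)

lemma smooth_on_const [simp]: "smooth_on S (\<lambda>x. c)"
  by (simp add: smooth_on_def hdo_const)

lemma smooth_on_linear: "bounded_linear f ==> smooth_on S f"
  by (simp add: smooth_on_def hdo_linear)

lemma smooth_on_id [simp]: "smooth_on S (\<lambda>x. x)"
  by (simp add: smooth_on_linear bounded_linear_ident)

lemma smooth_on_bounded_linear:
  "open S ==> bounded_linear L ==> smooth_on S f ==> smooth_on S (\<lambda>x. L (f x))"
  by (simp add: smooth_on_def hdo_bounded_linear)

lemma smooth_on_add:
  "open S ==> smooth_on S f ==> smooth_on S g ==> smooth_on S (\<lambda>x. f x + g x)"
  by (simp add: smooth_on_def hdo_add)

lemma smooth_on_minus: "open S ==> smooth_on S f ==> smooth_on S (\<lambda>x. - f x)"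
  by (rule smooth_on_bounded_linear[OF _ bounded_linear_minus[OF bounded_linear_ident]])

lemma smooth_on_diff:
  "open S ==> smooth_on S f ==> smooth_on S g ==> smooth_on S (\<lambda>x. f x - g x)"
  using smooth_on_add[of S f "\<lambda>x. - g x"] by (simp add: smooth_on_minus)

lemma smooth_on_mult:
  fixes f g :: "'e::euclidean_space => real"
  shows "open S ==> smooth_on S f ==> smooth_on S g ==> smooth_on S (\<lambda>x. f x * g x)"
  by (simp add: smooth_on_def hdo_bilinear[OF _ bounded_bilinear_mult])

lemma smooth_on_scaleR:
  fixes f :: "'e::euclidean_space => real"
  shows "open S ==> smooth_on S f ==> smooth_on S g ==> smooth_on S (\<lambda>x. f x *\<^sub>R g x)"
  by (simp add: smooth_on_def hdo_bilinear[OF _ bounded_bilinear_scaleR])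

lemma smooth_on_inner:
  "open S ==> smooth_on S f ==> smooth_on S g ==> smooth_on S (\<lambda>x. f x \<bullet> g x)"
  by (simp add: smooth_on_def hdo_bilinear[OF _ bounded_bilinear_inner])

lemma smooth_on_sum:
  "open S ==> (\<And>i. i \<in> I ==> smooth_on S (f i)) ==> smooth_on S (\<lambda>x. \<Sum>i\<in>I. f i x)"
  by (simp add: smooth_on_def hdo_sum)

lemma smooth_on_prod:
  fixes f :: "'i => 'e::euclidean_space => real"
  shows "open S ==> (\<And>i. i \<in> I ==> smooth_on S (f i)) ==> smooth_on S (\<lambda>x. \<Prod>i\<in>I. f i x)"
  by (induction I rule: infinite_finite_induct) (auto simp: smooth_on_mult)

lemma smooth_on_compose:
  "open S ==> open T ==> (\<And>x. x \<in> S ==> g x \<in> T) ==> smooth_on T f ==> smooth_on S g ==>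
    smooth_on S (\<lambda>x. f (g x))"
  using hdo_compose[of S T g f] by (simp add: smooth_on_def)

lemma smooth_on_inverse:
  fixes f :: "'e::euclidean_space => real"
  shows "open S ==> (\<And>x. x \<in> S ==> f x \<noteq> 0) ==> smooth_on S f ==> smooth_on S (\<lambda>x. inverse (f x))"
  by (simp add: smooth_on_def hdo_inverse)

lemma smooth_on_power:
  fixes f :: "'e::euclidean_space => real"
  shows "open S ==> smooth_on S f ==> smooth_on S (\<lambda>x. f x ^ m)"
  by (induction m) (auto simp: smooth_on_mult)

lemma smooth_on_imp_differentiable: "smooth_on S f ==> x \<in> S ==> f differentiable (at x)"
  unfolding smooth_on_def by (metis higher_differentiable_on.simps(2))

lemma smooth_on_has_derivative:
  "smooth_on S f ==> x \<in> S ==> (f has_derivative fd f x) (at x)"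
  using smooth_on_imp_differentiable frechet_derivative_works by blast

lemma smooth_on_fd: "smooth_on S f ==> smooth_on S (\<lambda>x. fd f x v)"
  unfolding smooth_on_def by (metis higher_differentiable_on.simps(2))

lemma smooth_on_imp_continuous_on: "smooth_on S f ==> continuous_on S f"
  unfolding smooth_on_def by (metis higher_differentiable_on.simps(1))

lemma linear_fd: "smooth_on S f ==> x \<in> S ==> linear (fd f x)"
  by (simp add: linear_frechet_derivative smooth_on_imp_differentiable)

lemma fd_basis_sum:
  assumes "linear L"
  shows "L v = (\<Sum>b\<in>Basis. (v \<bullet> b) *\<^sub>R L b)"
proof -
  have "L (\<Sum>b\<in>Basis. (v \<bullet> b) *\<^sub>R b) = (\<Sum>b\<in>Basis. (v \<bullet> b) *\<^sub>R L b)"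
    using assms by (simp add: linear_sum linear_scale)
  then show ?thesis by (simp add: euclidean_representation)
qed

lemma fd_compose:
  assumes "open S" "smooth_on T f" "smooth_on S g" "x \<in> S" "g x \<in> T"
  shows "fd (\<lambda>x. f (g x)) x v =
    fd f (g x) (fd g x v)"
  using has_derivative_compose[OF smooth_on_has_derivative[OF assms(3,4)] smooth_on_has_derivative[OF assms(2,5)]]
  by (simp add: fd_eqI)

lemma smooth_on_fd_apply:
  assumes "open S" "smooth_on S f" "smooth_on S X"
  shows "smooth_on S (\<lambda>x. fd f x (X x))"
proof -
  have "smooth_on S (\<lambda>x. \<Sum>b\<in>Basis. (X x \<bullet> b) *\<^sub>R fd f x b)"
    using assms by (intro smooth_on_sum smooth_on_scaleR smooth_on_fd smooth_on_inner) auto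
  moreover have "(\<Sum>b\<in>Basis. (X x \<bullet> b) *\<^sub>R fd f x b) = fd f x (X x)"
    if "x \<in> S" for x
    by (rule fd_basis_sum[OF linear_fd[OF assms(2) that], symmetric])
  ultimately show ?thesis by (rule smooth_on_cong[OF assms(1), rotated])
qed

subsection \<open>Symmetry of second derivatives\<close>

text \<open>The mean value theorem, applied first along \<open>u\<close> and then along
  \<open>v\<close>, turns the second difference into \<open>s^2\<close> times the mixed derivative
  at a point near \<open>x\<close>; continuity of that derivative finishes.\<close>

lemma double_difference_limit:
  fixes f :: "'e::euclidean_space => real"
  assumes S: "open S" "x \<in> S" and f: "smooth_on S f" and "e > 0"
  shows "\<exists>d>0. \<forall>s. 0 < s \<and> s < d \<longrightarrow>
    \<bar>(f (x + s *\<^sub>R u + s *\<^sub>R v) - f (x + s *\<^sub>R u) - f (x + s *\<^sub>R v) + f x) / s^2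
      - fd (\<lambda>y. fd f y u) x v\<bar> < e"
proof -
  let ?D = "\<lambda>f x v. fd f x v"
  let ?g = "\<lambda>y. ?D (\<lambda>y. ?D f y u) y v"
  have "continuous_on S ?g"
    by (intro smooth_on_imp_continuous_on smooth_on_fd f)
  then obtain d1 where d1: "d1 > 0" "\<And>y. y \<in> S ==> dist y x < d1 ==> dist (?g y) (?g x) < e"
    using \<open>e > 0\<close> S(2) unfolding continuous_on_iff by metis
  obtain d2 where d2: "d2 > 0" "ball x d2 \<subseteq> S" using S open_contains_ball by blast
  \<comment> \<open>Keeps all points \<open>x + a u + b v\<close> with
    \<open>0 \<le> a, b < d\<close> within \<open>min d1 d2\<close> of \<open>x\<close>; the summand
    1 covers \<open>u = v = 0\<close>.\<close>
  define d where "d = min d1 d2 / (norm u + norm v + 1)"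
  have pos: "norm u + norm v + 1 > 0" by (smt (verit) norm_ge_zero)
  have "d > 0" using d1 d2 pos by (simp add: d_def)
  have near: "dist (x + a *\<^sub>R u + b *\<^sub>R v) x < min d1 d2" if "0 \<le> a" "a \<le> s" "0 \<le> b" "b \<le> s" "s < d" for a b s
  proof -
    have "norm (a *\<^sub>R u + b *\<^sub>R v) \<le> a * norm u + b * norm v"
      using that by (metis abs_of_nonneg norm_scaleR norm_triangle_ineq)
    also have "\<dots> \<le> s * norm u + s * norm v"
      using that by (intro add_mono mult_right_mono) auto
    also have "\<dots> \<le> s * (norm u + norm v + 1)" using that by (simp add: algebra_simps)
    also have "\<dots> < d * (norm u + norm v + 1)" using that pos by simp
    also have "\<dots> = min d1 d2" using pos by (simp add: d_def)
    finally show ?thesis by (simp add: dist_norm add.assoc)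
  qed
  have inS: "x + a *\<^sub>R u + b *\<^sub>R v \<in> S" if "0 \<le> a" "a \<le> s" "0 \<le> b" "b \<le> s" "s < d" for a b s
    using near[OF that] d2 by (auto simp: dist_commute)
  have der: "DERIV (\<lambda>a. h (w + a *\<^sub>R z)) a :> ?D h (w + a *\<^sub>R z) z"
    if "smooth_on S h" "w + a *\<^sub>R z \<in> S" for h :: "'e => real" and w z a
  proof -
    have 1: "((\<lambda>a. w + a *\<^sub>R z) has_derivative (\<lambda>h. h *\<^sub>R z)) (at a)"
      by (auto intro!: derivative_eq_intros)
    have "((\<lambda>a. h (w + a *\<^sub>R z)) has_derivative (\<lambda>k. ?D h (w + a *\<^sub>R z) (k *\<^sub>R z))) (at a)"
      by (rule has_derivative_compose[OF 1 smooth_on_has_derivative[OF that]])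
    moreover have "?D h (w + a *\<^sub>R z) (k *\<^sub>R z) = ?D h (w + a *\<^sub>R z) z * k" for k
      using linear_fd[OF that] by (simp add: linear_scale)
    ultimately show ?thesis by (simp add: has_field_derivative_def)
  qed
  have "\<bar>(f (x + s *\<^sub>R u + s *\<^sub>R v) - f (x + s *\<^sub>R u) - f (x + s *\<^sub>R v) + f x) / s^2 - ?g x\<bar> < e"
    if s: "0 < s" "s < d" for s
  proof -
    let ?p = "\<lambda>a. f ((x + s *\<^sub>R v) + a *\<^sub>R u) - f (x + a *\<^sub>R u)"
    have "\<exists>z>0. z < s \<and> ?p s - ?p 0 = (s - 0) * (?D f ((x + s *\<^sub>R v) + z *\<^sub>R u) u - ?D f (x + z *\<^sub>R u) u)"
    proof (rule MVT2[OF s(1)])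
      fix a assume a: "0 \<le> a" "a \<le> s"
      have "x + s *\<^sub>R v + a *\<^sub>R u \<in> S" using inS[of a s s] a s by (simp add: algebra_simps)
      moreover have "x + a *\<^sub>R u \<in> S" using inS[of a s 0] a s by simp
      ultimately show "DERIV ?p a :> (?D f ((x + s *\<^sub>R v) + a *\<^sub>R u) u - ?D f (x + a *\<^sub>R u) u)"
        by (intro DERIV_diff der f)
    qed
    then obtain z where z: "z > 0" "z < s"
      "?p s - ?p 0 = s * (?D f ((x + s *\<^sub>R v) + z *\<^sub>R u) u - ?D f (x + z *\<^sub>R u) u)" by auto
    let ?q = "\<lambda>b. ?D f ((x + z *\<^sub>R u) + b *\<^sub>R v) u"
    have "\<exists>y>0. y < s \<and> ?q s - ?q 0 = (s - 0) * ?g ((x + z *\<^sub>R u) + y *\<^sub>R v)"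
      by (rule MVT2[OF s(1)]) (use inS[of z s] z s in \<open>intro der smooth_on_fd f, auto\<close>)
    then obtain y where y: "y > 0" "y < s" "?q s - ?q 0 = s * ?g ((x + z *\<^sub>R u) + y *\<^sub>R v)" by auto
    have "f (x + s *\<^sub>R u + s *\<^sub>R v) - f (x + s *\<^sub>R u) - f (x + s *\<^sub>R v) + f x = s^2 * ?g (x + z *\<^sub>R u + y *\<^sub>R v)"
      using z(3) y(3) by (simp add: algebra_simps power2_eq_square)
    moreover have "dist (?g (x + z *\<^sub>R u + y *\<^sub>R v)) (?g x) < e"
      using d1(2)[OF inS[of z s y]] near[of z s y] z y s by simp
    ultimately show ?thesis using s by (simp add: dist_real_def)
  qed
  then show ?thesis using \<open>d > 0\<close> by blast
qed

text \<open>The second difference is symmetric in \<open>u\<close> and \<open>v\<close>, so it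
  approximates both mixed derivatives; it cannot lie within half their distance of each.\<close>

lemma fd_commute:
  fixes f :: "'e::euclidean_space => real"
  assumes "open S" "x \<in> S" "smooth_on S f"
  shows "fd (\<lambda>y. fd f y u) x v =
    fd (\<lambda>y. fd f y v) x u" (is "?a = ?b")
proof (rule ccontr)
  assume "?a \<noteq> ?b"
  then have e: "\<bar>?a - ?b\<bar> / 2 > 0" by simp
  have no: "\<not> (\<bar>q - a\<bar> < \<bar>a - b\<bar> / 2 \<and> \<bar>q - b\<bar> < \<bar>a - b\<bar> / 2)" for a b q :: real
    by (auto simp: abs_if split: if_splits)
  let ?q = "\<lambda>s. (f (x + s *\<^sub>R u + s *\<^sub>R v) - f (x + s *\<^sub>R u) - f (x + s *\<^sub>R v) + f x) / s^2"
  obtain d1 where d1: "d1 > 0" "\<And>s. 0 < s \<and> s < d1 ==> \<bar>?q s - ?a\<bar> < \<bar>?a - ?b\<bar> / 2"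
    using double_difference_limit[OF assms e, of u v] by auto
  obtain d2 where d2: "d2 > 0" "\<And>s. 0 < s \<and> s < d2 ==> \<bar>?q s - ?b\<bar> < \<bar>?a - ?b\<bar> / 2"
    using double_difference_limit[OF assms e, of v u] by (auto simp: algebra_simps)
  have "\<bar>?q (min d1 d2 / 2) - ?a\<bar> < \<bar>?a - ?b\<bar> / 2" "\<bar>?q (min d1 d2 / 2) - ?b\<bar> < \<bar>?a - ?b\<bar> / 2"
    using d1 d2 by auto
  then show False using no by blast
qed

lemma fd_inner:
  assumes "f differentiable (at x)"
  shows "fd (\<lambda>x. f x \<bullet> b) x v = fd f x v \<bullet> b"
proof -
  have "((\<lambda>x. f x \<bullet> b) has_derivative (\<lambda>v. fd f x v \<bullet> b)) (at x)"
    by (rule bounded_linear.has_derivative[OF bounded_linear_inner_left]) (use assms frechet_derivative_works in blast)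
  then show ?thesis by (simp add: fd_eqI)
qed

lemma fd_commute_vector:
  fixes f :: "'e::euclidean_space => 'f::euclidean_space"
  assumes "open S" "x \<in> S" "smooth_on S f"
  shows "fd (\<lambda>y. fd f y u) x v =
    fd (\<lambda>y. fd f y v) x u"
proof (rule euclidean_eqI)
  fix b :: 'f assume "b \<in> Basis"
  have sm: "smooth_on S (\<lambda>x. f x \<bullet> b)" using assms by (intro smooth_on_inner) auto
  have "fd (\<lambda>y. fd f y u) x v \<bullet> b =
    fd (\<lambda>y. fd (\<lambda>y. f y \<bullet> b) y u) x v" for u v
  proof -
    have "fd (\<lambda>y. fd f y u) x v \<bullet> b =
      fd (\<lambda>y. fd f y u \<bullet> b) x v"
      by (rule fd_inner[symmetric])
        (rule smooth_on_imp_differentiable[OF smooth_on_fd[OF assms(3)] assms(2)])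
    also have "\<dots> = fd (\<lambda>y. fd (\<lambda>y. f y \<bullet> b) y u) x v"
      using fd_cong[OF assms(1,2), of "\<lambda>y. fd f y u \<bullet> b"
          "\<lambda>y. fd (\<lambda>y. f y \<bullet> b) y u"]
        fd_inner[OF smooth_on_imp_differentiable[OF assms(3)], of _ b u] by simp
    finally show ?thesis .
  qed
  then show "fd (\<lambda>y. fd f y u) x v \<bullet> b =
    fd (\<lambda>y. fd f y v) x u \<bullet> b"
    using fd_commute[OF assms(1,2) sm] by simp
qed

subsection \<open>Cutoff functions\<close>

text \<open>The functions \<open>t^-m exp (-1/t)\<close>, extended by 0 to \<open>t \<le> 0\<close>.
  Derivatives of members are linear combinations of members, so smoothness can be proved by
  induction for all \<open>m\<close> at once.\<close>

definition flat_exp :: "nat => real => real" where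
  "flat_exp m t = (if t \<le> 0 then 0 else inverse t ^ m * exp (- inverse t))"

lemma flat_exp_tendsto_0: "((flat_exp m) \<longlongrightarrow> 0) (at 0)"
proof -
  have "((\<lambda>u::real. u ^ m / exp u) \<longlongrightarrow> 0) at_top" by (rule tendsto_power_div_exp_0)
  then have "((\<lambda>t::real. inverse t ^ m / exp (inverse t)) \<longlongrightarrow> 0) (at_right 0)"
    using filterlim_compose[OF _ filterlim_inverse_at_top_right] by fastforce
  then have R: "((flat_exp m) \<longlongrightarrow> 0) (at_right 0)"
    by (rule Lim_transform_eventually)
       (auto simp: eventually_at_right_less flat_exp_def exp_minus divide_inverse intro!: eventually_at_rightI[of 0 1])
  have L: "((flat_exp m) \<longlongrightarrow> 0) (at_left 0)"
    by (rule Lim_transform_eventually[of "\<lambda>_. 0"]) (auto simp: flat_exp_def intro!: eventually_at_leftI[of "-1"])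
  show ?thesis using L R filterlim_split_at by blast
qed

lemma flat_exp_deriv: "DERIV (flat_exp m) t :> flat_exp (m + 2) t - real m * flat_exp (Suc m) t"
proof -
  consider "t < 0" | "t = 0" | "t > 0" by linarith
  then show ?thesis
  proof cases
    case 1
    have "DERIV (\<lambda>_. 0) t :> 0" by simp
    then have "DERIV (flat_exp m) t :> 0"
      by (rule has_field_derivative_transform_within[where d = "- t"]) (use 1 in \<open>auto simp: flat_exp_def dist_real_def\<close>)
    then show ?thesis using 1 by (simp add: flat_exp_def)
  next
    case 2
    \<comment> \<open>At 0 the difference quotient is the next member of the family, which tends to
      0.\<close>
    have "(flat_exp m (0 + h) - flat_exp m 0) / h = flat_exp (Suc m) h" if "h \<noteq> 0" for h
      using that by (simp add: flat_exp_def divide_inverse)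
    then have "((\<lambda>h. (flat_exp m (0 + h) - flat_exp m 0) / h) \<longlongrightarrow> 0) (at 0)"
      by (intro Lim_transform_eventually[OF flat_exp_tendsto_0[of "Suc m"]])
         (auto simp: eventually_at_filter)
    then show ?thesis using 2 by (simp add: DERIV_def flat_exp_def)
  next
    case 3
    have pw: "t * t ^ (n - Suc 0) = t ^ n \<or> n = 0" for n by (cases n) auto
    have "DERIV (\<lambda>t. inverse t ^ m * exp (- inverse t)) t :> flat_exp (m + 2) t - real m * flat_exp (Suc m) t"
      using 3 pw[of "m - 1"] by (cases m)
        (auto intro!: derivative_eq_intros simp: flat_exp_def field_simps power2_eq_square)
    then show ?thesis using 3
      by (elim has_field_derivative_transform_within[where d = t]) (auto simp: flat_exp_def dist_real_def)
  qed
qed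

lemma hdo_flat_exp: "hdo UNIV (flat_exp m) r"
proof (induction r arbitrary: m)
  case 0
  have "isCont (flat_exp m) t" for t using flat_exp_deriv DERIV_isCont by blast
  then show ?case by (simp add: continuous_at_imp_continuous_on)
next
  case (Suc r)
  show ?case
  proof (rule hdo_SucI[where F = "\<lambda>t v. (flat_exp (m + 2) t + (- real m) * flat_exp (Suc m) t) * v"])
    show "(flat_exp m has_derivative (\<lambda>v. (flat_exp (m + 2) t + (- real m) * flat_exp (Suc m) t) * v)) (at t)" for t
      using flat_exp_deriv[of m t] by (simp add: has_field_derivative_def)
    show "hdo UNIV (\<lambda>t. (flat_exp (m + 2) t + (- real m) * flat_exp (Suc m) t) * v) r" for v
      by (intro hdo_bilinear[OF _ bounded_bilinear_mult] hdo_add hdo_const Suc.IH) auto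
  qed auto
qed

lemma smooth_step_exists:
  "\<exists>s::real => real. smooth_on UNIV s \<and> (\<forall>t. 0 \<le> s t \<and> s t \<le> 1) \<and> (\<forall>t\<le>0. s t = 0) \<and> (\<forall>t\<ge>1. s t = 1)"
proof -
  let ?f = "flat_exp 0"
  \<comment> \<open>The denominator is positive because \<open>t\<close> or \<open>1 - t\<close> is
    positive.\<close>
  define s where "s t = ?f t * inverse (?f t + ?f (1 - t))" for t
  have f: "smooth_on UNIV ?f" by (simp add: smooth_on_def hdo_flat_exp)
  have nn: "?f t \<ge> 0" and pos: "t > 0 ==> ?f t > 0" for t by (auto simp: flat_exp_def)
  have p: "?f t + ?f (1 - t) > 0" for t
    using nn[of t] nn[of "1 - t"] pos[of t] pos[of "1 - t"] by (cases "t > 0") auto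
  have g: "smooth_on UNIV (\<lambda>t. ?f (1 - t))"
    by (rule smooth_on_compose[where T = UNIV]) (auto intro: f smooth_on_diff)
  have "smooth_on UNIV s"
    unfolding s_def using p
    by (intro smooth_on_mult smooth_on_inverse smooth_on_add f g) (auto simp: less_imp_neq[THEN not_sym])
  moreover have "0 \<le> s t" "s t \<le> 1" for t
    using nn[of t] nn[of "1 - t"] p[of t] by (auto simp: s_def field_simps)
  moreover have "s t = 0" if "t \<le> 0" for t using that by (simp add: s_def flat_exp_def)
  moreover have "s t = 1" if "t \<ge> 1" for t
  proof -
    have "?f (1 - t) = 0" using that by (simp add: flat_exp_def)
    then show ?thesis using p[of t] by (simp add: s_def)
  qed
  ultimately show ?thesis by blast
qed

lemma cutoff_exists:
  fixes y0 :: "'e::euclidean_space"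
  assumes "0 < r" "r < R"
  shows "\<exists>\<kappa>. smooth_on UNIV \<kappa> \<and> (\<forall>y. 0 \<le> \<kappa> y \<and> \<kappa> y \<le> (1::real)) \<and> (\<forall>y\<in>cball y0 r. \<kappa> y = 1) \<and> (\<forall>y. y \<notin> ball y0 R \<longrightarrow> \<kappa> y = 0)"
proof -
  obtain s :: "real => real" where s: "smooth_on UNIV s" "\<And>t. 0 \<le> s t \<and> s t \<le> 1" "\<And>t. t \<le> 0 ==> s t = 0" "\<And>t. t \<ge> 1 ==> s t = 1"
    using smooth_step_exists by auto
  \<comment> \<open>The squared distance is polynomial, hence smooth at the centre as well;
    \<open>?q\<close> is at least 1 on the inner ball and at most 0 off the outer one.\<close>
  let ?q = "\<lambda>y. (R^2 - (y - y0) \<bullet> (y - y0)) * inverse (R^2 - r^2)"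
  have q: "smooth_on UNIV ?q"
    by (intro smooth_on_mult smooth_on_diff smooth_on_inner) auto
  have pos: "R^2 - r^2 > 0" using assms by (simp add: power2_eq_square algebra_simps mult_strict_mono)
  have "smooth_on UNIV (\<lambda>y. s (?q y))" by (rule smooth_on_compose[OF _ _ _ s(1) q]) auto
  moreover have "s (?q y) = 1" if "y \<in> cball y0 r" for y
  proof -
    have "(y - y0) \<bullet> (y - y0) \<le> r^2"
      using that by (simp add: dot_square_norm dist_norm norm_minus_commute power_mono)
    then show ?thesis using pos by (intro s(4)) (simp add: field_simps)
  qed
  moreover have "s (?q y) = 0" if "y \<notin> ball y0 R" for y
  proof -
    have "(y - y0) \<bullet> (y - y0) \<ge> R^2"
      using that assms by (simp add: dot_square_norm dist_norm norm_minus_commute)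
    then show ?thesis using pos by (intro s(3)) (simp add: mult_nonpos_nonneg)
  qed
  ultimately show ?thesis using s(2) by blast
qed

subsection \<open>Integration by parts\<close>

lemma integral_lborel_translate:
  fixes f :: "'e::euclidean_space => real"
  assumes "f \<in> borel_measurable borel"
  shows "(LINT y|lborel. f (c + y)) = (LINT y|lborel. f y)"
proof -
  have "(LINT y|lborel. f y) = (LINT y|distr lborel borel ((+) c). f y)"
    by (simp add: lborel_distr_plus)
  also have "\<dots> = (LINT y|lborel. f (c + y))"
    by (rule integral_distr) (use assms in auto)
  finally show ?thesis ..
qed

text \<open>Difference quotients along \<open>v\<close> have integral zero by translation invariance
  of Lebesgue measure; dominated convergence carries this over to the derivative.\<close>

lemma integral_derivative_zero:
  fixes f :: "'e::euclidean_space => real"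
  assumes f: "smooth_on UNIV f" and K: "bounded K" "\<And>y. y \<notin> K ==> f y = 0"
  shows "(LINT y|lborel. fd f y v) = 0"
proof -
  let ?D = "\<lambda>y. fd f y v"
  obtain R where R: "R > 0" "K \<subseteq> cball 0 R" using K(1) by (meson bounded_pos mem_cball_0 subsetI)
  \<comment> \<open>Off this ball both \<open>f\<close> and its translates by
    \<open>s i *\<^sub>R v\<close> with \<open>s i \<le> 1\<close> vanish, so it carries the
    dominating function.\<close>
  let ?C = "cball (0::'e) (R + norm v)"
  have contD: "continuous_on UNIV ?D"
    by (intro smooth_on_imp_continuous_on smooth_on_fd f)
  have contf: "continuous_on UNIV f" by (intro smooth_on_imp_continuous_on f)
  have mf: "f \<in> borel_measurable borel" by (rule borel_measurable_continuous_onI[OF contf])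
  \<comment> \<open>Mean value points \<open>y + z v\<close> with \<open>y\<close> in
    \<open>?C\<close> may leave \<open>?C\<close>, but they stay in this larger ball.\<close>
  have "compact (?D ` cball 0 (R + 2 * norm v))"
    by (intro compact_continuous_image continuous_on_subset[OF contD]) auto
  then obtain B where B: "\<And>y. y \<in> cball 0 (R + 2 * norm v) ==> norm (?D y) \<le> B"
    by (meson bounded_iff compact_imp_bounded imageI)
  have der: "DERIV (\<lambda>a. f (y + a *\<^sub>R v)) a :> ?D (y + a *\<^sub>R v)" for y a
  proof -
    have 1: "((\<lambda>a. y + a *\<^sub>R v) has_derivative (\<lambda>h. h *\<^sub>R v)) (at a)"
      by (auto intro!: derivative_eq_intros)
    have "((\<lambda>a. f (y + a *\<^sub>R v)) has_derivative (\<lambda>k. fd f (y + a *\<^sub>R v) (k *\<^sub>R v))) (at a)"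
      by (rule has_derivative_compose[OF 1 smooth_on_has_derivative[OF f]]) simp
    moreover have "fd f (y + a *\<^sub>R v) (k *\<^sub>R v) = ?D (y + a *\<^sub>R v) * k" for k
      using linear_fd[OF f] by (simp add: linear_scale)
    ultimately show ?thesis by (simp add: has_field_derivative_def)
  qed
  define s where "s i = inverse (real (Suc i))" for i
  have s01: "0 < s i" "s i \<le> 1" for i by (auto simp: s_def inverse_le_1_iff)
  have s0: "s \<longlonglongrightarrow> 0" unfolding s_def by (rule LIMSEQ_inverse_real_of_nat)
  define q where "q i y = (f (s i *\<^sub>R v + y) - f y) / s i" for i y
  have int_f: "integrable lborel f"
  proof -
    have "integrable lborel (\<lambda>y. indicator (cball 0 R) y *\<^sub>R f y)"
      by (intro borel_integrable_compact continuous_on_subset[OF contf]) auto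
    moreover have "indicator (cball 0 R) y *\<^sub>R f y = f y" for y
      using R(2) K(2)[of y] by (cases "y \<in> K") (auto simp: indicator_def)
    ultimately show ?thesis by (simp only:)
  qed
  have int_tr: "integrable lborel (\<lambda>y. f (c + y))" for c
  proof -
    have "integrable (distr lborel borel ((+) c)) f" using int_f by (simp add: lborel_distr_plus)
    then show ?thesis by (subst (asm) integrable_distr_eq) (use mf in auto)
  qed
  have z: "(LINT y|lborel. q i y) = 0" for i
    unfolding q_def using int_tr int_f integral_lborel_translate[OF mf] by simp
  have bnd: "norm (q i y) \<le> B * indicator ?C y" for i y
  proof (cases "y \<in> ?C")
    case True
    have "\<exists>z>0. z < s i \<and> f (y + s i *\<^sub>R v) - f (y + 0 *\<^sub>R v) = (s i - 0) * ?D (y + z *\<^sub>R v)"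
      by (rule MVT2[OF s01(1)]) (rule der)
    then obtain z where z: "z > 0" "z < s i" "f (y + s i *\<^sub>R v) - f y = s i * ?D (y + z *\<^sub>R v)" by auto
    have "norm (y + z *\<^sub>R v) \<le> norm y + z * norm v" using z by (metis abs_of_pos norm_scaleR norm_triangle_ineq)
    also have "\<dots> \<le> (R + norm v) + 1 * norm v"
      using True z s01(2)[of i] by (intro add_mono mult_right_mono) auto
    finally have "norm (?D (y + z *\<^sub>R v)) \<le> B" by (intro B) simp
    moreover have "q i y = ?D (y + z *\<^sub>R v)" using z s01(1)[of i] by (simp add: q_def add.commute)
    ultimately show ?thesis using True by simp
  next
    case False
    have "norm (s i *\<^sub>R v) \<le> 1 * norm v" using s01[of i] by (simp add: mult_left_le_one_le)
    then have "norm y - norm v \<le> norm (s i *\<^sub>R v + y)" by (smt (verit) norm_triangle_ineq4 add_diff_cancel_left')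
    then have "s i *\<^sub>R v + y \<notin> K" "y \<notin> K" using False R by (auto simp: subset_iff) (smt (verit) norm_ge_zero)+
    then show ?thesis using K(2) False by (simp add: q_def)
  qed
  have lim: "(\<lambda>i. q i y) \<longlonglongrightarrow> ?D y" for y
  proof -
    have "((\<lambda>h. (f (y + (0 + h) *\<^sub>R v) - f (y + 0 *\<^sub>R v)) / h) \<longlongrightarrow> ?D (y + 0 *\<^sub>R v)) (at 0)"
      using der[of y 0] unfolding DERIV_def .
    moreover have "filterlim s (at 0) sequentially"
      using s0 s01(1) by (intro filterlim_atI) (auto simp: less_imp_neq[THEN not_sym])
    ultimately have "((\<lambda>i. (f (y + (0 + s i) *\<^sub>R v) - f (y + 0 *\<^sub>R v)) / s i) \<longlonglongrightarrow> ?D (y + 0 *\<^sub>R v))"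
      by (rule filterlim_compose)
    then show ?thesis by (simp add: q_def add.commute)
  qed
  have "(\<lambda>i. LINT y|lborel. q i y) \<longlonglongrightarrow> (LINT y|lborel. ?D y)"
  proof (rule integral_dominated_convergence)
    show "integrable lborel (\<lambda>y. B * indicator ?C y)"
      by (intro integrable_mult_right) (auto intro!: integrable_real_indicator simp: emeasure_bounded_finite[unfolded infinity_ennreal_def])
    show "?D \<in> borel_measurable lborel" using borel_measurable_continuous_onI[OF contD] by simp
    show "q i \<in> borel_measurable lborel" for i unfolding q_def using mf by measurable
  qed (use bnd lim in auto)
  then have "(\<lambda>i. 0) \<longlonglongrightarrow> (LINT y|lborel. ?D y)" by (simp only: z)
  then show ?thesis using LIMSEQ_unique[OF tendsto_const] by metis
qed

section \<open>Differential operators on the ring of smooth functions\<close>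

abbreviation "mi k \<equiv> {\<alpha>. set \<alpha> \<subseteq> Basis \<and> length \<alpha> < k}"

text \<open>Smooth functions on the whole model space form a commutative ring, so that operator
  identities become ring identities for the simplifier. Functions given on a chart only enter by way
  of cutoffs and germs.\<close>

typedef (overloaded) 'e sfun = "{f :: 'e::euclidean_space => real. smooth_on UNIV f}"
  morphisms ev Sfun
  by (rule exI[of _ "\<lambda>_. 0"]) simp

setup_lifting type_definition_sfun

instantiation sfun :: (euclidean_space) comm_ring_1
begin
lift_definition zero_sfun :: "'a sfun" is "\<lambda>_. 0" by simp
lift_definition one_sfun :: "'a sfun" is "\<lambda>_. 1" by simp
lift_definition plus_sfun :: "'a sfun => 'a sfun => 'a sfun" is "\<lambda>f g y. f y + g y" by (simp add: smooth_on_add)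
lift_definition minus_sfun :: "'a sfun => 'a sfun => 'a sfun" is "\<lambda>f g y. f y - g y" by (simp add: smooth_on_diff)
lift_definition uminus_sfun :: "'a sfun => 'a sfun" is "\<lambda>f y. - f y" by (simp add: smooth_on_minus)
lift_definition times_sfun :: "'a sfun => 'a sfun => 'a sfun" is "\<lambda>f g y. f y * g y" by (simp add: smooth_on_mult)
instance by standard (transfer; auto simp: algebra_simps dest: fun_cong)+
end

instantiation sfun :: (euclidean_space) real_algebra_1
begin
lift_definition scaleR_sfun :: "real => 'a sfun => 'a sfun" is "\<lambda>r f y. r * f y" by (simp add: smooth_on_mult)
instance by standard (transfer; auto simp: algebra_simps)+
end

lemma ev_simps [simp]:
  "ev 0 y = 0" "ev 1 y = 1" "ev (f + g) y = ev f y + ev g y" "ev (f - g) y = ev f y - ev g y"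
  "ev (- f) y = - ev f y" "ev (f * g) y = ev f y * ev g y" "ev (r *\<^sub>R f) y = r * ev f y"
  by (transfer; simp)+

lemma ev_of_real [simp]: "ev (of_real r) y = r"
  by (simp add: of_real_def)

lemma ev_of_nat [simp]: "ev (of_nat m) y = real m"
  using ev_of_real[of "real m" y] by (simp del: ev_of_real)

lemma ev_numeral [simp]: "ev (numeral m) y = numeral m"
  using ev_of_real[of "numeral m" y] by (simp del: ev_of_real)

lemma ev_sum [simp]: "ev (sum f I) y = (\<Sum>i\<in>I. ev (f i) y)"
  by (induction I rule: infinite_finite_induct) auto

lemma smooth_ev [simp]: "smooth_on S (ev f)"
  by (rule smooth_on_subset[of UNIV]) (use ev[of f] in auto)

lemma ev_Sfun: "smooth_on UNIV f ==> ev (Sfun f) = f"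
  by (simp add: Sfun_inverse)

lemma sfun_eqI: "(\<And>y. ev f y = ev g y) ==> f = g"
  by transfer auto

lift_definition dv :: "'e::euclidean_space => 'e sfun => 'e sfun" is
  "\<lambda>v f y. fd f y v"
  by (simp add: smooth_on_fd)

lift_definition xc :: "'e::euclidean_space => 'e sfun" is "\<lambda>i y. y \<bullet> i"
  by (simp add: smooth_on_inner)

lemma dv_add [simp]: "dv v (f + g) = dv v f + dv v g"
proof (transfer, rule ext)
  fix v y :: "'e::euclidean_space" and f g :: "'e => real"
  assume "smooth_on UNIV f" "smooth_on UNIV g"
  then have "((\<lambda>y. f y + g y) has_derivative (\<lambda>v. fd f y v + fd g y v)) (at y)"
    by (intro has_derivative_add smooth_on_has_derivative) auto
  then show "fd (\<lambda>y. f y + g y) y v = fd f y v + fd g y v"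
    by (simp add: fd_eqI)
qed

lemma dv_mult [simp]: "dv v (f * g) = f * dv v g + dv v f * g"
proof (transfer, rule ext)
  fix v y :: "'e::euclidean_space" and f g :: "'e => real"
  assume "smooth_on UNIV f" "smooth_on UNIV g"
  then have "((\<lambda>y. f y * g y) has_derivative (\<lambda>v. f y * fd g y v + fd f y v * g y)) (at y)"
    by (intro has_derivative_mult smooth_on_has_derivative) auto
  then show "fd (\<lambda>y. f y * g y) y v = f y * fd g y v + fd f y v * g y"
    by (simp add: fd_eqI)
qed

lemma dv_scaleR [simp]: "dv v (r *\<^sub>R f) = r *\<^sub>R dv v f"
proof (transfer, rule ext)
  fix r :: real and v y :: "'e::euclidean_space" and f :: "'e => real"
  assume "smooth_on UNIV f"
  then have "((\<lambda>y. r * f y) has_derivative (\<lambda>v. r * fd f y v)) (at y)"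
    by (intro has_derivative_mult_right smooth_on_has_derivative) auto
  then show "fd (\<lambda>y. r * f y) y v = r * fd f y v"
    by (simp add: fd_eqI)
qed

lemma dv_0 [simp]: "dv v 0 = 0" using dv_scaleR[of v 0 0] by simp
lemma dv_1 [simp]: "dv v 1 = 0" using dv_mult[of v 1 1] by simp
lemma dv_minus [simp]: "dv v (- f) = - dv v f" using dv_scaleR[of v "-1" f] by simp
lemma dv_diff [simp]: "dv v (f - g) = dv v f - dv v g" using dv_add[of v f "- g"] by simp
lemma dv_of_real [simp]: "dv v (of_real r) = 0" by (simp add: of_real_def)
lemma dv_of_nat [simp]: "dv v (of_nat m) = 0" using dv_of_real[of v "real m"] by (simp del: dv_of_real)
lemma dv_numeral [simp]: "dv v (numeral m) = 0" using dv_of_real[of v "numeral m"] by (simp del: dv_of_real)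
lemma dv_sum [simp]: "dv v (sum f I) = (\<Sum>i\<in>I. dv v (f i))"
  by (induction I rule: infinite_finite_induct) auto

lemma dv_xc: "dv v (xc i) = of_real (v \<bullet> i)"
proof (rule sfun_eqI)
  fix y
  have "((\<lambda>y. y \<bullet> i) has_derivative (\<lambda>v. v \<bullet> i)) (at y)" by (auto intro!: derivative_eq_intros)
  then show "ev (dv v (xc i)) y = ev (of_real (v \<bullet> i)) y"
    by (simp add: dv.rep_eq xc.rep_eq fd_eqI)
qed

lemma dv_xc_Basis: "i \<in> Basis ==> j \<in> Basis ==> dv j (xc i) = (if i = j then 1 else 0)"
  by (simp add: dv_xc inner_Basis)

lemma dv_commute: "dv u (dv v f) = dv v (dv u f)"
  by (transfer, rule ext) (rule fd_commute[of UNIV], auto)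

lemma dv_expand: "dv v f = (\<Sum>b\<in>Basis. (v \<bullet> b) *\<^sub>R dv b f)"
proof (rule sfun_eqI)
  fix y
  have "linear (fd (ev f) y)" by (rule linear_fd[of UNIV]) auto
  from fd_basis_sum[OF this, of v]
  show "ev (dv v f) y = ev (\<Sum>b\<in>Basis. (v \<bullet> b) *\<^sub>R dv b f) y" by (simp add: dv.rep_eq)
qed

definition eqon :: "'e::euclidean_space set => 'e sfun => 'e sfun => bool" where
  "eqon V f g \<longleftrightarrow> (\<forall>y\<in>V. ev f y = ev g y)"

lemma eqon_dv: "open V ==> eqon V f g ==> eqon V (dv v f) (dv v g)"
  unfolding eqon_def dv.rep_eq
  by (metis fd_cong)

section \<open>Iterated derivatives and operators of bounded order\<close>

primrec ds :: "'e::euclidean_space list => 'e sfun => 'e sfun" where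
  "ds [] f = f"
| "ds (v # vs) f = dv v (ds vs f)"

lemma ds_append: "ds (\<alpha> @ \<beta>) f = ds \<alpha> (ds \<beta> f)"
  by (induction \<alpha>) auto

lemma ds_add [simp]: "ds \<alpha> (f + g) = ds \<alpha> f + ds \<alpha> g"
  by (induction \<alpha>) auto

lemma ds_scaleR [simp]: "ds \<alpha> (r *\<^sub>R f) = r *\<^sub>R ds \<alpha> f"
  by (induction \<alpha>) auto

lemma ds_0 [simp]: "ds \<alpha> 0 = 0"
  by (induction \<alpha>) auto

lemma dv_ds: "dv v (ds \<alpha> f) = ds \<alpha> (dv v f)"
  by (induction \<alpha>) (auto simp: dv_commute[of v])

lemma eqon_ds: "open V ==> eqon V f g ==> eqon V (ds \<alpha> f) (ds \<alpha> g)"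
  by (induction \<alpha>) (auto simp: eqon_dv)

lemma ev_ds: "ev (ds \<alpha> f) = iter_deriv \<alpha> (ev f)"
  by (induction \<alpha>) (auto simp: dv.rep_eq)

text \<open>The order is strictly less than \<open>k\<close>, so that \<open>dopl 0\<close> contains only the zero operator.\<close>

inductive_set dopl :: "nat => ('e::euclidean_space sfun => 'e sfun) set" for k where
  monom: "set \<alpha> \<subseteq> Basis ==> length \<alpha> < k ==> (\<lambda>f. a * ds \<alpha> f) \<in> dopl k"
| add: "P \<in> dopl k ==> Q \<in> dopl k ==> (\<lambda>f. P f + Q f) \<in> dopl k"
| zero: "(\<lambda>f. 0) \<in> dopl k"

lemma finite_multi_indices: "finite {\<alpha>::'e::euclidean_space list. set \<alpha> \<subseteq> Basis \<and> length \<alpha> < k}"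
  by (rule finite_subset[OF _ finite_lists_length_le[OF finite_Basis, of k]]) auto

lemma dopl_coeffs:
  assumes "Q \<in> dopl k"
  obtains a where "\<And>f. Q f = (\<Sum>\<alpha>\<in>mi k. a \<alpha> * ds \<alpha> f)"
proof -
  have "\<exists>a. \<forall>f. Q f = (\<Sum>\<alpha>\<in>mi k. a \<alpha> * ds \<alpha> f)"
    using assms
  proof induction
    case (monom \<alpha> a)
    let ?S = "mi k"
    have "(\<Sum>\<beta>\<in>?S. (if \<beta> = \<alpha> then a else 0) * ds \<beta> f) = a * ds \<alpha> f" for f
    proof -
      have "(\<Sum>\<beta>\<in>?S. (if \<beta> = \<alpha> then a else 0) * ds \<beta> f) = (\<Sum>\<beta>\<in>?S. if \<beta> = \<alpha> then a * ds \<alpha> f else 0)"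
        by (rule sum.cong[OF refl]) simp
      also have "\<dots> = a * ds \<alpha> f" using monom by (simp only: sum.delta[OF finite_multi_indices] mem_Collect_eq simp_thms if_True)
      finally show ?thesis .
    qed
    then have F: "\<forall>f. a * ds \<alpha> f = (\<Sum>\<beta>\<in>?S. (if \<beta> = \<alpha> then a else 0) * ds \<beta> f)"
      by (intro allI) (rule sym)
    show ?case by (rule exI[where x = "\<lambda>\<beta>. if \<beta> = \<alpha> then a else 0"]) (rule F)
  next
    case (add P Q)
    obtain a where a: "\<forall>f. P f = (\<Sum>\<alpha>\<in>mi k. a \<alpha> * ds \<alpha> f)"
      by (rule exE[OF add.IH(1)])
    obtain b where b: "\<forall>f. Q f = (\<Sum>\<alpha>\<in>mi k. b \<alpha> * ds \<alpha> f)"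
      by (rule exE[OF add.IH(2)])
    show ?case
      by (rule exI[where x = "\<lambda>\<alpha>. a \<alpha> + b \<alpha>"]) (simp only: a[rule_format] b[rule_format] distrib_right sum.distrib simp_thms)
  next
    case zero
    show ?case by (intro exI[of _ "\<lambda>_. 0"]) simp
  qed
  then show ?thesis using that by blast
qed

lemma dopl_sum: "(\<And>i. i \<in> I ==> Q i \<in> dopl k) ==> (\<lambda>f. \<Sum>i\<in>I. Q i f) \<in> dopl k"
  by (induction I rule: infinite_finite_induct) (auto intro: dopl.zero dopl.add)

lemma dopl_0: "Q \<in> dopl 0 ==> Q f = 0"
  by (induction rule: dopl.induct) auto

lemma dopl_plus: "Q \<in> dopl k ==> Q (f + g) = Q f + Q g"
  by (induction rule: dopl.induct) (auto simp: algebra_simps)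

lemma dopl_zero_arg: "Q \<in> dopl k ==> Q 0 = 0"
  by (induction rule: dopl.induct) auto

lemma dopl_scale_arg: "Q \<in> dopl k ==> Q (r *\<^sub>R f) = r *\<^sub>R Q f"
  by (induction rule: dopl.induct) (auto simp: algebra_simps)

lemma dopl_minus_arg: "Q \<in> dopl k ==> Q (f - g) = Q f - Q g"
  using dopl_plus[of Q k f "- g"] dopl_scale_arg[of Q k "-1" g] by simp

lemma dopl_local: "Q \<in> dopl k ==> open V ==> eqon V f g ==> eqon V (Q f) (Q g)"
proof (induction rule: dopl.induct)
  case (monom \<alpha> a)
  then show ?case using eqon_ds[of V f g \<alpha>] by (simp add: eqon_def)
qed (auto simp: eqon_def)

lemma dopl_mono: "Q \<in> dopl k ==> k \<le> l ==> Q \<in> dopl l"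
  by (induction rule: dopl.induct) (auto intro: dopl.intros)

lemma dopl_mult: "Q \<in> dopl k ==> (\<lambda>f. h * Q f) \<in> dopl k"
proof (induction rule: dopl.induct)
  case (monom \<alpha> a)
  then show ?case using dopl.monom[of \<alpha> k "h * a"] by (simp add: mult.assoc)
next
  case (add P Q)
  then show ?case using dopl.add[OF add.IH] by (simp add: algebra_simps)
qed (simp add: dopl.zero)

lemma dopl_scaleR: "Q \<in> dopl k ==> (\<lambda>f. r *\<^sub>R Q f) \<in> dopl k"
  using dopl_mult[of Q k "of_real r"] by (simp add: of_real_def)

lemma dopl_minus: "P \<in> dopl k ==> Q \<in> dopl k ==> (\<lambda>f. P f - Q f) \<in> dopl k"
  using dopl.add[of P k "\<lambda>f. -1 * Q f"] dopl_mult[of Q k "-1"] by simp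

lemma dopl_dv_left: "Q \<in> dopl k ==> v \<in> Basis ==> (\<lambda>f. dv v (Q f)) \<in> dopl (Suc k)"
proof (induction rule: dopl.induct)
  case (monom \<alpha> a)
  then have "(\<lambda>f. a * ds (v # \<alpha>) f) \<in> dopl (Suc k)" "(\<lambda>f. dv v a * ds \<alpha> f) \<in> dopl (Suc k)"
    by (intro dopl.monom; auto)+
  from dopl.add[OF this] show ?case by simp
next
  case (add P Q)
  then show ?case using dopl.add by fastforce
qed (simp add: dopl.zero)

lemma dopl_dv_right: "Q \<in> dopl k ==> v \<in> Basis ==> (\<lambda>f. Q (dv v f)) \<in> dopl (Suc k)"
proof (induction rule: dopl.induct)
  case (monom \<alpha> a)
  then have "(\<lambda>f. a * ds (v # \<alpha>) f) \<in> dopl (Suc k)"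
    by (intro dopl.monom) auto
  then show ?case by (simp add: dv_ds)
next
  case (add P Q)
  then show ?case using dopl.add by fastforce
qed (simp add: dopl.zero)

text \<open>The commutator [Q, h] of \<open>Q\<close> with multiplication by \<open>h\<close>. It
  lowers the order by one, so that long iterated commutators vanish.\<close>

definition ad :: "'e::euclidean_space sfun => ('e sfun => 'e sfun) => 'e sfun => 'e sfun" where
  "ad h Q f = Q (h * f) - h * Q f"

lemma ad_ds_dopl:
  "set \<alpha> \<subseteq> Basis ==> length \<alpha> < Suc k ==> ad h (ds \<alpha>) \<in> dopl k"
proof (induction \<alpha> arbitrary: k)
  case Nil
  have "ad h (ds []) = (\<lambda>f. 0)" by (auto simp: ad_def)
  then show ?case using dopl.zero by (simp only:)
next
  case (Cons v \<alpha>)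
  then obtain k' where k: "k = Suc k'" by (cases k) auto
  have "ad h (ds (v # \<alpha>)) = (\<lambda>f. dv v (ad h (ds \<alpha>) f) + dv v h * ds \<alpha> f)"
    by (auto simp: ad_def algebra_simps)
  moreover have "(\<lambda>f. dv v (ad h (ds \<alpha>) f)) \<in> dopl k"
    unfolding k using Cons by (intro dopl_dv_left Cons.IH) (auto simp: k)
  moreover have "(\<lambda>f. dv v h * ds \<alpha> f) \<in> dopl k" using Cons by (intro dopl.monom) auto
  ultimately show ?case by (simp only: dopl.add)
qed

lemma ad_dopl: "Q \<in> dopl (Suc k) ==> ad h Q \<in> dopl k"
proof (induction rule: dopl.induct)
  case (monom \<alpha> a)
  have "ad h (\<lambda>f. a * ds \<alpha> f) = (\<lambda>f. a * ad h (ds \<alpha>) f)" by (auto simp: ad_def algebra_simps)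
  then show ?case using dopl_mult[OF ad_ds_dopl[OF monom(1,2)]] by simp
next
  case (add P Q)
  have "ad h (\<lambda>f. P f + Q f) = (\<lambda>f. ad h P f + ad h Q f)" by (auto simp: ad_def algebra_simps)
  then show ?case using dopl.add[OF add.IH] by simp
next
  case zero
  have "ad h (\<lambda>f. 0) = (\<lambda>f. 0)" by (auto simp: ad_def)
  then show ?case by (simp add: dopl.zero)
qed

lemma ad_dopl': "Q \<in> dopl k ==> ad h Q \<in> dopl k"
  using ad_dopl[of Q k h] dopl_mono[of Q k "Suc k"] by simp

lemma dopl_mult_right: "Q \<in> dopl k ==> (\<lambda>f. Q (h * f)) \<in> dopl k"
  using dopl.add[OF ad_dopl'[of Q k h] dopl_mult[of Q k h]] by (simp add: ad_def)

lemma dopl_commutator_dv: "Q \<in> dopl k ==> v \<in> Basis ==> (\<lambda>f. dv v (Q f) - Q (dv v f)) \<in> dopl k"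
proof (induction rule: dopl.induct)
  case (monom \<alpha> a)
  have "(\<lambda>f. dv v (a * ds \<alpha> f) - a * ds \<alpha> (dv v f)) = (\<lambda>f. dv v a * ds \<alpha> f)"
    by (auto simp: dv_ds)
  then show ?case using monom dopl.monom by force
next
  case (add P Q)
  have "(\<lambda>f. dv v (P f + Q f) - (P (dv v f) + Q (dv v f))) =
      (\<lambda>f. (dv v (P f) - P (dv v f)) + (dv v (Q f) - Q (dv v f)))" by (auto simp: algebra_simps)
  then show ?case using dopl.add[OF add.IH] add.prems by simp
qed (simp add: dopl.zero)

text \<open>Operators on the model space are compared at the points of \<open>V\<close> only: those
  carried over from a manifold are cut off, and they are the right ones only there.\<close>

definition eqop :: "'e::euclidean_space set => ('e sfun => 'e sfun) => ('e sfun => 'e sfun) => bool" where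
  "eqop V P Q \<longleftrightarrow> (\<forall>f. \<forall>y\<in>V. ev (P f) y = ev (Q f) y)"

lemma eqopI: "(\<And>f y. y \<in> V ==> ev (P f) y = ev (Q f) y) ==> eqop V P Q"
  by (simp add: eqop_def)

lemma eqopD: "eqop V P Q ==> y \<in> V ==> ev (P f) y = ev (Q f) y"
  by (simp add: eqop_def)

lemma eqop_refl [simp]: "eqop V P P" by (simp add: eqop_def)

lemma eqop_sym: "eqop V P Q ==> eqop V Q P" by (simp add: eqop_def)

lemma eqop_trans: "eqop V P Q ==> eqop V Q R ==> eqop V P R" by (simp add: eqop_def)

lemma eqop_dv: "open V ==> eqop V P Q ==> eqop V (\<lambda>f. dv v (P f)) (\<lambda>f. dv v (Q f))"
  using eqon_dv unfolding eqop_def eqon_def by blast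

lemma eqop_dvD: "open V ==> eqop V P Q ==> y \<in> V ==> ev (dv v (P f)) y = ev (dv v (Q f)) y"
  using eqop_dv[of V P Q v] by (simp add: eqop_def)

lemma ad_eqop: "eqop V P Q ==> eqop V (ad h P) (ad h Q)"
  by (simp add: eqop_def ad_def)

lemma ad_commute: "ad g (ad h Q) = ad h (ad g Q)"
  by (rule ext) (simp add: ad_def algebra_simps)

lemma ad_zero [simp]: "ad h (\<lambda>f. 0) = (\<lambda>f. 0)"
  by (rule ext) (simp add: ad_def)

lemma ad_pow_dopl: "Q \<in> dopl (m + k) ==> (ad h ^^ m) Q \<in> dopl k"
  by (induction m arbitrary: k) (auto intro!: ad_dopl simp flip: add_Suc_right)

lemma ad_pow_zero:
  assumes "Q \<in> dopl k" "k \<le> m"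
  shows "(ad h ^^ m) Q = (\<lambda>f. 0)"
proof -
  have "(ad h ^^ m) Q \<in> dopl 0" by (rule ad_pow_dopl) (use assms dopl_mono in auto)
  then show ?thesis using dopl_0 by auto
qed

lemma ad_pow_dopl': "Q \<in> dopl k ==> (ad h ^^ m) Q \<in> dopl k"
  by (induction m) (auto intro: ad_dopl')

lemma ad_relation_step:
  assumes i: "i \<in> Basis" and E: "E \<in> dopl l"
    and r: "eqop V (\<lambda>f. ad (xc i) E (dv i f)) (\<lambda>f. r *\<^sub>R E f)"
  shows "eqop V (\<lambda>f. ad (xc i) (ad (xc i) E) (dv i f)) (\<lambda>f. (r - 1) *\<^sub>R ad (xc i) E f)"
proof (rule eqopI)
  fix f y assume y: "y \<in> V"
  let ?G = "ad (xc i) E"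
  \<comment> \<open>Moving \<open>xc i\<close> past \<open>dv i\<close> costs one \<open>f\<close>;
    the relation, used at \<open>xc i * f\<close> and at \<open>f\<close>, therefore reappears with
    \<open>r - 1\<close>.\<close>
  have "xc i * dv i f = dv i (xc i * f) - f" using i by (simp add: dv_xc_Basis)
  then have "ad (xc i) ?G (dv i f) = ?G (dv i (xc i * f)) - ?G f - xc i * ?G (dv i f)"
    using dopl_minus_arg[OF ad_dopl'[OF E]] by (simp only: ad_def[of "xc i" ?G])
  from arg_cong[OF this, of "\<lambda>g. ev g y"] show "ev (ad (xc i) ?G (dv i f)) y = ev ((r - 1) *\<^sub>R ?G f) y"
    using eqopD[OF r y, of "xc i * f"] eqopD[OF r y, of f] by (simp add: ad_def algebra_simps del: dv_mult)
qed

text \<open>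
  The hypothesis says that \<open>E\<close> is homogeneous of degree \<open>r\<close> in \<open>\<partial>\<^sub>i\<close>. Iterated commutators with
  \<open>x\<^sub>i\<close> lower the degree by one each time and eventually vanish.
\<close>

lemma ad_relation_pow:
  assumes i: "i \<in> Basis" and E: "E \<in> dopl l"
    and r: "eqop V (\<lambda>f. ad (xc i) E (dv i f)) (\<lambda>f. r *\<^sub>R E f)"
  shows "eqop V (\<lambda>f. (ad (xc i) ^^ Suc m) E (dv i f)) (\<lambda>f. (r - real m) *\<^sub>R (ad (xc i) ^^ m) E f)"
proof (induction m)
  case 0
  then show ?case using r by simp
next
  case (Suc m)
  have "(ad (xc i) ^^ m) E \<in> dopl l" using E ad_pow_dopl' by blast
  from ad_relation_step[OF i this, of V "r - real m"] Suc show ?case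
    by (simp add: algebra_simps)
qed

text \<open>Descending induction on the length \<open>p\<close> of the commutator. From length
  \<open>l\<close> on it vanishes for reasons of order. If length \<open>p + 1\<close> vanishes, the
  relation shows that \<open>r - p\<close> times the commutator of length \<open>p\<close> is zero,
  and \<open>r \<noteq> p\<close> for \<open>p \<ge> m\<close>.\<close>

lemma ad_pow_vanish:
  assumes i: "i \<in> Basis" and E: "E \<in> dopl l"
    and r: "eqop V (\<lambda>f. ad (xc i) E (dv i f)) (\<lambda>f. r *\<^sub>R E f)"
    and m: "\<And>j. j \<ge> m ==> r \<noteq> real j"
  shows "eqop V ((ad (xc i) ^^ m) E) (\<lambda>f. 0)"
proof -
  have "eqop V ((ad (xc i) ^^ (l + m - j)) E) (\<lambda>f. 0)" if "j \<le> l" for j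
    using that
  proof (induction j)
    case 0
    then show ?case using ad_pow_zero[OF E] by simp
  next
    case (Suc j)
    define p where "p = l + m - Suc j"
    have p: "l + m - j = Suc p" "p \<ge> m" using Suc by (auto simp: p_def)
    have "eqop V ((ad (xc i) ^^ Suc p) E) (\<lambda>f. 0)" using Suc p by simp
    then have "(r - real p) * ev ((ad (xc i) ^^ p) E f) y = 0" if "y \<in> V" for f y
      using eqopD[OF ad_relation_pow[OF i E r, of p] that, of f] that by (simp add: eqop_def)
    then show ?case using m[OF p(2)] by (auto simp: eqop_def p_def[symmetric])
  qed
  from this[of l] show ?thesis by simp
qed

lemma ad_relation_nonnat:
  assumes "i \<in> Basis" "E \<in> dopl l" "eqop V (\<lambda>f. ad (xc i) E (dv i f)) (\<lambda>f. r *\<^sub>R E f)" "r < 0"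
  shows "eqop V E (\<lambda>f. 0)"
  using ad_pow_vanish[OF assms(1-3), of 0] assms(4) by simp

text \<open>Iterating the relation \<open>m\<close> times yields the factors m, m - 1, ..., 1. After
  that the degree in \<partial>_i is used up, and the next commutator vanishes.\<close>

lemma ad_relation_nat:
  assumes i: "i \<in> Basis" and E: "E \<in> dopl l"
    and r: "eqop V (\<lambda>f. ad (xc i) E (dv i f)) (\<lambda>f. real m *\<^sub>R E f)"
  shows "eqop V (\<lambda>f. (ad (xc i) ^^ m) E ((dv i ^^ m) f)) (\<lambda>f. fact m *\<^sub>R E f)"
    "eqop V ((ad (xc i) ^^ Suc m) E) (\<lambda>f. 0)"
proof -
  show "eqop V ((ad (xc i) ^^ Suc m) E) (\<lambda>f. 0)"
    by (rule ad_pow_vanish[OF i E r]) auto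
  have "eqop V (\<lambda>f. (ad (xc i) ^^ j) E ((dv i ^^ j) f)) (\<lambda>f. (\<Prod>p<j. real m - real p) *\<^sub>R E f)" for j
  proof (induction j)
    case (Suc j)
    show ?case
    proof (rule eqopI)
      fix f y assume y: "y \<in> V"
      show "ev ((ad (xc i) ^^ Suc j) E ((dv i ^^ Suc j) f)) y = ev ((\<Prod>p<Suc j. real m - real p) *\<^sub>R E f) y"
        using eqopD[OF ad_relation_pow[OF i E r, of j] y, of "(dv i ^^ j) f"] eqopD[OF Suc y, of f] by simp
    qed
  qed simp
  moreover have "(\<Prod>p<m. real m - real p) = fact m"
    using fact_prod_rev[of m, where ?'a = real] by (simp add: atLeast0LessThan of_nat_diff)
  ultimately show "eqop V (\<lambda>f. (ad (xc i) ^^ m) E ((dv i ^^ m) f)) (\<lambda>f. fact m *\<^sub>R E f)"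
    by metis
qed

text \<open>The number operator: it multiplies the part of degree \<open>j\<close> of a differential operator by \<open>j\<close>.\<close>

definition numop :: "('e::euclidean_space sfun => 'e sfun) => 'e sfun => 'e sfun" where
  "numop Q f = (\<Sum>i\<in>Basis. ad (xc i) Q (dv i f))"

lemma numop_ds: "set \<alpha> \<subseteq> Basis ==> numop (ds \<alpha>) f = of_nat (length \<alpha>) * ds \<alpha> f"
proof (induction \<alpha>)
  case Nil
  then show ?case by (simp add: numop_def ad_def)
next
  case (Cons v \<alpha>)
  have v: "v \<in> Basis" using Cons by simp
  have "numop (ds (v # \<alpha>)) f = (\<Sum>i\<in>Basis. dv v (ad (xc i) (ds \<alpha>) (dv i f)) + dv v (xc i) * ds \<alpha> (dv i f))"
    unfolding numop_def by (rule sum.cong) (auto simp: ad_def)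
  also have "\<dots> = dv v (numop (ds \<alpha>) f) + (\<Sum>i\<in>Basis. dv v (xc i) * ds \<alpha> (dv i f))"
    by (simp add: numop_def sum.distrib)
  also have "(\<Sum>i\<in>Basis. dv v (xc i) * ds \<alpha> (dv i f)) = (\<Sum>i\<in>Basis. if i = v then ds \<alpha> (dv i f) else 0)"
    using v by (intro sum.cong) (auto simp: dv_xc_Basis)
  finally show ?case using Cons v by (simp add: dv_ds[symmetric] algebra_simps)
qed

lemma numop_eqop: "eqop V P Q ==> eqop V (numop P) (numop Q)"
  using ad_eqop[of V P Q] by (simp add: eqop_def numop_def)

text \<open>Terms of order zero are excluded so that \<open>numop\<close> multiplies every monomial
  by a positive number.\<close>

inductive_set dop_pos :: "nat => ('e::euclidean_space sfun => 'e sfun) set" for k where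
  monom: "set \<alpha> \<subseteq> Basis ==> 0 < length \<alpha> ==> length \<alpha> < k ==> (\<lambda>f. a * ds \<alpha> f) \<in> dop_pos k"
| add: "P \<in> dop_pos k ==> Q \<in> dop_pos k ==> (\<lambda>f. P f + Q f) \<in> dop_pos k"
| zero: "(\<lambda>f. 0) \<in> dop_pos k"

lemma numop_monom: "set \<alpha> \<subseteq> Basis ==> numop (\<lambda>f. a * ds \<alpha> f) f = of_nat (length \<alpha>) * (a * ds \<alpha> f)"
proof -
  assume "set \<alpha> \<subseteq> Basis"
  have "numop (\<lambda>f. a * ds \<alpha> f) f = a * numop (ds \<alpha>) f"
    by (simp add: numop_def ad_def sum_distrib_left algebra_simps)
  then show ?thesis using numop_ds[OF \<open>set \<alpha> \<subseteq> Basis\<close>] by (simp add: algebra_simps)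
qed

lemma numop_add: "numop (\<lambda>f. P f + Q f) f = numop P f + numop Q f"
  by (simp add: numop_def ad_def sum.distrib[symmetric] algebra_simps)

lemma numop_scaleR: "numop (\<lambda>f. r *\<^sub>R P f) f = r *\<^sub>R numop P f"
  by (simp add: numop_def ad_def scaleR_sum_right algebra_simps)

lemma numop_zero [simp]: "numop (\<lambda>f. 0) = (\<lambda>f. 0)"
  by (rule ext) (simp add: numop_def)

text \<open>\<open>numop\<close> multiplies monomials of degree \<open>k\<close> by
  \<open>k\<close>, so subtracting \<open>k\<close> times the operator removes them. This lowers the
  order without speaking of principal symbols.\<close>

lemma numop_lower:
  assumes "Q \<in> dop_pos (Suc k)"
  shows "(\<lambda>f. numop Q f - real k *\<^sub>R Q f) \<in> dop_pos k"
  using assms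
proof induction
  case (monom \<alpha> a)
  have eq: "(\<lambda>f. numop (\<lambda>f. a * ds \<alpha> f) f - real k *\<^sub>R (a * ds \<alpha> f)) =
      (\<lambda>f. ((of_nat (length \<alpha>) - of_nat k) * a) * ds \<alpha> f)"
    using numop_monom[OF monom(1)] by (auto simp: algebra_simps scaleR_conv_of_real)
  show ?case
  proof (cases "length \<alpha> = k")
    case True
    then have z: "((of_nat (length \<alpha>) - of_nat k) * a) = 0" by simp
    show ?thesis unfolding eq z using dop_pos.zero by simp
  next
    case False
    then show ?thesis unfolding eq using monom by (intro dop_pos.monom) auto
  qed
next
  case (add P Q)
  have "(\<lambda>f. numop (\<lambda>f. P f + Q f) f - real k *\<^sub>R (P f + Q f)) =
      (\<lambda>f. (numop P f - real k *\<^sub>R P f) + (numop Q f - real k *\<^sub>R Q f))"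
    by (auto simp: numop_add algebra_simps)
  then show ?case using dop_pos.add[OF add.IH] by simp
next
  case zero
  show ?case by (simp add: dop_pos.zero)
qed

lemma dop_pos_0: "Q \<in> dop_pos k ==> k \<le> 1 ==> Q f = 0"
proof (induction rule: dop_pos.induct)
  case (monom \<alpha> a)
  then have False by linarith
  then show ?case ..
qed auto

text \<open>\<open>numop Q - k Q\<close> has lower order and is annihilated by \<open>numop\<close>
  as well, hence vanishes by induction; then \<open>k Q = 0\<close>.\<close>

lemma numop_eigen:
  assumes "Q \<in> dop_pos k" "eqop V (numop Q) (\<lambda>f. 0)"
  shows "eqop V Q (\<lambda>f. 0)"
  using assms
proof (induction k arbitrary: Q)
  case 0
  then show ?case using dop_pos_0[OF 0(1)] by (simp add: eqop_def)
next
  case (Suc k)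
  show ?case
  proof (cases "k = 0")
    case True
    then show ?thesis using dop_pos_0[OF Suc.prems(1)] by (simp add: eqop_def)
  next
    case False
    let ?R = "\<lambda>f. numop Q f - real k *\<^sub>R Q f"
    have RQ: "eqop V ?R (\<lambda>f. (- real k) *\<^sub>R Q f)" using Suc.prems(2) by (simp add: eqop_def)
    have "eqop V (numop ?R) (\<lambda>f. (- real k) *\<^sub>R numop Q f)"
      using numop_eqop[OF RQ] unfolding eqop_def numop_scaleR .
    then have "eqop V (numop ?R) (\<lambda>f. 0)" using Suc.prems(2) by (simp add: eqop_def)
    from Suc.IH[OF numop_lower[OF Suc.prems(1)] this] RQ False show ?thesis
      by (simp add: eqop_def)
  qed
qed

lemma dopl_split: "Q \<in> dopl k ==> \<exists>a. \<exists>P\<in>dop_pos k. Q = (\<lambda>f. a * f + P f)"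
proof (induction rule: dopl.induct)
  case (monom \<alpha> a)
  show ?case
  proof (cases "\<alpha> = []")
    case True
    then show ?thesis by (intro exI[of _ a] bexI[of _ "\<lambda>f. 0"]) (auto intro: dop_pos.zero)
  next
    case False
    then show ?thesis using monom by (intro exI[of _ 0] bexI[of _ "\<lambda>f. a * ds \<alpha> f"]) (auto intro: dop_pos.monom)
  qed
next
  case (add P Q)
  then obtain a b P' Q' where "P' \<in> dop_pos k" "Q' \<in> dop_pos k"
    "P = (\<lambda>f. a * f + P' f)" "Q = (\<lambda>f. b * f + Q' f)" by blast
  then show ?case
    by (intro exI[of _ "a + b"] bexI[of _ "\<lambda>f. P' f + Q' f"]) (auto intro: dop_pos.add simp: algebra_simps)
next
  case zero
  show ?case by (intro exI[of _ 0] bexI[of _ "\<lambda>f. 0"]) (auto intro: dop_pos.zero)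
qed

text \<open>If all commutators with coordinates vanish, so does \<open>numop\<close> of the part
  without terms of order zero, and with it that part.\<close>

lemma commuting_with_coordinates:
  assumes "Q \<in> dopl k" "\<And>i. i \<in> Basis ==> eqop V (ad (xc i) Q) (\<lambda>f. 0)"
  shows "eqop V Q (\<lambda>f. Q 1 * f)"
proof -
  obtain a P where P: "P \<in> dop_pos k" "Q = (\<lambda>f. a * f + P f)" using dopl_split[OF assms(1)] by blast
  have "ad (xc i) Q = ad (xc i) P" for i by (rule ext) (simp add: ad_def P(2) algebra_simps)
  then have "eqop V (numop P) (\<lambda>f. 0)" using assms(2) by (simp add: eqop_def numop_def)
  from numop_eigen[OF P(1) this] show ?thesis by (simp add: eqop_def P(2))
qed

lemma eqon_constant:
  assumes V: "convex V" "open V" "V \<noteq> {}" and d: "\<And>i y. i \<in> Basis ==> y \<in> V ==> ev (dv i e) y = 0"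
  shows "\<exists>c. \<forall>y\<in>V. ev e y = c"
proof -
  have "ev (dv v e) y = 0" if "y \<in> V" for v y
    by (subst dv_expand) (simp add: d that)
  then have "fd (ev e) y = (\<lambda>v. 0)" if "y \<in> V" for y
    using that by (simp add: dv.rep_eq fun_eq_iff)
  then have "(ev e has_derivative (\<lambda>v. 0)) (at y within V)" if "y \<in> V" for y
    using smooth_on_has_derivative[OF smooth_ev[of UNIV e], of y] that by (simp add: has_derivative_at_withinI)
  from has_derivative_zero_constant[OF V(1) this] show ?thesis by blast
qed

text \<open>
  Commuting with all \<open>x\<^sub>j\<close>, \<open>j \<noteq> i\<close>, and all \<open>\<partial>\<^sub>j\<close> leaves a polynomial in \<open>\<partial>\<^sub>i\<close> with constant
  coefficients.
\<close>

lemma dopl_characterize_power: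
  fixes E :: "'e::euclidean_space sfun => 'e sfun"
  assumes V: "convex V" "open V" "V \<noteq> {}" and i: "i \<in> Basis" and E: "E \<in> dopl l"
    and r: "eqop V (\<lambda>f. ad (xc i) E (dv i f)) (\<lambda>f. real m *\<^sub>R E f)"
    and x: "\<And>j. j \<in> Basis ==> j \<noteq> i ==> eqop V (ad (xc j) E) (\<lambda>f. 0)"
    and d: "\<And>j. j \<in> Basis ==> eqop V (\<lambda>f. dv j (E f) - E (dv j f)) (\<lambda>f. 0)"
  shows "\<exists>b. eqop V E (\<lambda>f. b *\<^sub>R (dv i ^^ m) f)"
proof -
  let ?F = "\<lambda>m. (ad (xc i) ^^ m) E"
  have Fd: "?F m \<in> dopl l" for m by (rule ad_pow_dopl'[OF E])
  \<comment> \<open>\<open>?F m\<close> commutes with \<open>xc i\<close> because its degree in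
    \<partial>_i is exhausted, and with the other coordinates because commutators with different
    coordinates may be taken in any order.\<close>
  have "eqop V (ad (xc j) (?F m)) (\<lambda>f. 0)" if "j \<in> Basis" for j
  proof (cases "j = i")
    case True
    then show ?thesis using ad_relation_nat(2)[OF i E r] by simp
  next
    case False
    have "eqop V (ad (xc j) (?F p)) (\<lambda>f. 0)" for p
    proof (induction p)
      case 0
      then show ?case using x[OF that False] by simp
    next
      case (Suc p)
      from ad_eqop[OF this, of "xc i"] show ?case by (simp add: ad_commute[of "xc j"])
    qed
    then show ?thesis .
  qed
  from commuting_with_coordinates[OF Fd this]
  have F1: "eqop V (?F m) (\<lambda>f. ?F m 1 * f)" .
  \<comment> \<open>Commuting with \<partial>_j is inherited by commutators with x_i since
    [\<partial>_j, x_i] is a number. It makes the function \<open>?F m 1\<close> constant.\<close>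
  have Fcom: "eqop V (\<lambda>f. dv j (?F p f) - ?F p (dv j f)) (\<lambda>f. 0)" if j: "j \<in> Basis" for j p
  proof (induction p)
    case 0
    then show ?case using d[OF j] by simp
  next
    case (Suc p)
    show ?case
    proof (rule eqopI)
      fix f y assume y: "y \<in> V"
      let ?G = "?F p"
      have c: "dv j (xc i) = of_real (j \<bullet> i)" by (rule dv_xc)
      have "ad (xc i) ?G (dv j f) = ?G (dv j (xc i * f)) - (j \<bullet> i) *\<^sub>R ?G f - xc i * ?G (dv j f)"
      proof -
        have "xc i * dv j f = dv j (xc i * f) - (j \<bullet> i) *\<^sub>R f" by (simp add: c scaleR_conv_of_real)
        then show ?thesis
          by (simp only: ad_def dopl_minus_arg[OF Fd] dopl_scale_arg[OF Fd])
      qed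
      moreover have "dv j (ad (xc i) ?G f) = dv j (?G (xc i * f)) - xc i * dv j (?G f) - (j \<bullet> i) *\<^sub>R ?G f"
        by (simp add: ad_def c scaleR_conv_of_real algebra_simps)
      ultimately show "ev (dv j (?F (Suc p) f) - ?F (Suc p) (dv j f)) y = ev 0 y"
        using eqopD[OF Suc y, of "xc i * f"] eqopD[OF Suc y, of f] by simp
    qed
  qed
  have "\<exists>c. \<forall>y\<in>V. ev (?F m 1) y = c"
  proof (rule eqon_constant[OF V])
    fix j y :: 'e assume "j \<in> Basis" "y \<in> V"
    then show "ev (dv j (?F m 1)) y = 0"
      using eqopD[OF Fcom[of j m], of y 1] dopl_zero_arg[OF Fd] by simp
  qed
  then obtain c where c: "\<And>y. y \<in> V ==> ev (?F m 1) y = c" by blast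
  \<comment> \<open>\<open>fact m\<close> times \<open>E\<close> is \<open>?F m\<close> composed
    with \<partial>_i^m, and on \<open>V\<close> the operator \<open>?F m\<close> is multiplication
    by \<open>c\<close>.\<close>
  have "eqop V E (\<lambda>f. (c / fact m) *\<^sub>R (dv i ^^ m) f)"
  proof (rule eqopI)
    fix f y assume y: "y \<in> V"
    show "ev (E f) y = ev ((c / fact m) *\<^sub>R (dv i ^^ m) f) y"
      using eqopD[OF ad_relation_nat(1)[OF i E r] y, of f] eqopD[OF F1 y, of "(dv i ^^ m) f"] c[OF y]
      by (simp add: field_simps)
  qed
  then show ?thesis by blast
qed

section \<open>Invariant maps on a coordinate domain\<close>

text \<open>
  The action of the vector field \<open>h \<partial>\<^sub>j\<close> on operators with values in functions, where the
  arguments are functions (\<open>w = 0\<close>) or coefficients of top degree forms (\<open>w = 1\<close>).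
\<close>

definition lieq :: "real => 'e::euclidean_space sfun => 'e => ('e sfun => 'e sfun) => 'e sfun => 'e sfun" where
  "lieq w h j Q f = h * dv j (Q f) - Q (h * dv j f) - w *\<^sub>R Q (dv j h * f)"

lemma lieq_dopl:
  assumes Q: "Q \<in> dopl k" and j: "j \<in> Basis"
  shows "lieq w h j Q \<in> dopl k"
proof (cases k)
  case 0
  then have "Q = (\<lambda>f. 0)" using dopl_0 Q by blast
  then have "lieq w h j Q = (\<lambda>f. 0)" by (auto simp: lieq_def)
  then show ?thesis using dopl.zero by simp
next
  case (Suc k')
  \<comment> \<open>Grouped as h [\<partial>_j, Q] - [Q, h] \<partial>_j - w Q (\<partial>_j h),
    where no term exceeds the order of \<open>Q\<close>.\<close>
  have "lieq w h j Q = (\<lambda>f. h * (dv j (Q f) - Q (dv j f)) - ad h Q (dv j f) - w *\<^sub>R Q (dv j h * f))"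
    by (auto simp: lieq_def ad_def algebra_simps)
  moreover have "(\<lambda>f. ad h Q (dv j f)) \<in> dopl k"
    using Suc Q j by (auto intro: dopl_dv_right ad_dopl)
  ultimately show ?thesis
    by (simp only:) (intro dopl_minus dopl_mult dopl_commutator_dv dopl_scaleR dopl_mult_right Q j; assumption)
qed

lemma lieq_eqop:
  assumes "open V" "eqop V P Q"
  shows "eqop V (lieq w h j P) (lieq w h j Q)"
  using eqop_dvD[OF assms, of _ j] assms(2) by (simp add: eqop_def lieq_def)

lemma lieq_add: "lieq w h j (\<lambda>f. P f + Q f) f = lieq w h j P f + lieq w h j Q f"
  by (simp add: lieq_def algebra_simps)

lemma lieq_scaleR: "lieq w h j (\<lambda>f. r *\<^sub>R P f) f = r *\<^sub>R lieq w h j P f"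
  by (simp add: lieq_def algebra_simps)

lemma lieq_zero: "lieq w h j (\<lambda>f. 0) f = 0"
  by (simp add: lieq_def)

text \<open>Linearity and invariance are required on \<open>V\<close> only, which is what a map
  transported from the manifold by cutoffs satisfies.\<close>

definition flat_inv ::
    "'e::euclidean_space set => real => nat => (('e sfun => 'e sfun) => 'e sfun => 'e sfun) => bool" where
  "flat_inv V w k t \<longleftrightarrow>
     (\<forall>Q\<in>dopl (Suc k). \<exists>l. t Q \<in> dopl l) \<and>
     (\<forall>P\<in>dopl (Suc k). \<forall>Q\<in>dopl (Suc k). eqop V (t (\<lambda>f. P f + Q f)) (\<lambda>f. t P f + t Q f)) \<and>
     (\<forall>r. \<forall>Q\<in>dopl (Suc k). eqop V (t (\<lambda>f. r *\<^sub>R Q f)) (\<lambda>f. r *\<^sub>R t Q f)) \<and>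
     (\<forall>j\<in>Basis. \<forall>h. \<forall>Q\<in>dopl (Suc k). eqop V (t (lieq w h j Q)) (lieq w h j (t Q)))"

lemma flat_inv_id: "flat_inv V w k (\<lambda>Q. Q)"
  by (auto simp: flat_inv_def)

lemma flat_inv_lincomb:
  assumes "open V" "flat_inv V w k t" "flat_inv V w k u"
  shows "flat_inv V w k (\<lambda>Q f. r *\<^sub>R t Q f + s *\<^sub>R u Q f)"
  unfolding flat_inv_def
proof (intro conjI ballI allI)
  fix Q :: "'a sfun => 'a sfun" assume Q: "Q \<in> dopl (Suc k)"
  obtain l1 l2 where l: "t Q \<in> dopl l1" "u Q \<in> dopl l2" using assms Q unfolding flat_inv_def by meson
  then have "t Q \<in> dopl (max l1 l2)" "u Q \<in> dopl (max l1 l2)" by (auto intro: dopl_mono)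
  then show "\<exists>l. (\<lambda>f. r *\<^sub>R t Q f + s *\<^sub>R u Q f) \<in> dopl l" by (metis dopl.add dopl_scaleR)
  show "eqop V (\<lambda>f. r *\<^sub>R t (\<lambda>f. c *\<^sub>R Q f) f + s *\<^sub>R u (\<lambda>f. c *\<^sub>R Q f) f)
       (\<lambda>f. c *\<^sub>R (r *\<^sub>R t Q f + s *\<^sub>R u Q f))" for c
    using assms Q by (simp add: flat_inv_def eqop_def algebra_simps)
  show "eqop V (\<lambda>f. r *\<^sub>R t (\<lambda>f. P f + Q f) f + s *\<^sub>R u (\<lambda>f. P f + Q f) f)
       (\<lambda>f. r *\<^sub>R t P f + s *\<^sub>R u P f + (r *\<^sub>R t Q f + s *\<^sub>R u Q f))" if "P \<in> dopl (Suc k)" for P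
    using assms Q that by (simp add: flat_inv_def eqop_def algebra_simps)
  fix j :: 'a and h assume "j \<in> Basis"
  then show "eqop V (\<lambda>f. r *\<^sub>R t (lieq w h j Q) f + s *\<^sub>R u (lieq w h j Q) f)
        (lieq w h j (\<lambda>f. r *\<^sub>R t Q f + s *\<^sub>R u Q f))"
    using assms Q by (simp add: flat_inv_def eqop_def lieq_add lieq_scaleR)
qed

text \<open>A constant of its own for powers of \<partial>_i, so that the simplifier collects
  derivatives into them (\<open>dpw_dv\<close>) instead of unfolding \<open>^^\<close>.\<close>

definition dpw :: "'e::euclidean_space => nat => 'e sfun => 'e sfun" where
  "dpw i m = dv i ^^ m"

lemma dpw_0 [simp]: "dpw i 0 f = f"
  and dpw_dv [simp]: "dv i (dpw i m f) = dpw i (Suc m) f"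
  by (auto simp: dpw_def)

lemma dpw_1 [simp]: "dpw i (Suc 0) f = dv i f"
  by (simp add: dpw_def)

lemma dv_dpw: "dpw i m (dv j f) = dv j (dpw i m f)"
  unfolding dpw_def by (induction m) (auto simp: dv_commute)

lemma dpw_dv' [simp]: "dpw i m (dv i f) = dpw i (Suc m) f"
  by (simp add: dv_dpw)

lemma dpw_add [simp]: "dpw i m (f + g) = dpw i m f + dpw i m g"
  unfolding dpw_def by (induction m) auto

lemma dpw_scaleR [simp]: "dpw i m (r *\<^sub>R f) = r *\<^sub>R dpw i m f"
  unfolding dpw_def by (induction m) auto

lemma dpw_zero [simp]: "dpw i m 0 = 0"
  using dpw_scaleR[of i m 0 0] by simp

lemma dpw_mult_const: "dv i h = 0 ==> dpw i m (h * f) = h * dpw i m f"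
  unfolding dpw_def by (induction m) auto

lemma dpw_2 [simp]: "dpw i m (2 * f) = 2 * dpw i m f"
  and dpw_3 [simp]: "dpw i m (3 * f) = 3 * dpw i m f"
  by (rule dpw_mult_const, simp)+

lemma dpw_x: "i \<in> Basis ==> dpw i (Suc m) (xc i * f) = xc i * dpw i (Suc m) f + of_nat (Suc m) * dpw i m f"
proof (induction m)
  case 0
  then show ?case using dpw_dv[of i 0] by (simp add: dv_xc_Basis flip: dpw_dv)
next
  case (Suc m)
  have "dpw i (Suc (Suc m)) (xc i * f) = dv i (dpw i (Suc m) (xc i * f))" by simp
  also have "\<dots> = xc i * dpw i (Suc (Suc m)) f + of_nat (Suc (Suc m)) * dpw i (Suc m) f"
    using Suc by (simp add: dv_xc_Basis algebra_simps del: of_nat_Suc) (simp add: algebra_simps)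
  finally show ?case .
qed

lemma dpw_x_dv: "i \<in> Basis ==> dpw i m (xc i * dv i f) = xc i * dpw i (Suc m) f + of_nat m * dpw i m f"
  by (cases m) (simp_all add: dpw_x del: of_nat_Suc)

lemma dpw_ds: "dpw i m f = ds (replicate m i) f"
  unfolding dpw_def by (induction m) auto

lemma dpw_dopl: "i \<in> Basis ==> m < k ==> dpw i m \<in> dopl k"
  using dopl.monom[of "replicate m i" k 1] by (simp add: dpw_ds[abs_def] set_replicate_conv_if)

lemma dopl_monom_dpw:
  assumes "i \<in> Basis" "set \<gamma> \<subseteq> Basis" "r + length \<gamma> < k"
  shows "(\<lambda>f. h * dpw i r (ds \<gamma> f)) \<in> dopl k"
  using dopl.monom[of "replicate r i @ \<gamma>" k h] assms by (simp add: ds_append dpw_ds set_replicate_conv_if)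

lemma ds_split: "ds \<alpha> f = dpw i (length (filter ((=) i) \<alpha>)) (ds (filter (\<lambda>j. j \<noteq> i) \<alpha>) f)"
  by (induction \<alpha>) (auto simp: dv_dpw simp flip: dpw_dv)

lemma dv_fact [simp]: "dv v (fact p) = 0"
  using dv_of_nat[of v "fact p"] by (simp del: dv_of_nat)

lemma ev_fact [simp]: "ev (fact p) y = fact p"
  using ev_of_nat[of "fact p" y] by (simp del: ev_of_nat)

lemma dpw_test: "i \<in> Basis ==> dv i g = 0 ==> dpw i p (xc i ^ p * g) = of_nat (fact p) * g"
proof (induction p)
  case (Suc p)
  have 0: "dpw i (Suc p) (xc i ^ p * g) = 0"
    using Suc by (simp flip: dpw_dv)
  have "dpw i (Suc p) (xc i ^ Suc p * g) = of_nat (Suc p) * dpw i p (xc i ^ p * g)"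
    using dpw_x[OF Suc.prems(1), of p "xc i ^ p * g"] 0 by (simp add: mult.assoc)
  then show ?case using Suc by (simp add: algebra_simps)
qed simp

text \<open>If F \<partial>_i = 0, then [F, x_i] \<partial>_i = F x_i \<partial>_i = F \<partial>_i
  x_i - F = - F, a relation with the impossible degree -1.\<close>

lemma dopl_cancel_dv:
  assumes i: "i \<in> Basis" and F: "F \<in> dopl l" and z: "eqop V (\<lambda>f. F (dv i f)) (\<lambda>f. 0)"
  shows "eqop V F (\<lambda>f. 0)"
proof (rule ad_relation_nonnat[OF i F, of V "-1"])
  show "eqop V (\<lambda>f. ad (xc i) F (dv i f)) (\<lambda>f. (-1) *\<^sub>R F f)"
  proof (rule eqopI)
    fix f y assume y: "y \<in> V"
    have "xc i * dv i f = dv i (xc i * f) - f" using i by (simp add: dv_xc_Basis)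
    then have "F (xc i * dv i f) = F (dv i (xc i * f)) - F f" using dopl_minus_arg[OF F] by metis
    then show "ev (ad (xc i) F (dv i f)) y = ev ((-1) *\<^sub>R F f) y"
      using eqopD[OF z y, of "xc i * f"] eqopD[OF z y, of f] by (simp add: ad_def)
  qed
qed simp

locale flat_map =
  fixes V :: "'e::euclidean_space set" and w :: real and k :: nat and t and i :: 'e
  assumes V: "convex V" "open V" "V \<noteq> {}" and dim: "DIM('e) \<ge> 2" and w: "w = 0 \<or> w = 1"
    and i: "i \<in> Basis" and inv: "flat_inv V w k t"
begin

abbreviation "x \<equiv> xc i"

lemma t_dopl: "Q \<in> dopl (Suc k) ==> \<exists>l. t Q \<in> dopl l"
  and t_add: "P \<in> dopl (Suc k) ==> Q \<in> dopl (Suc k) ==> eqop V (t (\<lambda>f. P f + Q f)) (\<lambda>f. t P f + t Q f)"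
  and t_scaleR: "Q \<in> dopl (Suc k) ==> eqop V (t (\<lambda>f. r *\<^sub>R Q f)) (\<lambda>f. r *\<^sub>R t Q f)"
  and t_lieq: "j \<in> Basis ==> Q \<in> dopl (Suc k) ==> eqop V (t (lieq w h j Q)) (lieq w h j (t Q))"
  using inv by (auto simp: flat_inv_def)

lemma t_lin:
  assumes "P \<in> dopl (Suc k)" "Q \<in> dopl (Suc k)" "R = (\<lambda>f. r *\<^sub>R P f + s *\<^sub>R Q f)" "y \<in> V"
  shows "ev (t R f) y = r * ev (t P f) y + s * ev (t Q f) y"
  using eqopD[OF t_add[OF dopl_scaleR[OF assms(1), of r] dopl_scaleR[OF assms(2), of s]] assms(4), of f]
    eqopD[OF t_scaleR[OF assms(1), of r] assms(4), of f] eqopD[OF t_scaleR[OF assms(2), of s] assms(4), of f]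
  unfolding assms(3) by simp

lemma t_zero: "eqop V (t (\<lambda>f. 0)) (\<lambda>f. 0)"
  using t_scaleR[OF dopl.zero, of 0] by (simp add: eqop_def)

lemma other_basis: obtains j where "j \<in> Basis" "j \<noteq> i"
proof -
  have "\<not> Basis \<subseteq> {i}" using dim card_mono[of "{i}" "Basis :: 'e set"] by auto
  then show ?thesis using that by blast
qed

text \<open>All \<partial>_j and all x_j \<partial>_i with \<open>j \<noteq> i\<close> annihilate
  \<partial>_i^m, and x_i \<partial>_i multiplies it by \<open>- (m + w)\<close>. The image inherits
  these properties, which characterise \<partial>_i^m up to a factor.\<close>

lemma t_dpw:
  assumes m: "m \<le> k"
  shows "\<exists>b. eqop V (t (dpw i m)) (\<lambda>f. b *\<^sub>R dpw i m f)"
proof -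
  let ?D = "dpw i m" and ?E = "t (dpw i m)"
  have D: "?D \<in> dopl (Suc k)" using i m by (simp add: dpw_dopl)
  obtain l where E: "?E \<in> dopl l" using t_dopl[OF D] by blast
  have d: "eqop V (\<lambda>f. dv j (?E f) - ?E (dv j f)) (\<lambda>f. 0)" if j: "j \<in> Basis" for j
  proof -
    have "lieq w 1 j ?D = (\<lambda>f. 0)" by (auto simp: lieq_def dv_dpw)
    then have "eqop V (lieq w 1 j ?E) (\<lambda>f. 0)"
      using t_lieq[OF j D, of 1] t_zero by (simp add: eqop_def)
    then show ?thesis using dopl_zero_arg[OF E] by (simp add: lieq_def eqop_def)
  qed
  \<comment> \<open>Invariance under x_j \<partial>_i gives [E, x_j] \<partial>_i = 0 only; the
    derivative is then cancelled.\<close>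
  have x: "eqop V (ad (xc j) ?E) (\<lambda>f. 0)" if j: "j \<in> Basis" "j \<noteq> i" for j
  proof (rule dopl_cancel_dv[OF i ad_dopl'[OF E]])
    have "lieq w (xc j) i ?D = (\<lambda>f. 0)"
      using i j by (auto simp: lieq_def dv_xc_Basis dpw_mult_const)
    then have "eqop V (lieq w (xc j) i ?E) (\<lambda>f. 0)"
      using t_lieq[OF i D, of "xc j"] t_zero by (simp add: eqop_def)
    then show "eqop V (\<lambda>f. ad (xc j) ?E (dv i f)) (\<lambda>f. 0)"
      using d[OF i] dopl_zero_arg[OF E] i j by (simp add: lieq_def eqop_def ad_def dv_xc_Basis)
  qed
  have r: "eqop V (\<lambda>f. ad x ?E (dv i f)) (\<lambda>f. real m *\<^sub>R ?E f)"
  proof (rule eqopI)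
    fix f y assume y: "y \<in> V"
    have "lieq w x i ?D = (\<lambda>f. (- (real m + w)) *\<^sub>R ?D f)"
      using i by (auto simp: lieq_def dpw_x_dv dv_xc_Basis algebra_simps scaleR_conv_of_real)
    then have "ev (lieq w x i ?E f) y = - (real m + w) * ev (?E f) y"
      using eqopD[OF t_lieq[OF i D, of x] y, of f] eqopD[OF t_scaleR[OF D, of "- (real m + w)"] y, of f] by simp
    then show "ev (ad x ?E (dv i f)) y = ev (real m *\<^sub>R ?E f) y"
      using eqopD[OF d[OF i] y, of f] i by (simp add: lieq_def ad_def dv_xc_Basis algebra_simps)
  qed
  from dopl_characterize_power[OF V i E r x d] show ?thesis by (simp add: dpw_def)
qed

definition kills :: "nat => bool" where
  "kills m \<longleftrightarrow> (\<forall>Q\<in>dopl m. eqop V (t Q) (\<lambda>f. 0))"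

lemma killsD: "kills m ==> Q \<in> dopl m ==> y \<in> V ==> ev (t Q f) y = 0"
  by (simp add: kills_def eqop_def)

lemma t_lieq_zero:
  assumes "eqop V (t Q) (\<lambda>f. 0)" "Q \<in> dopl (Suc k)" "j \<in> Basis" "y \<in> V"
  shows "ev (t (lieq w h j Q) f) y = 0"
  using eqopD[OF t_lieq[OF assms(3,2), of h] assms(4), of f]
    eqopD[OF lieq_eqop[OF V(2) assms(1), of w h j] assms(4), of f] by (simp add: lieq_zero)

lemma kills_0: "kills 0"
proof -
  have "Q = (\<lambda>f. 0)" if "Q \<in> dopl 0" for Q :: "'e sfun => 'e sfun" using dopl_0[OF that] by auto
  then show ?thesis unfolding kills_def using t_zero by metis
qed

text \<open>Modulo order below \<open>m\<close>, the Lie derivative of x_i \<partial>_i^m along h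
  \<partial>_i minus that of \<partial>_i^m along x_i h \<partial>_i equals (1 + m + w) h
  \<partial>_i^m. Two killed operators thus account for all coefficients \<open>h\<close>.\<close>

lemma kills_coefficient:
  assumes m: "m \<le> k" "kills m" "eqop V (t (dpw i m)) (\<lambda>f. 0)" "eqop V (t (\<lambda>f. x * dpw i m f)) (\<lambda>f. 0)"
  shows "eqop V (t (\<lambda>f. h * dpw i m f)) (\<lambda>f. 0)"
proof (rule eqopI)
  fix f y assume y: "y \<in> V"
  let ?D = "dpw i m"
  have D: "?D \<in> dopl (Suc k)" and xD: "(\<lambda>f. x * ?D f) \<in> dopl (Suc k)" and hD: "(\<lambda>f. h * ?D f) \<in> dopl (Suc k)"
    using i m(1) by (auto intro!: dopl_mult dpw_dopl)
  have Dm: "?D \<in> dopl (Suc m)" using i by (simp add: dpw_dopl)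
  let ?R = "\<lambda>f. ad h (ad x ?D) (dv i f) + (w *\<^sub>R ad h ?D f + w *\<^sub>R ad x ?D (dv i h * f))"
  \<comment> \<open>Two commutators and one derivative lower the order by one in total. For
    \<open>m = 0\<close> the index has no room for two drops, but the commutator is zero
    outright.\<close>
  have 1: "(\<lambda>f. ad h (ad x ?D) (dv i f)) \<in> dopl m"
  proof (cases m)
    case 0
    then have "(\<lambda>f. ad h (ad x ?D) (dv i f)) = (\<lambda>f. 0)" by (auto simp: ad_def)
    then show ?thesis using dopl.zero by simp
  next
    case (Suc m')
    then show ?thesis using ad_dopl[OF ad_dopl[of ?D "Suc m'" x], of h] Dm i by (auto intro: dopl_dv_right)
  qed
  have R: "?R \<in> dopl m"
    by (intro dopl.add 1 dopl_scaleR dopl_mult_right[of "ad x ?D"] ad_dopl Dm)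
  have lm: "lieq w h i (\<lambda>f. x * ?D f) \<in> dopl (Suc k)" "lieq w (x * h) i ?D \<in> dopl (Suc k)"
    by (auto intro: lieq_dopl D xD i)
  have eq: "(\<lambda>f. (1 + real m + w) *\<^sub>R (h * ?D f) + 1 *\<^sub>R ?R f) =
      (\<lambda>f. 1 *\<^sub>R lieq w h i (\<lambda>f. x * ?D f) f + (- 1) *\<^sub>R lieq w (x * h) i ?D f)"
  proof
    fix f
    have a: "ad x ?D (h * dv i f) = of_nat m * (h * ?D f) + ad h (ad x ?D) (dv i f)"
      using i by (simp add: ad_def dpw_x_dv algebra_simps)
    have b: "?D (h * f) = h * ?D f + ad h ?D f" by (simp add: ad_def)
    show "(1 + real m + w) *\<^sub>R (h * ?D f) + 1 *\<^sub>R ?R f =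
        1 *\<^sub>R lieq w h i (\<lambda>f. x * ?D f) f + (- 1) *\<^sub>R lieq w (x * h) i ?D f"
    proof -
      have "1 *\<^sub>R lieq w h i (\<lambda>f. x * ?D f) f + (- 1) *\<^sub>R lieq w (x * h) i ?D f =
        h * ?D f + ad x ?D (h * dv i f) + w *\<^sub>R (?D (h * f) + ad x ?D (dv i h * f))"
        using i by (simp add: lieq_def ad_def dv_xc_Basis algebra_simps)
      then show ?thesis unfolding a b by (simp add: algebra_simps scaleR_conv_of_real)
    qed
  qed
  have "(1 + real m + w) * ev (t (\<lambda>f. h * ?D f) f) y + 1 * ev (t ?R f) y = 0"
    using t_lin[OF hD dopl_mono[OF R] refl y, of "1 + real m + w" 1 f] m(1)
      t_lin[OF lm refl y, of 1 "-1" f] t_lieq_zero[OF m(3) D i y, of "x * h" f] t_lieq_zero[OF m(4) xD i y, of h f]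
    unfolding eq by simp
  moreover have "1 + real m + w > 0" using w by auto
  ultimately show "ev (t (\<lambda>f. h * ?D f) f) y = ev 0 y"
    using killsD[OF m(2) R y, of f] by simp
qed

text \<open>The Lie derivative along x_i \<partial>_j turns h \<partial>_i^(r+1) \<partial>^\<gamma>
  into -(r+1) h \<partial>_i^r \<partial>_j \<partial>^\<gamma>, up to a term x_i (\<partial>_j h)
  \<partial>_i^(r+1) \<partial>^\<gamma> killed by the induction hypothesis. Starting from h
  \<partial>_i^m, this reaches all monomials of order \<open>m\<close>.\<close>

lemma kills_Suc:
  assumes m: "m \<le> k" "kills m" "eqop V (t (dpw i m)) (\<lambda>f. 0)" "eqop V (t (\<lambda>f. x * dpw i m f)) (\<lambda>f. 0)"
  shows "kills (Suc m)"
proof -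
  have b: "eqop V (t (\<lambda>f. h * dpw i r (ds \<gamma> f))) (\<lambda>f. 0)"
    if "set \<gamma> \<subseteq> Basis - {i}" "r + length \<gamma> = m" for \<gamma> r h
    using that
  proof (induction \<gamma> arbitrary: r h)
    case Nil
    then show ?case using kills_coefficient[OF m] by simp
  next
    case (Cons j \<gamma>)
    have j: "j \<in> Basis" "j \<noteq> i" and g: "set \<gamma> \<subseteq> Basis" using Cons by auto
    let ?D = "\<lambda>f. dpw i (Suc r) (ds \<gamma> f)"
    let ?Q = "\<lambda>f. h * ?D f" and ?P = "\<lambda>f. (x * dv j h) * ?D f" and ?G = "\<lambda>f. h * dpw i r (ds (j # \<gamma>) f)"
    have Q: "?Q \<in> dopl (Suc k)" and P: "?P \<in> dopl (Suc k)" and G: "?G \<in> dopl (Suc k)"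
      using Cons m(1) i by (intro dopl_monom_dpw; auto)+
    have IHQ: "eqop V (t ?Q) (\<lambda>f. 0)" and IHP: "eqop V (t ?P) (\<lambda>f. 0)"
      using Cons by (intro Cons.IH; simp)+
    have dsx: "ds \<gamma> (x * f) = x * ds \<gamma> f" for f using Cons.prems(1)
      by (induction \<gamma>) (auto simp: dv_xc_Basis i)
    define D where "D = ?D"
    have D1: "D (x * g) = x * D g + of_nat (Suc r) * dpw i r (ds \<gamma> g)" for g
      using dpw_x[OF i, of r "ds \<gamma> g"] by (simp add: D_def dsx)
    have D2: "D (dv j f) = dv j (D f)" for f
      by (simp add: D_def dv_dpw dv_ds[symmetric])
    have D3: "dv j x = 0" using i j by (simp add: dv_xc_Basis)
    have D4: "D 0 = 0" by (simp add: D_def)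
    have "lieq w x j (\<lambda>f. h * D f) f = (x * dv j h) * D f - of_nat (Suc r) * (h * dpw i r (dv j (ds \<gamma> f)))" for f
      by (simp add: lieq_def D1 D2 D3 D4 dv_ds algebra_simps del: of_nat_Suc)
    then have eq: "lieq w x j ?Q = (\<lambda>f. 1 *\<^sub>R ?P f + (- real (Suc r)) *\<^sub>R ?G f)"
      by (auto simp: D_def scaleR_conv_of_real simp del: of_nat_Suc)
    show ?case
    proof (rule eqopI)
      fix f y assume y: "y \<in> V"
      show "ev (t ?G f) y = ev 0 y"
        using t_lin[OF P G eq y, of f] t_lieq_zero[OF IHQ Q j(1) y, of x f] eqopD[OF IHP y, of f] by simp
    qed
  qed
  have "eqop V (t Q) (\<lambda>f. 0)" if "Q \<in> dopl (Suc m)" for Q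
    using that
  proof induction
    case (monom \<alpha> a)
    show ?case
    proof (cases "length \<alpha> = m")
      case True
      let ?\<gamma> = "filter (\<lambda>j. j \<noteq> i) \<alpha>"
      have "length (filter ((=) i) \<alpha>) + length ?\<gamma> = m"
        using True sum_length_filter_compl[of "(=) i" \<alpha>] by (simp add: eq_commute)
      then have "eqop V (t (\<lambda>f. a * dpw i (length (filter ((=) i) \<alpha>)) (ds ?\<gamma> f))) (\<lambda>f. 0)"
        using monom by (intro b) auto
      then show ?thesis by (simp flip: ds_split)
    next
      case False
      then show ?thesis using m(2) monom unfolding kills_def by (metis dopl.monom less_SucE)
    qed
  next
    case (add P Q)
    then have "P \<in> dopl (Suc k)" "Q \<in> dopl (Suc k)" using m(1) by (auto intro: dopl_mono[of _ "Suc m"])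
    from t_add[OF this] add show ?case by (simp add: eqop_def)
  next
    case zero
    then show ?case using t_zero .
  qed
  then show ?thesis by (simp add: kills_def)
qed

lemma id_dopl: "(\<lambda>f::'e sfun. f) \<in> dopl (Suc k)" using dpw_dopl[OF i, of 0 "Suc k"] by (simp add: dpw_def id_def)

text \<open>For \<open>w = 1\<close> the field x_i^2 \<partial>_i sends 1 to -2 x_i. For
  \<open>w = 0\<close> every field annihilates 1. Then the constant fields and the fields x_l
  \<partial>_j with \<open>j \<noteq> i\<close>, which annihilate x_i, force the image of x_i to be
  a constant. The field x_i \<partial>_i reproduces x_i but annihilates constants, so this constant
  is 0.\<close>

lemma t_x_zero:
  assumes id: "eqop V (t (\<lambda>f. f)) (\<lambda>f. 0)"
  shows "eqop V (t (\<lambda>f. x * f)) (\<lambda>f. 0)"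
proof (cases "w = 0")
  case False
  then have w1: "w = 1" using w by simp
  show ?thesis
  proof (rule eqopI)
    fix f y assume y: "y \<in> V"
    have "lieq w (x * x) i (\<lambda>f. f) = (\<lambda>f. (- 2) *\<^sub>R (x * f))"
      using i w1 by (intro ext) (simp add: lieq_def dv_xc_Basis scaleR_conv_of_real algebra_simps)
    then show "ev (t (\<lambda>f. x * f) f) y = ev 0 y"
      using t_lieq_zero[OF id id_dopl i y, of "x * x" f] eqopD[OF t_scaleR[OF dopl_mult[OF id_dopl], of "-2" x] y, of f]
      by simp
  qed
next
  case w0: True
  let ?Q = "\<lambda>f. x * f"
  have Q: "?Q \<in> dopl (Suc k)" by (rule dopl_mult[OF id_dopl])
  obtain l where E: "t ?Q \<in> dopl l" using t_dopl[OF Q] by blast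
  obtain j where j: "j \<in> Basis" "j \<noteq> i" using other_basis .
  have li: "lieq w 1 i ?Q = (\<lambda>f. f)"
    using i w0 by (auto simp: lieq_def dv_xc_Basis algebra_simps)
  have lj: "lieq w h j' ?Q = (\<lambda>f. 0)" if "j' \<in> Basis" "j' \<noteq> i" for h j'
    using i w0 that by (auto simp: lieq_def dv_xc_Basis algebra_simps)
  have d: "eqop V (\<lambda>f. dv j' (t ?Q f) - t ?Q (dv j' f)) (\<lambda>f. 0)" if j': "j' \<in> Basis" for j'
  proof -
    have "eqop V (t (lieq w 1 j' ?Q)) (\<lambda>f. 0)"
      using li lj[of j' 1] id t_zero j' by (cases "j' = i") auto
    then show ?thesis using t_lieq[OF j' Q, of 1] w0 by (simp add: eqop_def lieq_def)
  qed
  have a: "eqop V (ad (xc l') (t ?Q)) (\<lambda>f. 0)" if "l' \<in> Basis" for l'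
  proof (rule dopl_cancel_dv[OF j(1) ad_dopl'[OF E]])
    have "eqop V (lieq w (xc l') j (t ?Q)) (\<lambda>f. 0)"
      using t_lieq[OF j(1) Q, of "xc l'"] lj[OF j] t_zero by (simp add: eqop_def)
    then show "eqop V (\<lambda>f. ad (xc l') (t ?Q) (dv j f)) (\<lambda>f. 0)"
      using d[OF j(1)] w0 by (simp add: eqop_def lieq_def ad_def)
  qed
  have r: "eqop V (\<lambda>f. ad x (t ?Q) (dv i f)) (\<lambda>f. real 0 *\<^sub>R t ?Q f)"
    using a[OF i] by (simp add: eqop_def)
  obtain b where b: "eqop V (t ?Q) (\<lambda>f. b *\<^sub>R f)"
    using dopl_characterize_power[OF V i E r a d] by auto
  have "lieq w x i ?Q = ?Q" using i w0 by (auto simp: lieq_def dv_xc_Basis algebra_simps)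
  then have "eqop V (t ?Q) (lieq w x i (t ?Q))" using t_lieq[OF i Q, of x] by simp
  moreover have "eqop V (lieq w x i (t ?Q)) (\<lambda>f. 0)"
    using lieq_eqop[OF V(2) b, of w x i] w0 by (simp add: eqop_def lieq_def)
  ultimately show ?thesis by (rule eqop_trans)
qed

lemma kills_1: "eqop V (t (\<lambda>f. f)) (\<lambda>f. 0) ==> kills (Suc 0)"
  using kills_Suc[OF _ kills_0] t_x_zero by (simp add: dpw_def id_def)

end

lemma flat_map_lincomb:
  "flat_map V w k t i ==> flat_inv V w k u ==> flat_map V w k (\<lambda>Q f. r *\<^sub>R t Q f + s *\<^sub>R u Q f) i"
  unfolding flat_map_def using flat_inv_lincomb by blast

context flat_map
begin

text \<open>The Lie derivative of \<partial>_i along x_i^2 \<partial>_i is -2 (1 + w) x_i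
  \<partial>_i up to order zero, which is killed; so x_i \<partial>_i is killed as well.\<close>

lemma kills_2:
  assumes k: "1 \<le> k" and K: "kills 1" and d: "eqop V (t (dv i)) (\<lambda>f. 0)"
  shows "kills 2"
proof -
  have d1: "dpw i (Suc 0) = dv i" by (rule ext) simp
  have D: "dv i \<in> dopl (Suc k)" using dpw_dopl[OF i, of "Suc 0" "Suc k"] k by (simp add: d1)
  have id1: "(\<lambda>f::'e sfun. f) \<in> dopl 1" using dpw_dopl[OF i, of 0 1] by (simp add: dpw_def id_def)
  have xD: "(\<lambda>f. x * dv i f) \<in> dopl (Suc k)" by (rule dopl_mult[OF D])
  have eq: "lieq w (x * x) i (dv i) = (\<lambda>f. (- 2 * (1 + w)) *\<^sub>R (x * dv i f) + (- 2 * w) *\<^sub>R f)"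
    using i by (intro ext) (simp add: lieq_def dv_xc_Basis scaleR_conv_of_real algebra_simps)
  have "eqop V (t (\<lambda>f. x * dv i f)) (\<lambda>f. 0)"
  proof (rule eqopI)
    fix f y assume y: "y \<in> V"
    show "ev (t (\<lambda>f. x * dv i f) f) y = ev 0 y"
      using t_lin[OF xD id_dopl eq y, of f] t_lieq_zero[OF d D i y, of "x * x" f] killsD[OF K id1 y, of f] w
      by auto
  qed
  then show ?thesis using kills_Suc[of "Suc 0"] k K d by (simp add: d1 numeral_2_eq_2)
qed

text \<open>The test functions x_i^p and x_i^p x_j allow \<partial>_i^p and \<partial>_i^p
  \<partial>_j to be cancelled from an equation at a point.\<close>

lemma dpw_eval_nonzero:
  assumes "y \<in> V" "j \<in> Basis" "j \<noteq> i"
  shows "\<exists>f. ev (dpw i p f) y \<noteq> 0" "\<exists>f. ev (dpw i p (dv j f)) y \<noteq> 0"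
proof -
  have "ev (dpw i p (x ^ p * 1)) y = fact p"
    by (subst dpw_test[OF i]) simp_all
  then show "\<exists>f. ev (dpw i p f) y \<noteq> 0" by (intro exI[of _ "x ^ p * 1"]) (simp only: fact_nonzero not_False_eq_True)
  have 0: "dv j (x ^ p) = 0" for p using assms i by (induction p) (auto simp: dv_xc_Basis)
  have "dv j (x ^ p * xc j) = x ^ p * 1"
    using assms 0 by (simp add: dv_xc_Basis)
  then have "ev (dpw i p (dv j (x ^ p * xc j))) y = fact p"
    by (simp only: \<open>ev (dpw i p (x ^ p * 1)) y = fact p\<close>)
  then show "\<exists>f. ev (dpw i p (dv j f)) y \<noteq> 0"
    by (intro exI[of _ "x ^ p * xc j"]) (simp only: fact_nonzero not_False_eq_True)
qed

lemma dpw_xx: "dpw i (Suc (Suc p)) (x * (x * g)) = x * (x * dpw i (Suc (Suc p)) g)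
    + of_nat (2 * (p + 2)) * (x * dpw i (Suc p) g) + of_nat ((p + 2) * (p + 1)) * dpw i p g"
  by (simp only: dpw_x[OF i]) (simp add: algebra_simps)

text \<open>The image of x_i \<partial>_i^(m-1) \<partial>_j is computed twice, from \<partial>_i^m
  along x_i^2 \<partial>_j and from \<partial>_i^(m-1) \<partial>_j along x_i^2 \<partial>_i. Let H
  = \<partial>_i^(m-2) \<partial>_j, which is killed. The results are b times the operator plus b
  (m-1)/2 H and plus b (m-2)/2 H respectively, so b H = 0.\<close>

lemma higher_order_w0:
  assumes w0: "w = 0" and m: "m = Suc (Suc p)" "m \<le> k" and K: "kills m"
    and b: "eqop V (t (dpw i m)) (\<lambda>f. b *\<^sub>R dpw i m f)"
  shows "b = 0"
proof -
  obtain j where j: "j \<in> Basis" "j \<noteq> i" using other_basis .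
  have jx: "dv j x = 0" using i j by (simp add: dv_xc_Basis)
  obtain y where y: "y \<in> V" using V by blast
  let ?D = "dpw i m" and ?G = "\<lambda>f. dpw i (Suc p) (dv j f)" and ?xG = "\<lambda>f. x * dpw i (Suc p) (dv j f)"
    and ?H = "\<lambda>f. dpw i p (dv j f)"
  have D: "?D \<in> dopl (Suc k)" using m i by (simp add: dpw_dopl)
  have GH: "(\<lambda>f. h * dpw i q (dv j f)) \<in> dopl l" if "q + 1 < l" for q h l
    using dopl_monom_dpw[OF i, of "[j]" q l h] j that by simp
  have G: "?G \<in> dopl (Suc k)" and xG: "?xG \<in> dopl (Suc k)" and H: "?H \<in> dopl (Suc k)" "?H \<in> dopl m"
    using GH[of "Suc p" "Suc k" 1] GH[of "Suc p" "Suc k" x] GH[of p "Suc k" 1] GH[of p m 1] m by auto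
  have tH: "ev (t ?H f) y = 0" for f by (rule killsD[OF K H(2) y])
  have eq1: "lieq w x j ?D = (\<lambda>f. (- real m) *\<^sub>R ?G f + 0 *\<^sub>R ?G f)"
    using w0 by (intro ext) (simp add: lieq_def m dpw_x[OF i] jx dv_dpw scaleR_conv_of_real algebra_simps)
  have b': "eqop V (lieq w h l (t ?D)) (\<lambda>f. b *\<^sub>R lieq w h l ?D f)" for h l
    using lieq_eqop[OF V(2) b, of w h l] by (simp add: eqop_def lieq_scaleR)
  have tG: "eqop V (t ?G) (\<lambda>f. b *\<^sub>R ?G f)"
  proof (rule eqopI)
    fix f z assume z: "z \<in> V"
    have "- real m * ev (t ?G f) z = b * (- real m * ev (?G f) z)"
      using t_lin[OF G G eq1 z, of f] eqopD[OF t_lieq[OF j(1) D, of x] z, of f] eqopD[OF b' z, of x j f]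
      unfolding eq1 by simp
    then show "ev (t ?G f) z = ev (b *\<^sub>R ?G f) z" using m by (simp del: of_nat_Suc)
  qed
  have eq2: "lieq w (x * x) j ?D = (\<lambda>f. (- 2 * real m) *\<^sub>R ?xG f + (- real (m * (p + 1))) *\<^sub>R ?H f)"
    using w0 by (intro ext) (simp add: lieq_def m mult.assoc dpw_xx jx dv_dpw scaleR_conv_of_real algebra_simps)
  have eq3: "lieq w (x * x) i ?G = (\<lambda>f. (- 2 * real (p + 1)) *\<^sub>R ?xG f + (- real ((p + 1) * p)) *\<^sub>R ?H f)"
  proof (rule ext)
    fix f
    have c: "dv j (x * (x * dv i f)) = x * (x * dv i (dv j f))" by (simp add: jx dv_commute[of j])
    have d: "dpw i p (x * dv i g) = x * dpw i (Suc p) g + of_nat p * dpw i p g" for g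
      by (rule dpw_x_dv[OF i])
    have "dpw i (Suc p) (x * (x * dv i g)) = x * (x * dpw i (Suc (Suc p)) g) + of_nat (2 * (p + 1)) * (x * dpw i (Suc p) g) + of_nat ((p + 1) * p) * dpw i p g" for g
      by (simp only: dpw_x[OF i] d) (simp add: algebra_simps)
    then show "lieq w (x * x) i ?G f = (- 2 * real (p + 1)) *\<^sub>R ?xG f + (- real ((p + 1) * p)) *\<^sub>R ?H f"
      using w0 by (simp add: lieq_def mult.assoc c scaleR_conv_of_real algebra_simps del: dv_mult)
  qed
  obtain f where f: "ev (?H f) y \<noteq> 0" using dpw_eval_nonzero(2)[OF y j] by blast
  have r2: "(- 2 * real m) * ev (t ?xG f) y = b * ((- 2 * real m) * ev (?xG f) y + (- real (m * (p + 1))) * ev (?H f) y)"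
    using t_lin[OF xG H(1) eq2 y, of f] eqopD[OF t_lieq[OF j(1) D, of "x * x"] y, of f] eqopD[OF b' y, of "x * x" j f] tH[of f]
    unfolding eq2 by simp
  have r3: "(- 2 * real (p + 1)) * ev (t ?xG f) y = b * ((- 2 * real (p + 1)) * ev (?xG f) y + (- real ((p + 1) * p)) * ev (?H f) y)"
    using t_lin[OF xG H(1) eq3 y, of f] eqopD[OF t_lieq[OF i G, of "x * x"] y, of f]
      eqopD[OF lieq_eqop[OF V(2) tG] y, of w "x * x" i f] tH[of f]
    unfolding lieq_scaleR eq3 by simp
  have "b * ev (?H f) y * real (p + 1) * real m = 0"
    using arg_cong[OF r2, of "\<lambda>z. real (p + 1) * z"] arg_cong[OF r3, of "\<lambda>z. real m * z"]
    by (simp add: m algebra_simps)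
  then show ?thesis using f m by simp
qed

text \<open>The image of x_i^2 \<partial>_i^m is computed twice, from \<partial>_i^m along x_i^3
  \<partial>_i and by applying x_i^2 \<partial>_i two times. The coefficients of \<partial>_i^(m-2)
  in the results are b m (m-1)/3 and b m^2 (m-1)/(4m+2); their difference is a nonzero multiple of b
  m (m-1) (m+2).\<close>

lemma higher_order_w1:
  assumes w1: "w = 1" and m: "m = Suc (Suc p)" "m \<le> k" and K: "kills m"
    and b: "eqop V (t (dpw i m)) (\<lambda>f. b *\<^sub>R dpw i m f)"
  shows "b = 0"
proof -
  obtain j where j: "j \<in> Basis" "j \<noteq> i" using other_basis .
  obtain y where y: "y \<in> V" using V by blast
  let ?D = "dpw i m" and ?D1 = "dpw i (Suc p)" and ?D2 = "dpw i p"
  let ?M = "real m"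
  have D: "?D \<in> dopl (Suc k)" and D1: "?D1 \<in> dopl m" and D2: "?D2 \<in> dopl m"
    using m i by (auto simp: dpw_dopl)
  have xD: "(\<lambda>f. x * ?D f) \<in> dopl (Suc k)" and xxD: "(\<lambda>f. x * (x * ?D f)) \<in> dopl (Suc k)"
    and xD1: "(\<lambda>f. x * ?D1 f) \<in> dopl m"
    by (intro dopl_mult D D1)+
  have up: "Q \<in> dopl m ==> Q \<in> dopl (Suc k)" for Q :: "'e sfun => 'e sfun"
    using m dopl_mono by (metis le_SucI)
  have b': "eqop V (lieq w h l (t ?D)) (\<lambda>f. b *\<^sub>R lieq w h l ?D f)" for h l
    using lieq_eqop[OF V(2) b, of w h l] by (simp add: eqop_def lieq_scaleR)
  have d: "dpw i p (x * dv i g) = x * dpw i (Suc p) g + of_nat p * dpw i p g" for g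
    by (rule dpw_x_dv[OF i])
  have xx: "?D (x * (x * dv i g)) = x * (x * dpw i (Suc m) g) + of_nat (2 * m) * (x * ?D g) + of_nat (m * (p + 1)) * ?D1 g" for g
    by (simp only: m dpw_xx dpw_dv') (simp add: algebra_simps)
  have xx0: "?D (x * (x * g)) = x * (x * ?D g) + of_nat (2 * m) * (x * ?D1 g) + of_nat (m * (p + 1)) * ?D2 g" for g
    by (simp only: m dpw_xx dpw_dv') (simp add: algebra_simps)
  have xxx: "?D (x * (x * (x * dv i g))) = x * (x * (x * dpw i (Suc m) g)) + of_nat (3 * m) * (x * (x * ?D g))
      + of_nat (3 * m * (p + 1)) * (x * ?D1 g) + of_nat (m * (p + 1) * p) * ?D2 g" for g
    by (simp only: m dpw_x[OF i] d dpw_dv') (simp add: algebra_simps)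
  have xx1: "?D1 (x * (x * dv i g)) = x * (x * ?D g) + of_nat (2 * (p + 1)) * (x * ?D1 g) + of_nat ((p + 1) * p) * ?D2 g" for g
    by (simp only: m dpw_x[OF i] d dpw_dv') (simp add: algebra_simps)
  have x0: "?D (x * g) = x * ?D g + of_nat m * ?D1 g" for g by (simp add: m dpw_x[OF i])
  have x1: "?D1 (x * g) = x * ?D1 g + of_nat (p + 1) * ?D2 g" for g by (simp add: dpw_x[OF i])
  note simps = lieq_def mult.assoc dv_xc_Basis i w1 scaleR_conv_of_real
  have e1: "lieq w (x * (x * x)) i ?D f = (- 3 * (?M + 1)) *\<^sub>R (x * (x * ?D f)) + 1 *\<^sub>R
      ((- 3 * ?M * (?M + 1)) *\<^sub>R (x * ?D1 f) + (- ?M * (real p + 1) * (?M + 1)) *\<^sub>R ?D2 f)" for f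
  proof -
    have "dv i (x * (x * x)) * f = 3 * (x * (x * f))" by (simp add: dv_xc_Basis i algebra_simps)
    then have *: "lieq w (x * (x * x)) i ?D f = x * (x * (x * dpw i (Suc m) f)) - ?D (x * (x * (x * dv i f))) - 3 * ?D (x * (x * f))"
      by (simp only: lieq_def w1 mult.assoc dpw_dv dpw_3 scaleR_one)
    show ?thesis by (simp only: * xxx[of f] xx0[of f]) (simp add: m scaleR_conv_of_real algebra_simps)
  qed
  have x2: "lieq w (x * x) i Q f = x * (x * dv i (Q f)) - Q (x * (x * dv i f)) - Q (2 * (x * f))" for Q f
  proof -
    have "dv i (x * x) * f = 2 * (x * f)" by (simp add: dv_xc_Basis i algebra_simps)
    then show ?thesis by (simp only: lieq_def w1 mult.assoc scaleR_one)
  qed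
  have e2: "lieq w (x * x) i ?D f = (- 2 * (?M + 1)) *\<^sub>R (x * ?D f) + (- ?M * (?M + 1)) *\<^sub>R ?D1 f" for f
    by (simp only: x2 dpw_2 xx[of f] x0[of f]) (simp add: m scaleR_conv_of_real algebra_simps)
  have e3: "lieq w (x * x) i (\<lambda>f. x * ?D f) f = (- (2 * ?M + 1)) *\<^sub>R (x * (x * ?D f)) + (- ?M * (?M + 1)) *\<^sub>R (x * ?D1 f)" for f
    by (simp only: x2 dpw_2 xx[of f] x0[of f]) (simp add: m dv_xc_Basis i scaleR_conv_of_real algebra_simps)
  have e4: "lieq w (x * x) i ?D1 f = (- 2 * ?M) *\<^sub>R (x * ?D1 f) + (- ?M * (?M - 1)) *\<^sub>R ?D2 f" for f
    by (simp only: x2 dpw_2 xx1[of f] x1[of f]) (simp add: m scaleR_conv_of_real algebra_simps)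
  let ?L = "\<lambda>f. (- 3 * ?M * (?M + 1)) *\<^sub>R (x * ?D1 f) + (- ?M * (real p + 1) * (?M + 1)) *\<^sub>R ?D2 f"
  have L: "?L \<in> dopl m" by (intro dopl.add dopl_scaleR xD1 D2)
  have r1: "- 3 * (?M + 1) * ev (t (\<lambda>f. x * (x * ?D f)) f) z = b * (- 3 * (?M + 1) * ev (x * (x * ?D f)) z + ev (?L f) z)"
    if "z \<in> V" for f z
    using t_lin[OF xxD up[OF L] ext[of "lieq w (x * (x * x)) i ?D", OF e1] that, of f]
      eqopD[OF t_lieq[OF i D, of "x * (x * x)"] that, of f] eqopD[OF b' that, of "x * (x * x)" i f] killsD[OF K L that, of f]
    unfolding e1 by simp
  have r2: "eqop V (t (\<lambda>f. x * ?D f)) (\<lambda>f. b *\<^sub>R (x * ?D f + (?M / 2) *\<^sub>R ?D1 f))"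
  proof (rule eqopI)
    fix f z assume z: "z \<in> V"
    have "- 2 * (?M + 1) * ev (t (\<lambda>f. x * ?D f) f) z = b * (- 2 * (?M + 1) * ev (x * ?D f) z + (- ?M * (?M + 1)) * ev (?D1 f) z)"
      using t_lin[OF xD up[OF D1] ext[of "lieq w (x * x) i ?D", OF e2] z, of f]
        eqopD[OF t_lieq[OF i D, of "x * x"] z, of f] eqopD[OF b' z, of "x * x" i f] killsD[OF K D1 z, of f]
      unfolding e2 by simp
    then have "- 2 * (?M + 1) * (ev (t (\<lambda>f. x * ?D f) f) z - b * (ev (x * ?D f) z + ?M / 2 * ev (?D1 f) z)) = 0"
      by (simp add: field_simps)
    moreover have "- 2 * (?M + 1) \<noteq> 0" by (smt (verit) of_nat_0_le_iff)
    ultimately show "ev (t (\<lambda>f. x * ?D f) f) z = ev (b *\<^sub>R (x * ?D f + (?M / 2) *\<^sub>R ?D1 f)) z" by simp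
  qed
  obtain f where f: "ev (?D2 f) y \<noteq> 0" using dpw_eval_nonzero(1)[OF y j] by blast
  have "- (2 * ?M + 1) * ev (t (\<lambda>f. x * (x * ?D f)) f) y =
      b * (ev (lieq w (x * x) i (\<lambda>f. x * ?D f) f) y + ?M / 2 * ev (lieq w (x * x) i ?D1 f) y)"
    using t_lin[OF xxD up[OF xD1] ext[of "lieq w (x * x) i (\<lambda>f. x * ?D f)", OF e3] y, of f]
      eqopD[OF t_lieq[OF i xD, of "x * x"] y, of f] eqopD[OF lieq_eqop[OF V(2) r2] y, of w "x * x" i f] killsD[OF K xD1 y, of f]
    by (simp add: lieq_scaleR lieq_add)
  then have r3: "- (2 * ?M + 1) * ev (t (\<lambda>f. x * (x * ?D f)) f) y =
      b * ((- (2 * ?M + 1)) * ev (x * (x * ?D f)) y + (- ?M * (?M + 1)) * ev (x * ?D1 f) y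
        + ?M / 2 * ((- 2 * ?M) * ev (x * ?D1 f) y + (- ?M * (?M - 1)) * ev (?D2 f) y))"
    unfolding e3 e4 by simp
  have M: "real p = ?M - 2" using m by simp
  have r1': "- 3 * (?M + 1) * (ev (t (\<lambda>f. x * (x * ?D f)) f) y - b * (ev (x * (x * ?D f)) y + ?M * ev (x * ?D1 f) y + ?M * (?M - 1) / 3 * ev (?D2 f) y)) = 0"
    using r1[OF y, of f] unfolding M by (simp add: field_simps)
  have "- 3 * (?M + 1) \<noteq> 0" by (smt (verit) of_nat_0_le_iff)
  with r1' have r1'': "ev (t (\<lambda>f. x * (x * ?D f)) f) y = b * (ev (x * (x * ?D f)) y + ?M * ev (x * ?D1 f) y + ?M * (?M - 1) / 3 * ev (?D2 f) y)"
    by simp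
  have "b * ?M * (?M - 1) * (?M + 2) * ev (?D2 f) y = 0"
    using r3 unfolding r1'' by (simp add: field_simps)
  moreover have "?M * (?M - 1) * (?M + 2) \<noteq> 0" using m by simp
  ultimately show ?thesis using f by simp
qed

text \<open>Once \<open>b = 0\<close> for the next power of \<partial>_i, the Lie derivative along
  x_i^2 \<partial>_i adds x_i times this power to the killed operators, and \<open>kills_Suc\<close>
  adds the rest of that order.\<close>

lemma kills_all:
  assumes "kills 1" "k \<ge> 1 ==> kills 2"
  shows "kills (Suc k)"
proof -
  have "kills (Suc m)" if "m \<le> k" for m
    using that
  proof (induction m)
    case 0
    then show ?case using assms by simp
  next
    case (Suc m)
    show ?case
    proof (cases m)
      case 0
      then show ?thesis using assms(2) Suc.prems by (simp add: numeral_2_eq_2)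
    next
      case (Suc p)
      have m: "Suc m = Suc (Suc p)" "Suc m \<le> k" and K: "kills (Suc m)" using Suc Suc.prems Suc.IH by auto
      obtain b where b: "eqop V (t (dpw i (Suc m))) (\<lambda>f. b *\<^sub>R dpw i (Suc m) f)" using t_dpw[OF m(2)] by blast
      have "b = 0" using w higher_order_w0[OF _ m K b] higher_order_w1[OF _ m K b] by blast
      then have z: "eqop V (t (dpw i (Suc m))) (\<lambda>f. 0)" using b by simp
      let ?M = "real (Suc m)" and ?D = "dpw i (Suc m)" and ?D1 = "dpw i (Suc p)"
      have D: "?D \<in> dopl (Suc k)" and D1: "?D1 \<in> dopl (Suc m)" "?D1 \<in> dopl (Suc k)"
        using m i by (auto simp: dpw_dopl)
      have xx: "?D (x * (x * dv i g)) = x * (x * dpw i (Suc (Suc m)) g) + of_nat (2 * Suc m) * (x * ?D g) + of_nat (Suc m * (p + 1)) * ?D1 g" for g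
        by (simp add: Suc dpw_xx algebra_simps)
      have x0: "?D (x * g) = x * ?D g + of_nat (Suc m) * ?D1 g" for g by (simp add: Suc dpw_x[OF i])
      have eq: "lieq w (x * x) i ?D = (\<lambda>f. (- 2 * (?M + w)) *\<^sub>R (x * ?D f) + (- ?M * (real p + 1) - 2 * w * ?M) *\<^sub>R ?D1 f)"
      proof (rule ext)
        fix f
        have "dv i (x * x) * f = 2 * (x * f)" by (simp add: dv_xc_Basis i algebra_simps)
        then have *: "lieq w (x * x) i ?D f = x * (x * dv i (?D f)) - ?D (x * (x * dv i f)) - w *\<^sub>R ?D (2 * (x * f))"
          by (simp only: lieq_def mult.assoc)
        then show "lieq w (x * x) i ?D f = (- 2 * (?M + w)) *\<^sub>R (x * ?D f) + (- ?M * (real p + 1) - 2 * w * ?M) *\<^sub>R ?D1 f"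
          by (simp only: * dpw_2 xx[of f] x0[of f] dpw_dv) (simp add: scaleR_conv_of_real algebra_simps)
      qed
      have "eqop V (t (\<lambda>f. x * ?D f)) (\<lambda>f. 0)"
      proof (rule eqopI)
        fix f y assume y: "y \<in> V"
        have "(- 2 * (?M + w)) * ev (t (\<lambda>f. x * ?D f) f) y = 0"
          using t_lin[OF dopl_mult[OF D] D1(2) eq y, of f] t_lieq_zero[OF z D i y, of "x * x" f] killsD[OF K D1(1) y, of f]
          by simp
        moreover have "?M + w > 0" using w by auto
        ultimately show "ev (t (\<lambda>f. x * ?D f) f) y = ev 0 y" by simp
      qed
      then show ?thesis using kills_Suc[OF m(2) K z] by simp
    qed
  qed
  then show ?thesis by simp
qed

theorem flat_classification_0: "\<exists>a. \<forall>Q\<in>dopl 1. eqop V (t Q) (\<lambda>f. a *\<^sub>R Q f)"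
proof -
  obtain b where b: "eqop V (t (dpw i 0)) (\<lambda>f. b *\<^sub>R dpw i 0 f)" using t_dpw[of 0] by blast
  have d0: "dpw i 0 = (\<lambda>f. f)" by (rule ext) simp
  interpret s: flat_map V w k "\<lambda>Q f. 1 *\<^sub>R t Q f + (- b) *\<^sub>R Q f" i
    using flat_map_lincomb[OF flat_map_axioms flat_inv_id] .
  have "s.kills (Suc 0)" by (rule s.kills_1) (use b in \<open>simp add: d0 eqop_def\<close>)
  then have "\<forall>Q\<in>dopl 1. eqop V (t Q) (\<lambda>f. b *\<^sub>R Q f)"
    unfolding s.kills_def by (simp add: eqop_def)
  then show ?thesis ..
qed

theorem flat_classification:
  assumes k: "k \<ge> 1" and u: "flat_inv V w k u" and u0: "eqop V (u (\<lambda>f. f)) (\<lambda>f. f)"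
    and u1: "eqop V (u (dv i)) (\<lambda>f. \<nu> *\<^sub>R dv i f)" and nu: "\<nu> \<noteq> 1"
  shows "\<exists>a b. \<forall>Q\<in>dopl (Suc k). eqop V (t Q) (\<lambda>f. a *\<^sub>R Q f + b *\<^sub>R u Q f)"
proof -
  obtain b0 where b0: "eqop V (t (dpw i 0)) (\<lambda>f. b0 *\<^sub>R dpw i 0 f)" using t_dpw[of 0] by blast
  obtain b1 where b1: "eqop V (t (dpw i (Suc 0))) (\<lambda>f. b1 *\<^sub>R dpw i (Suc 0) f)" using t_dpw[of "Suc 0"] k by auto
  have d0: "dpw i 0 = (\<lambda>f. f)" "dpw i (Suc 0) = dv i" by (rule ext, simp)+
  \<comment> \<open>The solution of \<open>a + b = b0\<close> and \<open>a + b * \<nu> = b1\<close>;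
    subtracting the corresponding combination kills 1 and \<partial>_i.\<close>
  define b where "b = (b1 - b0) / (\<nu> - 1)"
  define a where "a = b0 - b"
  have "b * (\<nu> - 1) = b1 - b0" using nu by (simp add: b_def)
  then have mu: "a + b = b0" "a + b * \<nu> = b1" by (auto simp: a_def algebra_simps)
  have uv: "flat_inv V w k (\<lambda>Q f. a *\<^sub>R Q f + b *\<^sub>R u Q f)"
    by (rule flat_inv_lincomb[OF V(2) flat_inv_id u])
  interpret s: flat_map V w k "\<lambda>Q f. 1 *\<^sub>R t Q f + (- 1) *\<^sub>R (a *\<^sub>R Q f + b *\<^sub>R u Q f)" i
    using flat_map_lincomb[OF flat_map_axioms uv] .
  have K1: "s.kills 1"
    using s.kills_1 b0 u0 by (simp add: d0 eqop_def mu(1)[symmetric] algebra_simps)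
  have "s.kills 2"
    by (rule s.kills_2[OF k K1]) (use b1 u1 in \<open>simp add: d0 eqop_def mu(2)[symmetric] algebra_simps\<close>)
  then have "s.kills (Suc k)" using s.kills_all K1 by blast
  then have K: "s.kills (Suc k)" .
  have "eqop V (t Q) (\<lambda>f. a *\<^sub>R Q f + b *\<^sub>R u Q f)" if "Q \<in> dopl (Suc k)" for Q
    using s.killsD[OF K that] by (auto simp: eqop_def algebra_simps)
  then show ?thesis by blast
qed

end

subsection \<open>Invariant operators\<close>

text \<open>Invariance under \<partial>_i and x_i \<partial>_i gives [E, x_i] \<partial>_i = - E,
  where the right hand side stems from the divergence 1 of x_i \<partial>_i; the degree -1 is
  impossible.\<close>

lemma invariant_operator_w1:
  fixes E :: "'e::euclidean_space sfun => 'e sfun"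
  assumes i: "i \<in> Basis" and E: "E \<in> dopl l" and inv: "\<And>h. eqop V (lieq 1 h i E) (\<lambda>f. 0)"
  shows "eqop V E (\<lambda>f. 0)"
proof (rule ad_relation_nonnat[OF i E, of V "-1"])
  show "eqop V (\<lambda>f. ad (xc i) E (dv i f)) (\<lambda>f. (- 1) *\<^sub>R E f)"
    using inv[of 1] inv[of "xc i"] dopl_zero_arg[OF E] i
    by (simp add: eqop_def lieq_def ad_def dv_xc_Basis algebra_simps)
qed simp

text \<open>Without a divergence term constants survive. The fields \<partial>_j and x_j
  \<partial>_j make \<open>E\<close> commute with all derivatives and, once \<partial>_j is
  cancelled, with all coordinates.\<close>

lemma invariant_operator_w0:
  fixes E :: "'e::euclidean_space sfun => 'e sfun"
  assumes V: "convex V" "open V" "V \<noteq> {}" and E: "E \<in> dopl l"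
    and inv: "\<And>h i. i \<in> Basis ==> eqop V (lieq 0 h i E) (\<lambda>f. 0)"
  shows "\<exists>c. eqop V E (\<lambda>f. c *\<^sub>R f)"
proof -
  have d: "eqop V (\<lambda>f. dv j (E f) - E (dv j f)) (\<lambda>f. 0)" if "j \<in> Basis" for j
    using inv[OF that, of 1] by (simp add: eqop_def lieq_def)
  have x: "eqop V (ad (xc j) E) (\<lambda>f. 0)" if "j \<in> Basis" for j
  proof (rule dopl_cancel_dv[OF that ad_dopl'[OF E]])
    show "eqop V (\<lambda>f. ad (xc j) E (dv j f)) (\<lambda>f. 0)"
      using inv[OF that, of "xc j"] d[OF that] by (simp add: eqop_def lieq_def ad_def)
  qed
  obtain i :: 'e where i: "i \<in> Basis" by (meson SOME_Basis)
  have r: "eqop V (\<lambda>f. ad (xc i) E (dv i f)) (\<lambda>f. real 0 *\<^sub>R E f)" using x[OF i] by (simp add: eqop_def)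
  show ?thesis using dopl_characterize_power[OF V i E r x d] by auto
qed

section \<open>Alternating forms of degree zero and of top degree\<close>

text \<open>In degree 0 and in top degree an alternating form is determined by its value on this one
  list, which allows both cases to be treated together.\<close>

definition frame :: "nat => 'e::euclidean_space list" where
  "frame p = (if p = 0 then [] else basis_frame)"

text \<open>The Leibniz formula for the determinant with respect to \<open>frame p\<close>; in
  degree 0 it gives 1 on the empty list.\<close>

definition vol :: "nat => 'e::euclidean_space list => real" where
  "vol p vs = (if length vs = p then \<Sum>\<pi> | \<pi> permutes {..<p}. of_int (sign \<pi>) * (\<Prod>l<p. vs ! l \<bullet> frame p ! \<pi> l) else 0)"

abbreviation zero_or_top :: "nat => 'e::euclidean_space itself => bool" where
  "zero_or_top p t \<equiv> p = 0 \<or> p = DIM('e)"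

lemma basis_frame: "distinct (basis_frame :: 'e::euclidean_space list)" "set (basis_frame :: 'e list) = Basis"
proof -
  have "\<exists>bs::'e list. distinct bs \<and> set bs = Basis"
    using finite_distinct_list[OF finite_Basis] by metis
  from someI_ex[OF this] show "distinct (basis_frame :: 'e list)" "set (basis_frame :: 'e list) = Basis"
    by (auto simp: basis_frame_def)
qed

lemma frame:
  assumes "zero_or_top p TYPE('e::euclidean_space)"
  shows "length (frame p :: 'e list) = p" "distinct (frame p :: 'e list)" "set (frame p :: 'e list) \<subseteq> Basis"
    "p \<noteq> 0 ==> set (frame p :: 'e list) = Basis"
  using assms basis_frame[where 'e='e] distinct_card[of "basis_frame :: 'e list"] by (auto simp: frame_def)

lemma alternating_linear:
  "alternating_multilinear p \<phi> ==> length vs = p ==> i < p ==> linear (\<lambda>v. \<phi> (vs[i := v]))"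
  and alternating_eq: "alternating_multilinear p \<phi> ==> length vs = p ==> i < p ==> j < p ==> i \<noteq> j ==> vs ! i = vs ! j ==> \<phi> vs = 0"
  and alternating_length: "alternating_multilinear p \<phi> ==> length vs \<noteq> p ==> \<phi> vs = 0"
  unfolding alternating_multilinear_def by (blast, metis nat_neq_iff, blast)

lemma alternating_swap:
  assumes \<phi>: "alternating_multilinear p \<phi>" and vs: "length vs = p" "i < p" "j < p" "i \<noteq> j"
  shows "\<phi> (vs[i := a, j := b]) = - \<phi> (vs[i := b, j := a])"
proof -
  have 1: "\<phi> (vs[i := u + v, j := z]) = \<phi> (vs[i := u, j := z]) + \<phi> (vs[i := v, j := z])" for u v z
    using linear_add[OF alternating_linear[OF \<phi>, of "vs[j := z]" i]] vs by (simp add: list_update_swap)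
  have 2: "\<phi> (vs[i := z, j := u + v]) = \<phi> (vs[i := z, j := u]) + \<phi> (vs[i := z, j := v])" for u v z
    using linear_add[OF alternating_linear[OF \<phi>, of "vs[i := z]" j]] vs by simp
  have 3: "\<phi> (vs[i := z, j := z]) = 0" for z
    by (rule alternating_eq[OF \<phi>, of _ i j]) (use vs in auto)
  have "\<phi> (vs[i := a + b, j := a + b]) = \<phi> (vs[i := a, j := b]) + \<phi> (vs[i := b, j := a])"
    unfolding 1 2 by (simp add: 3)
  then show ?thesis by (simp add: 3)
qed

lemma alternating_vol: "alternating_multilinear p (vol p :: 'e::euclidean_space list => real)"
  unfolding alternating_multilinear_def
proof (intro conjI allI impI)
  fix vs :: "'e list" and i assume vs: "length vs = p \<and> i < p"
  have "(\<Prod>l<p. vs[i := v] ! l \<bullet> frame p ! \<pi> l) =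
      (v \<bullet> frame p ! \<pi> i) * (\<Prod>l\<in>{..<p} - {i}. vs ! l \<bullet> frame p ! \<pi> l)" for v \<pi>
    using vs by (subst prod.remove[of _ i]) (auto intro!: prod.cong)
  then have "vol p (vs[i := v]) = (\<Sum>\<pi> | \<pi> permutes {..<p}. of_int (sign \<pi>) *
      ((v \<bullet> frame p ! \<pi> i) * (\<Prod>l\<in>{..<p} - {i}. vs ! l \<bullet> frame p ! \<pi> l)))" for v
    using vs by (simp add: vol_def)
  then show "linear (\<lambda>v. vol p (vs[i := v]))"
    by (auto intro!: linearI simp: inner_add_left algebra_simps sum.distrib sum_distrib_left)
next
  fix vs :: "'e list" and i j assume vs: "length vs = p \<and> i < j \<and> j < p \<and> vs ! i = vs ! j"
  let ?P = "{\<pi>. \<pi> permutes {..<p}}" and ?t = "Transposition.transpose i j"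
  let ?f = "\<lambda>\<pi>. of_int (sign \<pi>) * (\<Prod>l<p. vs ! l \<bullet> (frame p :: 'e list) ! \<pi> l) :: real"
  have t: "?t permutes {..<p}" using vs by (intro permutes_swap_id) auto
  \<comment> \<open>Composition with the transposition of the two equal entries reverses the sign of
    each summand while it permutes the summands, so the sum is its own negative.\<close>
  have "?f (\<pi> \<circ> ?t) = - ?f \<pi>" if "\<pi> permutes {..<p}" for \<pi>
  proof -
    have "sign (\<pi> \<circ> ?t) = - sign \<pi>"
      using that t vs by (subst sign_compose) (auto simp: sign_swap_id permutation_swap_id intro: permutes_imp_permutation[of "{..<p}"])
    moreover have "(\<Prod>l<p. vs ! l \<bullet> (frame p :: 'e list) ! \<pi> l) = (\<Prod>l<p. vs ! l \<bullet> (frame p :: 'e list) ! (\<pi> \<circ> ?t) l)"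
    proof -
      have "vs ! ?t l = vs ! l" for l using vs by (auto simp: Transposition.transpose_def)
      then show ?thesis by (subst prod.permute[OF t]) (simp add: o_def)
    qed
    ultimately show ?thesis by simp
  qed
  then have "sum ?f ?P = (\<Sum>\<pi>\<in>?P. - ?f \<pi>)"
    by (subst sum_permutations_compose_right[OF t]) (auto intro!: sum.cong)
  then show "vol p vs = 0" using vs by (simp add: vol_def sum_negf)
qed (simp add: vol_def)

lemma vol_frame:
  assumes p: "zero_or_top p TYPE('e::euclidean_space)"
  shows "vol p (frame p :: 'e list) = 1"
proof -
  let ?f = "frame p :: 'e list"
  have "(\<Prod>l<p. ?f ! l \<bullet> ?f ! \<pi> l) = 0" if pi: "\<pi> permutes {..<p}" "\<pi> \<noteq> id" for \<pi>
  proof -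
    obtain l where l: "\<pi> l \<noteq> l" using pi(2) eq_id_iff by metis
    then have "l < p" using permutes_not_in[OF pi(1), of l] by auto
    moreover have "\<pi> l < p" using permutes_in_image[OF pi(1), of l] \<open>l < p\<close> by simp
    moreover have "?f ! l \<in> Basis" "?f ! \<pi> l \<in> Basis"
      using frame(1,3)[OF p] calculation nth_mem[of l ?f] nth_mem[of "\<pi> l" ?f] by (metis subsetD)+
    moreover have "?f ! l \<noteq> ?f ! \<pi> l" using frame(1,2)[OF p] calculation l by (simp add: nth_eq_iff_index_eq)
    ultimately have "?f ! l \<bullet> ?f ! \<pi> l = 0" by (simp add: inner_not_same_Basis)
    then show ?thesis using \<open>l < p\<close> by (intro prod_zero) auto
  qed
  then have "vol p ?f = (\<Sum>\<pi> | \<pi> permutes {..<p}. if \<pi> = id then (\<Prod>l<p. ?f ! l \<bullet> ?f ! l) else 0)"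
    using frame[OF p] by (auto simp: vol_def sign_id intro!: sum.cong)
  also have "\<dots> = (\<Prod>l<p. ?f ! l \<bullet> ?f ! l)"
    by (subst sum.delta) (auto simp: permutes_id finite_permutations)
  also have "\<dots> = 1"
  proof (rule prod.neutral, rule ballI)
    fix l assume "l \<in> {..<p}"
    then have "?f ! l \<in> Basis" using frame(1,3)[OF p] by (metis lessThan_iff nth_mem subset_iff)
    then show "?f ! l \<bullet> ?f ! l = 1" by (rule inner_same_Basis)
  qed
  finally show ?thesis .
qed

lemma alternating_zero_on_basis:
  fixes \<psi> :: "'e::euclidean_space list => real"
  assumes \<psi>: "alternating_multilinear p \<psi>" and z: "\<And>\<beta>. length \<beta> = p ==> set \<beta> \<subseteq> Basis ==> \<psi> \<beta> = 0"
  shows "\<psi> vs = 0"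
proof -
  \<comment> \<open>Induction on the number \<open>j\<close> of leading entries that are still
    arbitrary vectors.\<close>
  have "\<forall>vs. length vs = p \<and> (\<forall>i. j \<le> i \<and> i < p \<longrightarrow> vs ! i \<in> Basis) \<longrightarrow> \<psi> vs = 0" if "j \<le> p" for j
    using that
  proof (induction j)
    case 0
    then show ?case using z by (metis in_set_conv_nth subsetI zero_le)
  next
    case (Suc j)
    show ?case
    proof (intro allI impI)
      fix vs :: "'e list" assume vs: "length vs = p \<and> (\<forall>i. Suc j \<le> i \<and> i < p \<longrightarrow> vs ! i \<in> Basis)"
      have lin: "linear (\<lambda>v. \<psi> (vs[j := v]))" using alternating_linear[OF \<psi>] vs Suc by auto
      have "\<psi> (vs[j := b]) = 0" if "b \<in> Basis" for b
        using Suc vs that by (auto simp: nth_list_update Suc_le_eq)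
      then have "\<psi> (vs[j := vs ! j]) = 0"
        using fd_basis_sum[OF lin, of "vs ! j"] by simp
      then show "\<psi> vs = 0" by simp
    qed
  qed
  from this[of p] show ?thesis using alternating_length[OF \<psi>] by (cases "length vs = p") auto
qed

lemma alternating_zero_on_frame:
  fixes \<psi> :: "'e::euclidean_space list => real"
  assumes p: "zero_or_top p TYPE('e)" and \<psi>: "alternating_multilinear p \<psi>" and z: "\<psi> (frame p) = 0"
  shows "\<psi> vs = 0"
proof (rule alternating_zero_on_basis[OF \<psi>])
  fix \<beta> :: "'e list" assume \<beta>: "length \<beta> = p" "set \<beta> \<subseteq> Basis"
  \<comment> \<open>Sorting by transpositions: \<open>j\<close> counts the entries already in place,
    and each exchange changes only the sign.\<close>
  have step: "\<psi> \<beta> = 0" if "j \<le> p" "length \<beta> = p" "distinct \<beta>" "set \<beta> = set (frame p)" "\<forall>i<j. \<beta> ! i = frame p ! i" for j \<beta>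
    using that
  proof (induction "p - j" arbitrary: j \<beta>)
    case 0
    then have "\<beta> = frame p" using frame(1)[OF p] by (intro nth_equalityI) auto
    then show ?case using z by simp
  next
    case (Suc d)
    then have j: "j < p" by simp
    have "frame p ! j \<in> set \<beta>" using j frame(1)[OF p] Suc.prems by simp
    then obtain k where k: "k < p" "\<beta> ! k = frame p ! j" using Suc.prems by (metis in_set_conv_nth)
    have "k \<ge> j"
    proof (rule ccontr)
      assume "\<not> k \<ge> j"
      then have "frame p ! k = (frame p ! j :: 'e)" using Suc.prems k by auto
      then show False using frame(1,2)[OF p] k j \<open>\<not> k \<ge> j\<close> by (simp add: nth_eq_iff_index_eq)
    qed
    show ?case
    proof (cases "k = j")
      case True
      then have "\<forall>i<Suc j. \<beta> ! i = frame p ! i" using Suc.prems k by (auto simp: less_Suc_eq)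
      then show ?thesis using Suc.hyps Suc.prems j by (intro Suc.hyps(1)[of "Suc j"]) auto
    next
      case False
      let ?\<gamma> = "\<beta>[j := \<beta> ! k, k := \<beta> ! j]"
      have g: "length ?\<gamma> = p" "distinct ?\<gamma>" "set ?\<gamma> = set (frame p)"
        using Suc.prems j k(1) distinct_swap[of j \<beta> k] set_swap[of j \<beta> k] by simp_all
      have "\<forall>i<Suc j. ?\<gamma> ! i = frame p ! i"
        using Suc.prems k j False \<open>k \<ge> j\<close> by (auto simp: less_Suc_eq nth_list_update)
      then have "\<psi> ?\<gamma> = 0" using Suc.hyps j g by (intro Suc.hyps(1)[of "Suc j"]) auto
      moreover have "\<psi> (\<beta>[j := \<beta> ! j, k := \<beta> ! k]) = - \<psi> ?\<gamma>"
        using alternating_swap[OF \<psi>] Suc.prems j k False by blast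
      ultimately show ?thesis by simp
    qed
  qed
  show "\<psi> \<beta> = 0"
  proof (cases "distinct \<beta>")
    case True
    have "set \<beta> = set (frame p)"
    proof (cases "p = 0")
      case True
      then show ?thesis using \<beta> by (simp add: frame_def)
    next
      case False
      then have "card (set \<beta>) = DIM('e)" using True \<beta> p distinct_card by fastforce
      then have "set \<beta> = Basis" using \<beta> by (intro card_subset_eq) auto
      then show ?thesis using frame(4)[OF p False] by simp
    qed
    then show ?thesis using step[of 0 \<beta>] \<beta> True by simp
  next
    case False
    then obtain i j where "i < p" "j < p" "i \<noteq> j" "\<beta> ! i = \<beta> ! j"
      using \<beta> by (auto simp: distinct_conv_nth)
    then show ?thesis using alternating_eq[OF \<psi> \<beta>(1)] by blast
  qed
qed

lemma alternating_add: "alternating_multilinear p \<phi> ==> alternating_multilinear p \<psi> ==> alternating_multilinear p (\<lambda>vs. \<phi> vs + \<psi> vs)"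
  unfolding alternating_multilinear_def by (simp add: linear_compose_add)

lemma alternating_mult: "alternating_multilinear p \<phi> ==> alternating_multilinear p (\<lambda>vs. c * \<phi> vs)"
  unfolding alternating_multilinear_def using linear_compose_scale_right[where 'b=real and c=c] by auto

lemma alternating_unique:
  fixes \<phi> :: "'e::euclidean_space list => real"
  assumes p: "zero_or_top p TYPE('e)" and \<phi>: "alternating_multilinear p \<phi>"
  shows "\<phi> vs = vol p vs * \<phi> (frame p)"
proof -
  have alt: "alternating_multilinear p (\<lambda>vs. \<phi> vs + (- \<phi> (frame p)) * vol p vs)"
    by (intro alternating_add alternating_mult alternating_vol \<phi>)
  have "\<phi> (frame p) + (- \<phi> (frame p)) * vol p (frame p :: 'e list) = 0"
    using vol_frame[OF p] by simp
  from alternating_zero_on_frame[OF p alt this] have "\<phi> vs + (- \<phi> (frame p)) * vol p vs = 0" .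
  then show ?thesis by (simp add: algebra_simps)
qed

lemma alternating_map:
  fixes L :: "'e::euclidean_space => 'e"
  assumes \<phi>: "alternating_multilinear p \<phi>" and L: "linear L"
  shows "alternating_multilinear p (\<lambda>vs. \<phi> (map L vs))"
  unfolding alternating_multilinear_def
proof (intro conjI allI impI)
  fix vs :: "'e list" and i assume vs: "length vs = p \<and> i < p"
  have "linear (\<lambda>v. \<phi> ((map L vs)[i := v]))" using alternating_linear[OF \<phi>] vs by simp
  from linear_compose[OF L this] show "linear (\<lambda>v. \<phi> (map L (vs[i := v])))" by (simp add: o_def map_update)
next
  fix vs :: "'e list" and i j assume "length vs = p \<and> i < j \<and> j < p \<and> vs ! i = vs ! j"
  then show "\<phi> (map L vs) = 0" by (intro alternating_eq[OF \<phi>, of _ i j]) auto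
qed (use \<phi> in \<open>auto simp: alternating_length\<close>)

text \<open>The trace of \<open>M\<close> in top degree and 0 in degree 0; for the derivative of a
  vector field, the divergence term of the Lie derivative.\<close>

definition dvg :: "nat => ('e::euclidean_space => 'e) => real" where
  "dvg p M = (\<Sum>i<p. M (frame p ! i) \<bullet> frame p ! i)"

lemma dvg_0 [simp]: "dvg 0 M = 0" by (simp add: dvg_def)

lemma dvg_top: "dvg DIM('e) (M :: 'e::euclidean_space => 'e) = (\<Sum>b\<in>Basis. M b \<bullet> b)"
proof -
  have p: "zero_or_top DIM('e) TYPE('e)" by simp
  let ?f = "frame DIM('e) :: 'e list"
  have "(\<Sum>b\<in>set ?f. M b \<bullet> b) = (\<Sum>i\<in>{..<DIM('e)}. M (?f ! i) \<bullet> ?f ! i)"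
    by (rule sum.reindex_bij_betw[symmetric], rule bij_betw_nth) (use frame[OF p] in auto)
  then show ?thesis using frame(4)[OF p] by (simp add: dvg_def)
qed

lemma alternating_derivation:
  assumes \<phi>: "alternating_multilinear p \<phi>" and M: "linear M"
  shows "alternating_multilinear p (\<lambda>vs. \<Sum>i<length vs. \<phi> (vs[i := M (vs ! i)]))"
  unfolding alternating_multilinear_def
proof (intro conjI allI impI)
  fix vs :: "'a list" and j assume vs: "length vs = p \<and> j < p"
  have "linear (\<lambda>v. \<phi> (vs[j := v, i := M (vs[j := v] ! i)]))" if "i < p" for i
  proof (cases "i = j")
    case True
    have "linear (\<lambda>v. \<phi> (vs[j := v]))" using alternating_linear[OF \<phi>] vs by simp
    from linear_compose[OF M this] show ?thesis using True vs by (simp add: o_def)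
  next
    case False
    have "linear (\<lambda>v. \<phi> ((vs[i := M (vs ! i)])[j := v]))" using alternating_linear[OF \<phi>] vs by simp
    then show ?thesis using False by (simp add: list_update_swap)
  qed
  then show "linear (\<lambda>v. \<Sum>i<length (vs[j := v]). \<phi> (vs[j := v, i := M (vs[j := v] ! i)]))"
    using vs by (auto intro!: linear_compose_sum)
next
  fix vs :: "'a list" and a b assume vs: "length vs = p \<and> a < b \<and> b < p \<and> vs ! a = vs ! b"
  \<comment> \<open>Summands in which both equal entries survive vanish; the two others differ by a
    transposition and cancel.\<close>
  have "\<phi> (vs[i := M (vs ! i)]) = 0" if "i \<in> {..<p} - {a, b}" for i
    by (rule alternating_eq[OF \<phi>, of _ a b]) (use vs that in auto)
  then have "(\<Sum>i<length vs. \<phi> (vs[i := M (vs ! i)])) = (\<Sum>i\<in>{a, b}. \<phi> (vs[i := M (vs ! i)]))"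
    using vs by (intro sum.mono_neutral_right) auto
  also have "\<dots> = \<phi> (vs[a := M (vs ! a), b := vs ! a]) + \<phi> (vs[a := vs ! a, b := M (vs ! a)])"
  proof -
    have "vs[a := M (vs ! a), b := vs ! a] = vs[a := M (vs ! a)]" "vs[a := vs ! a, b := M (vs ! a)] = vs[b := M (vs ! b)]"
      using vs by (auto intro!: nth_equalityI simp: nth_list_update)
    then show ?thesis using vs by simp
  qed
  also have "\<dots> = 0" using alternating_swap[OF \<phi>, of vs a b "M (vs ! a)" "vs ! a"] vs by simp
  finally show "(\<Sum>i<length vs. \<phi> (vs[i := M (vs ! i)])) = 0" .
qed (use \<phi> in \<open>auto simp: alternating_length\<close>)

text \<open>Expand \<open>M (frame p ! i)\<close> in the basis: every component except the one along
  \<open>frame p ! i\<close> repeats an entry of the frame, so only the diagonal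
  contributes.\<close>

lemma derivation_frame:
  fixes M :: "'e::euclidean_space => 'e"
  assumes p: "zero_or_top p TYPE('e)" and \<phi>: "alternating_multilinear p \<phi>"
  shows "(\<Sum>i<p. \<phi> ((frame p)[i := M (frame p ! i)])) = dvg p M * \<phi> (frame p)"
proof -
  let ?f = "frame p :: 'e list"
  have "\<phi> (?f[i := M (?f ! i)]) = (M (?f ! i) \<bullet> ?f ! i) * \<phi> ?f" if i: "i < p" for i
  proof -
    have B: "set ?f = Basis" using frame(4)[OF p] i by auto
    have lin: "linear (\<lambda>v. \<phi> (?f[i := v]))" using alternating_linear[OF \<phi>] frame(1)[OF p] i by simp
    have z: "\<phi> (?f[i := b]) = 0" if b: "b \<in> Basis" "b \<noteq> ?f ! i" for b
    proof -
      obtain j where j: "j < p" "?f ! j = b" using b B frame(1)[OF p] by (metis in_set_conv_nth)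
      then have "j \<noteq> i" using b by auto
      then show ?thesis
        by (intro alternating_eq[OF \<phi>, of _ i j]) (use i j frame(1)[OF p] in auto)
    qed
    have "\<phi> (?f[i := M (?f ! i)]) = (\<Sum>b\<in>Basis. (M (?f ! i) \<bullet> b) *\<^sub>R \<phi> (?f[i := b]))"
      by (rule fd_basis_sum[OF lin])
    also have "\<dots> = (\<Sum>b\<in>Basis. if b = ?f ! i then (M (?f ! i) \<bullet> b) * \<phi> ?f else 0)"
      using z by (intro sum.cong[OF refl]) simp
    also have "\<dots> = (M (?f ! i) \<bullet> ?f ! i) * \<phi> ?f"
    proof -
      have "?f ! i \<in> Basis" using B frame(1)[OF p] i nth_mem by metis
      then show ?thesis by (simp add: sum.delta[OF finite_Basis])
    qed
    finally show ?thesis .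
  qed
  then show ?thesis by (simp add: dvg_def sum_distrib_right)
qed

lemma derivation_eq:
  fixes M :: "'e::euclidean_space => 'e"
  assumes p: "zero_or_top p TYPE('e)" and \<phi>: "alternating_multilinear p \<phi>" and M: "linear M"
  shows "(\<Sum>i<length vs. \<phi> (vs[i := M (vs ! i)])) = vol p vs * (dvg p M * \<phi> (frame p))"
  using alternating_unique[OF p alternating_derivation[OF \<phi> M], of vs] derivation_frame[OF p \<phi>, of M] frame(1)[OF p]
  by simp

lemma vol_has_derivative:
  assumes "length us = p" "\<And>i. i < p ==> ((\<lambda>y. (us ! i) y) has_derivative (\<lambda>h. (us' ! i) h)) (at y)" "length us' = p"
  shows "((\<lambda>y. vol p (map (\<lambda>u. u y) us)) has_derivative
    (\<lambda>h. \<Sum>i<p. vol p ((map (\<lambda>u. u y) us)[i := (us' ! i) h]))) (at y)"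
proof -
  let ?g = "\<lambda>\<pi> y. \<Prod>l<p. (us ! l) y \<bullet> frame p ! \<pi> l"
  have g: "(?g \<pi> has_derivative (\<lambda>h. \<Sum>i<p. ((us' ! i) h \<bullet> frame p ! \<pi> i) * (\<Prod>l\<in>{..<p} - {i}. (us ! l) y \<bullet> frame p ! \<pi> l))) (at y)" for \<pi>
    by (rule has_derivative_prod) (auto intro!: has_derivative_inner_left assms)
  have "((\<lambda>y. \<Sum>\<pi> | \<pi> permutes {..<p}. of_int (sign \<pi>) * ?g \<pi> y) has_derivative
     (\<lambda>h. \<Sum>\<pi> | \<pi> permutes {..<p}. of_int (sign \<pi>) * (\<Sum>i<p. ((us' ! i) h \<bullet> frame p ! \<pi> i) * (\<Prod>l\<in>{..<p} - {i}. (us ! l) y \<bullet> frame p ! \<pi> l)))) (at y)"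
    by (intro has_derivative_sum has_derivative_mult_right g)
  moreover have "vol p (map (\<lambda>u. u y) us) = (\<Sum>\<pi> | \<pi> permutes {..<p}. of_int (sign \<pi>) * ?g \<pi> y)" for y
    using assms by (auto simp: vol_def intro!: sum.cong prod.cong)
  moreover have "(\<Sum>i<p. vol p ((map (\<lambda>u. u y) us)[i := (us' ! i) h])) =
     (\<Sum>\<pi> | \<pi> permutes {..<p}. of_int (sign \<pi>) * (\<Sum>i<p. ((us' ! i) h \<bullet> frame p ! \<pi> i) * (\<Prod>l\<in>{..<p} - {i}. (us ! l) y \<bullet> frame p ! \<pi> l)))" for h
  proof -
    have "(\<Prod>l<p. (map (\<lambda>u. u y) us)[i := (us' ! i) h] ! l \<bullet> frame p ! \<pi> l) =
        ((us' ! i) h \<bullet> frame p ! \<pi> i) * (\<Prod>l\<in>{..<p} - {i}. (us ! l) y \<bullet> frame p ! \<pi> l)" if "i < p" for i \<pi>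
      using assms that by (subst prod.remove[of _ i]) (auto intro!: prod.cong)
    then have "(\<Sum>i<p. vol p ((map (\<lambda>u. u y) us)[i := (us' ! i) h])) = (\<Sum>i<p. \<Sum>\<pi> | \<pi> permutes {..<p}. of_int (sign \<pi>) *
       (((us' ! i) h \<bullet> frame p ! \<pi> i) * (\<Prod>l\<in>{..<p} - {i}. (us ! l) y \<bullet> frame p ! \<pi> l)))"
      using assms by (auto simp: vol_def intro!: sum.cong)
    then show ?thesis by (subst (asm) sum.swap) (simp add: sum_distrib_left)
  qed
  ultimately show ?thesis by simp
qed

lemma smooth_on_vol:
  assumes "open S" "length us = p" "\<And>i. i < p ==> smooth_on S (us ! i)"
  shows "smooth_on S (\<lambda>y. vol p (map (\<lambda>u. u y) us))"
proof -
  have "smooth_on S (\<lambda>y. \<Sum>\<pi> | \<pi> permutes {..<p}. of_int (sign \<pi>) * (\<Prod>l<p. (us ! l) y \<bullet> frame p ! \<pi> l))"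
    using assms by (intro smooth_on_sum smooth_on_mult smooth_on_prod smooth_on_inner) auto
  moreover have "vol p (map (\<lambda>u. u y) us) = (\<Sum>\<pi> | \<pi> permutes {..<p}. of_int (sign \<pi>) * (\<Prod>l<p. (us ! l) y \<bullet> frame p ! \<pi> l))" for y
    using assms by (auto simp: vol_def intro!: sum.cong prod.cong)
  ultimately show ?thesis by simp
qed


section \<open>Charts and coordinates\<close>

definition cset :: "('a, 'e) chart => 'a set => 'e set" where
  "cset c N = {y \<in> chart_img c. chart_inv c y \<in> N}"

abbreviation tr :: "('a, 'e) chart => ('a, 'e) chart => 'e => 'e" where
  "tr c c' \<equiv> (\<lambda>y. chart_map c' (chart_inv c y))"

text \<open>The differential of the transition map. It also converts between the chosen chart at a
  point, in which tangent vectors are stored, and any other chart.\<close>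

definition TT :: "('a, 'e::euclidean_space) chart => ('a, 'e) chart => 'e => 'e => 'e" where
  "TT c c' y = fd (tr c c') y"

locale mfd =
  fixes A :: "('a::{second_countable_topology, t2_space}, 'e::euclidean_space) chart set"
  assumes M: "smooth_manifold A"
begin

abbreviation "at_chart \<equiv> chart_at A"

lemma chart_props:
  assumes "c \<in> A"
  shows "open (chart_dom c)" "open (chart_img c)"
    "continuous_on (chart_img c) (chart_inv c)" "continuous_on (chart_dom c) (chart_map c)"
    "x \<in> chart_dom c ==> chart_inv c (chart_map c x) = x"
    "y \<in> chart_img c ==> chart_map c (chart_inv c y) = y"
    "y \<in> chart_img c ==> chart_inv c y \<in> chart_dom c"
proof -
  have "is_chart c" using M assms by (simp add: smooth_manifold_def)
  then have o: "open (chart_dom c)" "open (chart_img c)"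
    and h: "homeomorphism (chart_dom c) (chart_img c) (chart_map c) (chart_inv c)"
    by (auto simp: is_chart_def)
  show "open (chart_dom c)" "open (chart_img c)" by fact+
  show "continuous_on (chart_img c) (chart_inv c)" "continuous_on (chart_dom c) (chart_map c)"
    "x \<in> chart_dom c ==> chart_inv c (chart_map c x) = x"
    "y \<in> chart_img c ==> chart_map c (chart_inv c y) = y"
    "y \<in> chart_img c ==> chart_inv c y \<in> chart_dom c"
    using h by (auto simp: homeomorphism_def)
qed

lemma cset_open: "c \<in> A ==> open N ==> open (cset c N)"
  using continuous_open_preimage[OF chart_props(3,2), of c N]
  by (simp add: cset_def vimage_def Int_def conj_commute)

lemma chart_preimage_open: "c \<in> A ==> open V ==> open {x \<in> chart_dom c. chart_map c x \<in> V}"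
  using continuous_open_preimage[OF chart_props(4,1), of c V]
  by (simp add: vimage_def Int_def conj_commute)

lemma cset_subset: "cset c N \<subseteq> chart_img c" by (auto simp: cset_def)

lemma cset_cm: "c \<in> A ==> x \<in> chart_dom c ==> x \<in> N ==> chart_map c x \<in> cset c N"
  by (simp add: cset_def chart_props)

lemma csetD: "y \<in> cset c N ==> y \<in> chart_img c" "y \<in> cset c N ==> chart_inv c y \<in> N"
  by (auto simp: cset_def)

lemma compact_chart_inv:
  assumes "c \<in> A" "compact K" "K \<subseteq> chart_img c"
  shows "compact (chart_inv c ` K)" "open (- chart_inv c ` K)"
proof -
  show "compact (chart_inv c ` K)"
    by (rule compact_continuous_image[OF continuous_on_subset[OF chart_props(3)]]) (use assms in auto)
  then show "open (- chart_inv c ` K)" by (simp add: compact_imp_closed open_Compl)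
qed

lemma chart_at: "at_chart x \<in> A" "x \<in> chart_dom (at_chart x)"
proof -
  have "(\<Union>c\<in>A. chart_dom c) = UNIV" using M by (simp only: smooth_manifold_def)
  then have "\<exists>c. c \<in> A \<and> x \<in> chart_dom c" by blast
  from someI_ex[OF this] show "at_chart x \<in> A" "x \<in> chart_dom (at_chart x)" by (simp_all add: chart_at_def)
qed

lemma tr_smooth:
  assumes "c \<in> A" "c' \<in> A"
  shows "smooth_on (cset c (chart_dom c')) (tr c c')"
proof -
  have "chart_map c ` (chart_dom c \<inter> chart_dom c') = cset c (chart_dom c')"
    by (auto simp: cset_def chart_props[OF assms(1)] image_iff)
  moreover have "smooth_compatible c c'" using M assms by (simp add: smooth_manifold_def)
  ultimately show ?thesis by (simp add: smooth_compatible_def o_def)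
qed

lemma tr_tr: "c \<in> A ==> c' \<in> A ==> y \<in> cset c (chart_dom c') ==> tr c' c'' (tr c c' y) = tr c c'' y"
  by (simp add: cset_def chart_props)

lemma ci_tr: "c' \<in> A ==> y \<in> cset c (chart_dom c') ==> chart_inv c' (tr c c' y) = chart_inv c y"
  by (simp add: cset_def chart_props)

lemma tr_in: "c \<in> A ==> c' \<in> A ==> y \<in> cset c N ==> y \<in> cset c (chart_dom c') ==> tr c c' y \<in> cset c' N"
  by (auto simp: cset_def chart_props)

lemma TT_smooth:
  assumes "c \<in> A" "c' \<in> A"
  shows "smooth_on (cset c (chart_dom c')) (\<lambda>y. TT c c' y v)"
  unfolding TT_def by (rule smooth_on_fd[OF tr_smooth[OF assms]])

lemma TT_linear: "c \<in> A ==> c' \<in> A ==> y \<in> cset c (chart_dom c') ==> linear (TT c c' y)"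
  unfolding TT_def by (rule linear_fd[OF tr_smooth])

lemma TT_chain:
  assumes c: "c \<in> A" "c' \<in> A" "c'' \<in> A" and y: "y \<in> cset c (chart_dom c')" "y \<in> cset c (chart_dom c'')"
  shows "TT c c'' y v = TT c' c'' (tr c c' y) (TT c c' y v)"
proof -
  let ?S = "cset c (chart_dom c' \<inter> chart_dom c'')"
  have S: "open ?S" "y \<in> ?S" using c y by (auto intro!: cset_open open_Int chart_props) (auto simp: cset_def)
  have 1: "TT c c'' y = fd (\<lambda>z. tr c' c'' (tr c c' z)) y"
    unfolding TT_def by (rule fd_cong[OF S]) (use c in \<open>auto simp: cset_def chart_props\<close>)
  have "fd (\<lambda>z. tr c' c'' (tr c c' z)) y v = TT c' c'' (tr c c' y) (TT c c' y v)"
    unfolding TT_def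
    by (rule fd_compose[OF S(1) tr_smooth[OF c(2,3)] smooth_on_subset[OF tr_smooth[OF c(1,2)]] S(2)])
       (use c y tr_in[of c c' y "chart_dom c''"] in \<open>auto simp: cset_def\<close>)
  then show ?thesis by (simp only: 1)
qed

lemma TT_id: "c \<in> A ==> y \<in> chart_img c ==> TT c c y = (\<lambda>v. v)"
proof -
  assume c: "c \<in> A" "y \<in> chart_img c"
  have "TT c c y = fd (\<lambda>z. z) y"
    unfolding TT_def by (rule fd_cong[OF chart_props(2)[OF c(1)] c(2)]) (use c chart_props in auto)
  then show ?thesis by (simp add: fd_eqI[OF has_derivative_ident])
qed

lemma TT_inverse: "c \<in> A ==> c' \<in> A ==> y \<in> cset c (chart_dom c') ==> TT c' c (tr c c' y) (TT c c' y v) = v"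
  using TT_chain[of c c' c y v] TT_id[of c y] by (auto simp: cset_def chart_props)

subsection \<open>Functions\<close>

lemma smooth_functionsD: "f \<in> smooth_functions A ==> c \<in> A ==> smooth_on (chart_img c) (\<lambda>y. f (chart_inv c y))"
  by (simp add: smooth_functions_def o_def)

text \<open>The common pattern for functions, fields and forms: if smoothness of the representation
  passes from chart to chart, it need only be checked near each point in one suitable chart.\<close>

lemma smooth_transfer:
  assumes "\<And>x. \<exists>c\<in>A. \<exists>N. open N \<and> x \<in> N \<and> N \<subseteq> chart_dom c \<and> smooth_on (cset c N) (F c)"
    and tr: "\<And>c c' N. c \<in> A ==> c' \<in> A ==> open N ==> N \<subseteq> chart_dom c ==> smooth_on (cset c N) (F c) ==>
      smooth_on (cset c' N) (F c')"
    and c': "c' \<in> A"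
  shows "smooth_on (chart_img c') (F c')"
proof (rule smooth_on_local)
  fix y assume y: "y \<in> chart_img c'"
  obtain c N where c: "c \<in> A" "open N" "chart_inv c' y \<in> N" "N \<subseteq> chart_dom c" "smooth_on (cset c N) (F c)"
    using assms(1) by blast
  have "smooth_on (cset c' N) (F c')" by (rule tr[OF c(1) c' c(2,4,5)])
  then show "\<exists>N. open N \<and> y \<in> N \<and> smooth_on N (F c')"
    using cset_open[OF c' c(2)] c(3) y by (intro exI[of _ "cset c' N"]) (auto simp: cset_def)
qed

lemma smooth_on_tr_compose:
  assumes "c \<in> A" "c' \<in> A" "open N" "N \<subseteq> chart_dom c" "smooth_on (cset c N) h"
  shows "smooth_on (cset c' N) (\<lambda>y. h (tr c' c y))"
  by (rule smooth_on_compose[OF cset_open cset_open _ assms(5) smooth_on_subset[OF tr_smooth]])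
     (use assms chart_props in \<open>auto simp: cset_def\<close>)

lemma smooth_functionsI:
  assumes "\<And>x. \<exists>c\<in>A. \<exists>N. open N \<and> x \<in> N \<and> N \<subseteq> chart_dom c \<and> smooth_on (cset c N) (\<lambda>y. f (chart_inv c y))"
  shows "f \<in> smooth_functions A"
proof -
  have "smooth_on (chart_img c') (\<lambda>y. f (chart_inv c' y))" if "c' \<in> A" for c'
  proof (rule smooth_transfer[where F = "\<lambda>c y. f (chart_inv c y)", OF assms _ that])
    fix c c' N assume *: "c \<in> A" "c' \<in> A" "open N" "N \<subseteq> chart_dom c" "smooth_on (cset c N) (\<lambda>y. f (chart_inv c y))"
    have "f (chart_inv c (tr c' c y)) = f (chart_inv c' y)" if "y \<in> cset c' N" for y
      using that * chart_props by (auto simp: cset_def)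
    with smooth_on_tr_compose[OF *] show "smooth_on (cset c' N) (\<lambda>y. f (chart_inv c' y))"
      by (rule smooth_on_cong[OF cset_open[OF *(2,3)], rotated])
  qed
  then show ?thesis by (simp add: smooth_functions_def o_def)
qed

lemma smooth_functions_iff: "f \<in> smooth_functions A \<longleftrightarrow> (\<forall>c\<in>A. smooth_on (chart_img c) (\<lambda>y. f (chart_inv c y)))"
  by (simp add: smooth_functions_def o_def)

lemma smooth_functions_add: "f \<in> smooth_functions A ==> g \<in> smooth_functions A ==> (\<lambda>x. f x + g x) \<in> smooth_functions A"
  unfolding smooth_functions_iff using smooth_on_add[OF chart_props(2)] by blast

lemma smooth_functions_minus: "f \<in> smooth_functions A ==> g \<in> smooth_functions A ==> (\<lambda>x. f x - g x) \<in> smooth_functions A"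
  unfolding smooth_functions_iff using smooth_on_diff[OF chart_props(2)] by blast

lemma smooth_functions_mult: "f \<in> smooth_functions A ==> g \<in> smooth_functions A ==> (\<lambda>x. f x * g x) \<in> smooth_functions A"
  unfolding smooth_functions_iff using smooth_on_mult[OF chart_props(2)] by blast

lemma smooth_functions_const: "(\<lambda>x. r) \<in> smooth_functions A"
  by (simp add: smooth_functions_iff)

lemma smooth_functions_supported:
  assumes c: "c \<in> A" and K: "compact K" "K \<subseteq> chart_dom c" "\<And>x. x \<notin> K ==> f x = 0"
    and s: "smooth_on (chart_img c) (\<lambda>y. f (chart_inv c y))"
  shows "f \<in> smooth_functions A"
proof (rule smooth_functionsI)
  fix x
  show "\<exists>b\<in>A. \<exists>N. open N \<and> x \<in> N \<and> N \<subseteq> chart_dom b \<and> smooth_on (cset b N) (\<lambda>y. f (chart_inv b y))"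
  proof (cases "x \<in> chart_dom c")
    case True
    then show ?thesis using chart_props(1)[OF c] smooth_on_subset[OF s cset_subset]
      by (intro bexI[OF _ c] exI[of _ "chart_dom c"]) blast
  next
    case False
    let ?b = "at_chart x" and ?N = "chart_dom (at_chart x) - K"
    have N: "open ?N" "x \<in> ?N" using False K chart_at chart_props(1)[OF chart_at(1)] by (auto intro: open_Diff compact_imp_closed)
    have "smooth_on (cset ?b ?N) (\<lambda>y. f (chart_inv ?b y))"
      by (rule smooth_on_cong[OF cset_open[OF chart_at(1) N(1)] _ smooth_on_const[of _ 0]]) (simp add: cset_def K)
    then show ?thesis using N by (intro bexI[OF _ chart_at(1)[of x]] exI[of _ ?N]) blast
  qed
qed

lemma lie_function_chart:
  assumes f: "f \<in> smooth_functions A" and c: "c \<in> A" "y \<in> chart_img c"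
  shows "lie_function A X f (chart_inv c y) = fd (\<lambda>y. f (chart_inv c y)) y (vf_in_chart A c X y)"
proof -
  let ?x = "chart_inv c y" let ?b = "at_chart ?x"
  have b: "?b \<in> A" "?x \<in> chart_dom ?b" using chart_at by auto
  let ?y = "chart_map ?b ?x" and ?S = "cset ?b (chart_dom c)"
  have S: "open ?S" "?y \<in> ?S" using b c by (auto intro!: cset_open cset_cm chart_props)
  have 1: "fd (\<lambda>z. f (chart_inv ?b z)) ?y v =
      fd (\<lambda>z. f (chart_inv c (tr ?b c z))) ?y v" for v
    by (rule arg_cong[where f = "\<lambda>h. h v"], rule fd_cong[OF S])
       (use b c in \<open>auto simp: cset_def chart_props\<close>)
  have 2: "fd (\<lambda>z. f (chart_inv c (tr ?b c z))) ?y v =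
      fd (\<lambda>z. f (chart_inv c z)) y (TT ?b c ?y v)" for v
    using fd_compose[OF S(1) smooth_functionsD[OF f c(1)] tr_smooth[OF b(1) c(1)] S(2), of v] b c
    by (auto simp: TT_def chart_props cset_def)
  show ?thesis
    using 1 2 by (simp add: lie_function_def Let_def o_def vf_in_chart_def TT_def)
qed

subsection \<open>Vector fields\<close>

lemma vf_in_chart_eq: "vf_in_chart A c X y = TT (at_chart (chart_inv c y)) c (chart_map (at_chart (chart_inv c y)) (chart_inv c y)) (X (chart_inv c y))"
  by (simp add: vf_in_chart_def Let_def TT_def o_def)

lemma vf_in_chart_tr:
  assumes "c \<in> A" "c' \<in> A" "y \<in> cset c (chart_dom c')"
  shows "vf_in_chart A c' X (tr c c' y) = TT c c' y (vf_in_chart A c X y)"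
proof -
  let ?x = "chart_inv c y" let ?b = "at_chart ?x"
  have b: "?b \<in> A" "?x \<in> chart_dom ?b" using chart_at by auto
  have "tr ?b c (chart_map ?b ?x) = y" using assms b by (simp add: cset_def chart_props)
  moreover have "chart_map ?b ?x \<in> cset ?b (chart_dom c)" "chart_map ?b ?x \<in> cset ?b (chart_dom c')"
    using assms b by (auto intro!: cset_cm simp: cset_def chart_props)
  ultimately show ?thesis
    using TT_chain[OF b(1) assms(1,2), of "chart_map ?b ?x"] ci_tr[OF assms(2,3)] by (simp add: vf_in_chart_eq)
qed

lemma vector_fieldsD: "X \<in> vector_fields A ==> c \<in> A ==> smooth_on (chart_img c) (vf_in_chart A c X)"
  by (simp add: vector_fields_def)

lemma vector_fieldsI:
  assumes "\<And>x. \<exists>c\<in>A. \<exists>N. open N \<and> x \<in> N \<and> N \<subseteq> chart_dom c \<and> smooth_on (cset c N) (vf_in_chart A c X)"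
  shows "X \<in> vector_fields A"
proof -
  have "smooth_on (chart_img c') (vf_in_chart A c' X)" if "c' \<in> A" for c'
  proof (rule smooth_transfer[where F = "\<lambda>c. vf_in_chart A c X", OF assms _ that])
    fix c c' N assume *: "c \<in> A" "c' \<in> A" "open N" "N \<subseteq> chart_dom c" "smooth_on (cset c N) (vf_in_chart A c X)"
    have S: "open (cset c' N)" using * cset_open by blast
    have sub: "cset c' N \<subseteq> cset c' (chart_dom c)" using *(4) by (auto simp: cset_def)
    have eq: "vf_in_chart A c' X y = (\<Sum>b\<in>Basis. (vf_in_chart A c X (tr c' c y) \<bullet> b) *\<^sub>R TT c c' (tr c' c y) b)"
      if y: "y \<in> cset c' N" for y
    proof -
      have y': "y \<in> cset c' (chart_dom c)" using sub y by auto
      have z: "tr c' c y \<in> cset c (chart_dom c')" by (rule tr_in[OF *(2,1) _ y']) (use y * in \<open>auto simp: cset_def chart_props\<close>)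
      have "tr c c' (tr c' c y) = y" using tr_tr[OF *(2,1) y'] y' * by (simp add: cset_def chart_props)
      then show ?thesis
        using vf_in_chart_tr[OF *(1,2) z, of X] fd_basis_sum[OF TT_linear[OF *(1,2) z]] by metis
    qed
    have "smooth_on (cset c' N) (\<lambda>y. \<Sum>b\<in>Basis. (vf_in_chart A c X (tr c' c y) \<bullet> b) *\<^sub>R TT c c' (tr c' c y) b)"
    proof -
      have TTs: "smooth_on (cset c' N) (\<lambda>y. TT c c' (tr c' c y) b)" for b
      proof (rule smooth_on_compose[OF S cset_open[OF *(1) chart_props(1)[OF *(2)]] _ TT_smooth[OF *(1,2)] smooth_on_subset[OF tr_smooth[OF *(2,1)] sub]])
        fix y assume "y \<in> cset c' N"
        then show "tr c' c y \<in> cset c (chart_dom c')" using *(1,2,4) by (auto simp: cset_def chart_props)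
      qed
      show ?thesis
        by (intro smooth_on_sum smooth_on_scaleR smooth_on_inner S smooth_on_const TTs smooth_on_tr_compose[OF *])
    qed
    from smooth_on_cong[OF S eq[symmetric] this] show "smooth_on (cset c' N) (vf_in_chart A c' X)" .
  qed
  then show ?thesis by (simp add: vector_fields_def)
qed

text \<open>Components in the chart \<open>c\<close> are converted to those in
  \<open>at_chart x\<close>, in which vector fields are stored.\<close>

definition mkfield :: "('a, 'e) chart => ('a => 'e) => 'a => 'e" where
  "mkfield c v x = (if x \<in> chart_dom c then TT c (at_chart x) (chart_map c x) (v x) else 0)"

lemma vf_zero: "X (chart_inv c y) = 0 ==> c \<in> A ==> y \<in> chart_img c ==> vf_in_chart A c X y = 0"
  unfolding vf_in_chart_eq by (auto intro!: linear_0 TT_linear cset_cm chart_at simp: chart_props)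

lemma vf_mkfield: "c \<in> A ==> y \<in> chart_img c ==> vf_in_chart A c (mkfield c v) y = v (chart_inv c y)"
proof -
  assume c: "c \<in> A" "y \<in> chart_img c"
  let ?b = "at_chart (chart_inv c y)"
  have "y \<in> cset c (chart_dom ?b)" using c chart_at by (simp add: cset_def)
  from TT_inverse[OF c(1) chart_at(1) this] show ?thesis
    using c by (simp add: vf_in_chart_eq mkfield_def chart_props)
qed

lemma mkfield_vector_field:
  assumes c: "c \<in> A" and K: "compact K" "K \<subseteq> chart_dom c" "\<And>x. x \<notin> K ==> v x = 0"
    and s: "smooth_on (chart_img c) (\<lambda>y. v (chart_inv c y))"
  shows "mkfield c v \<in> vector_fields A"
proof (rule vector_fieldsI)
  fix x
  show "\<exists>c'\<in>A. \<exists>N. open N \<and> x \<in> N \<and> N \<subseteq> chart_dom c' \<and> smooth_on (cset c' N) (vf_in_chart A c' (mkfield c v))"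
  proof (cases "x \<in> chart_dom c")
    case True
    have "smooth_on (chart_img c) (vf_in_chart A c (mkfield c v))"
      by (rule smooth_on_cong[OF chart_props(2)[OF c] _ s]) (simp add: vf_mkfield[OF c])
    then show ?thesis using True c chart_props(1)[OF c]
      by (intro bexI[of _ c] exI[of _ "chart_dom c"]) (auto intro: smooth_on_subset[OF _ cset_subset])
  next
    case False
    let ?b = "at_chart x" and ?N = "chart_dom (at_chart x) - K"
    have N: "open ?N" "x \<in> ?N" using False K chart_at chart_props(1)[OF chart_at(1)] by (auto intro: open_Diff compact_imp_closed)
    have z: "0 = vf_in_chart A ?b (mkfield c v) y" if "y \<in> cset ?b ?N" for y
    proof (rule vf_zero[OF _ chart_at(1), symmetric])
      let ?z = "chart_inv ?b y"
      have "v ?z = 0" using that K(3) by (simp add: cset_def)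
      moreover have "linear (TT c (at_chart ?z) (chart_map c ?z))" if "?z \<in> chart_dom c"
        using that c chart_at by (intro TT_linear cset_cm) auto
      ultimately show "mkfield c v ?z = 0" by (simp add: mkfield_def linear_0)
    qed (use that in \<open>auto simp: cset_def\<close>)
    have "smooth_on (cset ?b ?N) (vf_in_chart A ?b (mkfield c v))"
      by (rule smooth_on_cong[OF cset_open[OF chart_at(1) N(1)] z smooth_on_const])
    then show ?thesis using N chart_at(1) by (intro bexI[of _ ?b] exI[of _ ?N] conjI) (simp_all add: Diff_subset)
  qed
qed

end

text \<open>Multiplicativity of the determinant, from the uniqueness of alternating forms.\<close>

lemma vol_map:
  fixes L :: "'e::euclidean_space => 'e"
  assumes "zero_or_top p TYPE('e)" "linear L"
  shows "vol p (map L vs) = vol p vs * vol p (map L (frame p))"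
  using alternating_unique[OF assms(1) alternating_map[OF alternating_vol assms(2)], of vs] .

section \<open>Forms in coordinates\<close>

locale mfdp = mfd A for A :: "('a::{second_countable_topology, t2_space}, 'e::euclidean_space) chart set" +
  fixes p :: nat
  assumes p: "zero_or_top p TYPE('e)"
begin

text \<open>A form of degree zero or of top degree has only this component in a chart.\<close>

definition co :: "('a, 'e) chart => ('a, 'e) form => 'e => real" where
  "co c \<omega> y = form_in_chart A c \<omega> y (frame p)"

text \<open>The Jacobian determinant of the transition map in top degree, and 1 in degree 0.\<close>

definition J :: "('a, 'e) chart => ('a, 'e) chart => 'e => real" where
  "J c c' y = vol p (map (TT c c' y) (frame p))"

lemma form_in_chart_eq: "form_in_chart A c \<omega> y vs = \<omega> (chart_inv c y) (map (TT c (at_chart (chart_inv c y)) y) vs)"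
  by (simp add: form_in_chart_def Let_def TT_def o_def)

lemma form_tr:
  assumes "c \<in> A" "c' \<in> A" "y \<in> cset c (chart_dom c')"
  shows "form_in_chart A c \<omega> y vs = form_in_chart A c' \<omega> (tr c c' y) (map (TT c c' y) vs)"
proof -
  have "y \<in> cset c (chart_dom (at_chart (chart_inv c y)))" using assms chart_at by (simp add: cset_def)
  from TT_chain[OF assms(1,2) chart_at(1) assms(3) this]
  have "map (TT c (at_chart (chart_inv c y)) y) vs = map (TT c' (at_chart (chart_inv c y)) (tr c c' y)) (map (TT c c' y) vs)"
    by (simp only: map_map o_def cong: map_cong)
  then show ?thesis by (simp only: form_in_chart_eq ci_tr[OF assms(2,3)])
qed

lemma form_alternating:
  assumes "alternating_multilinear p (\<omega> (chart_inv c y))" "c \<in> A" "y \<in> chart_img c"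
  shows "alternating_multilinear p (form_in_chart A c \<omega> y)"
proof -
  have "y \<in> cset c (chart_dom (at_chart (chart_inv c y)))" using assms chart_at by (simp add: cset_def)
  from alternating_map[OF assms(1) TT_linear[OF assms(2) chart_at(1) this]] show ?thesis
    by (simp add: form_in_chart_eq[abs_def])
qed

lemma form_vol:
  assumes "alternating_multilinear p (\<omega> (chart_inv c y))" "c \<in> A" "y \<in> chart_img c"
  shows "form_in_chart A c \<omega> y vs = vol p vs * co c \<omega> y"
  using alternating_unique[OF p form_alternating[of \<omega> c y, OF assms], of vs] by (simp add: co_def)

lemma co_tr:
  assumes "alternating_multilinear p (\<omega> (chart_inv c y))" "c \<in> A" "c' \<in> A" "y \<in> cset c (chart_dom c')"
  shows "co c \<omega> y = J c c' y * co c' \<omega> (tr c c' y)"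
proof -
  have "tr c c' y \<in> chart_img c'" using assms by (simp add: cset_def)
  moreover have "alternating_multilinear p (\<omega> (chart_inv c' (tr c c' y)))" using assms by (simp only: ci_tr)
  ultimately have "form_in_chart A c' \<omega> (tr c c' y) (map (TT c c' y) (frame p)) = J c c' y * co c' \<omega> (tr c c' y)"
    using form_vol[of \<omega> c' "tr c c' y"] assms(3) by (simp only: J_def)
  then show ?thesis by (simp only: co_def[of c] form_tr[OF assms(2-4)])
qed

lemma J_inverse:
  assumes "c \<in> A" "c' \<in> A" "y \<in> cset c (chart_dom c')"
  shows "J c c' y * J c' c (tr c c' y) = 1"
proof -
  have y': "tr c c' y \<in> cset c' (chart_dom c)" using assms by (auto simp: cset_def chart_props)
  have "map (TT c' c (tr c c' y)) (map (TT c c' y) (frame p)) = frame p"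
    by (simp add: TT_inverse[OF assms] o_def)
  then show ?thesis
    using vol_map[OF p TT_linear[OF assms(2,1) y'], of "map (TT c c' y) (frame p)"] vol_frame[OF p]
    by (simp add: J_def)
qed

lemma J_smooth:
  assumes "c \<in> A" "c' \<in> A"
  shows "smooth_on (cset c (chart_dom c')) (J c c')"
proof -
  have "smooth_on (cset c (chart_dom c')) (\<lambda>y. vol p (map (\<lambda>u. u y) (map (\<lambda>v y. TT c c' y v) (frame p))))"
    using assms frame(1)[OF p] by (intro smooth_on_vol) (auto intro!: TT_smooth cset_open chart_props)
  then show ?thesis by (simp add: J_def[abs_def] o_def)
qed

lemma J_self: "c \<in> A ==> y \<in> chart_img c ==> J c c y = 1"
  by (simp add: J_def TT_id vol_frame[OF p])

lemma formsD:
  assumes "\<omega> \<in> forms A p"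
  shows "alternating_multilinear p (\<omega> x)" "c \<in> A ==> smooth_on (chart_img c) (co c \<omega>)"
  using assms unfolding forms_def co_def[abs_def] by blast+

lemma co_tr': "\<omega> \<in> forms A p ==> c \<in> A ==> c' \<in> A ==> y \<in> cset c (chart_dom c') ==>
    co c \<omega> y = J c c' y * co c' \<omega> (tr c c' y)"
  by (rule co_tr[OF formsD(1)])

lemma formsI:
  assumes alt: "\<And>x. alternating_multilinear p (\<omega> x)"
    and "\<And>x. \<exists>c\<in>A. \<exists>N. open N \<and> x \<in> N \<and> N \<subseteq> chart_dom c \<and> smooth_on (cset c N) (co c \<omega>)"
  shows "\<omega> \<in> forms A p"
proof -
  have s: "smooth_on (chart_img c') (co c' \<omega>)" if "c' \<in> A" for c'
  proof (rule smooth_transfer[where F = "\<lambda>c. co c \<omega>", OF assms(2) _ that])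
    fix c c' N assume *: "c \<in> A" "c' \<in> A" "open N" "N \<subseteq> chart_dom c" "smooth_on (cset c N) (co c \<omega>)"
    have sub: "cset c' N \<subseteq> cset c' (chart_dom c)" using *(4) by (auto simp: cset_def)
    have "smooth_on (cset c' N) (\<lambda>y. J c' c y * co c \<omega> (tr c' c y))"
      by (intro smooth_on_mult cset_open * smooth_on_subset[OF J_smooth[OF *(2,1)] sub] smooth_on_tr_compose[OF *])
    moreover have "J c' c y * co c \<omega> (tr c' c y) = co c' \<omega> y" if "y \<in> cset c' N" for y
      using co_tr[OF alt *(2,1), of y] that sub by auto
    ultimately show "smooth_on (cset c' N) (co c' \<omega>)"
      by (rule smooth_on_cong[OF cset_open[OF *(2,3)], rotated])
  qed
  have "smooth_on (chart_img c) (\<lambda>y. form_in_chart A c \<omega> y vs)" if c: "c \<in> A" for c vs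
  proof (rule smooth_on_cong[OF chart_props(2)[OF c]])
    show "smooth_on (chart_img c) (\<lambda>y. vol p vs * co c \<omega> y)"
      using c by (intro smooth_on_mult s chart_props) auto
    show "vol p vs * co c \<omega> y = form_in_chart A c \<omega> y vs" if "y \<in> chart_img c" for y
      using form_vol[OF alt c that] by simp
  qed
  then show ?thesis using alt unfolding forms_def by blast
qed

text \<open>In top degree \<open>g dy_1 ... dy_n\<close> for the coordinates of the chart
  \<open>c\<close>, in degree 0 the function \<open>g\<close>, extended by zero in either
  case.\<close>

definition mkform :: "('a, 'e) chart => ('a => real) => ('a, 'e) form" where
  "mkform c g x vs = (if x \<in> chart_dom c then g x * vol p (map (TT (at_chart x) c (chart_map (at_chart x) x)) vs) else 0)"

lemma alternating_zero: "alternating_multilinear p (\<lambda>vs. 0)"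
  by (auto simp: alternating_multilinear_def linear_zero)

lemma alternating_mkform: "c \<in> A ==> alternating_multilinear p (mkform c g x)"
proof (cases "x \<in> chart_dom c")
  case True
  assume c: "c \<in> A"
  have "chart_map (at_chart x) x \<in> cset (at_chart x) (chart_dom c)" using chart_at True by (intro cset_cm)
  from alternating_mult[OF alternating_map[OF alternating_vol TT_linear[OF chart_at(1) c this]], where c = "g x"] True
  show ?thesis by (simp add: mkform_def[abs_def])
qed (simp add: mkform_def[abs_def] alternating_zero)

lemma co_mkform:
  assumes "c \<in> A" "c' \<in> A" "y \<in> chart_img c'"
  shows "co c' (mkform c g) y = (if chart_inv c' y \<in> chart_dom c then g (chart_inv c' y) * J c' c y else 0)"
proof (cases "chart_inv c' y \<in> chart_dom c")
  case True
  let ?b = "at_chart (chart_inv c' y)"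
  have y: "y \<in> cset c' (chart_dom ?b)" "y \<in> cset c' (chart_dom c)" using assms chart_at True by (auto simp: cset_def)
  have *: "map (TT c' c y) vs = map (TT ?b c (tr c' ?b y)) (map (TT c' ?b y) vs)" for vs
    using TT_chain[OF assms(2) chart_at(1) assms(1) y] by (simp only: map_map o_def cong: map_cong)
  show ?thesis using True by (simp only: co_def form_in_chart_eq mkform_def J_def if_True *[of "frame p"])
qed (simp add: co_def form_in_chart_eq mkform_def)

lemma co_mkform_self:
  assumes "c \<in> A" "y \<in> chart_img c"
  shows "co c (mkform c g) y = g (chart_inv c y)"
  using co_mkform[OF assms(1,1,2)] assms by (simp add: chart_props J_self)

lemma mkform_forms:
  assumes c: "c \<in> A" and K: "compact K" "K \<subseteq> chart_dom c" "\<And>x. x \<in> chart_dom c ==> x \<notin> K ==> g x = 0"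
    and s: "smooth_on (chart_img c) (\<lambda>y. g (chart_inv c y))"
  shows "mkform c g \<in> forms A p"
proof (rule formsI[OF alternating_mkform[OF c]])
  fix x
  show "\<exists>c'\<in>A. \<exists>N. open N \<and> x \<in> N \<and> N \<subseteq> chart_dom c' \<and> smooth_on (cset c' N) (co c' (mkform c g))"
  proof (cases "x \<in> chart_dom c")
    case True
    have "smooth_on (chart_img c) (co c (mkform c g))"
      by (rule smooth_on_cong[OF chart_props(2)[OF c] _ s]) (simp add: co_mkform_self[OF c])
    then show ?thesis using True c chart_props(1)[OF c]
      by (intro bexI[of _ c] exI[of _ "chart_dom c"]) (auto intro: smooth_on_subset[OF _ cset_subset])
  next
    case False
    let ?b = "at_chart x" and ?N = "chart_dom (at_chart x) - K"
    have N: "open ?N" "x \<in> ?N" using False K chart_at chart_props(1)[OF chart_at(1)] by (auto intro: open_Diff compact_imp_closed)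
    have z: "0 = co ?b (mkform c g) y" if "y \<in> cset ?b ?N" for y
      using that K(3) co_mkform[OF c chart_at(1), of y x g] by (auto simp: cset_def)
    have "smooth_on (cset ?b ?N) (co ?b (mkform c g))"
      by (rule smooth_on_cong[OF cset_open[OF chart_at(1) N(1)] z smooth_on_const])
    then show ?thesis using N chart_at(1) by (intro bexI[of _ ?b] exI[of _ ?N] conjI) (simp_all add: Diff_subset)
  qed
qed

lemma form_value:
  assumes "alternating_multilinear p (\<omega> x)" "c \<in> A" "x \<in> chart_dom c"
  shows "\<omega> x vs = vol p (map (TT (at_chart x) c (chart_map (at_chart x) x)) vs) * co c \<omega> (chart_map c x)"
proof -
  let ?b = "at_chart x"
  have y: "chart_map ?b x \<in> cset ?b (chart_dom c)" "chart_map ?b x \<in> chart_img ?b" "chart_inv ?b (chart_map ?b x) = x"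
    using assms chart_at by (auto intro!: cset_cm simp: chart_props)
  have y': "chart_map c x \<in> chart_img c" "chart_inv c (chart_map c x) = x" using assms by (auto simp: chart_props)
  have "\<omega> x vs = form_in_chart A ?b \<omega> (chart_map ?b x) vs"
    using y by (simp add: form_in_chart_eq TT_id[OF chart_at(1)])
  also have "\<dots> = form_in_chart A c \<omega> (chart_map c x) (map (TT ?b c (chart_map ?b x)) vs)"
    using form_tr[OF chart_at(1) assms(2) y(1)] y by simp
  also have "\<dots> = vol p (map (TT ?b c (chart_map ?b x)) vs) * co c \<omega> (chart_map c x)"
    using form_vol[of \<omega> c "chart_map c x"] assms y' by simp
  finally show ?thesis .
qed

lemma form_eqI:
  assumes "\<omega> \<in> forms A p" "\<omega>' \<in> forms A p" "c \<in> A" "x \<in> chart_dom c" "co c \<omega> (chart_map c x) = co c \<omega>' (chart_map c x)"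
  shows "\<omega> x = \<omega>' x"
  using form_value[of \<omega>, OF formsD(1)[OF assms(1)] assms(3,4)] form_value[of \<omega>', OF formsD(1)[OF assms(2)] assms(3,4)] assms(5)
  by (intro ext) simp

subsection \<open>The Lie derivative of forms\<close>

text \<open>The coordinate expression X(f) + div(X) f of the Lie derivative; in degree 0 the
  divergence term is zero.\<close>

definition lco :: "('a, 'e) chart => ('a => 'e) => ('a, 'e) form => 'e => real" where
  "lco c X \<omega> y = fd (co c \<omega>) y (vf_in_chart A c X y)
     + dvg p (fd (vf_in_chart A c X) y) * co c \<omega> y"

text \<open>In the chosen chart at \<open>x\<close> tangent vectors are their own coordinates. The
  sum over the slots of the form is a derivation, which acts on the one-dimensional space of such
  forms as a trace.\<close>

lemma lie_form_at:
  assumes \<omega>: "\<omega> \<in> forms A p" and X: "X \<in> vector_fields A"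
  shows "lie_form A X \<omega> x vs = vol p vs * lco (at_chart x) X \<omega> (chart_map (at_chart x) x)"
proof -
  let ?b = "at_chart x" let ?y = "chart_map ?b x"
  have b: "?b \<in> A" "?y \<in> chart_img ?b" "chart_inv ?b ?y = x" using chart_at by (auto simp: chart_props)
  have Xb: "vf_in_chart A ?b X ?y = X x" using b by (simp add: vf_in_chart_eq TT_id)
  have wb: "\<omega> x vs = vol p vs * co ?b \<omega> ?y" for vs
    using form_vol[OF formsD(1)[OF \<omega>] b(1,2), where vs = vs] b by (simp add: form_in_chart_eq TT_id)
  have wf: "\<omega> x (frame p) = co ?b \<omega> ?y" using wb[of "frame p"] vol_frame[OF p] by simp
  have "fd (\<lambda>z. form_in_chart A ?b \<omega> z vs) ?y = fd (\<lambda>z. vol p vs * co ?b \<omega> z) ?y"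
    by (rule fd_cong[OF chart_props(2)[OF b(1)] b(2)]) (rule form_vol[OF formsD(1)[OF \<omega>] b(1)])
  also have "\<dots> = (\<lambda>h. vol p vs * fd (co ?b \<omega>) ?y h)"
    by (intro fd_eqI has_derivative_mult_right smooth_on_has_derivative[OF formsD(2)[OF \<omega> b(1)] b(2)])
  finally have 1: "fd (\<lambda>z. form_in_chart A ?b \<omega> z vs) ?y (X x)
    = vol p vs * fd (co ?b \<omega>) ?y (X x)" by simp
  have "linear (fd (vf_in_chart A ?b X) ?y)"
    by (rule linear_fd[OF vector_fieldsD[OF X b(1)] b(2)])
  from derivation_eq[OF p formsD(1)[OF \<omega>, of x] this, where vs = vs] show ?thesis
    by (simp add: lie_form_def Let_def 1 lco_def Xb wf algebra_simps)
qed

text \<open>The product rule for a matrix applied to a vector, obtained by expanding in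
  columns.\<close>

lemma TT_apply_derivative:
  assumes c: "c \<in> A" "c' \<in> A" and S: "y \<in> cset c (chart_dom c')" and X: "smooth_on (chart_img c) X"
  shows "fd (\<lambda>z. TT c c' z (X z)) y v =
    fd (\<lambda>z. TT c c' z (X y)) y v + TT c c' y (fd X y v)"
proof -
  let ?S = "cset c (chart_dom c')"
  have o: "open ?S" using c by (intro cset_open chart_props)
  have yU: "y \<in> chart_img c" using S by (simp add: cset_def)
  have dX: "(X has_derivative fd X y) (at y)" by (rule smooth_on_has_derivative[OF X yU])
  have dT: "((\<lambda>z. TT c c' z b) has_derivative fd (\<lambda>z. TT c c' z b) y) (at y)" for b
    by (rule smooth_on_has_derivative[OF TT_smooth[OF c] S])
  have ex: "TT c c' z u = (\<Sum>b\<in>Basis. (u \<bullet> b) *\<^sub>R TT c c' z b)" if "z \<in> ?S" for z u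
    by (rule fd_basis_sum[OF TT_linear[OF c that]])
  have 1: "fd (\<lambda>z. TT c c' z (X z)) y = fd (\<lambda>z. \<Sum>b\<in>Basis. (X z \<bullet> b) *\<^sub>R TT c c' z b) y"
    by (rule fd_cong[OF o S]) (rule ex)
  have 2: "fd (\<lambda>z. TT c c' z (X y)) y = fd (\<lambda>z. \<Sum>b\<in>Basis. (X y \<bullet> b) *\<^sub>R TT c c' z b) y"
    by (rule fd_cong[OF o S]) (rule ex)
  have 3: "fd (\<lambda>z. \<Sum>b\<in>Basis. (X z \<bullet> b) *\<^sub>R TT c c' z b) y =
     (\<lambda>v. \<Sum>b\<in>Basis. (X y \<bullet> b) *\<^sub>R fd (\<lambda>z. TT c c' z b) y v + (fd X y v \<bullet> b) *\<^sub>R TT c c' y b)"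
    by (intro fd_eqI has_derivative_sum has_derivative_scaleR has_derivative_inner_left dX dT)
  have 4: "fd (\<lambda>z. \<Sum>b\<in>Basis. (X y \<bullet> b) *\<^sub>R TT c c' z b) y =
     (\<lambda>v. \<Sum>b\<in>Basis. (X y \<bullet> b) *\<^sub>R fd (\<lambda>z. TT c c' z b) y v)"
    by (intro fd_eqI has_derivative_sum has_derivative_scaleR_right dT)
  show ?thesis unfolding 1 2 3 4 by (simp add: sum.distrib ex[OF S, of "fd X y v"])
qed

text \<open>Jacobi's formula enters here, as the product rule for the determinant of the transition map.\<close>

lemma lco_tr:
  assumes \<omega>: "\<omega> \<in> forms A p" and X: "X \<in> vector_fields A" and c: "c \<in> A" "c' \<in> A" and y: "y \<in> cset c (chart_dom c')"
  shows "lco c X \<omega> y = J c c' y * lco c' X \<omega> (tr c c' y)"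
proof -
  let ?S = "cset c (chart_dom c')" and ?y = "tr c c' y" and ?T = "TT c c'"
  let ?D = "\<lambda>f y. fd f y"
  let ?X = "vf_in_chart A c X" and ?X' = "vf_in_chart A c' X"
  let ?f = "frame p :: 'e list"
  have o: "open ?S" using c by (intro cset_open chart_props)
  have yU: "y \<in> chart_img c" and yU': "?y \<in> chart_img c'" using y by (auto simp: cset_def)
  have Xt: "?X' (tr c c' z) = ?T z (?X z)" if "z \<in> ?S" for z by (rule vf_in_chart_tr[OF c that])
  have lf: "length ?f = p" by (rule frame(1)[OF p])
  have lM: "linear (?D ?X y)" "linear (?D ?X' ?y)"
    by (intro linear_fd[OF vector_fieldsD[OF X]] c yU yU')+
  have "((\<lambda>z. vol p (map (\<lambda>u. u z) (map (\<lambda>v z. ?T z v) ?f))) has_derivative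
    (\<lambda>h. \<Sum>i<p. vol p ((map (\<lambda>u. u y) (map (\<lambda>v z. ?T z v) ?f))[i := (map (\<lambda>v. ?D (\<lambda>z. ?T z v) y) ?f ! i) h]))) (at y)"
    by (rule vol_has_derivative) (use lf in \<open>auto intro!: smooth_on_has_derivative[OF TT_smooth[OF c] y]\<close>)
  then have dJ: "(J c c' has_derivative (\<lambda>h. \<Sum>i<p. vol p ((map (?T y) ?f)[i := ?D (\<lambda>z. ?T z (?f ! i)) y h]))) (at y)"
    using lf by (simp add: J_def[abs_def] o_def cong: sum.cong_simp)
  \<comment> \<open>Differentiates the transformation law of the components of \<open>X\<close>.
    Symmetry of second derivatives turns the derivative of the transition differential along
    \<open>v\<close> into one along \<open>X\<close>, as it occurs in the derivative of
    \<open>J\<close>.\<close>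
  have X'D: "?D ?X' ?y (?T y v) = ?D (\<lambda>z. ?T z v) y (?X y) + ?T y (?D ?X y v)" for v
  proof -
    have "?D ?X' ?y (?T y v) = ?D (\<lambda>z. ?X' (tr c c' z)) y v"
      using fd_compose[OF o vector_fieldsD[OF X c(2)] tr_smooth[OF c] y yU', of v] by (simp add: TT_def)
    also have "\<dots> = ?D (\<lambda>z. ?T z (?X z)) y v"
      by (rule arg_cong[where f = "\<lambda>h. h v"], rule fd_cong[OF o y]) (rule Xt)
    also have "\<dots> = ?D (\<lambda>z. ?T z (?X y)) y v + ?T y (?D ?X y v)"
      by (rule TT_apply_derivative[OF c y vector_fieldsD[OF X c(1)]])
    also have "?D (\<lambda>z. ?T z (?X y)) y v = ?D (\<lambda>z. ?T z v) y (?X y)"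
      unfolding TT_def by (rule fd_commute_vector[OF o y tr_smooth[OF c]])
    finally show ?thesis .
  qed
  \<comment> \<open>X(J) + div(X) J = J div'(X), with the divergences taken in the two charts: the
    derivative of the determinant changes one column at a time, and so does the trace.\<close>
  have key: "?D (J c c') y (?X y) + dvg p (?D ?X y) * J c c' y = J c c' y * dvg p (?D ?X' ?y)"
  proof -
    let ?W = "map (?T y) ?f"
    have lW: "length ?W = p" using lf by simp
    have "J c c' y * dvg p (?D ?X' ?y) = (\<Sum>i<p. vol p (?W[i := ?D ?X' ?y (?W ! i)]))"
      using derivation_eq[OF p alternating_vol lM(2), of ?W] vol_frame[OF p] lW by (simp add: J_def)
    also have "\<dots> = (\<Sum>i<p. vol p (?W[i := ?D (\<lambda>z. ?T z (?f ! i)) y (?X y)]) + vol p (?W[i := ?T y (?D ?X y (?f ! i))]))"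
    proof (rule sum.cong[OF refl])
      fix i assume "i \<in> {..<p}"
      then have i: "i < p" by simp
      have "linear (\<lambda>v. vol p (?W[i := v]))" by (rule alternating_linear[OF alternating_vol lW i])
      from linear_add[OF this] show "vol p (?W[i := ?D ?X' ?y (?W ! i)]) =
        vol p (?W[i := ?D (\<lambda>z. ?T z (?f ! i)) y (?X y)]) + vol p (?W[i := ?T y (?D ?X y (?f ! i))])"
        using i lf by (simp add: X'D)
    qed
    also have "\<dots> = ?D (J c c') y (?X y) + (\<Sum>i<p. vol p (map (?T y) (?f[i := ?D ?X y (?f ! i)])))"
      using dJ by (simp add: fd_eqI sum.distrib map_update)
    also have "(\<Sum>i<p. vol p (map (?T y) (?f[i := ?D ?X y (?f ! i)]))) = dvg p (?D ?X y) * J c c' y"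
      using derivation_frame[OF p alternating_map[OF alternating_vol TT_linear[OF c y]], of "?D ?X y"] by (simp add: J_def)
    finally show ?thesis by simp
  qed
  have "?D (co c \<omega>) y = ?D (\<lambda>z. J c c' z * co c' \<omega> (tr c c' z)) y"
    by (rule fd_cong[OF o y]) (rule co_tr'[OF \<omega> c])
  also have "\<dots> = (\<lambda>h. J c c' y * ?D (\<lambda>z. co c' \<omega> (tr c c' z)) y h + ?D (J c c') y h * co c' \<omega> ?y)"
  proof (intro fd_eqI has_derivative_mult)
    show "(J c c' has_derivative ?D (J c c') y) (at y)" by (rule smooth_on_has_derivative[OF J_smooth[OF c] y])
    have "smooth_on ?S (\<lambda>z. co c' \<omega> (tr c c' z))"
      by (rule smooth_on_compose[OF o chart_props(2)[OF c(2)] _ formsD(2)[OF \<omega> c(2)] tr_smooth[OF c]]) (auto simp: cset_def)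
    then show "((\<lambda>z. co c' \<omega> (tr c c' z)) has_derivative ?D (\<lambda>z. co c' \<omega> (tr c c' z)) y) (at y)"
      by (rule smooth_on_has_derivative[OF _ y])
  qed
  finally have "?D (co c \<omega>) y (?X y) = J c c' y * ?D (co c' \<omega>) ?y (?X' ?y) + ?D (J c c') y (?X y) * co c' \<omega> ?y"
    using fd_compose[OF o formsD(2)[OF \<omega> c(2)] tr_smooth[OF c] y yU', of "?X y"]
    by (simp add: Xt[OF y] TT_def)
  then have "lco c X \<omega> y = J c c' y * ?D (co c' \<omega>) ?y (?X' ?y) + (?D (J c c') y (?X y) + dvg p (?D ?X y) * J c c' y) * co c' \<omega> ?y"
    by (simp add: lco_def co_tr'[OF \<omega> c y] algebra_simps)
  then show ?thesis unfolding key by (simp add: lco_def algebra_simps)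
qed

lemma co_lie_form:
  assumes \<omega>: "\<omega> \<in> forms A p" and X: "X \<in> vector_fields A" and c: "c \<in> A" "y \<in> chart_img c"
  shows "co c (lie_form A X \<omega>) y = lco c X \<omega> y"
proof -
  let ?b = "at_chart (chart_inv c y)"
  have y: "y \<in> cset c (chart_dom ?b)" using c chart_at by (simp add: cset_def)
  have "co c (lie_form A X \<omega>) y = J c ?b y * lco ?b X \<omega> (tr c ?b y)"
    by (simp add: co_def form_in_chart_eq lie_form_at[OF \<omega> X] J_def)
  then show ?thesis by (simp add: lco_tr[OF \<omega> X c(1) chart_at(1) y])
qed

lemma smooth_lco:
  assumes \<omega>: "\<omega> \<in> forms A p" and X: "X \<in> vector_fields A" and c: "c \<in> A"
  shows "smooth_on (chart_img c) (lco c X \<omega>)"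
  unfolding lco_def[abs_def] dvg_def
  by (intro smooth_on_add smooth_on_mult smooth_on_sum smooth_on_inner smooth_on_fd_apply smooth_on_fd
      smooth_on_const chart_props c formsD \<omega> vector_fieldsD X)

lemma lie_form_forms:
  assumes \<omega>: "\<omega> \<in> forms A p" and X: "X \<in> vector_fields A"
  shows "lie_form A X \<omega> \<in> forms A p"
proof (rule formsI)
  fix x
  show "alternating_multilinear p (lie_form A X \<omega> x)"
    using alternating_mult[OF alternating_vol, of p "lco (at_chart x) X \<omega> (chart_map (at_chart x) x)"]
    by (simp add: lie_form_at[OF \<omega> X, abs_def] mult.commute)
  let ?b = "at_chart x"
  have "smooth_on (chart_img ?b) (co ?b (lie_form A X \<omega>))"
    by (rule smooth_on_cong[OF chart_props(2)[OF chart_at(1)] _ smooth_lco[OF \<omega> X chart_at(1)]])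
       (simp add: co_lie_form[OF \<omega> X chart_at(1)])
  then show "\<exists>c\<in>A. \<exists>N. open N \<and> x \<in> N \<and> N \<subseteq> chart_dom c \<and> smooth_on (cset c N) (co c (lie_form A X \<omega>))"
    using chart_at[of x] chart_props(1)[OF chart_at(1)[of x]]
    by (intro bexI[of _ ?b] exI[of _ "chart_dom ?b"]) (auto intro: smooth_on_subset[OF _ cset_subset])
qed

end

section \<open>Differential operators on open sets\<close>

lemma smooth_on_iter_deriv: "smooth_on U f ==> smooth_on U (iter_deriv \<alpha> f)"
  by (induction \<alpha>) (auto simp: smooth_on_fd)

lemma iter_deriv_cong:
  assumes "open U"
  shows "(\<And>y. y \<in> U ==> f y = g y) ==> y \<in> U ==> iter_deriv \<alpha> f y = iter_deriv \<alpha> g y"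
proof (induction \<alpha> arbitrary: y)
  case (Cons v \<alpha>)
  have "fd (iter_deriv \<alpha> f) y = fd (iter_deriv \<alpha> g) y"
    by (rule fd_cong[OF assms Cons.prems(2)]) (rule Cons.IH[OF Cons.prems(1)])
  then show ?case by simp
qed simp

lemma fd_add:
  "smooth_on U f ==> smooth_on U g ==> y \<in> U ==>
    fd (\<lambda>y. f y + g y) y v = fd f y v + fd g y v"
  by (simp add: fd_eqI[OF has_derivative_add[OF smooth_on_has_derivative smooth_on_has_derivative]])

lemma fd_mult:
  fixes f g :: "'e::euclidean_space => real"
  shows "smooth_on U f ==> smooth_on U g ==> y \<in> U ==>
    fd (\<lambda>y. f y * g y) y v = f y * fd g y v + fd f y v * g y"
  by (simp add: fd_eqI[OF has_derivative_mult[OF smooth_on_has_derivative smooth_on_has_derivative]])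

lemma iter_deriv_add:
  assumes "open U" "smooth_on U f" "smooth_on U g"
  shows "y \<in> U ==> iter_deriv \<alpha> (\<lambda>y. f y + g y) y = iter_deriv \<alpha> f y + iter_deriv \<alpha> g y"
proof (induction \<alpha> arbitrary: y)
  case (Cons v \<alpha>)
  have "fd (iter_deriv \<alpha> (\<lambda>y. f y + g y)) y = fd (\<lambda>y. iter_deriv \<alpha> f y + iter_deriv \<alpha> g y) y"
    by (rule fd_cong[OF assms(1) Cons.prems]) (rule Cons.IH)
  then show ?case using fd_add[of U "iter_deriv \<alpha> f" "iter_deriv \<alpha> g" y v] assms Cons.prems
    by (simp add: smooth_on_iter_deriv)
qed simp

lemma fd_const [simp]: "fd (\<lambda>y. c) y v = 0"
  by (simp add: fd_eqI[OF has_derivative_const])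

lemma iter_deriv_scale:
  assumes "open U" "smooth_on U f"
  shows "y \<in> U ==> iter_deriv \<alpha> (\<lambda>y. c * f y) y = c * iter_deriv \<alpha> f y"
proof (induction \<alpha> arbitrary: y)
  case (Cons v \<alpha>)
  have "fd (iter_deriv \<alpha> (\<lambda>y. c * f y)) y = fd (\<lambda>y. c * iter_deriv \<alpha> f y) y"
    by (rule fd_cong[OF assms(1) Cons.prems]) (rule Cons.IH)
  then show ?case using fd_mult[of U "\<lambda>_. c" "iter_deriv \<alpha> f" y v] assms Cons.prems
    by (simp add: smooth_on_iter_deriv)
qed simp

lemma iter_deriv_append: "iter_deriv (\<alpha> @ \<beta>) f = iter_deriv \<alpha> (iter_deriv \<beta> f)"
  by (induction \<alpha>) auto

lemma iter_deriv_commute: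
  assumes "open U" "smooth_on U f"
  shows "y \<in> U ==> fd (iter_deriv \<alpha> f) y v = iter_deriv \<alpha> (\<lambda>z. fd f z v) y"
proof (induction \<alpha> arbitrary: y)
  case (Cons u \<alpha>)
  have "fd (iter_deriv \<alpha> (\<lambda>z. fd f z v)) y =
      fd (\<lambda>z. fd (iter_deriv \<alpha> f) z v) y"
    by (rule fd_cong[OF assms(1) Cons.prems]) (simp add: Cons.IH)
  then show ?case using fd_commute[OF assms(1) Cons.prems smooth_on_iter_deriv[OF assms(2)], of \<alpha> u v] by simp
qed simp

text \<open>The counterpart of \<open>dopl\<close> for functions given on an open set. The rule
  \<open>cong\<close> makes values on non-smooth functions and outside \<open>U\<close>
  immaterial.\<close>

inductive_set dopU :: "'e::euclidean_space set => nat => (('e => real) => 'e => real) set" for U k where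
  monom: "set \<alpha> \<subseteq> Basis ==> length \<alpha> < k ==> smooth_on U a ==> (\<lambda>f y. a y * iter_deriv \<alpha> f y) \<in> dopU U k"
| add: "P \<in> dopU U k ==> Q \<in> dopU U k ==> (\<lambda>f y. P f y + Q f y) \<in> dopU U k"
| zero: "(\<lambda>f y. 0) \<in> dopU U k"
| cong: "P \<in> dopU U k ==> (\<And>f y. smooth_on U f ==> y \<in> U ==> P f y = Q f y) ==> Q \<in> dopU U k"

lemma dopU_coeffs:
  assumes "Q \<in> dopU U k" "open U"
  shows "\<exists>a. (\<forall>\<alpha>. smooth_on U (a \<alpha>)) \<and> (\<forall>f y. smooth_on U f \<longrightarrow> y \<in> U \<longrightarrow>
    Q f y = (\<Sum>\<alpha>\<in>mi k. a \<alpha> y * iter_deriv \<alpha> f y))"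
  using assms(1)
proof induction
  case (monom \<alpha> a)
  let ?S = "mi k" and ?a = "\<lambda>\<beta>. if \<beta> = \<alpha> then a else (\<lambda>_. 0)"
  have "a y * iter_deriv \<alpha> f y = (\<Sum>\<beta>\<in>?S. ?a \<beta> y * iter_deriv \<beta> f y)" for f y
  proof -
    have "(\<Sum>\<beta>\<in>?S. ?a \<beta> y * iter_deriv \<beta> f y) = (\<Sum>\<beta>\<in>?S. if \<beta> = \<alpha> then a y * iter_deriv \<alpha> f y else 0)"
      by (rule sum.cong[OF refl]) simp
    also have "\<dots> = a y * iter_deriv \<alpha> f y" using monom by (simp only: sum.delta[OF finite_multi_indices] mem_Collect_eq simp_thms if_True)
    finally show ?thesis ..
  qed
  moreover have "smooth_on U (?a \<beta>)" for \<beta> using monom by simp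
  ultimately show ?case by (intro exI[where x = ?a] conjI allI impI)
next
  case (add P Q)
  obtain a where a: "\<forall>\<alpha>. smooth_on U (a \<alpha>)" "\<forall>f y. smooth_on U f \<longrightarrow> y \<in> U \<longrightarrow>
      P f y = (\<Sum>\<alpha>\<in>mi k. a \<alpha> y * iter_deriv \<alpha> f y)"
    by (rule exE[OF add.IH(1)], erule conjE, rule that)
  obtain b where b: "\<forall>\<alpha>. smooth_on U (b \<alpha>)" "\<forall>f y. smooth_on U f \<longrightarrow> y \<in> U \<longrightarrow>
      Q f y = (\<Sum>\<alpha>\<in>mi k. b \<alpha> y * iter_deriv \<alpha> f y)"
    by (rule exE[OF add.IH(2)], erule conjE, rule that)
  show ?case
    by (rule exI[where x = "\<lambda>\<alpha> y. a \<alpha> y + b \<alpha> y"])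
      (simp add: a(1) b(1) smooth_on_add[OF assms(2)] a(2)[rule_format] b(2)[rule_format] distrib_right sum.distrib)
next
  case zero
  show ?case by (rule exI[where x = "\<lambda>_ _. 0"]) simp
next
  case (cong P Q)
  obtain a where a: "\<forall>\<alpha>. smooth_on U (a \<alpha>)" "\<forall>f y. smooth_on U f \<longrightarrow> y \<in> U \<longrightarrow>
      P f y = (\<Sum>\<alpha>\<in>mi k. a \<alpha> y * iter_deriv \<alpha> f y)"
    by (rule exE[OF cong.IH], erule conjE, rule that)
  have "Q f y = (\<Sum>\<alpha>\<in>mi k. a \<alpha> y * iter_deriv \<alpha> f y)"
    if "smooth_on U f" "y \<in> U" for f y
    using a(2) cong.hyps(2)[OF that] that by simp
  then show ?case by (intro exI[where x = a] conjI allI impI a(1)[rule_format])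
qed

lemma dopU_sum: "(\<And>i. i \<in> I ==> Q i \<in> dopU U k) ==> (\<lambda>f y. \<Sum>i\<in>I. Q i f y) \<in> dopU U k"
  by (induction I rule: infinite_finite_induct) (auto intro: dopU.zero dopU.add)

lemma dopU_smooth: "Q \<in> dopU U k ==> open U ==> smooth_on U f ==> smooth_on U (Q f)"
proof (induction rule: dopU.induct)
  case (cong P Q)
  then show ?case using smooth_on_cong[of U "P f" "Q f"] by blast
qed (auto intro!: smooth_on_mult smooth_on_iter_deriv smooth_on_add)

lemma dopU_0: "Q \<in> dopU U 0 ==> smooth_on U f ==> y \<in> U ==> Q f y = 0"
  by (induction rule: dopU.induct) auto

lemma dopU_local:
  "Q \<in> dopU U k ==> smooth_on U f ==> smooth_on U g ==> open N ==> (\<And>y. y \<in> N ==> f y = g y) ==> y \<in> N ==> y \<in> U ==> Q f y = Q g y"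
proof (induction rule: dopU.induct)
  case (monom \<alpha> a)
  have "iter_deriv \<alpha> f y = iter_deriv \<alpha> g y" by (rule iter_deriv_cong[of N]) (use monom in auto)
  then show ?case by simp
qed auto

lemma dopU_plus: "Q \<in> dopU U k ==> open U ==> smooth_on U f ==> smooth_on U g ==> y \<in> U ==>
    Q (\<lambda>y. f y + g y) y = Q f y + Q g y"
proof (induction rule: dopU.induct)
  case (cong P Q)
  then show ?case using smooth_on_add[of U f g] by metis
qed (auto simp: iter_deriv_add algebra_simps)

lemma dopU_scale: "Q \<in> dopU U k ==> open U ==> smooth_on U f ==> y \<in> U ==>
    Q (\<lambda>y. r * f y) y = r * Q f y"
proof (induction rule: dopU.induct)
  case (cong P Q)
  then show ?case using smooth_on_mult[of U "\<lambda>_. r" f] by (metis smooth_on_const)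
qed (auto simp: iter_deriv_scale algebra_simps)

lemma dopU_mono: "Q \<in> dopU U k ==> k \<le> l ==> Q \<in> dopU U l"
proof (induction rule: dopU.induct)
  case (cong P Q)
  then show ?case using dopU.cong by blast
qed (auto intro: dopU.monom dopU.add dopU.zero)

lemma dopU_mult: "Q \<in> dopU U k ==> open U ==> smooth_on U h ==> (\<lambda>f y. h y * Q f y) \<in> dopU U k"
proof (induction rule: dopU.induct)
  case (monom \<alpha> a)
  then show ?case using dopU.monom[of \<alpha> k U "\<lambda>y. h y * a y"] by (simp add: mult.assoc smooth_on_mult)
next
  case (add P Q)
  then show ?case using dopU.add[of "\<lambda>f y. h y * P f y" U k "\<lambda>f y. h y * Q f y"] by (simp add: algebra_simps)
next
  case (cong P Q)
  show ?case by (rule dopU.cong[OF cong.IH]) (use cong in auto)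
qed (simp add: dopU.zero)

lemma dopU_minus: "P \<in> dopU U k ==> Q \<in> dopU U k ==> open U ==> (\<lambda>f y. P f y - Q f y) \<in> dopU U k"
  using dopU.add[of P U k "\<lambda>f y. -1 * Q f y"] dopU_mult[of Q U k "\<lambda>_. -1"] by simp

lemma dopU_dv_left: "Q \<in> dopU U k ==> open U ==> v \<in> Basis ==> (\<lambda>f y. fd (Q f) y v) \<in> dopU U (Suc k)"
proof (induction rule: dopU.induct)
  case (monom \<alpha> a)
  have 1: "(\<lambda>f y. a y * iter_deriv (v # \<alpha>) f y) \<in> dopU U (Suc k)"
    by (rule dopU.monom) (use monom in auto)
  have 2: "(\<lambda>f y. fd a y v * iter_deriv \<alpha> f y) \<in> dopU U (Suc k)"
    by (rule dopU.monom) (use monom in \<open>auto intro: smooth_on_fd\<close>)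
  show ?case
    by (rule dopU.cong[OF dopU.add[OF 1 2]])
      (use monom in \<open>simp add: fd_mult[of U a] smooth_on_iter_deriv\<close>)
next
  case (add P Q)
  show ?case
    by (rule dopU.cong[OF dopU.add[OF add.IH]])
      (use add in \<open>auto simp: fd_add[of U] dopU_smooth\<close>)
next
  case zero
  then show ?case by (simp add: dopU.zero)
next
  case (cong P Q)
  show ?case
  proof (rule dopU.cong[OF cong.IH])
    fix f :: "'a => real" and y assume "smooth_on U f" "y \<in> U"
    then have "fd (P f) y = fd (Q f) y"
      using cong by (intro fd_cong[of U]) auto
    then show "fd (P f) y v = fd (Q f) y v" by simp
  qed (use cong in auto)
qed

lemma dopU_dv_right: "Q \<in> dopU U k ==> open U ==> v \<in> Basis ==> (\<lambda>f. Q (\<lambda>y. fd f y v)) \<in> dopU U (Suc k)"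
proof (induction rule: dopU.induct)
  case (monom \<alpha> a)
  have "(\<lambda>f y. a y * iter_deriv (\<alpha> @ [v]) f y) \<in> dopU U (Suc k)"
    by (rule dopU.monom) (use monom in auto)
  then show ?case by (simp add: iter_deriv_append)
next
  case (add P Q)
  then show ?case using dopU.add by fastforce
next
  case (cong P Q)
  show ?case by (rule dopU.cong[OF cong.IH]) (use cong in \<open>auto simp: smooth_on_fd\<close>)
qed (simp add: dopU.zero)

lemma iter_deriv_ad:
  "set \<alpha> \<subseteq> Basis ==> length \<alpha> < Suc k ==> open U ==> smooth_on U h ==>
    (\<lambda>f y. iter_deriv \<alpha> (\<lambda>z. h z * f z) y - h y * iter_deriv \<alpha> f y) \<in> dopU U k"
proof (induction \<alpha> arbitrary: k)
  case Nil
  then show ?case by (simp add: dopU.zero)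
next
  case (Cons v \<alpha>)
  then obtain k' where k: "k = Suc k'" by (cases k) auto
  let ?R = "\<lambda>f y. iter_deriv \<alpha> (\<lambda>z. h z * f z) y - h y * iter_deriv \<alpha> f y"
  have R: "?R \<in> dopU U k'" using Cons k by (intro Cons.IH) auto
  have 1: "(\<lambda>f y. fd (?R f) y v) \<in> dopU U k"
    using dopU_dv_left[OF R] Cons k by simp
  have 2: "(\<lambda>f y. fd h y v * iter_deriv \<alpha> f y) \<in> dopU U k"
    by (rule dopU.monom) (use Cons in \<open>auto intro: smooth_on_fd\<close>)
  show ?case
  proof (rule dopU.cong[OF dopU.add[OF 1 2]])
    fix f :: "'a => real" and y assume f: "smooth_on U f" "y \<in> U"
    let ?u = "iter_deriv \<alpha> (\<lambda>z. h z * f z)" and ?w = "iter_deriv \<alpha> f"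
    have s: "smooth_on U ?u" "smooth_on U ?w" "smooth_on U (\<lambda>z. h z * ?w z)" "smooth_on U (?R f)"
      using f Cons.prems dopU_smooth[OF R] by (auto intro!: smooth_on_iter_deriv smooth_on_mult)
    have "fd ?u y v = fd (\<lambda>z. ?R f z + h z * ?w z) y v" by simp
    also have "\<dots> = fd (?R f) y v + fd (\<lambda>z. h z * ?w z) y v"
      by (rule fd_add[OF s(4,3) f(2)])
    also have "fd (\<lambda>z. h z * ?w z) y v = h y * fd ?w y v + fd h y v * ?w y"
      by (rule fd_mult[OF Cons.prems(4) s(2) f(2)])
    finally show "fd (?R f) y v + fd h y v * iter_deriv \<alpha> f y =
      iter_deriv (v # \<alpha>) (\<lambda>z. h z * f z) y - h y * iter_deriv (v # \<alpha>) f y" by simp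
  qed
qed

lemma dopU_ad: "Q \<in> dopU U (Suc k) ==> open U ==> smooth_on U h ==>
    (\<lambda>f y. Q (\<lambda>z. h z * f z) y - h y * Q f y) \<in> dopU U k"
proof (induction rule: dopU.induct)
  case (monom \<alpha> a)
  show ?case
    by (rule dopU.cong[OF dopU_mult[OF iter_deriv_ad[OF monom(1,2) monom(4,5)] monom(4,3)]]) (simp add: algebra_simps)
next
  case (add P Q)
  show ?case
    by (rule dopU.cong[OF dopU.add[OF add.IH]]) (use add in \<open>auto simp: algebra_simps\<close>)
next
  case zero
  then show ?case by (simp add: dopU.zero)
next
  case (cong P Q)
  show ?case
    by (rule dopU.cong[OF cong.IH]) (use cong in \<open>auto simp: smooth_on_mult\<close>)
qed

lemma dopU_mult_right: "Q \<in> dopU U k ==> open U ==> smooth_on U h ==> (\<lambda>f. Q (\<lambda>z. h z * f z)) \<in> dopU U k"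
  using dopU.add[OF dopU_ad[OF dopU_mono[of Q U k "Suc k"]] dopU_mult[of Q U k h], of h] by simp

lemma dopU_commutator_dv: "Q \<in> dopU U k ==> open U ==> v \<in> Basis ==>
    (\<lambda>f y. fd (Q f) y v - Q (\<lambda>y. fd f y v) y) \<in> dopU U k"
proof (induction rule: dopU.induct)
  case (monom \<alpha> a)
  have "(\<lambda>f y. fd a y v * iter_deriv \<alpha> f y) \<in> dopU U k"
    by (rule dopU.monom) (use monom in \<open>auto intro: smooth_on_fd\<close>)
  then show ?case
    by (rule dopU.cong)
      (use monom in \<open>simp add: fd_mult[of U a] smooth_on_iter_deriv iter_deriv_commute[of U]\<close>)
next
  case (add P Q)
  show ?case
    by (rule dopU.cong[OF dopU.add[OF add.IH]])
      (use add in \<open>auto simp: fd_add[of U] dopU_smooth\<close>)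
next
  case zero
  then show ?case by (simp add: dopU.zero)
next
  case (cong P Q)
  show ?case
  proof (rule dopU.cong[OF cong.IH])
    fix f :: "'a => real" and y assume "smooth_on U f" "y \<in> U"
    moreover then have "fd (P f) y = fd (Q f) y"
      using cong by (intro fd_cong[of U]) auto
    ultimately show "fd (P f) y v - P (\<lambda>y. fd f y v) y
        = fd (Q f) y v - Q (\<lambda>y. fd f y v) y"
      using cong by (simp add: smooth_on_fd)
  qed (use cong in auto)
qed

lemma fd_apply_sum:
  assumes "smooth_on U f" "y \<in> U"
  shows "fd f y v = (\<Sum>b\<in>Basis. (v \<bullet> b) *\<^sub>R fd f y b)"
  by (rule fd_basis_sum[OF linear_fd[OF assms]])

lemma dopU_argsum:
  "Q \<in> dopU U k ==> open U ==> (\<And>i. i \<in> I ==> smooth_on U (f i)) ==> y \<in> U ==>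
    Q (\<lambda>y. \<Sum>i\<in>I. f i y) y = (\<Sum>i\<in>I. Q (f i) y)"
proof (induction I rule: infinite_finite_induct)
  case (insert i I)
  then show ?case using dopU_plus[of Q U k "f i" "\<lambda>y. \<Sum>i\<in>I. f i y" y] by (simp add: smooth_on_sum)
next
  case (infinite I)
  then show ?case using dopU_scale[of Q U k "\<lambda>_. 0" y 0] by simp
next
  case empty
  then show ?case using dopU_scale[of Q U k "\<lambda>_. 0" y 0] by simp
qed

lemma dopU_lie:
  assumes Q: "Q \<in> dopU U k" and U: "open U" and X: "smooth_on U X" and d: "smooth_on U d"
  shows "(\<lambda>f y. fd (Q f) y (X y) - Q (\<lambda>z. fd f z (X z) + d z * f z) y) \<in> dopU U k"
proof (cases k)
  case 0
  \<comment> \<open>Index 0 admits only the zero operator; it is treated apart because the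
    commutator lemma starts from a positive index.\<close>
  show ?thesis
  proof (rule dopU.cong[OF dopU.zero])
    fix f :: "'a => real" and y assume f: "smooth_on U f" "y \<in> U"
    have "fd (Q f) y = fd (\<lambda>_. 0) y"
      by (rule fd_cong[OF U f(2)]) (use dopU_0 Q 0 f in auto)
    moreover have "Q (\<lambda>z. fd f z (X z) + d z * f z) y = 0"
      by (rule dopU_0[OF Q[unfolded 0] _ f(2)]) (intro smooth_on_add smooth_on_fd_apply smooth_on_mult U X d f)
    ultimately show "0 = fd (Q f) y (X y) - Q (\<lambda>z. fd f z (X z) + d z * f z) y"
      by simp
  qed
next
  case (Suc k')
  have Xb: "smooth_on U (\<lambda>y. X y \<bullet> b)" for b by (intro smooth_on_inner U X smooth_on_const)
  \<comment> \<open>The terms X_b [\<partial>_b, Q] and, next, [Q, X_b] \<partial>_b: grouped in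
    this way the terms of order one higher cancel.\<close>
  let ?A = "\<lambda>b f y. (X y \<bullet> b) * (fd (Q f) y b - Q (\<lambda>y. fd f y b) y)"
  let ?B = "\<lambda>b f y. Q (\<lambda>z. (X z \<bullet> b) * fd f z b) y - (X y \<bullet> b) * Q (\<lambda>y. fd f y b) y"
  have A: "?A b \<in> dopU U k" if "b \<in> Basis" for b
    by (rule dopU_mult[OF dopU_commutator_dv[OF Q U that] U Xb])
  have B: "?B b \<in> dopU U k" if "b \<in> Basis" for b
    using dopU_dv_right[OF dopU_ad[of Q U k' "\<lambda>y. X y \<bullet> b"] U that] Q U Xb Suc by simp
  have C: "(\<lambda>f. Q (\<lambda>z. d z * f z)) \<in> dopU U k" by (intro dopU_mult_right Q U d)
  have "(\<lambda>f y. (\<Sum>b\<in>Basis. ?A b f y - ?B b f y) - Q (\<lambda>z. d z * f z) y) \<in> dopU U k"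
    by (intro dopU_minus dopU_sum A B C U) auto
  then show ?thesis
  proof (rule dopU.cong)
    fix f :: "'a => real" and y assume f: "smooth_on U f" "y \<in> U"
    have s: "smooth_on U (\<lambda>z. (X z \<bullet> b) * fd f z b)" for b
      by (intro smooth_on_mult U Xb smooth_on_fd f)
    have "Q (\<lambda>z. fd f z (X z) + d z * f z) y =
        Q (\<lambda>z. (\<Sum>b\<in>Basis. (X z \<bullet> b) * fd f z b) + d z * f z) y"
    proof (rule dopU_local[OF Q _ _ U _ f(2) f(2)])
      show "fd f z (X z) + d z * f z = (\<Sum>b\<in>Basis. (X z \<bullet> b) * fd f z b) + d z * f z" if "z \<in> U" for z
        using fd_apply_sum[OF f(1) that, of "X z"] by simp
    qed (intro smooth_on_add smooth_on_fd_apply smooth_on_mult smooth_on_sum U X d f s)+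
    also have "\<dots> = (\<Sum>b\<in>Basis. Q (\<lambda>z. (X z \<bullet> b) * fd f z b) y) + Q (\<lambda>z. d z * f z) y"
      by (subst dopU_plus[OF Q U]) (auto intro!: smooth_on_sum s smooth_on_mult U d f simp: dopU_argsum[OF Q U s f(2)])
    finally show "(\<Sum>b\<in>Basis. ?A b f y - ?B b f y) - Q (\<lambda>z. d z * f z) y =
        fd (Q f) y (X y) - Q (\<lambda>z. fd f z (X z) + d z * f z) y"
      using fd_apply_sum[OF dopU_smooth[OF Q U f(1)] f(2), of "X y"]
      by (simp add: sum_subtractf algebra_simps)
  qed
qed

lemma smooth_on_extend_zero:
  assumes W: "open W" "smooth_on W h" and z: "\<And>y. y \<in> U ==> y \<notin> W ==> \<exists>N. open N \<and> y \<in> N \<and> (\<forall>z\<in>N \<inter> W. h z = 0)"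
  shows "smooth_on U (\<lambda>y. if y \<in> W then h y else (0::real))"
proof (rule smooth_on_local)
  fix y assume y: "y \<in> U"
  show "\<exists>N. open N \<and> y \<in> N \<and> smooth_on N (\<lambda>y. if y \<in> W then h y else 0)"
  proof (cases "y \<in> W")
    case True
    have "smooth_on W (\<lambda>y. if y \<in> W then h y else 0)"
      by (rule smooth_on_cong[OF W(1) _ W(2)]) simp
    then show ?thesis using W True by blast
  next
    case False
    then obtain N where N: "open N" "y \<in> N" "\<And>z. z \<in> N \<inter> W ==> h z = 0" using z y by metis
    have "smooth_on N (\<lambda>y. if y \<in> W then h y else 0)"
      by (rule smooth_on_cong[OF N(1) _ smooth_on_const[of _ 0]]) (use N(3) in auto)
    then show ?thesis using N by blast
  qed
qed

text \<open>A smooth function on the whole space that agrees with \<open>f\<close> near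
  \<open>y\<close>. Since differential operators are local, \<open>hat\<close> can evaluate them on
  functions that are smooth near \<open>y\<close> only.\<close>

definition germ :: "('e::euclidean_space => real) => 'e => 'e sfun" where
  "germ f y = (SOME g. \<exists>N. open N \<and> y \<in> N \<and> (\<forall>z\<in>N. ev g z = f z))"

definition hat :: "('e::euclidean_space sfun => 'e sfun) => ('e => real) => 'e => real" where
  "hat Q f y = ev (Q (germ f y)) y"

lemma germ_exists:
  assumes "open U" "smooth_on U f" "y \<in> U"
  shows "\<exists>N. open N \<and> y \<in> N \<and> (\<forall>z\<in>N. ev (germ f y) z = f z)"
proof -
  obtain R where R: "R > 0" "cball y R \<subseteq> U" using assms(1,3) open_contains_cball by blast
  obtain \<kappa> where k: "smooth_on UNIV \<kappa>" "\<And>z. z \<in> cball y (R/2) ==> \<kappa> z = (1::real)" "\<And>z. z \<notin> ball y R ==> \<kappa> z = 0"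
    using cutoff_exists[of "R/2" R y] R(1) by auto
  let ?h = "\<lambda>z. if z \<in> U then \<kappa> z * f z else 0"
  have "smooth_on UNIV ?h"
  proof (rule smooth_on_extend_zero[OF assms(1)])
    show "smooth_on U (\<lambda>z. \<kappa> z * f z)" by (intro smooth_on_mult assms smooth_on_subset[OF k(1)]) auto
    fix z assume "z \<notin> U"
    then have "z \<in> - cball y R" using R by auto
    then show "\<exists>N. open N \<and> z \<in> N \<and> (\<forall>z\<in>N \<inter> U. \<kappa> z * f z = 0)"
      using k(3) by (intro exI[of _ "- cball y R"]) (auto simp: open_Compl)
  qed
  then have "ev (Sfun ?h) = ?h" by (rule ev_Sfun)
  then have "\<forall>z\<in>ball y (R/2). ev (Sfun ?h) z = f z" using k(2) R by (auto simp: subset_iff)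
  then have "\<exists>g. \<exists>N. open N \<and> y \<in> N \<and> (\<forall>z\<in>N. ev g z = f z)"
    using R(1) by (intro exI[of _ "Sfun ?h"] exI[of _ "ball y (R/2)"]) auto
  from someI_ex[OF this] show ?thesis by (simp add: germ_def)
qed

lemma hat_eq:
  assumes Q: "Q \<in> dopl k" and N: "open N" "y \<in> N" "\<And>z. z \<in> N ==> ev g z = f z"
  shows "hat Q f y = ev (Q g) y"
proof -
  have "\<exists>g. \<exists>N. open N \<and> y \<in> N \<and> (\<forall>z\<in>N. ev g z = f z)" using N by blast
  from someI_ex[OF this] obtain N' where N': "open N'" "y \<in> N'" "\<forall>z\<in>N'. ev (germ f y) z = f z"
    by (auto simp: germ_def)
  have "eqon (N \<inter> N') (Q (germ f y)) (Q g)"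
    by (rule dopl_local[OF Q]) (use N N' in \<open>auto simp: eqon_def\<close>)
  then show ?thesis using N(2) N'(2) by (simp add: hat_def eqon_def)
qed

lemma hat_dopU:
  assumes Q: "Q \<in> dopl k" and U: "open U"
  shows "hat Q \<in> dopU U k"
proof -
  obtain a where a: "\<And>f. Q f = (\<Sum>\<alpha>\<in>mi k. a \<alpha> * ds \<alpha> f)"
    using dopl_coeffs[OF Q] by blast
  have "(\<lambda>f y. \<Sum>\<alpha>\<in>mi k. ev (a \<alpha>) y * iter_deriv \<alpha> f y) \<in> dopU U k"
    by (intro dopU_sum dopU.monom) auto
  then show ?thesis
  proof (rule dopU.cong)
    fix f :: "'a => real" and y assume f: "smooth_on U f" "y \<in> U"
    obtain N where N: "open N" "y \<in> N" "\<And>z. z \<in> N ==> ev (germ f y) z = f z"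
      using germ_exists[OF U f] by blast
    have "iter_deriv \<alpha> (ev (germ f y)) y = iter_deriv \<alpha> f y" for \<alpha>
      by (rule iter_deriv_cong[OF N(1) N(3) N(2)])
    then show "(\<Sum>\<alpha>\<in>mi k. ev (a \<alpha>) y * iter_deriv \<alpha> f y) = hat Q f y"
      by (simp add: hat_def a ev_ds)
  qed
qed

section \<open>Differential operators on manifolds in charts\<close>

context mfdp
begin

abbreviation "in_chart c D Q \<equiv> \<forall>\<omega>\<in>forms A p. \<forall>y\<in>chart_img c. D \<omega> (chart_inv c y) = Q (co c \<omega>) y"

lemma diff_opsD:
  assumes D: "D \<in> diff_ops A k p" and c: "c \<in> A"
  shows "\<exists>Q\<in>dopU (chart_img c) (Suc k). in_chart c D Q"
proof -
  let ?A = "{\<alpha>::'e list. set \<alpha> \<subseteq> Basis \<and> length \<alpha> \<le> k}" and ?B = "{\<beta>::'e list. set \<beta> \<subseteq> Basis \<and> length \<beta> = p}"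
  have "\<exists>a. (\<forall>\<alpha> \<beta>. smooth_on (chart_img c) (a \<alpha> \<beta>)) \<and> (\<forall>\<omega>\<in>forms A p. \<forall>y\<in>chart_img c.
     D \<omega> (chart_inv c y) = (\<Sum>\<alpha>\<in>?A. \<Sum>\<beta>\<in>?B. a \<alpha> \<beta> y * iter_deriv \<alpha> (\<lambda>z. form_in_chart A c \<omega> z \<beta>) y))"
    using D unfolding diff_ops_def mem_Collect_eq by (elim conjE) (erule bspec[OF _ c])
  then obtain a where a': "\<forall>\<alpha> \<beta>. smooth_on (chart_img c) (a \<alpha> \<beta>)" "\<forall>\<omega>\<in>forms A p. \<forall>y\<in>chart_img c.
     D \<omega> (chart_inv c y) = (\<Sum>\<alpha>\<in>?A. \<Sum>\<beta>\<in>?B. a \<alpha> \<beta> y * iter_deriv \<alpha> (\<lambda>z. form_in_chart A c \<omega> z \<beta>) y)"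
    by (elim exE conjE) (rule that)
  note a = a'(1)[rule_format] a'(2)[rule_format]
  \<comment> \<open>Every component of the form is \<open>vol p \<beta>\<close> times the one
    component \<open>co\<close>, so the coefficients for all \<open>\<beta>\<close> merge.\<close>
  let ?Q = "\<lambda>f y. \<Sum>\<alpha>\<in>?A. (\<Sum>\<beta>\<in>?B. a \<alpha> \<beta> y * vol p \<beta>) * iter_deriv \<alpha> f y"
  have M1: "?Q \<in> dopU (chart_img c) (Suc k)"
    by (intro dopU_sum dopU.monom smooth_on_sum smooth_on_mult smooth_on_const a(1) chart_props c) auto
  have M2: "D \<omega> (chart_inv c y) = ?Q (co c \<omega>) y" if w: "\<omega> \<in> forms A p" and y: "y \<in> chart_img c" for \<omega> y
  proof -
    have "iter_deriv \<alpha> (\<lambda>z. form_in_chart A c \<omega> z \<beta>) y = vol p \<beta> * iter_deriv \<alpha> (co c \<omega>) y" for \<alpha> \<beta>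
    proof -
      have "iter_deriv \<alpha> (\<lambda>z. form_in_chart A c \<omega> z \<beta>) y = iter_deriv \<alpha> (\<lambda>z. vol p \<beta> * co c \<omega> z) y"
        by (rule iter_deriv_cong[OF chart_props(2)[OF c] _ y]) (rule form_vol[OF formsD(1)[OF w] c])
      then show ?thesis using iter_deriv_scale[OF chart_props(2)[OF c] formsD(2)[OF w c] y] by simp
    qed
    then show ?thesis by (simp add: a(2)[OF w y] sum_distrib_right mult.assoc)
  qed
  show ?thesis by (rule bexI[OF _ M1], intro ballI, rule M2)
qed

lemma diff_ops_off: "D \<in> diff_ops A k p ==> \<omega> \<notin> forms A p ==> D \<omega> = 0"
  and diff_ops_smooth: "D \<in> diff_ops A k p ==> \<omega> \<in> forms A p ==> D \<omega> \<in> smooth_functions A"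
  unfolding diff_ops_def by blast+

lemma diff_opsI:
  assumes off: "\<And>\<omega>. \<omega> \<notin> forms A p ==> D \<omega> = 0"
    and Q: "\<And>c. c \<in> A ==> \<exists>Q\<in>dopU (chart_img c) (Suc k). in_chart c D Q"
  shows "D \<in> diff_ops A k p"
proof -
  have "D \<omega> \<in> smooth_functions A" if w: "\<omega> \<in> forms A p" for \<omega>
    unfolding smooth_functions_iff
  proof
    fix c assume c: "c \<in> A"
    obtain Q where Q': "Q \<in> dopU (chart_img c) (Suc k)" "\<And>y. y \<in> chart_img c ==> D \<omega> (chart_inv c y) = Q (co c \<omega>) y"
      using Q[OF c] w by blast
    show "smooth_on (chart_img c) (\<lambda>y. D \<omega> (chart_inv c y))"
      by (rule smooth_on_cong[OF chart_props(2)[OF c] Q'(2)[symmetric] dopU_smooth[OF Q'(1) chart_props(2)[OF c] formsD(2)[OF w c]]])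
  qed
  moreover have "\<exists>a. (\<forall>\<alpha> \<beta>. smooth_on (chart_img c) (a \<alpha> \<beta>)) \<and>
        (\<forall>\<omega>\<in>forms A p. \<forall>y\<in>chart_img c. D \<omega> (chart_inv c y) =
           (\<Sum>\<alpha>\<in>{\<alpha>. set \<alpha> \<subseteq> Basis \<and> length \<alpha> \<le> k}. \<Sum>\<beta>\<in>{\<beta>. set \<beta> \<subseteq> Basis \<and> length \<beta> = p}.
              a \<alpha> \<beta> y * iter_deriv \<alpha> (\<lambda>z. form_in_chart A c \<omega> z \<beta>) y))" if c: "c \<in> A" for c
  proof -
    let ?B = "{\<beta>::'e list. set \<beta> \<subseteq> Basis \<and> length \<beta> = p}"
    obtain Q where Q': "Q \<in> dopU (chart_img c) (Suc k)" "\<And>\<omega> y. \<omega> \<in> forms A p ==> y \<in> chart_img c ==> D \<omega> (chart_inv c y) = Q (co c \<omega>) y"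
      using Q[OF c] by blast
    obtain a where a: "\<And>\<alpha>. smooth_on (chart_img c) (a \<alpha>)" "\<And>f y. smooth_on (chart_img c) f ==> y \<in> chart_img c ==>
        Q f y = (\<Sum>\<alpha>\<in>mi (Suc k). a \<alpha> y * iter_deriv \<alpha> f y)"
      using dopU_coeffs[OF Q'(1) chart_props(2)[OF c]] by blast
    \<comment> \<open>The component \<open>co\<close> is the one with index \<open>frame p\<close>;
      all other indices get the coefficient 0.\<close>
    let ?a = "\<lambda>\<alpha> \<beta>. if \<beta> = (frame p :: 'e list) then a \<alpha> else (\<lambda>_. 0)"
    have "(\<Sum>\<beta>\<in>?B. ?a \<alpha> \<beta> y * iter_deriv \<alpha> (\<lambda>z. form_in_chart A c \<omega> z \<beta>) y) = a \<alpha> y * iter_deriv \<alpha> (co c \<omega>) y" for \<alpha> y \<omega>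
    proof -
      have fB: "finite ?B" using finite_lists_length_eq[OF finite_Basis, of p] by simp
      have "(\<Sum>\<beta>\<in>?B. ?a \<alpha> \<beta> y * iter_deriv \<alpha> (\<lambda>z. form_in_chart A c \<omega> z \<beta>) y) =
        (\<Sum>\<beta>\<in>?B. if \<beta> = frame p then a \<alpha> y * iter_deriv \<alpha> (co c \<omega>) y else 0)"
        by (rule sum.cong[OF refl]) (simp add: co_def[abs_def])
      then show ?thesis using frame(1,3)[OF p] by (simp add: sum.delta[OF fB])
    qed
    then show ?thesis
      by (intro exI[of _ ?a]) (simp add: a Q' formsD(2)[OF _ c] less_Suc_eq_le)
  qed
  ultimately show ?thesis using off unfolding diff_ops_def by blast
qed

lemma diff_ops_local:
  assumes D: "D \<in> diff_ops A k p" and w: "\<omega> \<in> forms A p" "\<omega>' \<in> forms A p" and c: "c \<in> A" "x \<in> chart_dom c"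
    and N: "open N" "chart_map c x \<in> N" "\<And>y. y \<in> N ==> y \<in> chart_img c ==> co c \<omega> y = co c \<omega>' y"
  shows "D \<omega> x = D \<omega>' x"
proof -
  obtain Q where Q: "Q \<in> dopU (chart_img c) (Suc k)" "\<And>\<omega> y. \<omega> \<in> forms A p ==> y \<in> chart_img c ==> D \<omega> (chart_inv c y) = Q (co c \<omega>) y"
    using diff_opsD[OF D c(1)] by blast
  have "Q (co c \<omega>) (chart_map c x) = Q (co c \<omega>') (chart_map c x)"
    by (rule dopU_local[OF Q(1) formsD(2)[OF w(1) c(1)] formsD(2)[OF w(2) c(1)], of "N \<inter> chart_img c"])
       (use N c chart_props(2)[OF c(1)] in auto)
  then show ?thesis using Q(2)[of _ "chart_map c x"] w c by (simp add: chart_props)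
qed

lemma diff_ops_local':
  assumes D: "D \<in> diff_ops A k p" and w: "\<omega> \<in> forms A p" "\<omega>' \<in> forms A p"
    and N: "open N" "x \<in> N" "\<And>z. z \<in> N ==> \<omega> z = \<omega>' z"
  shows "D \<omega> x = D \<omega>' x"
  by (rule diff_ops_local[OF D w chart_at cset_open[OF chart_at(1)[of x] N(1)]])
     (use N chart_at chart_at[of x] in \<open>simp_all add: co_def form_in_chart_eq cset_def chart_props\<close>)

lemma forms_zero: "(\<lambda>x vs. 0) \<in> forms A p"
proof (rule formsI)
  fix x
  show "\<exists>c\<in>A. \<exists>N. open N \<and> x \<in> N \<and> N \<subseteq> chart_dom c \<and> smooth_on (cset c N) (co c (\<lambda>x vs. 0))"
    by (rule bexI[OF _ chart_at(1)[of x]])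
      (intro exI[of _ "chart_dom (at_chart x)"] conjI chart_props(1)[OF chart_at(1)] chart_at(2) subset_refl,
        simp add: co_def[abs_def] form_in_chart_eq)
qed (simp add: alternating_zero)

lemma diff_ops_zero_form:
  assumes D: "D \<in> diff_ops A k p" and w: "\<omega> \<in> forms A p" and N: "open N" "x \<in> N" "\<And>z vs. z \<in> N ==> \<omega> z vs = 0"
  shows "D \<omega> x = 0"
proof -
  let ?b = "at_chart x"
  obtain Q where Q: "Q \<in> dopU (chart_img ?b) (Suc k)" "\<And>\<omega> y. \<omega> \<in> forms A p ==> y \<in> chart_img ?b ==> D \<omega> (chart_inv ?b y) = Q (co ?b \<omega>) y"
    using diff_opsD[OF D chart_at(1)] by blast
  have b: "chart_map ?b x \<in> chart_img ?b" "chart_inv ?b (chart_map ?b x) = x" using chart_at by (auto simp: chart_props)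
  have "D \<omega> x = D (\<lambda>x vs. 0) x" by (rule diff_ops_local'[OF D w forms_zero N(1,2)]) (use N in auto)
  also have "\<dots> = Q (\<lambda>_. 0 * 0) (chart_map ?b x)"
    using Q(2)[OF forms_zero b(1)] b by (simp add: co_def[abs_def] form_in_chart_eq)
  also have "\<dots> = 0" using dopU_scale[OF Q(1) chart_props(2)[OF chart_at(1)] smooth_on_const b(1), of 0 0] by simp
  finally show ?thesis .
qed

definition lm :: "('a => real) => ('a, 'e) diffop => ('a, 'e) diffop" where
  "lm g D = (\<lambda>\<omega> x. g x * D \<omega> x)"

text \<open>The operators of order strictly less than the index, so that the index \<open>0\<close> leaves only the zero operator.\<close>

definition dlt :: "nat => ('a, 'e) diffop set" where
  "dlt l = {D. (\<forall>\<omega>. \<omega> \<notin> forms A p \<longrightarrow> D \<omega> = 0) \<and>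
     (\<forall>c\<in>A. \<exists>Q\<in>dopU (chart_img c) l. in_chart c D Q)}"

lemma dltD:
  assumes "D \<in> dlt l"
  shows "\<omega> \<notin> forms A p ==> D \<omega> = 0"
    "c \<in> A ==> \<exists>Q\<in>dopU (chart_img c) l. in_chart c D Q"
  using assms by (simp_all add: dlt_def)

lemma dltI:
  assumes "\<And>\<omega>. \<omega> \<notin> forms A p ==> D \<omega> = 0"
    "\<And>c. c \<in> A ==> \<exists>Q\<in>dopU (chart_img c) l. in_chart c D Q"
  shows "D \<in> dlt l"
  using assms by (simp add: dlt_def)

lemma dlt_Suc: "dlt (Suc k) = diff_ops A k p"
proof (intro equalityI subsetI)
  fix D assume D: "D \<in> dlt (Suc k)"
  show "D \<in> diff_ops A k p" by (rule diff_opsI[OF dltD[OF D]])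
next
  fix D assume D: "D \<in> diff_ops A k p"
  show "D \<in> dlt (Suc k)" by (rule dltI[OF diff_ops_off[OF D] diff_opsD[OF D]])
qed

lemma dlt_mono: "D \<in> dlt k ==> k \<le> l ==> D \<in> dlt l"
  unfolding dlt_def using dopU_mono by blast

lemma dlt_zero: "0 \<in> dlt l"
  by (rule dltI) (auto intro!: bexI[OF _ dopU.zero])

lemma dlt_add:
  assumes D: "D \<in> dlt k" and E: "E \<in> dlt k"
  shows "D + E \<in> dlt k"
proof (rule dltI)
  fix c assume c: "c \<in> A"
  obtain P Q where "P \<in> dopU (chart_img c) k" "Q \<in> dopU (chart_img c) k"
    "in_chart c D P"
    "in_chart c E Q"
    using dltD(2)[OF D c] dltD(2)[OF E c] by blast
  then show "\<exists>Q\<in>dopU (chart_img c) k. in_chart c (D + E) Q"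
    by (intro bexI[OF _ dopU.add[of P _ _ Q]]) auto
qed (simp add: dltD(1)[OF D] dltD(1)[OF E])

lemma dlt_lm:
  assumes D: "D \<in> dlt k" and g: "g \<in> smooth_functions A"
  shows "lm g D \<in> dlt k"
proof (rule dltI)
  fix c assume c: "c \<in> A"
  obtain P where "P \<in> dopU (chart_img c) k" "in_chart c D P"
    using dltD(2)[OF D c] by blast
  then show "\<exists>Q\<in>dopU (chart_img c) k. in_chart c (lm g D) Q"
    by (intro bexI[OF _ dopU_mult[OF _ chart_props(2)[OF c] smooth_functionsD[OF g c]]]) (auto simp: lm_def)
qed (simp add: dltD(1)[OF D] lm_def fun_eq_iff)

lemma diff_ops_mono: "D \<in> diff_ops A k p ==> k \<le> l ==> D \<in> diff_ops A l p"
  using dlt_mono[of D "Suc k" "Suc l"] by (simp add: dlt_Suc)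

lemma diff_ops_plus: "D \<in> diff_ops A k p ==> E \<in> diff_ops A k p ==> D + E \<in> diff_ops A k p"
  using dlt_add[of D "Suc k" E] by (simp add: dlt_Suc)

lemma diff_ops_mult: "D \<in> diff_ops A k p ==> f \<in> smooth_functions A ==> (\<lambda>\<omega> x. f x * D \<omega> x) \<in> diff_ops A k p"
  using dlt_lm[of D "Suc k" f] by (simp add: dlt_Suc lm_def)

lemma diff_ops_scaleR: "D \<in> diff_ops A k p ==> r *\<^sub>R D \<in> diff_ops A k p"
  using diff_ops_mult[of D k "\<lambda>_. r"] smooth_functions_const by (simp add: scaleR_fun_def)

lemma diff_ops_minus: "D \<in> diff_ops A k p ==> E \<in> diff_ops A k p ==> D - E \<in> diff_ops A k p"
  using diff_ops_plus[of D k "(-1) *\<^sub>R E"] diff_ops_scaleR[of E k "-1"] by simp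

lemma diff_ops_zero: "0 \<in> diff_ops A k p"
  by (rule diff_opsI) (auto intro!: bexI[of _ "\<lambda>f y. 0"] dopU.zero)

lemma lie_op_chart:
  assumes D: "D \<in> diff_ops A k p" and X: "X \<in> vector_fields A" and w: "\<omega> \<in> forms A p" and c: "c \<in> A" "y \<in> chart_img c"
  shows "lie_op A p X D \<omega> (chart_inv c y) =
    fd (\<lambda>y. D \<omega> (chart_inv c y)) y (vf_in_chart A c X y) - D (lie_form A X \<omega>) (chart_inv c y)"
  using w by (simp add: lie_op_def lie_function_chart[OF diff_ops_smooth[OF D w] c])

lemma lie_op_diff_ops:
  assumes D: "D \<in> diff_ops A k p" and X: "X \<in> vector_fields A"
  shows "lie_op A p X D \<in> diff_ops A k p"
proof (rule diff_opsI)
  fix c assume c: "c \<in> A"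
  let ?U = "chart_img c" and ?X = "vf_in_chart A c X"
  let ?d = "\<lambda>y. dvg p (fd ?X y)"
  have U: "open ?U" and sX: "smooth_on ?U ?X" using chart_props c vector_fieldsD[OF X] by auto
  have d: "smooth_on ?U ?d" unfolding dvg_def
    by (intro smooth_on_sum smooth_on_inner smooth_on_fd sX smooth_on_const U)
  obtain Q where Q: "Q \<in> dopU ?U (Suc k)" "\<And>\<omega> y. \<omega> \<in> forms A p ==> y \<in> ?U ==> D \<omega> (chart_inv c y) = Q (co c \<omega>) y"
    using diff_opsD[OF D c] by blast
  have "lie_op A p X D \<omega> (chart_inv c y) = fd (Q (co c \<omega>)) y (?X y) -
      Q (\<lambda>z. fd (co c \<omega>) z (?X z) + ?d z * co c \<omega> z) y" if w: "\<omega> \<in> forms A p" and y: "y \<in> ?U" for \<omega> y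
  proof -
    have "fd (\<lambda>y. D \<omega> (chart_inv c y)) y = fd (Q (co c \<omega>)) y"
      by (rule fd_cong[OF U y]) (rule Q(2)[OF w])
    moreover have "Q (co c (lie_form A X \<omega>)) y = Q (\<lambda>z. fd (co c \<omega>) z (?X z) + ?d z * co c \<omega> z) y"
    proof (rule dopU_local[OF Q(1) _ _ U _ y y])
      show "smooth_on ?U (co c (lie_form A X \<omega>))" by (rule formsD(2)[OF lie_form_forms[OF w X] c])
      show "smooth_on ?U (\<lambda>z. fd (co c \<omega>) z (?X z) + ?d z * co c \<omega> z)"
        by (intro smooth_on_add smooth_on_fd_apply smooth_on_mult U sX d formsD(2)[OF w c])
      show "co c (lie_form A X \<omega>) z = fd (co c \<omega>) z (?X z) + ?d z * co c \<omega> z" if "z \<in> ?U" for z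
        using co_lie_form[OF w X c that] by (simp add: lco_def)
    qed
    ultimately show ?thesis using Q(2)[OF lie_form_forms[OF w X] y] by (simp add: lie_op_chart[OF D X w c y])
  qed
  then show "\<exists>Q\<in>dopU ?U (Suc k). in_chart c (lie_op A p X D) Q"
    by (intro bexI[OF _ dopU_lie[OF Q(1) U sX d]]) auto
qed (simp add: lie_op_def zero_fun_def)

subsection \<open>Operators supported in a chart\<close>

definition liftop :: "('a => real) => ('a, 'e) chart => (('e => real) => 'e => real) => ('a, 'e) diffop" where
  "liftop \<kappa> c Q \<omega> x = (if \<omega> \<in> forms A p \<and> x \<in> chart_dom c then \<kappa> x * Q (co c \<omega>) (chart_map c x) else 0)"

text \<open>The chain rule expresses a derivative in \<open>c\<close> by derivatives in
  \<open>c'\<close>, with coefficients from the differential of the transition map; the induction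
  starts with the Jacobian that relates the two components.\<close>

lemma iter_deriv_tr:
  assumes c: "c \<in> A" "c' \<in> A"
  shows "set \<alpha> \<subseteq> Basis ==> \<exists>R\<in>dopU (cset c' (chart_dom c)) (Suc (length \<alpha>)). \<forall>\<omega>\<in>forms A p. \<forall>y\<in>cset c (chart_dom c').
    iter_deriv \<alpha> (co c \<omega>) y = R (co c' \<omega>) (tr c c' y)"
proof (induction \<alpha>)
  case Nil
  let ?W = "cset c (chart_dom c')" and ?W' = "cset c' (chart_dom c)"
  have J: "smooth_on ?W' (\<lambda>y. J c c' (tr c' c y))"
    by (rule smooth_on_compose[OF cset_open cset_open _ J_smooth[OF c] tr_smooth[OF c(2,1)]])
       (use c chart_props in \<open>auto simp: cset_def\<close>)
  have "(\<lambda>f y. J c c' (tr c' c y) * iter_deriv [] f y) \<in> dopU ?W' (Suc (length []))"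
    by (rule dopU.monom) (use J in auto)
  moreover have "co c \<omega> y = J c c' (tr c' c (tr c c' y)) * co c' \<omega> (tr c c' y)" if "\<omega> \<in> forms A p" "y \<in> ?W" for \<omega> y
    using co_tr'[OF that(1) c that(2)] tr_tr[OF c that(2)] that(2) c by (simp add: cset_def chart_props)
  ultimately show ?case by (intro bexI[of _ "\<lambda>f y. J c c' (tr c' c y) * iter_deriv [] f y"]) auto
next
  case (Cons v \<alpha>)
  let ?W = "cset c (chart_dom c')" and ?W' = "cset c' (chart_dom c)"
  have W: "open ?W" "open ?W'" using c by (auto intro: cset_open chart_props)
  obtain R where R: "R \<in> dopU ?W' (Suc (length \<alpha>))" "\<And>\<omega> y. \<omega> \<in> forms A p ==> y \<in> ?W ==> iter_deriv \<alpha> (co c \<omega>) y = R (co c' \<omega>) (tr c c' y)"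
    using Cons by auto
  have TTs: "smooth_on ?W' (\<lambda>y. TT c c' (tr c' c y) v \<bullet> b)" for b
  proof (rule smooth_on_inner[OF W(2) _ smooth_on_const], rule smooth_on_compose[OF W(2) W(1) _ TT_smooth[OF c] tr_smooth[OF c(2,1)]])
    show "tr c' c y \<in> ?W" if "y \<in> ?W'" for y using that c by (auto simp: cset_def chart_props)
  qed
  let ?R = "\<lambda>f y. \<Sum>b\<in>Basis. (TT c c' (tr c' c y) v \<bullet> b) * fd (R f) y b"
  have M1: "?R \<in> dopU ?W' (Suc (length (v # \<alpha>)))"
    using dopU_mult[OF dopU_dv_left[OF R(1) W(2)] W(2) TTs] by (intro dopU_sum) simp
  have M2: "iter_deriv (v # \<alpha>) (co c \<omega>) y = ?R (co c' \<omega>) (tr c c' y)" if w: "\<omega> \<in> forms A p" and y: "y \<in> ?W" for \<omega> y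
  proof -
    have y': "tr c c' y \<in> ?W'" using y c by (auto simp: cset_def chart_props)
    have sR: "smooth_on ?W' (R (co c' \<omega>))"
      by (rule dopU_smooth[OF R(1) W(2) smooth_on_subset[OF formsD(2)[OF w c(2)] cset_subset]])
    have "iter_deriv (v # \<alpha>) (co c \<omega>) y = fd (\<lambda>z. R (co c' \<omega>) (tr c c' z)) y v"
      using fd_cong[OF W(1) y R(2)[OF w]] by simp
    also have "\<dots> = fd (R (co c' \<omega>)) (tr c c' y) (TT c c' y v)"
      unfolding TT_def by (rule fd_compose[OF W(1) sR tr_smooth[OF c] y y'])
    also have "\<dots> = ?R (co c' \<omega>) (tr c c' y)"
      using fd_apply_sum[OF sR y', of "TT c c' y v"] tr_tr[OF c y, of c] y c by (simp add: cset_def chart_props)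
    finally show ?thesis .
  qed
  show ?case by (rule bexI[OF _ M1], intro ballI, rule M2)
qed

lemma dopU_tr:
  assumes c: "c \<in> A" "c' \<in> A" and Q: "Q \<in> dopU (chart_img c) k"
  shows "\<exists>R\<in>dopU (cset c' (chart_dom c)) k. \<forall>\<omega>\<in>forms A p. \<forall>y\<in>cset c (chart_dom c'). Q (co c \<omega>) y = R (co c' \<omega>) (tr c c' y)"
  using Q
proof induction
  case (monom \<alpha> a)
  let ?W = "cset c (chart_dom c')" and ?W' = "cset c' (chart_dom c)"
  have W: "open ?W" "open ?W'" using c by (auto intro: cset_open chart_props)
  obtain R where R: "R \<in> dopU ?W' (Suc (length \<alpha>))" "\<And>\<omega> y. \<omega> \<in> forms A p ==> y \<in> ?W ==> iter_deriv \<alpha> (co c \<omega>) y = R (co c' \<omega>) (tr c c' y)"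
    using iter_deriv_tr[OF c monom(1)] by auto
  have a: "smooth_on ?W' (\<lambda>y. a (tr c' c y))"
    by (rule smooth_on_compose[OF W(2) chart_props(2)[OF c(1)] _ monom(3) tr_smooth[OF c(2,1)]]) (auto simp: cset_def)
  have "(\<lambda>f y. a (tr c' c y) * R f y) \<in> dopU ?W' k"
    using dopU_mult[OF dopU_mono[OF R(1)] W(2) a, of k] monom by simp
  then show ?case
    by (rule bexI[rotated]) (use R(2) c in \<open>auto simp: cset_def chart_props\<close>)
next
  case (add P Q)
  then obtain R S where "R \<in> dopU (cset c' (chart_dom c)) k" "S \<in> dopU (cset c' (chart_dom c)) k"
    "\<forall>\<omega>\<in>forms A p. \<forall>y\<in>cset c (chart_dom c'). P (co c \<omega>) y = R (co c' \<omega>) (tr c c' y)"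
    "\<forall>\<omega>\<in>forms A p. \<forall>y\<in>cset c (chart_dom c'). Q (co c \<omega>) y = S (co c' \<omega>) (tr c c' y)" by blast
  then show ?case by (intro bexI[OF _ dopU.add[of R _ _ S]]) auto
next
  case zero
  show ?case by (intro bexI[OF _ dopU.zero]) auto
next
  case (cong P Q)
  then obtain R where R: "R \<in> dopU (cset c' (chart_dom c)) k"
    "\<forall>\<omega>\<in>forms A p. \<forall>y\<in>cset c (chart_dom c'). P (co c \<omega>) y = R (co c' \<omega>) (tr c c' y)" by blast
  have "P (co c \<omega>) y = Q (co c \<omega>) y" if "\<omega> \<in> forms A p" "y \<in> cset c (chart_dom c')" for \<omega> y
    using cong.hyps(2)[OF formsD(2)[OF that(1) c(1)]] that by (auto simp: cset_def)
  then show ?case using R by (intro bexI[OF _ R(1)]) auto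
qed

lemma liftop_diff_ops:
  assumes c: "c \<in> A" and K: "compact K" "K \<subseteq> chart_dom c" "\<And>x. x \<in> chart_dom c ==> x \<notin> K ==> \<kappa> x = 0"
    and s: "smooth_on (chart_img c) (\<lambda>y. \<kappa> (chart_inv c y))" and Q: "Q \<in> dopU (chart_img c) (Suc k)"
  shows "liftop \<kappa> c Q \<in> diff_ops A k p"
proof (rule diff_opsI)
  show "liftop \<kappa> c Q \<omega> = 0" if "\<omega> \<notin> forms A p" for \<omega> using that by (simp add: liftop_def fun_eq_iff)
  fix c' assume c': "c' \<in> A"
  let ?W = "cset c (chart_dom c')" and ?W' = "cset c' (chart_dom c)" and ?S = "(mi (Suc k) :: 'e list set)"
  have W: "open ?W" "open ?W'" using c c' by (auto intro: cset_open chart_props)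
  obtain R where R: "R \<in> dopU ?W' (Suc k)" "\<And>\<omega> y. \<omega> \<in> forms A p ==> y \<in> ?W ==> Q (co c \<omega>) y = R (co c' \<omega>) (tr c c' y)"
    using dopU_tr[OF c c' Q] by blast
  obtain a where a: "\<And>\<alpha>. smooth_on ?W' (a \<alpha>)" "\<And>f y. smooth_on ?W' f ==> y \<in> ?W' ==> R f y = (\<Sum>\<alpha>\<in>?S. a \<alpha> y * iter_deriv \<alpha> f y)"
    using dopU_coeffs[OF R(1) W(2)] by blast
  \<comment> \<open>The coefficients in \<open>c'\<close> exist on the overlap only; multiplied by
    the compactly supported \<open>\<kappa>\<close> they extend by zero.\<close>
  define b where "b \<alpha> y = (if y \<in> ?W' then \<kappa> (chart_inv c' y) * a \<alpha> y else 0)" for \<alpha> y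
  have "smooth_on (cset c (chart_dom c)) (\<lambda>y. \<kappa> (chart_inv c y))" by (rule smooth_on_subset[OF s cset_subset])
  from smooth_on_tr_compose[OF c c' chart_props(1)[OF c] subset_refl this]
  have k': "smooth_on ?W' (\<lambda>y. \<kappa> (chart_inv c' y))"
    by (rule smooth_on_cong[OF W(2), rotated]) (use c c' in \<open>auto simp: cset_def chart_props\<close>)
  have b: "smooth_on (chart_img c') (b \<alpha>)" for \<alpha>
    unfolding b_def
  proof (rule smooth_on_extend_zero[OF W(2)])
    show "smooth_on ?W' (\<lambda>y. \<kappa> (chart_inv c' y) * a \<alpha> y)" by (intro smooth_on_mult W k' a)
    fix y assume y: "y \<in> chart_img c'" "y \<notin> ?W'"
    show "\<exists>N. open N \<and> y \<in> N \<and> (\<forall>z\<in>N \<inter> ?W'. \<kappa> (chart_inv c' z) * a \<alpha> z = 0)"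
      by (rule exI[of _ "cset c' (- K)"])
        (use y K cset_open[OF c' open_Compl[OF compact_imp_closed[OF K(1)]]] in \<open>auto simp: cset_def\<close>)
  qed
  let ?Q = "\<lambda>f y. \<Sum>\<alpha>\<in>?S. b \<alpha> y * iter_deriv \<alpha> f y"
  have M1: "?Q \<in> dopU (chart_img c') (Suc k)" by (intro dopU_sum dopU.monom b) auto
  have M2: "liftop \<kappa> c Q \<omega> (chart_inv c' y) = ?Q (co c' \<omega>) y" if w: "\<omega> \<in> forms A p" and y: "y \<in> chart_img c'" for \<omega> y
  proof (cases "y \<in> ?W'")
    case True
    have z: "tr c' c y \<in> ?W" "chart_inv c' y \<in> chart_dom c" "tr c c' (tr c' c y) = y"
      using True c c' by (auto simp: cset_def chart_props)
    have "liftop \<kappa> c Q \<omega> (chart_inv c' y) = \<kappa> (chart_inv c' y) * R (co c' \<omega>) y"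
      using R(2)[OF w z(1)] z w by (simp add: liftop_def)
    also have "R (co c' \<omega>) y = (\<Sum>\<alpha>\<in>?S. a \<alpha> y * iter_deriv \<alpha> (co c' \<omega>) y)"
      by (rule a(2)[OF smooth_on_subset[OF formsD(2)[OF w c'] cset_subset] True])
    finally show ?thesis using True by (simp add: b_def sum_distrib_left mult.assoc)
  next
    case False
    then have "chart_inv c' y \<notin> chart_dom c" using y by (auto simp: cset_def)
    then show ?thesis using False by (simp add: liftop_def b_def)
  qed
  show "\<exists>Q'\<in>dopU (chart_img c') (Suc k). \<forall>\<omega>\<in>forms A p. \<forall>y\<in>chart_img c'. liftop \<kappa> c Q \<omega> (chart_inv c' y) = Q' (co c' \<omega>) y"
    by (rule bexI[OF _ M1], intro ballI, rule M2)
qed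

definition eqN :: "'a set => ('a, 'e) diffop => ('a, 'e) diffop => bool" where
  "eqN N D E \<longleftrightarrow> (\<forall>\<omega>\<in>forms A p. \<forall>x\<in>N. D \<omega> x = E \<omega> x)"

end

text \<open>
  Functions, fields and operators on the model space are carried over to the manifold by means of a cutoff
  function \<open>kap\<close>: \<open>rep\<close> is inverse to \<open>lop\<close> as long as operators are only compared on the ball \<open>V\<close>.
  The weight \<open>w\<close> is the coefficient of the divergence in the Lie derivative.
\<close>

locale loc = mfdp A p for A :: "('a::{second_countable_topology, t2_space}, 'e::euclidean_space) chart set" and p +
  fixes c :: "('a, 'e) chart" and y0 :: 'e and R :: real and kap :: "'e sfun"
  assumes c: "c \<in> A" and R: "R > 0" "cball y0 R \<subseteq> chart_img c"
    and kap: "\<And>y. y \<in> cball y0 (R/2) ==> ev kap y = 1" "\<And>y. y \<notin> ball y0 R ==> ev kap y = 0"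
begin

definition "V = ball y0 (R/2)"
definition "NV = {x \<in> chart_dom c. chart_map c x \<in> V}"
definition "K = chart_inv c ` cball y0 R"
definition "kp x = (if x \<in> chart_dom c then ev kap (chart_map c x) else 0)"
definition "w = (if p = 0 then 0 else 1 :: real)"
definition "lf f = mkform c (\<lambda>x. kp x * ev f (chart_map c x))"
definition "lfield h j = mkfield c (\<lambda>x. (kp x * ev h (chart_map c x)) *\<^sub>R j)"
definition "lop Q = liftop kp c (hat Q)"
definition "rep E f = Sfun (\<lambda>y. if y \<in> chart_img c then ev kap y * E (lf f) (chart_inv c y) else 0)"

lemma V: "open V" "convex V" "V \<noteq> {}" "V \<subseteq> chart_img c" "y0 \<in> V" "V \<subseteq> cball y0 R"
  using R by (auto simp: V_def subset_iff)

lemma U: "open (chart_img c)" using c by (rule chart_props)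

lemma NV_open: "open NV" unfolding NV_def by (rule chart_preimage_open[OF c V(1)])

lemma NV_iff: "x \<in> NV \<longleftrightarrow> (\<exists>y\<in>V. x = chart_inv c y)"
proof
  show "x \<in> NV ==> \<exists>y\<in>V. x = chart_inv c y"
    using c by (intro bexI[of _ "chart_map c x"]) (simp_all add: NV_def chart_props)
  assume "\<exists>y\<in>V. x = chart_inv c y"
  then obtain y where "y \<in> V" "x = chart_inv c y" by blast
  then show "x \<in> NV" using c V(4) by (simp add: NV_def chart_props subset_iff)
qed

lemma kap_V: "y \<in> V ==> ev kap y = 1"
  using kap(1) by (auto simp: V_def)

lemma K: "compact K" "K \<subseteq> chart_dom c" "x \<notin> K ==> kp x = 0" "open (- K)"
proof -
  show "compact K" "open (- K)" unfolding K_def using compact_chart_inv[OF c _ R(2)] by auto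
  show "K \<subseteq> chart_dom c" using R c by (auto simp: K_def chart_props)
  show "kp x = 0" if "x \<notin> K"
  proof (cases "x \<in> chart_dom c")
    case True
    then have "chart_map c x \<notin> cball y0 R" using that c unfolding K_def by (metis chart_props(5) image_eqI)
    then show ?thesis using kap(2) by (simp add: kp_def)
  qed (simp add: kp_def)
qed

lemma kp_ci: "y \<in> chart_img c ==> kp (chart_inv c y) = ev kap y"
  using c by (simp add: kp_def chart_props)

lemma smooth_kp_ci: "smooth_on (chart_img c) (\<lambda>y. kp (chart_inv c y))"
  by (rule smooth_on_cong[OF U _ smooth_ev[of _ kap]]) (simp add: kp_ci)

lemma lf_forms: "lf f \<in> forms A p"
  unfolding lf_def
proof (rule mkform_forms[OF c K(1,2)])
  show "smooth_on (chart_img c) (\<lambda>y. kp (chart_inv c y) * ev f (chart_map c (chart_inv c y)))"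
    by (rule smooth_on_cong[OF U _ smooth_on_mult[OF U smooth_ev[of _ kap] smooth_ev[of _ f]]])
       (simp add: kp_ci chart_props c)
qed (simp add: K)

lemma co_lf: "y \<in> chart_img c ==> co c (lf f) y = ev kap y * ev f y"
  using c by (simp add: lf_def co_mkform_self kp_ci chart_props)

lemma co_lf_V: "y \<in> V ==> co c (lf f) y = ev f y"
  using co_lf V(4) kap_V by auto

lemma lfield: "lfield h j \<in> vector_fields A"
  unfolding lfield_def
proof (rule mkfield_vector_field[OF c K(1,2)])
  show "smooth_on (chart_img c) (\<lambda>y. (kp (chart_inv c y) * ev h (chart_map c (chart_inv c y))) *\<^sub>R j)"
    by (rule smooth_on_cong[OF U _ smooth_on_scaleR[OF U smooth_on_mult[OF U smooth_ev[of _ kap] smooth_ev[of _ h]] smooth_on_const[of _ j]]])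
       (simp add: kp_ci chart_props c)
qed (simp add: K)

lemma vf_lfield: "y \<in> chart_img c ==> vf_in_chart A c (lfield h j) y = (ev kap y * ev h y) *\<^sub>R j"
  using c by (simp add: lfield_def vf_mkfield kp_ci chart_props)

lemma lop_diff_ops: "Q \<in> dopl (Suc k) ==> lop Q \<in> diff_ops A k p"
  unfolding lop_def by (rule liftop_diff_ops[OF c K(1,2) _ smooth_kp_ci hat_dopU[OF _ U]]) (simp_all add: K)

lemma smooth_rep:
  assumes E: "E \<in> diff_ops A l p"
  shows "smooth_on UNIV (\<lambda>y. if y \<in> chart_img c then ev kap y * E (lf f) (chart_inv c y) else 0)"
proof (rule smooth_on_extend_zero[OF U])
  show "smooth_on (chart_img c) (\<lambda>y. ev kap y * E (lf f) (chart_inv c y))"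
    by (intro smooth_on_mult U smooth_ev smooth_functionsD[OF diff_ops_smooth[OF E lf_forms] c])
  fix y assume "y \<notin> chart_img c"
  then show "\<exists>N. open N \<and> y \<in> N \<and> (\<forall>z\<in>N \<inter> chart_img c. ev kap z * E (lf f) (chart_inv c z) = 0)"
    using R kap(2) by (intro exI[of _ "- cball y0 R"]) (auto simp: open_Compl)
qed

lemma ev_rep: "E \<in> diff_ops A l p ==> ev (rep E f) y = (if y \<in> chart_img c then ev kap y * E (lf f) (chart_inv c y) else 0)"
  unfolding rep_def by (simp add: ev_Sfun[OF smooth_rep])

lemma ev_rep_V: "E \<in> diff_ops A l p ==> y \<in> V ==> ev (rep E f) y = E (lf f) (chart_inv c y)"
  using V(4) kap_V by (auto simp: ev_rep)

lemma rep_dopl: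
  assumes E: "E \<in> diff_ops A l p"
  shows "rep E \<in> dopl (Suc l)"
proof -
  let ?S = "(mi (Suc l) :: 'e list set)"
  obtain Q where Q: "Q \<in> dopU (chart_img c) (Suc l)" "\<And>\<omega> y. \<omega> \<in> forms A p ==> y \<in> chart_img c ==> E \<omega> (chart_inv c y) = Q (co c \<omega>) y"
    using diff_opsD[OF E c] by blast
  obtain a where a: "\<And>\<alpha>. smooth_on (chart_img c) (a \<alpha>)" "\<And>f y. smooth_on (chart_img c) f ==> y \<in> chart_img c ==> Q f y = (\<Sum>\<alpha>\<in>?S. a \<alpha> y * iter_deriv \<alpha> f y)"
    using dopU_coeffs[OF Q(1) U] by blast
  define b where "b \<alpha> = Sfun (\<lambda>y. if y \<in> chart_img c then ev kap y * a \<alpha> y else 0)" for \<alpha>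
  have b: "ev (b \<alpha>) y = (if y \<in> chart_img c then ev kap y * a \<alpha> y else 0)" for \<alpha> y
  proof -
    have "smooth_on UNIV (\<lambda>y. if y \<in> chart_img c then ev kap y * a \<alpha> y else 0)"
    proof (rule smooth_on_extend_zero[OF U])
      fix y assume "y \<notin> chart_img c"
      then show "\<exists>N. open N \<and> y \<in> N \<and> (\<forall>z\<in>N \<inter> chart_img c. ev kap z * a \<alpha> z = 0)"
        using R kap(2) by (intro exI[of _ "- cball y0 R"]) (auto simp: open_Compl)
    qed (intro smooth_on_mult U smooth_ev a)
    then show ?thesis by (simp add: b_def ev_Sfun)
  qed
  have eq: "rep E = (\<lambda>f. \<Sum>\<alpha>\<in>?S. b \<alpha> * ds \<alpha> (kap * f))"
  proof (intro ext sfun_eqI)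
    fix f y
    show "ev (rep E f) y = ev (\<Sum>\<alpha>\<in>?S. b \<alpha> * ds \<alpha> (kap * f)) y"
    proof (cases "y \<in> chart_img c")
      case True
      have "iter_deriv \<alpha> (co c (lf f)) y = iter_deriv \<alpha> (ev (kap * f)) y" for \<alpha>
        by (rule iter_deriv_cong[OF U _ True]) (simp add: co_lf)
      then show ?thesis using True
        by (simp add: ev_rep[OF E] Q(2)[OF lf_forms] a(2)[OF formsD(2)[OF lf_forms c]] b ev_ds sum_distrib_left mult.assoc)
    qed (simp add: ev_rep[OF E] b)
  qed
  have "(\<lambda>f. \<Sum>\<alpha>\<in>?S. b \<alpha> * ds \<alpha> f) \<in> dopl (Suc l)" by (intro dopl_sum dopl.monom) auto
  then show ?thesis unfolding eq by (rule dopl_mult_right)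
qed

lemma rep_lop: "Q \<in> dopl (Suc k) ==> eqop V (rep (lop Q)) Q"
proof (rule eqopI)
  fix f y assume Q: "Q \<in> dopl (Suc k)" and y: "y \<in> V"
  have "hat Q (co c (lf f)) y = ev (Q f) y" by (rule hat_eq[OF Q V(1) y]) (simp add: co_lf_V)
  moreover have "y \<in> chart_img c" using V(4) y by auto
  moreover have "ev (rep (lop Q) f) y = lop Q (lf f) (chart_inv c y)" by (rule ev_rep_V[OF lop_diff_ops[OF Q] y])
  ultimately show "ev (rep (lop Q) f) y = ev (Q f) y"
    using y kap_V c by (simp add: lop_def liftop_def lf_forms kp_ci chart_props)
qed

lemma lop_rep: "D \<in> diff_ops A k p ==> eqN NV (lop (rep D)) D"
  unfolding eqN_def
proof (intro ballI)
  fix \<omega> x assume D: "D \<in> diff_ops A k p" and w: "\<omega> \<in> forms A p" and x: "x \<in> NV"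
  then obtain y where y: "y \<in> V" "x = chart_inv c y" by (auto simp: NV_iff)
  have yU: "y \<in> chart_img c" using y V(4) by auto
  let ?g = "germ (co c \<omega>) y"
  obtain N where N: "open N" "y \<in> N" "\<And>z. z \<in> N ==> ev ?g z = co c \<omega> z" using germ_exists[OF U formsD(2)[OF w c] yU] by blast
  have "lop (rep D) \<omega> x = ev (rep D ?g) y"
    using yU y kap_V c w by (simp add: lop_def liftop_def kp_ci chart_props hat_def)
  also have "\<dots> = D (lf ?g) x" using y by (simp add: ev_rep_V[OF D])
  also have "\<dots> = D \<omega> x"
    by (rule diff_ops_local[OF D lf_forms w c, of _ "N \<inter> V"]) (use N V y yU c co_lf_V in \<open>auto simp: chart_props\<close>)
  finally show "lop (rep D) \<omega> x = D \<omega> x" .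
qed

lemma rep_eqN: 
  assumes D: "D \<in> diff_ops A k p" "E \<in> diff_ops A l p"
  shows "eqop V (rep D) (rep E) \<longleftrightarrow> eqN NV D E"
proof
  assume e: "eqop V (rep D) (rep E)"
  \<comment> \<open>\<open>rep\<close> evaluates operators on lifted forms only, so general forms
    are reached through \<open>lop\<close>.\<close>
  have "lop (rep D) \<omega> x = lop (rep E) \<omega> x" if "x \<in> NV" for \<omega> x
    using e that by (auto simp: lop_def liftop_def hat_def eqop_def NV_def)
  then show "eqN NV D E" using lop_rep[OF D(1)] lop_rep[OF D(2)] by (simp add: eqN_def)
next
  assume "eqN NV D E"
  then show "eqop V (rep D) (rep E)"
    using lf_forms NV_iff by (simp add: eqop_def eqN_def ev_rep_V[OF D(1)] ev_rep_V[OF D(2)]) metis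
qed

lemma w: "w = 0 \<or> w = 1" by (simp add: w_def)

text \<open>The derivative of a field h j sends v to dh(v) j and has trace dh(j); this is the origin
  of the weight \<open>w\<close> on the model space.\<close>

lemma dvg_rank_one:
  fixes j :: 'e
  assumes "j \<in> Basis" "linear l"
  shows "dvg p (\<lambda>v. l v *\<^sub>R j) = w * l j"
proof (cases "p = 0")
  case False
  then have "p = DIM('e)" using p by simp
  then have "dvg p (\<lambda>v. l v *\<^sub>R j) = (\<Sum>b\<in>Basis. l b * (j \<bullet> b))" using dvg_top[of "\<lambda>v. l v *\<^sub>R j"] by simp
  also have "\<dots> = (\<Sum>b\<in>Basis. if b = j then l j else 0)"
    using assms(1) by (intro sum.cong) (auto simp: inner_Basis)
  finally show ?thesis using assms(1) False by (simp add: w_def)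
next
  case True
  then show ?thesis unfolding w_def by simp
qed

lemma rep_lie_op:
  assumes E: "E \<in> diff_ops A l p" and j: "j \<in> Basis"
  shows "eqop V (rep (lie_op A p (lfield h j) E)) (lieq w h j (rep E))"
proof (rule eqopI)
  fix f y assume y: "y \<in> V"
  let ?X = "lfield h j" let ?D = "\<lambda>f y. fd f y"
  have yU: "y \<in> chart_img c" using y V by auto
  have Xc: "vf_in_chart A c ?X z = ev h z *\<^sub>R j" if "z \<in> V" for z using vf_lfield[of z h j] that V(4) kap_V by auto
  have "?D (\<lambda>y. E (lf f) (chart_inv c y)) y = ?D (ev (rep E f)) y"
    by (rule fd_cong[OF V(1) y]) (simp add: ev_rep_V[OF E])
  moreover have "linear (?D (ev (rep E f)) y)" by (rule linear_fd[of UNIV]) auto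
  ultimately have 1: "?D (\<lambda>y. E (lf f) (chart_inv c y)) y (vf_in_chart A c ?X y) = ev (h * dv j (rep E f)) y"
    by (simp add: Xc[OF y] linear_scale dv.rep_eq)
  let ?g = "h * dv j f + w *\<^sub>R (dv j h * f)"
  have "co c (lie_form A ?X (lf f)) z = ev ?g z" if z: "z \<in> V" for z
  proof -
    have zU: "z \<in> chart_img c" using z V by auto
    have l: "linear (?D (ev f) z)" "linear (?D (ev h) z)" by (rule linear_fd[of UNIV]; auto)+
    have "?D (co c (lf f)) z = ?D (ev f) z"
      by (rule fd_cong[OF V(1) z]) (rule co_lf_V)
    moreover have "?D (vf_in_chart A c ?X) z = ?D (\<lambda>z. ev h z *\<^sub>R j) z"
      by (rule fd_cong[OF V(1) z]) (rule Xc)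
    moreover have "?D (\<lambda>z. ev h z *\<^sub>R j) z = (\<lambda>v. ?D (ev h) z v *\<^sub>R j)"
      by (intro fd_eqI has_derivative_scaleR_left smooth_on_has_derivative[of UNIV]) auto
    ultimately show ?thesis
      using l by (simp add: co_lie_form[OF lf_forms lfield c zU] lco_def Xc[OF z] dvg_rank_one[OF j] co_lf_V[OF z] linear_scale dv.rep_eq)
  qed
  then have "E (lie_form A ?X (lf f)) (chart_inv c y) = E (lf ?g) (chart_inv c y)"
    by (intro diff_ops_local[OF E lie_form_forms[OF lf_forms lfield] lf_forms c, of _ V])
       (use V y yU c co_lf_V in \<open>auto simp: chart_props\<close>)
  also have "\<dots> = ev (rep E ?g) y" by (simp add: ev_rep_V[OF E y])
  also have "rep E ?g = rep E (h * dv j f) + w *\<^sub>R rep E (dv j h * f)"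
    using rep_dopl[OF E] by (simp add: dopl_plus dopl_scale_arg)
  finally show "ev (rep (lie_op A p ?X E) f) y = ev (lieq w h j (rep E) f) y"
    by (simp add: ev_rep_V[OF lie_op_diff_ops[OF E lfield] y] lie_op_chart[OF E lfield lf_forms c yU] 1 lieq_def)
qed

lemma lop_lieq:
  assumes Q: "Q \<in> dopl (Suc k)" and j: "j \<in> Basis"
  shows "eqN NV (lop (lieq w h j Q)) (lie_op A p (lfield h j) (lop Q))"
proof -
  have L: "lieq w h j Q \<in> dopl (Suc k)" by (rule lieq_dopl[OF Q j])
  have "eqop V (rep (lop (lieq w h j Q))) (rep (lie_op A p (lfield h j) (lop Q)))"
    using eqop_trans[OF rep_lop[OF L] eqop_sym[OF eqop_trans[OF rep_lie_op[OF lop_diff_ops[OF Q] j, of h] lieq_eqop[OF V(1) rep_lop[OF Q]]]]] .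
  then show ?thesis using rep_eqN[OF lop_diff_ops[OF L] lie_op_diff_ops[OF lop_diff_ops[OF Q] lfield]] by blast
qed

lemma lop_add: "lop (\<lambda>f. P f + Q f) = lop P + lop Q"
  and lop_scaleR: "lop (\<lambda>f. r *\<^sub>R Q f) = r *\<^sub>R lop Q"
  by (auto simp: fun_eq_iff lop_def liftop_def hat_def algebra_simps)

lemma NV_y0: "chart_inv c y0 \<in> NV" using V by (auto simp: NV_iff)

end

context mfdp
begin

lemma loc_exists:
  assumes c: "c \<in> A" "x \<in> chart_dom c" and N: "open N" "x \<in> N"
  shows "\<exists>R kap. loc A p c (chart_map c x) R kap \<and> chart_inv c ` cball (chart_map c x) R \<subseteq> N"
proof -
  have "open (cset c N)" "chart_map c x \<in> cset c N" using c N by (auto intro: cset_open cset_cm)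
  then obtain R where R: "R > 0" "cball (chart_map c x) R \<subseteq> cset c N" using open_contains_cball by blast
  obtain \<kappa> where k: "smooth_on UNIV \<kappa>" "\<And>z. z \<in> cball (chart_map c x) (R/2) ==> \<kappa> z = (1::real)"
      "\<And>z. z \<notin> ball (chart_map c x) R ==> \<kappa> z = 0"
    using cutoff_exists[of "R/2" R "chart_map c x"] R(1) by auto
  have "loc A p c (chart_map c x) R (Sfun \<kappa>)"
    by unfold_locales (use c R k cset_subset[of c N] in \<open>auto simp: ev_Sfun\<close>)
  moreover have "chart_inv c ` cball (chart_map c x) R \<subseteq> N" using R by (auto simp: cset_def)
  ultimately show ?thesis by blast
qed

end

section \<open>Local invariant maps\<close>

context mfdp
begin

definition local_map :: "nat => (('a, 'e) diffop => ('a, 'e) diffop) => bool" where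
  "local_map k T \<longleftrightarrow> (\<forall>D\<in>diff_ops A k p. \<forall>E\<in>diff_ops A k p. \<forall>N. open N \<longrightarrow> eqN N D E \<longrightarrow> eqN N (T D) (T E))"

lemma invariantD:
  assumes "T \<in> invariant_maps A k p p"
  shows "D \<in> diff_ops A k p ==> \<exists>l. T D \<in> diff_ops A l p"
    "D \<in> diff_ops A k p ==> E \<in> diff_ops A k p ==> T (D + E) = T D + T E"
    "D \<in> diff_ops A k p ==> T (r *\<^sub>R D) = r *\<^sub>R T D"
    "X \<in> vector_fields A ==> D \<in> diff_ops A k p ==> T (lie_op A p X D) = lie_op A p X (T D)"
    "D \<notin> diff_ops A k p ==> T D = 0"
proof -
  note C = assms[unfolded invariant_maps_def mem_Collect_eq]
  note T = C[THEN conjunct1] C[THEN conjunct2, THEN conjunct1] C[THEN conjunct2, THEN conjunct2, THEN conjunct1]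
    C[THEN conjunct2, THEN conjunct2, THEN conjunct2, THEN conjunct1] C[THEN conjunct2, THEN conjunct2, THEN conjunct2, THEN conjunct2]
  show "D \<in> diff_ops A k p ==> \<exists>l. T D \<in> diff_ops A l p" using T(1) by (simp add: all_diff_ops_def)
  show "D \<in> diff_ops A k p ==> E \<in> diff_ops A k p ==> T (D + E) = T D + T E" by (rule T(3)[rule_format])
  show "D \<in> diff_ops A k p ==> T (r *\<^sub>R D) = r *\<^sub>R T D" by (rule T(4)[rule_format])
  show "X \<in> vector_fields A ==> D \<in> diff_ops A k p ==> T (lie_op A p X D) = lie_op A p X (T D)" by (rule T(5)[rule_format])
  show "D \<notin> diff_ops A k p ==> T D = 0" by (rule T(2)[rule_format])
qed

lemma invariant_zero: "T \<in> invariant_maps A k p p ==> T 0 = 0"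
  using invariantD(3)[of T k 0 0] diff_ops_zero by simp

lemma invariant_minus:
  assumes "T \<in> invariant_maps A k p p" "D \<in> diff_ops A k p" "E \<in> diff_ops A k p"
  shows "T (D - E) = T D - T E"
  using invariantD(2)[OF assms(1,2) diff_ops_scaleR[OF assms(3), of "-1"]] invariantD(3)[OF assms(1,3), of "-1"] by simp

lemma eqN_refl [simp]: "eqN N D D" by (simp add: eqN_def)

lemma eqN_minus_iff: "eqN N (D - E) 0 \<longleftrightarrow> eqN N D E" by (simp add: eqN_def)

text \<open>By linearity it is enough to treat operators that vanish on \<open>N\<close>.\<close>

lemma local_mapI:
  assumes T: "T \<in> invariant_maps A k p p"
    and z: "\<And>D N x. D \<in> diff_ops A k p ==> open N ==> eqN N D 0 ==> x \<in> N ==> \<exists>N'. x \<in> N' \<and> eqN N' (T D) 0"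
  shows "local_map k T"
  unfolding local_map_def
proof (intro ballI allI impI)
  fix D E N assume D: "D \<in> diff_ops A k p" "E \<in> diff_ops A k p" and N: "open N" "eqN N D E"
  show "eqN N (T D) (T E)"
    unfolding eqN_def
  proof (intro ballI)
    fix \<omega> x assume w: "\<omega> \<in> forms A p" and x: "x \<in> N"
    have "eqN N (D - E) 0" using N(2) eqN_minus_iff by simp
    from z[OF diff_ops_minus[OF D] N(1) this x] obtain N' where "x \<in> N'" "eqN N' (T (D - E)) 0" by blast
    then have "T (D - E) \<omega> x = 0" using w by (simp add: eqN_def)
    then show "T D \<omega> x = T E \<omega> x" by (simp add: invariant_minus[OF T D])
  qed
qed

lemma lie_form_zero:
  assumes \<omega>: "\<omega> \<in> forms A p" and X: "X \<in> vector_fields A" and N: "open N" "\<And>x. x \<in> N ==> X x = 0" and x: "x \<in> N"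
  shows "lie_form A X \<omega> x vs = 0"
proof -
  let ?b = "at_chart x" let ?y = "chart_map ?b x" and ?S = "cset ?b N"
  have S: "open ?S" "?y \<in> ?S" using cset_open[OF chart_at(1) N(1)] cset_cm[OF chart_at x] by auto
  have z: "vf_in_chart A ?b X y = 0" if "y \<in> ?S" for y
    using that N(2) by (intro vf_zero[OF _ chart_at(1)]) (auto simp: cset_def)
  have "fd (vf_in_chart A ?b X) ?y = fd (\<lambda>_. 0) ?y"
    by (rule fd_cong[OF S]) (rule z)
  then have "dvg p (fd (vf_in_chart A ?b X) ?y) = 0" by (simp add: dvg_def)
  moreover have "linear (fd (co ?b \<omega>) ?y)"
    by (rule linear_fd[OF formsD(2)[OF \<omega> chart_at(1)]]) (use chart_at in auto)
  ultimately show ?thesis by (simp add: lie_form_at[OF \<omega> X] lco_def z[OF S(2)] linear_0)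
qed

lemma lie_function_zero:
  assumes f: "f \<in> smooth_functions A" and N: "open N" "x \<in> N" and z: "(\<forall>y\<in>N. f y = 0) \<or> X x = 0"
  shows "lie_function A X f x = 0"
proof -
  let ?b = "at_chart x" let ?y = "chart_map ?b x" and ?S = "cset ?b N"
  have b: "?b \<in> A" "?y \<in> chart_img ?b" "chart_inv ?b ?y = x" using chart_at by (auto simp: chart_props)
  have S: "open ?S" "?y \<in> ?S" using cset_open[OF chart_at(1) N(1)] cset_cm[OF chart_at N(2)] by auto
  have e: "lie_function A X f x = fd (\<lambda>y. f (chart_inv ?b y)) ?y (vf_in_chart A ?b X ?y)"
    using lie_function_chart[OF f b(1,2), of X] b(3) by simp
  from z show ?thesis
  proof
    assume "\<forall>y\<in>N. f y = 0"
    then have "fd (\<lambda>y. f (chart_inv ?b y)) ?y = fd (\<lambda>_. 0) ?y"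
      by (intro fd_cong[OF S]) (auto simp: cset_def)
    then show ?thesis by (simp add: e)
  next
    assume "X x = 0"
    then have "vf_in_chart A ?b X ?y = 0" using b by (intro vf_zero) auto
    then show ?thesis using linear_0[OF linear_fd[OF smooth_functionsD[OF f b(1)] b(2)]] by (simp add: e)
  qed
qed

text \<open>On \<open>N\<close> the operator vanishes, and off \<open>K\<close> the field does. Both
  sets are open, and together they cover the manifold.\<close>

lemma lie_op_zero:
  assumes D: "D \<in> diff_ops A k p" and X: "X \<in> vector_fields A"
    and N: "open N" "eqN N D 0" and K: "open (- K)" "K \<subseteq> N" "\<And>x. x \<notin> K ==> X x = 0"
  shows "lie_op A p X D = 0"
proof (intro ext)
  fix \<omega> x
  show "lie_op A p X D \<omega> x = 0 \<omega> x"
  proof (cases "\<omega> \<in> forms A p")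
    case w: True
    have e: "lie_op A p X D \<omega> x = lie_function A X (D \<omega>) x - D (lie_form A X \<omega>) x"
      using w by (simp add: lie_op_def)
    have sm: "D \<omega> \<in> smooth_functions A" by (rule diff_ops_smooth[OF D w])
    show ?thesis
    proof (cases "x \<in> N")
      case True
      have "lie_function A X (D \<omega>) x = 0"
        by (rule lie_function_zero[OF sm N(1) True]) (use N(2) w in \<open>simp add: eqN_def\<close>)
      moreover have "D (lie_form A X \<omega>) x = 0" using N(2) lie_form_forms[OF w X] True by (simp add: eqN_def)
      ultimately show ?thesis by (simp add: e)
    next
      case False
      then have x: "x \<in> - K" using K by auto
      have "lie_function A X (D \<omega>) x = 0"
        by (rule lie_function_zero[OF sm K(1) x]) (use x K(3) in simp)
      moreover have "D (lie_form A X \<omega>) x = 0"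
        by (rule diff_ops_zero_form[OF D lie_form_forms[OF w X] K(1) x], rule lie_form_zero[OF w X K(1)]) (use K(3) in auto)
      ultimately show ?thesis by (simp add: e)
    qed
  qed (simp add: lie_op_def)
qed

end

context loc
begin

lemma lfield_off: "x \<notin> K ==> lfield h j x = 0"
proof -
  assume "x \<notin> K"
  moreover have "linear (TT c (at_chart x) (chart_map c x))" if "x \<in> chart_dom c"
    using that c chart_at by (intro TT_linear cset_cm) auto
  ultimately show ?thesis by (simp add: lfield_def mkfield_def K linear_0)
qed

lemma rep_zero: "eqop V (rep 0) (\<lambda>f. 0)"
  by (rule eqopI) (simp add: ev_rep_V[OF diff_ops_zero])

lemma vanishing_rep_invariant:
  assumes T: "T \<in> invariant_maps A k p p" and D: "D \<in> diff_ops A k p" and N: "open N" "eqN N D 0" "K \<subseteq> N" and j: "j \<in> Basis"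
  shows "eqop V (lieq w h j (rep (T D))) (\<lambda>f. 0)"
proof -
  obtain l where TD: "T D \<in> diff_ops A l p" using invariantD(1)[OF T D] by blast
  have "lie_op A p (lfield h j) D = 0"
    by (rule lie_op_zero[OF D lfield N(1,2) K(4) N(3) lfield_off])
  then have "lie_op A p (lfield h j) (T D) = 0"
    using invariantD(4)[OF T lfield D] invariant_zero[OF T] by metis
  then show ?thesis using rep_lie_op[OF TD j, of h] rep_zero by (simp add: eqop_def)
qed

lemma rep_add: "D \<in> diff_ops A k p ==> E \<in> diff_ops A l p ==> eqop V (rep (D + E)) (\<lambda>f. rep D f + rep E f)"
proof (rule eqopI)
  fix f y assume *: "D \<in> diff_ops A k p" "E \<in> diff_ops A l p" and y: "y \<in> V"
  have "D \<in> diff_ops A (max k l) p" "E \<in> diff_ops A (max k l) p" using * diff_ops_mono by auto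
  from diff_ops_plus[OF this] show "ev (rep (D + E) f) y = ev (rep D f + rep E f) y"
    using * y by (simp add: ev_rep_V)
qed

lemma rep_scaleR: "D \<in> diff_ops A k p ==> eqop V (rep (r *\<^sub>R D)) (\<lambda>f. r *\<^sub>R rep D f)"
  using ev_rep_V[of D k] ev_rep_V[OF diff_ops_scaleR, of D k] by (simp add: eqop_def)

lemma flat_inv_of_invariant:
  assumes T: "T \<in> invariant_maps A k p p" and L: "local_map k T"
  shows "flat_inv V w k (\<lambda>Q. rep (T (lop Q)))"
  unfolding flat_inv_def
proof (intro conjI ballI allI)
  fix Q :: "'e sfun => 'e sfun" assume Q: "Q \<in> dopl (Suc k)"
  obtain l where TQ: "T (lop Q) \<in> diff_ops A l p" using invariantD(1)[OF T lop_diff_ops[OF Q]] by blast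
  show "\<exists>l. rep (T (lop Q)) \<in> dopl l" using rep_dopl[OF TQ] by blast
  show "eqop V (rep (T (lop (\<lambda>f. r *\<^sub>R Q f)))) (\<lambda>f. r *\<^sub>R rep (T (lop Q)) f)" for r
    using rep_scaleR[OF TQ] by (simp add: lop_scaleR invariantD(3)[OF T lop_diff_ops[OF Q]])
  show "eqop V (rep (T (lop (\<lambda>f. P f + Q f)))) (\<lambda>f. rep (T (lop P)) f + rep (T (lop Q)) f)" if P: "P \<in> dopl (Suc k)" for P
  proof -
    obtain l' where TP: "T (lop P) \<in> diff_ops A l' p" using invariantD(1)[OF T lop_diff_ops[OF P]] by blast
    show ?thesis using rep_add[OF TP TQ] by (simp add: lop_add invariantD(2)[OF T lop_diff_ops[OF P] lop_diff_ops[OF Q]])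
  qed
  fix j :: 'e and h assume j: "j \<in> Basis"
  \<comment> \<open>Here locality is used: the two arguments of \<open>T\<close> are known to agree
    on \<open>NV\<close> only.\<close>
  have "eqN NV (T (lop (lieq w h j Q))) (T (lie_op A p (lfield h j) (lop Q)))"
    using L NV_open lop_lieq[OF Q j] lop_diff_ops[OF lieq_dopl[OF Q j]] lie_op_diff_ops[OF lop_diff_ops[OF Q] lfield]
    unfolding local_map_def by blast
  moreover obtain l' where TL: "T (lop (lieq w h j Q)) \<in> diff_ops A l' p"
    using invariantD(1)[OF T lop_diff_ops[OF lieq_dopl[OF Q j]]] by blast
  ultimately have "eqop V (rep (T (lop (lieq w h j Q)))) (rep (lie_op A p (lfield h j) (T (lop Q))))"
    using rep_eqN[OF TL lie_op_diff_ops[OF TQ lfield]] invariantD(4)[OF T lfield lop_diff_ops[OF Q]] by simp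
  then show "eqop V (rep (T (lop (lieq w h j Q)))) (lieq w h j (rep (T (lop Q))))"
    using rep_lie_op[OF TQ j, of h] by (rule eqop_trans)
qed

lemma T_lop_rep:
  assumes T: "T \<in> invariant_maps A k p p" and L: "local_map k T" and D: "D \<in> diff_ops A k p"
  shows "eqop V (rep (T (lop (rep D)))) (rep (T D))"
proof -
  have LD: "lop (rep D) \<in> diff_ops A k p" by (rule lop_diff_ops[OF rep_dopl[OF D]])
  have "eqN NV (T (lop (rep D))) (T D)"
    using L NV_open lop_rep[OF D] LD D unfolding local_map_def by blast
  then show ?thesis using invariantD(1)[OF T LD] invariantD(1)[OF T D] rep_eqN by blast
qed

lemma flat_map_of_invariant:
  assumes T: "T \<in> invariant_maps A k p p" and L: "local_map k T" and dim: "DIM('e) \<ge> 2" and i: "i \<in> Basis"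
  shows "flat_map V w k (\<lambda>Q. rep (T (lop Q))) i"
  by unfold_locales (use V dim w i flat_inv_of_invariant[OF T L] in auto)

lemma local_classification_0:
  assumes T: "T \<in> invariant_maps A 0 p p" and L: "local_map 0 T" and dim: "DIM('e) \<ge> 2"
  shows "\<exists>a. \<forall>D\<in>diff_ops A 0 p. eqN NV (T D) (a *\<^sub>R D)"
proof -
  obtain i :: 'e where i: "i \<in> Basis" by (meson SOME_Basis)
  obtain a where a: "\<And>Q. Q \<in> dopl 1 ==> eqop V (rep (T (lop Q))) (\<lambda>f. a *\<^sub>R Q f)"
    using flat_map.flat_classification_0[OF flat_map_of_invariant[OF T L dim i]] by blast
  have "eqN NV (T D) (a *\<^sub>R D)" if D: "D \<in> diff_ops A 0 p" for D
  proof -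
    have "eqop V (rep (T D)) (\<lambda>f. a *\<^sub>R rep D f)"
      using eqop_trans[OF eqop_sym[OF T_lop_rep[OF T L D]] a] rep_dopl[OF D] by simp
    then have "eqop V (rep (T D)) (rep (a *\<^sub>R D))" by (rule eqop_trans[OF _ eqop_sym[OF rep_scaleR[OF D]]])
    then show ?thesis using rep_eqN invariantD(1)[OF T D] diff_ops_scaleR[OF D] by blast
  qed
  then show ?thesis by blast
qed

lemma local_classification:
  assumes T: "T \<in> invariant_maps A k p p" and L: "local_map k T" and dim: "DIM('e) \<ge> 2" and k: "k \<ge> 1"
    and U: "U \<in> invariant_maps A k p p" and LU: "local_map k U" and i: "i \<in> Basis"
    and U0: "eqN NV (U (lop (\<lambda>f. f))) (lop (\<lambda>f. f))" and U1: "eqN NV (U (lop (dv i))) (\<nu> *\<^sub>R lop (dv i))" and nu: "\<nu> \<noteq> 1"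
  shows "\<exists>a b. \<forall>D\<in>diff_ops A k p. eqN NV (T D) (a *\<^sub>R D + b *\<^sub>R U D)"
proof -
  have id: "(\<lambda>f::'e sfun. f) \<in> dopl (Suc k)" using dpw_dopl[OF i, of 0 "Suc k"] by (simp add: dpw_def id_def)
  have d1: "dpw i (Suc 0) = dv i" by (rule ext) simp
  have di: "dv i \<in> dopl (Suc k)" using dpw_dopl[OF i, of "Suc 0" "Suc k"] k by (simp add: d1)
  have u0: "eqop V (rep (U (lop (\<lambda>f. f)))) (\<lambda>f. f)"
    using U0 rep_eqN invariantD(1)[OF U lop_diff_ops[OF id]] lop_diff_ops[OF id] rep_lop[OF id] eqop_trans by blast
  have "eqop V (rep (U (lop (dv i)))) (rep (\<nu> *\<^sub>R lop (dv i)))"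
    using U1 rep_eqN invariantD(1)[OF U lop_diff_ops[OF di]] diff_ops_scaleR[OF lop_diff_ops[OF di]] by blast
  then have u1: "eqop V (rep (U (lop (dv i)))) (\<lambda>f. \<nu> *\<^sub>R dv i f)"
    using rep_scaleR[OF lop_diff_ops[OF di], of \<nu>] rep_lop[OF di] by (simp add: eqop_def)
  obtain a b where ab: "\<And>Q. Q \<in> dopl (Suc k) ==> eqop V (rep (T (lop Q))) (\<lambda>f. a *\<^sub>R Q f + b *\<^sub>R rep (U (lop Q)) f)"
    using flat_map.flat_classification[OF flat_map_of_invariant[OF T L dim i] k flat_inv_of_invariant[OF U LU] u0 u1 nu] by blast
  have "eqN NV (T D) (a *\<^sub>R D + b *\<^sub>R U D)" if D: "D \<in> diff_ops A k p" for D
  proof -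
    obtain l where UD: "U D \<in> diff_ops A l p" using invariantD(1)[OF U D] by blast
    have s: "a *\<^sub>R D \<in> diff_ops A k p" "b *\<^sub>R U D \<in> diff_ops A l p" by (rule diff_ops_scaleR[OF D], rule diff_ops_scaleR[OF UD])
    have sum: "a *\<^sub>R D + b *\<^sub>R U D \<in> diff_ops A (max k l) p"
      using s diff_ops_mono by (intro diff_ops_plus) auto
    have "eqop V (rep (T D)) (rep (a *\<^sub>R D + b *\<^sub>R U D))"
      using T_lop_rep[OF T L D] T_lop_rep[OF U LU D] ab[OF rep_dopl[OF D]] rep_add[OF s] rep_scaleR[OF D, of a] rep_scaleR[OF UD, of b]
      by (simp add: eqop_def)
    then show ?thesis using rep_eqN[OF _ sum] invariantD(1)[OF T D] by blast
  qed
  then show ?thesis by blast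
qed

lemma lop_test:
  assumes "Q \<in> dopl (Suc k)"
  shows "lop Q (lf f) (chart_inv c y0) = ev (Q f) y0"
  using eqopD[OF rep_lop[OF assms] V(5), of f] ev_rep_V[OF lop_diff_ops[OF assms] V(5), of f] by simp

end

context mfdp
begin

text \<open>Each value works on a neighbourhood, and uniqueness forces nearby points to have the
  same one; on a connected space it is then constant.\<close>

lemma locally_constant_coefficients:
  fixes P :: "'a => 'b => bool"
  assumes ex: "\<And>x. \<exists>v N. open N \<and> x \<in> N \<and> (\<forall>y\<in>N. P y v)" and un: "\<And>x v v'. P x v ==> P x v' ==> v = v'"
  shows "\<exists>v. \<forall>x. P x v"
proof -
  obtain v where v: "\<And>x. \<exists>N. open N \<and> x \<in> N \<and> (\<forall>y\<in>N. P y (v x))" using ex by metis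
  have "connected (UNIV :: 'a set)" using M by (simp only: smooth_manifold_def)
  moreover have "eventually (\<lambda>y. v x = v y) (at x)" for x
  proof -
    obtain N where N: "open N" "x \<in> N" "\<forall>y\<in>N. P y (v x)" using v[of x] by (elim exE conjE) (rule that)
    have "v x = v y" if "y \<in> N" for y
    proof -
      obtain N' where "open N' \<and> y \<in> N' \<and> (\<forall>z\<in>N'. P z (v y))" using v[of y] by (rule exE)
      then have "P y (v y)" by (elim conjE) (erule bspec)
      then show ?thesis by (rule un[OF N(3)[rule_format, OF that]])
    qed
    then show ?thesis unfolding eventually_at_topological by (intro exI[of _ N] conjI ballI impI N(1,2))
  qed
  ultimately have "v x = v y" for x y using connected_local_const[of UNIV x y v] by simp
  moreover have "P x (v x)" for x
  proof -
    obtain N where "open N \<and> x \<in> N \<and> (\<forall>z\<in>N. P z (v x))" using v[of x] by (rule exE)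
    then show ?thesis by (elim conjE) (erule bspec)
  qed
  ultimately have "P x (v undefined)" for x by metis
  then show ?thesis by blast
qed

lemma point_loc: "\<exists>c y0 R kap. loc A p c y0 R kap \<and> x = chart_inv c y0 \<and> chart_inv c ` cball y0 R \<subseteq> N"
  if N: "open N" "x \<in> N"
proof -
  obtain R kap where l: "loc A p (at_chart x) (chart_map (at_chart x) x) R kap" "chart_inv (at_chart x) ` cball (chart_map (at_chart x) x) R \<subseteq> N"
    using loc_exists[OF chart_at N] by blast
  have "x = chart_inv (at_chart x) (chart_map (at_chart x) x)" using chart_at by (simp add: chart_props)
  then show ?thesis using l by blast
qed

theorem global_classification_0:
  assumes T: "T \<in> invariant_maps A 0 p p" and L: "local_map 0 T" and dim: "DIM('e) \<ge> 2"
  shows "\<exists>a. \<forall>D\<in>diff_ops A 0 p. T D = a *\<^sub>R D"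
proof -
  let ?P = "\<lambda>x a. \<exists>N. open N \<and> x \<in> N \<and> (\<forall>D\<in>diff_ops A 0 p. eqN N (T D) (a *\<^sub>R D))"
  have "\<exists>a. \<forall>x. ?P x a"
  proof (rule locally_constant_coefficients)
    fix x
    obtain c y0 R kap where l: "loc A p c y0 R kap" "x = chart_inv c y0" using point_loc[of UNIV x] by auto
    interpret loc A p c y0 R kap by (rule l)
    obtain a where "\<forall>D\<in>diff_ops A 0 p. eqN NV (T D) (a *\<^sub>R D)" using local_classification_0[OF T L dim] by blast
    then show "\<exists>a N. open N \<and> x \<in> N \<and> (\<forall>y\<in>N. ?P y a)"
      using NV_open NV_y0 l(2) by blast
  next
    fix x a b assume "?P x a" "?P x b"
    then obtain N N' where N: "x \<in> N" "\<forall>D\<in>diff_ops A 0 p. eqN N (T D) (a *\<^sub>R D)"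
      "x \<in> N'" "\<forall>D\<in>diff_ops A 0 p. eqN N' (T D) (b *\<^sub>R D)" by blast
    obtain c y0 R kap where l: "loc A p c y0 R kap" "x = chart_inv c y0" using point_loc[of UNIV x] by auto
    interpret loc A p c y0 R kap by (rule l)
    obtain i :: 'e where i: "i \<in> Basis" by (meson SOME_Basis)
    have id: "(\<lambda>f::'e sfun. f) \<in> dopl (Suc 0)" using dpw_dopl[OF i, of 0 "Suc 0"] by (simp add: dpw_def id_def)
    have D: "lop (\<lambda>f. f) \<in> diff_ops A 0 p" by (rule lop_diff_ops[OF id])
    have "lop (\<lambda>f. f) (lf 1) x = 1" using lop_test[OF id, of 1] l by simp
    then show "a = b" using N D lf_forms[of 1] by (fastforce simp: eqN_def)
  qed
  then obtain a where a: "\<And>x. ?P x a" by blast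
  have "T D \<omega> x = (a *\<^sub>R D) \<omega> x" if D: "D \<in> diff_ops A 0 p" for D \<omega> x
  proof (cases "\<omega> \<in> forms A p")
    case True
    then show ?thesis using a[of x] D by (auto simp: eqN_def)
  next
    case False
    then show ?thesis using invariantD(1)[OF T D] diff_ops_off diff_ops_off[OF D] by fastforce
  qed
  then show ?thesis by (intro exI[of _ a] ballI ext)
qed

theorem global_classification:
  assumes T: "T \<in> invariant_maps A k p p" and L: "local_map k T" and dim: "DIM('e) \<ge> 2" and k: "k \<ge> 1"
    and UI: "U \<in> invariant_maps A k p p" and LU: "local_map k U" and nu: "\<nu> \<noteq> 1"
    and U0: "\<And>c y0 R kap. loc A p c y0 R kap ==> eqN (loc.NV c y0 R) (U (loc.lop A p c kap (\<lambda>f. f))) (loc.lop A p c kap (\<lambda>f. f))"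
    and U1: "\<And>c y0 R kap i. loc A p c y0 R kap ==> i \<in> Basis ==>
      eqN (loc.NV c y0 R) (U (loc.lop A p c kap (dv i))) (\<nu> *\<^sub>R loc.lop A p c kap (dv i))"
  shows "\<exists>a b. \<forall>D\<in>diff_ops A k p. T D = a *\<^sub>R D + b *\<^sub>R U D"
proof -
  let ?P = "\<lambda>x (a, b). \<exists>N. open N \<and> x \<in> N \<and> (\<forall>D\<in>diff_ops A k p. eqN N (T D) (a *\<^sub>R D + b *\<^sub>R U D))"
  obtain i :: 'e where i: "i \<in> Basis" by (meson SOME_Basis)
  have "\<exists>ab. \<forall>x. ?P x ab"
  proof (rule locally_constant_coefficients)
    fix x
    obtain c y0 R kap where l: "loc A p c y0 R kap" "x = chart_inv c y0" using point_loc[of UNIV x] by auto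
    interpret loc A p c y0 R kap by (rule l)
    obtain a b where "\<forall>D\<in>diff_ops A k p. eqN NV (T D) (a *\<^sub>R D + b *\<^sub>R U D)"
      using local_classification[OF T L dim k UI LU i U0[OF l(1)] U1[OF l(1) i] nu] by blast
    then show "\<exists>ab N. open N \<and> x \<in> N \<and> (\<forall>y\<in>N. ?P y ab)"
      using NV_open NV_y0 l(2) by (intro exI[of _ "(a, b)"] exI[of _ NV]) auto
  next
    fix x and ab ab' :: "real \<times> real" assume P: "?P x ab" "?P x ab'"
    obtain a b a' b' where ab: "ab = (a, b)" "ab' = (a', b')" by fastforce
    obtain N N' where N: "x \<in> N" "\<And>D. D \<in> diff_ops A k p ==> eqN N (T D) (a *\<^sub>R D + b *\<^sub>R U D)"
      "x \<in> N'" "\<And>D. D \<in> diff_ops A k p ==> eqN N' (T D) (a' *\<^sub>R D + b' *\<^sub>R U D)" using P ab by auto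
    obtain c y0 R kap where l: "loc A p c y0 R kap" "x = chart_inv c y0" using point_loc[of UNIV x] by auto
    interpret loc A p c y0 R kap by (rule l)
    have xN: "x \<in> NV" using NV_y0 l by simp
    have id: "(\<lambda>f::'e sfun. f) \<in> dopl (Suc k)" using dpw_dopl[OF i, of 0 "Suc k"] by (simp add: dpw_def id_def)
    have d1: "dpw i (Suc 0) = dv i" by (rule ext) simp
    have di: "dv i \<in> dopl (Suc k)" using dpw_dopl[OF i, of "Suc 0" "Suc k"] k by (simp add: d1)
    have eq: "a * D \<omega> x + b * U D \<omega> x = a' * D \<omega> x + b' * U D \<omega> x" if D: "D \<in> diff_ops A k p" and w: "\<omega> \<in> forms A p" for D \<omega>
    proof -
      have "T D \<omega> x = (a *\<^sub>R D + b *\<^sub>R U D) \<omega> x" "T D \<omega> x = (a' *\<^sub>R D + b' *\<^sub>R U D) \<omega> x"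
        using N(2,4)[OF D] w N(1,3) unfolding eqN_def by blast+
      then show ?thesis by simp
    qed
    \<comment> \<open>The identity on the lift of 1 and \<partial>_i on the lift of x_i read off
      \<open>a + b\<close> and \<open>a + b * \<nu>\<close>, which determine the
      coefficients.\<close>
    have v0: "lop (\<lambda>f. f) (lf 1) x = 1" using lop_test[OF id, of 1] l by simp
    have "U (lop (\<lambda>f. f)) (lf 1) x = lop (\<lambda>f. f) (lf 1) x" using U0[OF l(1)] xN lf_forms unfolding eqN_def by blast
    then have 1: "a + b = a' + b'" using eq[OF lop_diff_ops[OF id] lf_forms[of 1]] v0 by simp
    have v1: "lop (dv i) (lf (xc i)) x = 1" using lop_test[OF di, of "xc i"] l i by (simp add: dv_xc_Basis)
    have "U (lop (dv i)) (lf (xc i)) x = (\<nu> *\<^sub>R lop (dv i)) (lf (xc i)) x" using U1[OF l(1) i] xN lf_forms unfolding eqN_def by blast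
    then have 2: "a + b * \<nu> = a' + b' * \<nu>" using eq[OF lop_diff_ops[OF di] lf_forms[of "xc i"]] v1 by simp
    have "(b - b') * (\<nu> - 1) = 0" using 1 2 by (simp add: algebra_simps)
    then have "b = b'" using nu by simp
    then show "ab = ab'" using 1 ab by simp
  qed
  then obtain ab where ab: "\<forall>x. ?P x ab" by (rule exE)
  obtain a b where "ab = (a, b)" by (cases ab)
  then have a: "?P x (a, b)" for x using ab by simp
  have "T D \<omega> x = (a *\<^sub>R D + b *\<^sub>R U D) \<omega> x" if D: "D \<in> diff_ops A k p" for D \<omega> x
  proof (cases "\<omega> \<in> forms A p")
    case True
    obtain N where "x \<in> N" "eqN N (T D) (a *\<^sub>R D + b *\<^sub>R U D)" using a[of x] D by auto
    then show ?thesis using True unfolding eqN_def by blast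
  next
    case False
    obtain l l' where "T D \<in> diff_ops A l p" "U D \<in> diff_ops A l' p" using invariantD(1)[OF T D] invariantD(1)[OF UI D] by blast
    then show ?thesis using diff_ops_off[OF D False] diff_ops_off False by simp
  qed
  then show ?thesis by (intro exI[of _ a] exI[of _ b] ballI ext)
qed

lemma local_map_top:
  assumes T: "T \<in> invariant_maps A k p p" and top: "p \<noteq> 0"
  shows "local_map k T"
proof (rule local_mapI[OF T])
  fix D N x assume D: "D \<in> diff_ops A k p" and N: "open N" "eqN N D 0" and x: "x \<in> N"
  obtain c y0 R kap where l: "loc A p c y0 R kap" "x = chart_inv c y0" "chart_inv c ` cball y0 R \<subseteq> N" using point_loc[OF N(1) x] by auto
  interpret loc A p c y0 R kap by (rule l)
  have KN: "K \<subseteq> N" using l by (simp add: K_def)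
  have w1: "w = 1" using top by (simp add: w_def)
  obtain i :: 'e where i: "i \<in> Basis" by (meson SOME_Basis)
  obtain m where TD: "T D \<in> diff_ops A m p" using invariantD(1)[OF T D] by blast
  have "eqop V (rep (T D)) (\<lambda>f. 0)"
    by (rule invariant_operator_w1[OF i rep_dopl[OF TD]]) (use vanishing_rep_invariant[OF T D N KN i] w1 in simp)
  then have "eqop V (rep (T D)) (rep 0)" using rep_zero by (simp add: eqop_def)
  then show "\<exists>N'. x \<in> N' \<and> eqN N' (T D) 0" using rep_eqN[OF TD diff_ops_zero[of 0]] NV_y0 l(2) by blast
qed

end

section \<open>Integration over chart domains\<close>

lemma set_integrable_compact_support:
  fixes h :: "'e::euclidean_space => real"
  assumes h: "continuous_on U h" and K: "compact K" "K \<subseteq> U" "\<And>y. y \<in> U ==> y \<notin> K ==> h y = 0"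
  shows "set_integrable lborel U h"
proof -
  have "integrable lborel (\<lambda>y. indicator K y *\<^sub>R h y)"
    by (intro borel_integrable_compact K continuous_on_subset[OF h])
  moreover have "indicator K y *\<^sub>R h y = indicator U y *\<^sub>R h y" for y
    using K by (auto simp: indicator_def)
  ultimately show ?thesis by (simp only: set_integrable_def)
qed

lemma set_integral_derivative_zero:
  fixes h :: "'e::euclidean_space => real"
  assumes U: "open U" and h: "smooth_on U h" and K: "compact K" "K \<subseteq> U" "\<And>y. y \<in> U ==> y \<notin> K ==> h y = 0"
  shows "(LINT y:U|lborel. fd h y v) = 0"
proof -
  let ?g = "\<lambda>y. if y \<in> U then h y else 0"
  have g: "smooth_on UNIV ?g"
  proof (rule smooth_on_extend_zero[OF U h])
    fix y assume "y \<notin> U"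
    then show "\<exists>N. open N \<and> y \<in> N \<and> (\<forall>z\<in>N \<inter> U. h z = 0)"
      using K by (intro exI[of _ "- K"]) (auto simp: open_Compl compact_imp_closed)
  qed
  have "indicator U y *\<^sub>R fd h y v = fd ?g y v" for y
  proof (cases "y \<in> U")
    case True
    have "fd ?g y = fd h y"
      by (rule fd_cong[OF U True]) simp
    then show ?thesis using True by simp
  next
    case False
    have "fd ?g y = fd (\<lambda>_. 0) y"
      by (rule fd_cong[of "- K"]) (use K False in \<open>auto simp: open_Compl compact_imp_closed\<close>)
    then show ?thesis using False by simp
  qed
  moreover have "(LINT y|lborel. fd ?g y v) = 0"
    by (rule integral_derivative_zero[OF g, of K]) (use K in \<open>auto simp: compact_imp_bounded\<close>)
  ultimately show ?thesis by (simp add: set_lebesgue_integral_def)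
qed

lemma set_integral_sum_lborel:
  fixes f :: "'i => 'e::euclidean_space => real"
  assumes "finite I" "\<And>i. i \<in> I ==> set_integrable lborel U (f i)"
  shows "(LINT y:U|lborel. \<Sum>i\<in>I. f i y) = (\<Sum>i\<in>I. LINT y:U|lborel. f i y)"
  using assms(2) unfolding set_lebesgue_integral_def set_integrable_def scaleR_sum_right by (rule Bochner_Integration.integral_sum)

text \<open>The divergence of the compactly supported field \<phi> F X has integral zero.\<close>

lemma integrate_by_parts:
  fixes \<phi> F :: "'e::euclidean_space => real"
  assumes U: "open U" and \<phi>: "smooth_on U \<phi>" and X: "smooth_on U X" and F: "smooth_on U F"
    and K: "compact K" "K \<subseteq> U" "\<And>y. y \<in> U ==> y \<notin> K ==> F y = 0"
  shows "(LINT y:U|lborel. fd \<phi> y (X y) * F y) =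
    - (LINT y:U|lborel. \<phi> y * (fd F y (X y) + (\<Sum>b\<in>Basis. fd X y b \<bullet> b) * F y))"
proof -
  let ?D = "\<lambda>f y. fd f y"
  have DF0: "?D F y v = 0" if "y \<in> U" "y \<notin> K" for y v
  proof -
    have "?D F y = ?D (\<lambda>_. 0) y"
      by (rule fd_cong[of "U - K"]) (use U K that in \<open>auto simp: open_Diff compact_imp_closed\<close>)
    then show ?thesis by simp
  qed
  have Xb: "smooth_on U (\<lambda>y. X y \<bullet> b)" for b by (intro smooth_on_inner U X smooth_on_const)
  let ?h = "\<lambda>b y. \<phi> y * (F y * (X y \<bullet> b))"
  have h: "smooth_on U (?h b)" for b by (intro smooth_on_mult U \<phi> F Xb)
  have Dh: "?D (?h b) y b = (X y \<bullet> b) * ?D \<phi> y b * F y + \<phi> y * ((X y \<bullet> b) * ?D F y b + (?D X y b \<bullet> b) * F y)" if y: "y \<in> U" for b y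
  proof -
    have s: "smooth_on U (\<lambda>y. F y * (X y \<bullet> b))" by (intro smooth_on_mult U F Xb)
    show ?thesis
      using fd_mult[OF \<phi> s y, of b] fd_mult[OF F Xb y, of b b]
        fd_inner[OF smooth_on_imp_differentiable[OF X y], of b b]
      by (simp add: algebra_simps)
  qed
  let ?L = "\<lambda>y. ?D \<phi> y (X y) * F y" and ?M = "\<lambda>y. \<phi> y * (?D F y (X y) + (\<Sum>b\<in>Basis. ?D X y b \<bullet> b) * F y)"
  have "(LINT y:U|lborel. \<Sum>b\<in>Basis. ?D (?h b) y b) = (\<Sum>b\<in>Basis. LINT y:U|lborel. ?D (?h b) y b)"
  proof (rule set_integral_sum_lborel[OF finite_Basis], rule set_integrable_compact_support[OF _ K(1,2)])
    show "continuous_on U (\<lambda>y. ?D (?h b) y b)" for b by (intro smooth_on_imp_continuous_on smooth_on_fd h)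
    show "?D (?h b) y b = 0" if "y \<in> U" "y \<notin> K" for y b using Dh[OF that(1), of b] K(3)[OF that] DF0[OF that] by simp
  qed
  also have "\<dots> = 0" using set_integral_derivative_zero[OF U h K(1,2)] K(3) by simp
  also have "(LINT y:U|lborel. \<Sum>b\<in>Basis. ?D (?h b) y b) = (LINT y:U|lborel. ?L y + ?M y)"
  proof (rule set_lebesgue_integral_cong)
    show "U \<in> sets lborel" using U by simp
    show "\<forall>y. y \<in> U \<longrightarrow> (\<Sum>b\<in>Basis. ?D (?h b) y b) = ?L y + ?M y"
    proof (intro allI impI)
      fix y assume y: "y \<in> U"
      have 1: "?D \<phi> y (X y) = (\<Sum>b\<in>Basis. (X y \<bullet> b) * ?D \<phi> y b)" using fd_apply_sum[OF \<phi> y, of "X y"] by simp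
      have 2: "?D F y (X y) = (\<Sum>b\<in>Basis. (X y \<bullet> b) * ?D F y b)" using fd_apply_sum[OF F y, of "X y"] by simp
      have "(\<Sum>b\<in>Basis. ?D (?h b) y b) = (\<Sum>b\<in>Basis. (X y \<bullet> b) * ?D \<phi> y b * F y + \<phi> y * ((X y \<bullet> b) * ?D F y b + (?D X y b \<bullet> b) * F y))"
        by (simp only: Dh[OF y])
      then show "(\<Sum>b\<in>Basis. ?D (?h b) y b) = ?L y + ?M y"
        by (simp only: 1 2 sum.distrib sum_distrib_left[symmetric] sum_distrib_right[symmetric])
    qed
  qed
  also have "\<dots> = (LINT y:U|lborel. ?L y) + (LINT y:U|lborel. ?M y)"
  proof (rule set_integral_add; rule set_integrable_compact_support[OF _ K(1,2)])
    show "continuous_on U ?L" by (intro smooth_on_imp_continuous_on smooth_on_mult smooth_on_fd_apply U \<phi> X F)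
    show "continuous_on U ?M"
      by (intro smooth_on_imp_continuous_on smooth_on_mult smooth_on_add smooth_on_sum smooth_on_inner smooth_on_const
          smooth_on_fd smooth_on_fd_apply U \<phi> X F)
  qed (use K(3) DF0 in auto)
  finally show ?thesis by simp
qed

lemma iter_deriv_support:
  assumes "open U" "compact K" "\<And>y. y \<in> U ==> y \<notin> K ==> F y = 0" "y \<in> U" "y \<notin> K"
  shows "iter_deriv \<alpha> F y = 0"
proof -
  have "iter_deriv \<alpha> F y = iter_deriv \<alpha> (\<lambda>_. 0 * 0) y"
    by (rule iter_deriv_cong[of "U - K"]) (use assms in \<open>auto simp: open_Diff compact_imp_closed\<close>)
  also have "\<dots> = 0" using iter_deriv_scale[of UNIV "\<lambda>_. 0" y \<alpha> 0] by simp
  finally show ?thesis .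
qed

text \<open>The outermost derivative of \<open>F\<close> is moved first and becomes the innermost
  one on \<open>\<phi>\<close>, whence \<open>rev\<close>.\<close>

lemma integrate_by_parts_iter:
  fixes \<phi> F :: "'e::euclidean_space => real"
  assumes U: "open U" and F: "smooth_on U F" and K: "compact K" "K \<subseteq> U" "\<And>y. y \<in> U ==> y \<notin> K ==> F y = 0"
  shows "smooth_on U \<phi> ==> (LINT y:U|lborel. iter_deriv \<alpha> F y * \<phi> y) = (-1) ^ length \<alpha> * (LINT y:U|lborel. F y * iter_deriv (rev \<alpha>) \<phi> y)"
proof (induction \<alpha> arbitrary: \<phi>)
  case (Cons v \<alpha>)
  let ?G = "iter_deriv \<alpha> F"
  have G: "smooth_on U ?G" "\<And>y. y \<in> U ==> y \<notin> K ==> ?G y = 0"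
    using smooth_on_iter_deriv[OF F] iter_deriv_support[OF U K(1,3)] by auto
  have "(LINT y:U|lborel. iter_deriv (v # \<alpha>) F y * \<phi> y) = - (LINT y:U|lborel. ?G y * fd \<phi> y v)"
    using integrate_by_parts[OF U Cons.prems smooth_on_const G(1) K(1,2) G(2), of v] by (simp add: mult.commute)
  also have "\<dots> = - ((-1) ^ length \<alpha> * (LINT y:U|lborel. F y * iter_deriv (rev \<alpha>) (\<lambda>y. fd \<phi> y v) y))"
    using Cons.IH[OF smooth_on_fd[OF Cons.prems]] by simp
  finally show ?case by (simp add: iter_deriv_append)
qed simp

lemma set_integral_pos:
  fixes h :: "'e::euclidean_space => real"
  assumes U: "open U" and h: "continuous_on U h" "set_integrable lborel U h" "\<And>y. y \<in> U ==> h y \<ge> 0" and y1: "y1 \<in> U" "h y1 > 0"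
  shows "(LINT y:U|lborel. h y) > 0"
proof -
  have "isCont h y1" using h(1) U y1 continuous_on_eq_continuous_at by blast
  then have "eventually (\<lambda>y. h y > h y1 / 2) (at y1)" using y1 by (intro order_tendstoD(1)[of _ "h y1"]) (auto simp: isCont_def)
  then obtain d where d: "d > 0" "\<And>y. y \<noteq> y1 ==> dist y y1 < d ==> h y > h y1 / 2" by (auto simp: eventually_at)
  obtain e where e: "e > 0" "ball y1 e \<subseteq> U" using U y1 open_contains_ball by blast
  let ?B = "ball y1 (min d e)"
  have B: "h y \<ge> h y1 / 2" "y \<in> U" if "y \<in> ?B" for y
  proof -
    show "y \<in> U" using that e by auto
    show "h y \<ge> h y1 / 2"
    proof (cases "y = y1")
      case False
      then show ?thesis using d(2)[OF False] that by (simp add: dist_commute less_imp_le)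
    qed (use y1 in simp)
  qed
  have fin: "emeasure lborel ?B < \<infinity>" by (rule emeasure_bounded_finite) simp
  have "0 < h y1 / 2 * measure lborel ?B"
    using y1 d e content_ball_pos[of "min d e" y1] by simp
  also have "\<dots> = (LINT y|lborel. h y1 / 2 * indicator ?B y)" using fin by simp
  also have "\<dots> \<le> (LINT y|lborel. indicator U y *\<^sub>R h y)"
  proof (rule integral_mono)
    show "integrable lborel (\<lambda>y. h y1 / 2 * indicator ?B y)" using fin by (intro integrable_mult_right integrable_real_indicator) auto
    show "integrable lborel (\<lambda>y. indicator U y *\<^sub>R h y)" using h(2) by (simp add: set_integrable_def)
    show "h y1 / 2 * indicator ?B y \<le> indicator U y *\<^sub>R h y" for y
      using B[of y] h(3)[of y] by (auto simp: indicator_def)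
  qed
  finally show ?thesis by (simp add: set_lebesgue_integral_def)
qed

section \<open>The formal adjoint in coordinates\<close>

definition adj :: "nat => ('e list => 'e => real) => ('e::euclidean_space => real) => 'e => real" where
  "adj k a g y = (\<Sum>\<alpha>\<in>mi k. (-1) ^ length \<alpha> * iter_deriv (rev \<alpha>) (\<lambda>z. a \<alpha> z * g z) y)"

lemma adj_dopU:
  assumes "open U" "\<And>\<alpha>. smooth_on U (a \<alpha>)"
  shows "adj k a \<in> dopU U k"
proof -
  have "(\<lambda>f y. (-1) ^ length \<alpha> * iter_deriv (rev \<alpha>) (\<lambda>z. a \<alpha> z * f z) y) \<in> dopU U k"
    if "set \<alpha> \<subseteq> Basis" "length \<alpha> < k" for \<alpha>
    using dopU_mult_right[OF dopU.monom[of "rev \<alpha>" k U "\<lambda>_. (-1) ^ length \<alpha>"] assms(1) assms(2)[of \<alpha>]] that by simp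
  then show ?thesis unfolding adj_def[abs_def] by (intro dopU_sum) simp
qed

lemma adj_integral:
  fixes F g :: "'e::euclidean_space => real"
  assumes U: "open U" and F: "smooth_on U F" and K: "compact K" "K \<subseteq> U" "\<And>y. y \<in> U ==> y \<notin> K ==> F y = 0"
    and a: "\<And>\<alpha>. smooth_on U (a \<alpha>)" and g: "smooth_on U g"
  shows "(LINT y:U|lborel. (\<Sum>\<alpha>\<in>mi k. a \<alpha> y * iter_deriv \<alpha> F y) * g y) =
    (LINT y:U|lborel. F y * adj k a g y)"
proof -
  let ?S = "(mi k :: 'e list set)"
  have ag: "smooth_on U (\<lambda>z. a \<alpha> z * g z)" for \<alpha> by (intro smooth_on_mult U a g)
  have "(LINT y:U|lborel. (\<Sum>\<alpha>\<in>?S. a \<alpha> y * iter_deriv \<alpha> F y) * g y) = (LINT y:U|lborel. \<Sum>\<alpha>\<in>?S. iter_deriv \<alpha> F y * (a \<alpha> y * g y))"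
    by (simp only: sum_distrib_right mult.commute[of "a _ _"] mult.assoc)
  also have "\<dots> = (\<Sum>\<alpha>\<in>?S. LINT y:U|lborel. iter_deriv \<alpha> F y * (a \<alpha> y * g y))"
    by (rule set_integral_sum_lborel[OF finite_multi_indices], rule set_integrable_compact_support[OF _ K(1,2)])
      (use iter_deriv_support[OF U K(1,3)] in \<open>auto intro!: smooth_on_imp_continuous_on smooth_on_mult smooth_on_iter_deriv U F a g\<close>)
  also have "\<dots> = (\<Sum>\<alpha>\<in>?S. LINT y:U|lborel. F y * ((-1) ^ length \<alpha> * iter_deriv (rev \<alpha>) (\<lambda>z. a \<alpha> z * g z) y))"
  proof (rule sum.cong[OF refl])
    fix \<alpha>
    show "(LINT y:U|lborel. iter_deriv \<alpha> F y * (a \<alpha> y * g y)) = (LINT y:U|lborel. F y * ((-1) ^ length \<alpha> * iter_deriv (rev \<alpha>) (\<lambda>z. a \<alpha> z * g z) y))"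
      using integrate_by_parts_iter[OF U F K ag[of \<alpha>], of \<alpha>] by (simp only: mult.left_commute[of "F _"] set_integral_mult_right) simp
  qed
  also have "\<dots> = (LINT y:U|lborel. \<Sum>\<alpha>\<in>?S. F y * ((-1) ^ length \<alpha> * iter_deriv (rev \<alpha>) (\<lambda>z. a \<alpha> z * g z) y))"
    by (rule set_integral_sum_lborel[OF finite_multi_indices, symmetric], rule set_integrable_compact_support[OF _ K(1,2)])
      (use K(3) in \<open>auto intro!: smooth_on_imp_continuous_on smooth_on_mult smooth_on_iter_deriv U F ag smooth_on_const\<close>)
  also have "\<dots> = (LINT y:U|lborel. F y * adj k a g y)" by (simp add: adj_def sum_distrib_left)
  finally show ?thesis .
qed

section \<open>Conjugation\<close>

context loc
begin

definition "lfun h x = (if x \<in> chart_dom c then kp x * ev h (chart_map c x) else 0)"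

text \<open>\<open>kap\<close> is 1 on \<open>V\<close>, and support in the quarter ball keeps a
  distance from the boundary of \<open>V\<close>; hence lifting such functions involves no cutoff
  error.\<close>

definition "small u \<longleftrightarrow> (\<forall>z. z \<notin> cball y0 (R/4) \<longrightarrow> ev u z = 0)"

lemma small_subset: "cball y0 (R/4) \<subseteq> V" "cball y0 (R/4) \<subseteq> chart_img c"
  using R V(4) by (auto simp: V_def)

lemma small_dv: "small u ==> small (dv v u)"
  unfolding small_def
proof (intro allI impI)
  fix z assume u: "\<forall>z. z \<notin> cball y0 (R/4) \<longrightarrow> ev u z = 0" and z: "z \<notin> cball y0 (R/4)"
  have "fd (ev u) z = fd (\<lambda>_. 0) z"
    by (rule fd_cong[of "- cball y0 (R/4)"]) (use u z in \<open>auto simp: open_Compl\<close>)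
  then show "ev (dv v u) z = 0" by (simp add: dv.rep_eq)
qed

lemma small_ds: "small u ==> small (ds \<alpha> u)"
  by (induction \<alpha>) (auto simp: small_dv)

lemma co_lf_small: "small u ==> y \<in> chart_img c ==> co c (lf u) y = ev u y"
  using small_subset kap_V by (cases "y \<in> cball y0 (R/4)") (auto simp: co_lf small_def)

lemma smooth_lfun: "lfun h \<in> smooth_functions A"
proof (rule smooth_functions_supported[OF c K(1,2)])
  show "lfun h x = 0" if "x \<notin> K" for x using K(3)[OF that] by (simp add: lfun_def)
  show "smooth_on (chart_img c) (\<lambda>y. lfun h (chart_inv c y))"
    by (rule smooth_on_cong[OF U _ smooth_on_mult[OF U smooth_ev[of _ kap] smooth_ev[of _ h]]]) (simp add: lfun_def kp_ci chart_props c)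
qed

lemma lf_off: "x \<notin> chart_dom c ==> lf u x = (\<lambda>vs. 0)"
  by (rule ext) (simp add: lf_def mkform_def)

text \<open>On \<open>V\<close> the field is \<partial>_j, with divergence zero, and off the quarter
  ball both sides vanish. The identity thus holds on the whole manifold and can be used in every
  chart.\<close>

lemma lie_form_lf:
  assumes u: "small u" and j: "j \<in> Basis"
  shows "lie_form A (lfield 1 j) (lf u) = lf (dv j u)"
proof
  fix x
  let ?X = "lfield 1 j" let ?D = "\<lambda>f y. fd f y"
  have L: "lie_form A ?X (lf u) \<in> forms A p" by (rule lie_form_forms[OF lf_forms lfield])
  show "lie_form A ?X (lf u) x = lf (dv j u) x"
  proof (cases "x \<in> chart_dom c")
    case True
    let ?y = "chart_map c x"
    have yU: "?y \<in> chart_img c" using True by simp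
    have "co c (lie_form A ?X (lf u)) ?y = ev (dv j u) ?y"
    proof (cases "?y \<in> cball y0 (R/4)")
      case in_ball: True
      then have y: "?y \<in> V" using small_subset by auto
      have Xc: "vf_in_chart A c ?X z = j" if "z \<in> V" for z using vf_lfield[of z 1 j] that V(4) kap_V by auto
      have "?D (co c (lf u)) ?y = ?D (ev u) ?y"
        by (rule fd_cong[OF V(1) y]) (rule co_lf_V)
      moreover have "?D (vf_in_chart A c ?X) ?y = ?D (\<lambda>_. j) ?y"
        by (rule fd_cong[OF V(1) y]) (rule Xc)
      ultimately show ?thesis
        by (simp add: co_lie_form[OF lf_forms lfield c yU] lco_def Xc[OF y] dvg_def dv.rep_eq)
    next
      case False
      let ?N = "chart_img c - cball y0 (R/4)"
      have z: "co c (lf u) z = 0" if "z \<in> ?N" for z using that u co_lf_small[OF u] by (simp add: small_def)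
      have "?D (co c (lf u)) ?y = ?D (\<lambda>_. 0) ?y"
        by (rule fd_cong[of ?N]) (use U False yU z in \<open>auto intro: open_Diff\<close>)
      then show ?thesis using small_dv[OF u, of j] False yU z
        by (simp add: co_lie_form[OF lf_forms lfield c yU] lco_def small_def)
    qed
    then have "co c (lie_form A ?X (lf u)) ?y = co c (lf (dv j u)) ?y"
      using co_lf_small[OF small_dv[OF u] yU] by simp
    then show ?thesis by (rule form_eqI[OF L lf_forms c True])
  next
    case False
    then have x: "x \<in> - K" using K by auto
    have "lie_form A ?X (lf u) x vs = 0" for vs
      by (rule lie_form_zero[OF lf_forms lfield K(4) _ x]) (use lfield_off in auto)
    then show ?thesis using lf_off[OF False] by auto
  qed
qed

lemma co_lf_support: "small u ==> c' \<in> A ==> y \<in> chart_img c' ==>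
    co c' (lf u) y = (if chart_inv c' y \<in> chart_dom c then J c' c y * ev u (tr c' c y) else 0)"
proof -
  assume u: "small u" and c': "c' \<in> A" "y \<in> chart_img c'"
  show ?thesis
  proof (cases "chart_inv c' y \<in> chart_dom c")
    case True
    then have "y \<in> cset c' (chart_dom c)" using c' by (simp add: cset_def)
    then show ?thesis using co_tr'[OF lf_forms c'(1) c, of y u] co_lf_small[OF u] True by simp
  qed (simp add: co_def form_in_chart_eq lf_off)
qed

lemma support_compact:
  assumes "c' \<in> A" "K \<subseteq> chart_dom c'"
  shows "compact (chart_map c' ` K)" "chart_map c' ` K \<subseteq> chart_img c'"
proof -
  show "compact (chart_map c' ` K)"
    by (rule compact_continuous_image[OF continuous_on_subset[OF chart_props(4)[OF assms(1)] assms(2)] K(1)])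
  show "chart_map c' ` K \<subseteq> chart_img c'" using assms by auto
qed

lemma co_lf_outside:
  assumes "small u" "c' \<in> A" "y \<in> chart_img c'" "y \<notin> chart_map c' ` K"
  shows "co c' (lf u) y = 0"
proof (cases "chart_inv c' y \<in> chart_dom c")
  case True
  have "chart_inv c' y \<notin> K" using assms chart_props(6)[OF assms(2,3)] by (metis image_eqI)
  then have "tr c' c y \<notin> cball y0 R" using True c unfolding K_def by (metis chart_props(5) image_eqI)
  then have "tr c' c y \<notin> cball y0 (R/4)" using R by auto
  then show ?thesis using assms co_lf_support[OF assms(1-3)] by (simp add: small_def)
qed (simp add: co_lf_support[OF assms(1-3)])

text \<open>Integration by parts in \<open>c'\<close>, where the field \<partial>_j of
  \<open>c\<close> has variable components; its divergence there is absorbed by the Lie derivative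
  of the bump form. This takes the place of a change of variables.\<close>

lemma lf_integral_step:
  assumes top: "p \<noteq> 0" and u: "small u" and j: "j \<in> Basis" and c': "c' \<in> A" "K \<subseteq> chart_dom c'"
  shows "(LINT y:chart_img c'|lborel. co c' (lf (dv j u)) y * lfun h (chart_inv c' y)) =
    - (LINT y:chart_img c'|lborel. co c' (lf u) y * lfun (dv j h) (chart_inv c' y))"
proof -
  let ?U = "chart_img c'" let ?X = "lfield 1 j" let ?D = "\<lambda>f y. fd f y"
  let ?F = "co c' (lf u)" and ?\<phi> = "\<lambda>y. lfun h (chart_inv c' y)" and ?Xc = "vf_in_chart A c' (lfield 1 j)"
  have U': "open ?U" by (rule chart_props(2)[OF c'(1)])
  have "(LINT y:?U|lborel. ?D ?\<phi> y (?Xc y) * ?F y) =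
    - (LINT y:?U|lborel. ?\<phi> y * (?D ?F y (?Xc y) + (\<Sum>b\<in>Basis. ?D ?Xc y b \<bullet> b) * ?F y))"
    by (rule integrate_by_parts[OF U' smooth_functionsD[OF smooth_lfun c'(1)] vector_fieldsD[OF lfield c'(1)] formsD(2)[OF lf_forms c'(1)]
          support_compact[OF c'] co_lf_outside[OF u c'(1)]])
  moreover have "?D ?F y (?Xc y) + (\<Sum>b\<in>Basis. ?D ?Xc y b \<bullet> b) * ?F y = co c' (lf (dv j u)) y" if "y \<in> ?U" for y
  proof -
    have "dvg p (?D ?Xc y) = (\<Sum>b\<in>Basis. ?D ?Xc y b \<bullet> b)" using p top dvg_top by auto
    then show ?thesis using co_lie_form[OF lf_forms[of u] lfield[of 1 j] c'(1) that] lie_form_lf[OF u j] by (simp add: lco_def)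
  qed
  moreover have "?D ?\<phi> y (?Xc y) * ?F y = ?F y * lfun (dv j h) (chart_inv c' y)" if y: "y \<in> ?U" for y
  proof (cases "?F y = 0")
    case False
    then have x: "chart_inv c' y \<in> chart_dom c" and z: "tr c' c y \<in> cball y0 (R/4)"
      using co_lf_support[OF u c'(1) y] u by (auto simp: small_def split: if_splits)
    let ?z = "tr c' c y"
    have zV: "?z \<in> V" using z small_subset by auto
    then have zU: "?z \<in> chart_img c" using V by auto
    have xz: "chart_inv c ?z = chart_inv c' y" using x c by (simp add: chart_props)
    have "?D ?\<phi> y (?Xc y) = lie_function A ?X (lfun h) (chart_inv c' y)"
      using lie_function_chart[OF smooth_lfun c'(1) y] by simp
    also have "\<dots> = ?D (\<lambda>z. lfun h (chart_inv c z)) ?z (vf_in_chart A c ?X ?z)"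
      using lie_function_chart[OF smooth_lfun c zU, of ?X] xz by simp
    also have "?D (\<lambda>z. lfun h (chart_inv c z)) ?z = ?D (ev h) ?z"
    proof (rule fd_cong[OF V(1) zV])
      fix v assume v: "v \<in> V"
      then have "v \<in> chart_img c" using V(4) by blast
      then show "lfun h (chart_inv c v) = ev h v" using kap_V[OF v] c by (simp add: lfun_def kp_ci chart_props)
    qed
    also have "vf_in_chart A c ?X ?z = j" using vf_lfield[OF zU, of 1 j] kap_V[OF zV] by simp
    also have "?D (ev h) ?z j = lfun (dv j h) (chart_inv c' y)"
      using x kap_V[OF zV] by (simp add: lfun_def kp_def dv.rep_eq)
    finally show ?thesis by simp
  qed simp
  ultimately show ?thesis
    using set_lebesgue_integral_cong[of ?U lborel "\<lambda>y. ?D ?\<phi> y (?Xc y) * ?F y" "\<lambda>y. ?F y * lfun (dv j h) (chart_inv c' y)"]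
      set_lebesgue_integral_cong[of ?U lborel "\<lambda>y. ?\<phi> y * (?D ?F y (?Xc y) + (\<Sum>b\<in>Basis. ?D ?Xc y b \<bullet> b) * ?F y)"
        "\<lambda>y. co c' (lf (dv j u)) y * lfun h (chart_inv c' y)"] U'
    by (simp add: mult.commute)
qed

lemma lf_integral_iter:
  assumes top: "p \<noteq> 0" and u: "small u" and c': "c' \<in> A" "K \<subseteq> chart_dom c'"
  shows "set \<alpha> \<subseteq> Basis ==> (LINT y:chart_img c'|lborel. co c' (lf (ds \<alpha> u)) y * lfun h (chart_inv c' y)) =
    (-1) ^ length \<alpha> * (LINT y:chart_img c'|lborel. co c' (lf u) y * lfun (ds (rev \<alpha>) h) (chart_inv c' y))"
proof (induction \<alpha> arbitrary: h)
  case (Cons v \<alpha>)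
  then show ?case using lf_integral_step[OF top small_ds[OF u] _ c', of v \<alpha> h] by (simp add: ds_append)
qed simp

text \<open>\<open>\<phi>\<close> is controlled on the overlap of the charts only; off the compact
  image of \<open>K\<close> the product vanishes.\<close>

lemma lf_continuous:
  assumes c': "c' \<in> A" "K \<subseteq> chart_dom c'" and \<phi>: "continuous_on (cset c' (chart_dom c)) (\<lambda>y. \<phi> (chart_inv c' y))" and u: "small u"
  shows "continuous_on (chart_img c') (\<lambda>y. co c' (lf u) y * \<phi> (chart_inv c' y))" (is "continuous_on ?U ?h")
proof (rule continuous_at_imp_continuous_on, rule ballI)
    fix y assume y: "y \<in> ?U"
    have o: "open (cset c' (chart_dom c))" "open ?U" by (rule cset_open[OF c'(1) chart_props(1)[OF c]], rule chart_props(2)[OF c'(1)])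
    have o3: "open (?U - (chart_map c' ` K))" by (rule open_Diff[OF o(2) compact_imp_closed[OF support_compact(1)[OF c']]])
    show "isCont ?h y"
    proof (cases "y \<in> (chart_map c' ` K)")
      case True
      then obtain x where x: "x \<in> K" "y = chart_map c' x" by blast
      then have "chart_inv c' y = x" using c' chart_props(5)[OF c'(1), of x] by blast
      then have "y \<in> cset c' (chart_dom c)" using y K(2) x by (auto simp: cset_def)
      moreover have "continuous_on (cset c' (chart_dom c)) ?h"
        by (intro continuous_on_mult \<phi> continuous_on_subset[OF smooth_on_imp_continuous_on[OF formsD(2)[OF lf_forms c'(1)]] cset_subset])
      ultimately show ?thesis using o continuous_on_eq_continuous_at by blast
    next
      case False
      have "continuous_on (?U - (chart_map c' ` K)) ?h"
        by (rule continuous_on_eq[of _ "\<lambda>_. 0"]) (use co_lf_outside[OF u c'(1)] in auto)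
      then show ?thesis using o3 False y continuous_on_eq_continuous_at by blast
    qed
  qed

lemma lf_integrable:
  assumes "c' \<in> A" "K \<subseteq> chart_dom c'" "continuous_on (cset c' (chart_dom c)) (\<lambda>y. \<phi> (chart_inv c' y))" "small u"
  shows "set_integrable lborel (chart_img c') (\<lambda>y. co c' (lf u) y * \<phi> (chart_inv c' y))"
  by (rule set_integrable_compact_support[OF lf_continuous[OF assms] support_compact[OF assms(1,2)]]) (simp add: co_lf_outside[OF assms(4,1)])

text \<open>The fundamental lemma of the calculus of variations, for bumps that are given in
  \<open>c\<close> and integrated in \<open>c'\<close>.\<close>

lemma test_zero:
  assumes c': "c' \<in> A" "K \<subseteq> chart_dom c'"
    and \<phi>: "continuous_on (cset c (chart_dom c')) (\<lambda>z. \<phi> (chart_inv c z))" "continuous_on (cset c' (chart_dom c)) (\<lambda>y. \<phi> (chart_inv c' y))"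
    and int: "\<And>u. small u ==> (LINT y:chart_img c'|lborel. co c' (lf u) y * \<phi> (chart_inv c' y)) = 0"
  shows "\<phi> (chart_inv c y0) = 0"
proof (rule ccontr)
  assume n0: "\<phi> (chart_inv c y0) \<noteq> 0"
  let ?W = "cset c (chart_dom c')" and ?U = "chart_img c'" and ?K = "chart_map c' ` K"
  have W: "open ?W" by (rule cset_open[OF c chart_props(1)[OF c'(1)]])
  have y0U: "y0 \<in> chart_img c" using V by auto
  have y0K: "chart_inv c y0 \<in> K" using R unfolding K_def by auto
  then have y0W: "y0 \<in> ?W" using c' y0U by (auto simp: cset_def)
  define \<psi> where "\<psi> z = J c' c (tr c c' z) * \<phi> (chart_inv c z)" for z
  have Jn: "J c' c (tr c c' z) \<noteq> 0" if "z \<in> ?W" for z using J_inverse[OF c c'(1) that] by auto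
  have Jc: "continuous_on ?W (\<lambda>z. J c' c (tr c c' z))"
    by (rule continuous_on_compose2[OF smooth_on_imp_continuous_on[OF J_smooth[OF c'(1) c]] smooth_on_imp_continuous_on[OF tr_smooth[OF c c'(1)]]])
      (use c c' in \<open>auto simp: cset_def chart_props\<close>)
  have "continuous_on ?W \<psi>" unfolding \<psi>_def by (intro continuous_on_mult Jc \<phi>)
  moreover have psi0: "\<psi> y0 \<noteq> 0" using Jn[OF y0W] n0 by (simp add: \<psi>_def)
  ultimately have "isCont \<psi> y0" using W y0W continuous_on_eq_continuous_at by blast
  then have "eventually (\<lambda>z. \<psi> z * \<psi> y0 > 0) (at y0)"
    using psi0 by (intro order_tendstoD(1)[of _ "\<psi> y0 * \<psi> y0"]) (auto simp: isCont_def intro!: tendsto_intros, metis not_real_square_gt_zero)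
  then obtain d where d: "d > 0" "\<And>z. z \<noteq> y0 ==> dist z y0 < d ==> \<psi> z * \<psi> y0 > 0" by (auto simp: eventually_at)
  define r where "r = min d (R/4)"
  have r: "r > 0" "r \<le> d" "r \<le> R/4" using d R by (auto simp: r_def)
  obtain \<kappa> where k: "smooth_on UNIV \<kappa>" "\<And>z. 0 \<le> \<kappa> z" "\<And>z. z \<in> cball y0 (r/2) ==> \<kappa> z = (1::real)" "\<And>z. z \<notin> ball y0 r ==> \<kappa> z = 0"
    using cutoff_exists[of "r/2" r y0] r(1) by auto
  define u where "u = Sfun \<kappa>"
  have eu: "ev u = \<kappa>" using k(1) by (simp add: u_def ev_Sfun)
  have u: "small u" unfolding small_def eu using k(4) r(3) by auto
  let ?h = "\<lambda>y. co c' (lf u) y * \<phi> (chart_inv c' y)"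
  have h: "?h y = (if chart_inv c' y \<in> chart_dom c then \<kappa> (tr c' c y) * \<psi> (tr c' c y) else 0)" if y: "y \<in> ?U" for y
  proof (cases "chart_inv c' y \<in> chart_dom c")
    case True
    then have "y \<in> cset c' (chart_dom c)" using y by (simp add: cset_def)
    then have "tr c c' (tr c' c y) = y" "chart_inv c (tr c' c y) = chart_inv c' y" using True c c' y by (auto simp: chart_props)
    then show ?thesis using True co_lf_support[OF u c'(1) y] by (simp add: \<psi>_def eu)
  qed (simp add: co_lf_support[OF u c'(1) y])
  have h0: "?h y = 0" if "y \<in> ?U" "y \<notin> ?K" for y using co_lf_outside[OF u c'(1) that] by simp
  have nn: "?h y * \<psi> y0 \<ge> 0" if y: "y \<in> ?U" for y
  proof -
    have "\<kappa> z * (\<psi> z * \<psi> y0) \<ge> 0" for z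
    proof (cases "z \<in> ball y0 r")
      case True
      then have "\<psi> z * \<psi> y0 \<ge> 0" using d(2)[of z] r by (cases "z = y0") (auto simp: dist_commute less_imp_le)
      then show ?thesis using k(2) by simp
    qed (simp add: k(4))
    then show ?thesis by (simp add: h[OF y] mult.assoc)
  qed
  let ?y1 = "tr c c' y0"
  have y1: "?y1 \<in> ?U" using y0W by (auto simp: cset_def)
  have "chart_inv c' ?y1 = chart_inv c y0" "chart_inv c y0 \<in> chart_dom c" using y0W c c' by (auto simp: cset_def chart_props)
  then have "?h ?y1 = \<psi> y0" using h[OF y1] k(3)[of y0] r y0U c by (simp add: chart_props)
  then have pos: "?h ?y1 * \<psi> y0 > 0" using psi0 by (metis not_real_square_gt_zero)
  have conth: "continuous_on ?U ?h" by (rule lf_continuous[OF c' \<phi>(2) u])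
  have U': "open ?U" by (rule chart_props(2)[OF c'(1)])
  have "(LINT y:?U|lborel. ?h y * \<psi> y0) > 0"
  proof (rule set_integral_pos[where h="\<lambda>y. ?h y * \<psi> y0", OF U' _ _ nn y1 pos])
    show c0: "continuous_on ?U (\<lambda>y. ?h y * \<psi> y0)" by (intro continuous_on_mult[OF conth] continuous_on_const)
    show "set_integrable lborel ?U (\<lambda>y. ?h y * \<psi> y0)"
      by (rule set_integrable_compact_support[OF c0 support_compact[OF c']]) (subst h0, simp_all)
  qed
  then show False using int[OF u] by simp
qed

text \<open>Makes the adjoints of two charts comparable: the adjoint is formed in \<open>c\<close>,
  the integrals are taken in \<open>c'\<close>, and the derivatives of \<open>c\<close> are moved by
  \<open>lf_integral_iter\<close>.\<close>

lemma adj_lf_integral: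
  assumes top: "p \<noteq> 0" and D: "D \<in> diff_ops A k p" and g: "g \<in> forms A p" and c': "c' \<in> A" "K \<subseteq> chart_dom c'"
    and a: "\<And>\<alpha>. smooth_on (chart_img c) (a \<alpha>)"
      "\<And>\<omega> y. \<omega> \<in> forms A p ==> y \<in> chart_img c ==> D \<omega> (chart_inv c y) = (\<Sum>\<alpha>\<in>mi (Suc k). a \<alpha> y * iter_deriv \<alpha> (co c \<omega>) y)"
    and u: "small u"
  shows "(LINT y:chart_img c'|lborel. D (lf u) (chart_inv c' y) * co c' g y) =
    (LINT y:chart_img c'|lborel. co c' (lf u) y * adj (Suc k) a (co c g) (tr c' c y))"
proof -
  let ?U = "chart_img c'" and ?S = "(mi (Suc k) :: 'e list set)"
  have U': "open ?U" by (rule chart_props(2)[OF c'(1)])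
  have ext: "\<exists>s. \<forall>z\<in>V. ev s z = f z" if f: "smooth_on (chart_img c) f" for f
  proof -
    have "smooth_on UNIV (\<lambda>y. if y \<in> chart_img c then ev kap y * f y else 0)"
    proof (rule smooth_on_extend_zero[OF U])
      fix y assume "y \<notin> chart_img c"
      then show "\<exists>N. open N \<and> y \<in> N \<and> (\<forall>z\<in>N \<inter> chart_img c. ev kap z * f z = 0)"
        using R kap(2) by (intro exI[of _ "- cball y0 R"]) (auto simp: open_Compl)
    qed (intro smooth_on_mult U smooth_ev f)
    then show ?thesis using V(4) kap_V
      by (intro exI[of _ "Sfun (\<lambda>y. if y \<in> chart_img c then ev kap y * f y else 0)"]) (auto simp: ev_Sfun)
  qed
  have "\<exists>s. \<forall>z\<in>V. ev s z = a \<alpha> z * co c g z" for \<alpha>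
    by (rule ext) (intro smooth_on_mult U a formsD(2)[OF g c])
  then obtain s where s: "\<And>\<alpha> z. z \<in> V ==> ev (s \<alpha>) z = a \<alpha> z * co c g z" by metis
  \<comment> \<open>The Jacobian contained in \<open>co c' g\<close> passes to the derivative of the
    bump and makes it a form; \<open>a \<alpha> * co c g\<close> remains as a function, extended
    from \<open>V\<close> as \<open>s \<alpha>\<close>.\<close>
  have fu: "D (lf u) (chart_inv c' y) * co c' g y = (\<Sum>\<alpha>\<in>?S. co c' (lf (ds \<alpha> u)) y * lfun (s \<alpha>) (chart_inv c' y))" if y: "y \<in> ?U" for y
  proof (cases "chart_inv c' y \<in> chart_dom c \<and> tr c' c y \<in> cball y0 (R/4)")
    case True
    let ?z = "tr c' c y"
    have zV: "?z \<in> V" and zU: "?z \<in> chart_img c" using True small_subset V(4) by auto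
    have xz: "chart_inv c ?z = chart_inv c' y" using True c by (simp add: chart_props)
    have yW: "y \<in> cset c' (chart_dom c)" using True y by (simp add: cset_def)
    have "iter_deriv \<alpha> (co c (lf u)) ?z = ev (ds \<alpha> u) ?z" for \<alpha>
      unfolding ev_ds by (rule iter_deriv_cong[OF U _ zU]) (rule co_lf_small[OF u])
    then have 1: "D (lf u) (chart_inv c' y) = (\<Sum>\<alpha>\<in>?S. a \<alpha> ?z * ev (ds \<alpha> u) ?z)"
      using a(2)[OF lf_forms zU, of u] xz by simp
    have 2: "co c' g y = J c' c y * co c g ?z" by (rule co_tr'[OF g c'(1) c yW])
    have 3: "co c' (lf (ds \<alpha> u)) y = J c' c y * ev (ds \<alpha> u) ?z" for \<alpha>
      using co_lf_support[OF small_ds[OF u] c'(1) y] True by simp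
    have 4: "lfun (s \<alpha>) (chart_inv c' y) = a \<alpha> ?z * co c g ?z" for \<alpha>
      using True s[OF zV] kap_V[OF zV] by (simp add: lfun_def kp_def)
    show ?thesis unfolding 1 2 3 4 sum_distrib_right by (intro sum.cong refl) (simp only: mult_ac)
  next
    case False
    let ?N = "chart_dom c' - chart_inv c ` cball y0 (R/4)"
    have oK: "open (- chart_inv c ` cball y0 (R/4))" by (rule compact_chart_inv[OF c _ small_subset(2)]) simp
    have x: "chart_inv c' y \<in> - chart_inv c ` cball y0 (R/4)"
    proof (rule ComplI)
      assume "chart_inv c' y \<in> chart_inv c ` cball y0 (R/4)"
      then obtain z where z: "z \<in> cball y0 (R/4)" "chart_inv c' y = chart_inv c z" by blast
      have "z \<in> chart_img c" using z small_subset by auto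
      then show False using z False chart_props(6,7)[OF c, of z] by simp
    qed
    have "D (lf u) (chart_inv c' y) = 0"
    proof (rule diff_ops_zero_form[OF D lf_forms oK x])
      fix z vs assume z: "z \<in> - chart_inv c ` cball y0 (R/4)"
      show "lf u z vs = 0"
      proof (cases "z \<in> chart_dom c")
        case True
        then have "chart_map c z \<notin> cball y0 (R/4)" using z chart_props(5)[OF c True] by (metis ComplD image_eqI)
        then show ?thesis using u True by (simp add: lf_def mkform_def small_def)
      qed (simp add: lf_off)
    qed
    moreover have "co c' (lf (ds \<alpha> u)) y = 0" for \<alpha>
      using co_lf_support[OF small_ds[OF u] c'(1) y] False small_ds[OF u, of \<alpha>] by (auto simp: small_def)
    ultimately show ?thesis by simp
  qed
  have ad: "adj (Suc k) a (co c g) z = (\<Sum>\<alpha>\<in>?S. (-1) ^ length \<alpha> * ev (ds (rev \<alpha>) (s \<alpha>)) z)" if z: "z \<in> V" for z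
  proof -
    have "iter_deriv (rev \<alpha>) (\<lambda>z. a \<alpha> z * co c g z) z = ev (ds (rev \<alpha>) (s \<alpha>)) z" for \<alpha>
      unfolding ev_ds by (rule iter_deriv_cong[OF V(1) _ z]) (simp add: s)
    then show ?thesis by (simp add: adj_def)
  qed
  have it: "set_integrable lborel ?U (\<lambda>y. co c' (lf v) y * lfun h (chart_inv c' y))" if "small v" for v h
    by (rule set_integrable_compact_support[OF _ support_compact[OF c']])
      (use co_lf_outside[OF that c'(1)] in \<open>auto intro!: smooth_on_imp_continuous_on smooth_on_mult U' formsD(2)[OF lf_forms c'(1)] smooth_functionsD[OF smooth_lfun c'(1)]\<close>)
  have "(LINT y:?U|lborel. D (lf u) (chart_inv c' y) * co c' g y) =
      (LINT y:?U|lborel. \<Sum>\<alpha>\<in>?S. co c' (lf (ds \<alpha> u)) y * lfun (s \<alpha>) (chart_inv c' y))"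
    by (rule set_lebesgue_integral_cong) (use U' fu in auto)
  also have "\<dots> = (\<Sum>\<alpha>\<in>?S. LINT y:?U|lborel. co c' (lf (ds \<alpha> u)) y * lfun (s \<alpha>) (chart_inv c' y))"
    by (rule set_integral_sum_lborel[OF finite_multi_indices it[OF small_ds[OF u]]])
  also have "\<dots> = (\<Sum>\<alpha>\<in>?S. LINT y:?U|lborel. (-1) ^ length \<alpha> * (co c' (lf u) y * lfun (ds (rev \<alpha>) (s \<alpha>)) (chart_inv c' y)))"
    by (rule sum.cong[OF refl]) (simp add: lf_integral_iter[OF top u c'])
  also have "\<dots> = (LINT y:?U|lborel. \<Sum>\<alpha>\<in>?S. (-1) ^ length \<alpha> * (co c' (lf u) y * lfun (ds (rev \<alpha>) (s \<alpha>)) (chart_inv c' y)))"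
    by (rule set_integral_sum_lborel[OF finite_multi_indices, symmetric]) (intro set_integrable_mult_right it[OF u])
  also have "\<dots> = (LINT y:?U|lborel. co c' (lf u) y * adj (Suc k) a (co c g) (tr c' c y))"
  proof (rule set_lebesgue_integral_cong)
    show "?U \<in> sets lborel" using U' by simp
    show "\<forall>y. y \<in> ?U \<longrightarrow> (\<Sum>\<alpha>\<in>?S. (-1) ^ length \<alpha> * (co c' (lf u) y * lfun (ds (rev \<alpha>) (s \<alpha>)) (chart_inv c' y))) =
      co c' (lf u) y * adj (Suc k) a (co c g) (tr c' c y)"
    proof (intro allI impI)
      fix y assume y: "y \<in> ?U"
      show "(\<Sum>\<alpha>\<in>?S. (-1) ^ length \<alpha> * (co c' (lf u) y * lfun (ds (rev \<alpha>) (s \<alpha>)) (chart_inv c' y))) =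
        co c' (lf u) y * adj (Suc k) a (co c g) (tr c' c y)"
      proof (cases "co c' (lf u) y = 0")
        case False
        then have x: "chart_inv c' y \<in> chart_dom c" and z: "tr c' c y \<in> cball y0 (R/4)"
          using co_lf_support[OF u c'(1) y] u by (auto simp: small_def split: if_splits)
        then have zV: "tr c' c y \<in> V" using small_subset by auto
        show ?thesis using x kap_V[OF zV] by (simp add: ad[OF zV] lfun_def kp_def sum_distrib_left algebra_simps)
      qed simp
    qed
  qed
  finally show ?thesis .
qed

end

context mfdp
begin

definition coeffs :: "nat => ('a, 'e) chart => ('a, 'e) diffop => ('e list => 'e => real) => bool" where
  "coeffs k c D a \<longleftrightarrow> (\<forall>\<alpha>. smooth_on (chart_img c) (a \<alpha>)) \<and> (\<forall>\<omega>\<in>forms A p. \<forall>y\<in>chart_img c.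
     D \<omega> (chart_inv c y) = (\<Sum>\<alpha>\<in>mi (Suc k). a \<alpha> y * iter_deriv \<alpha> (co c \<omega>) y))"

lemma coeffsD:
  assumes "coeffs k c D a"
  shows "smooth_on (chart_img c) (a \<alpha>)"
    "\<omega> \<in> forms A p ==> y \<in> chart_img c ==> D \<omega> (chart_inv c y) = (\<Sum>\<alpha>\<in>mi (Suc k). a \<alpha> y * iter_deriv \<alpha> (co c \<omega>) y)"
  using assms unfolding coeffs_def by auto

lemma coeffs_exist:
  assumes D: "D \<in> diff_ops A k p" and c: "c \<in> A"
  shows "\<exists>a. coeffs k c D a"
proof -
  obtain Q where Q: "Q \<in> dopU (chart_img c) (Suc k)" "\<And>\<omega> y. \<omega> \<in> forms A p ==> y \<in> chart_img c ==> D \<omega> (chart_inv c y) = Q (co c \<omega>) y"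
    using diff_opsD[OF D c] by blast
  obtain a where a: "\<And>\<alpha>. smooth_on (chart_img c) (a \<alpha>)" "\<And>f y. smooth_on (chart_img c) f ==> y \<in> chart_img c ==>
      Q f y = (\<Sum>\<alpha>\<in>mi (Suc k). a \<alpha> y * iter_deriv \<alpha> f y)"
    using dopU_coeffs[OF Q(1) chart_props(2)[OF c]] by blast
  show ?thesis unfolding coeffs_def
    by (rule exI[of _ a], intro conjI allI ballI a(1)) (simp only: Q(2) a(2) formsD(2)[OF _ c])
qed

lemma smooth_adj:
  assumes "c \<in> A" "coeffs k c D a" "\<omega> \<in> forms A p"
  shows "smooth_on (chart_img c) (adj (Suc k) a (co c \<omega>))"
  by (rule dopU_smooth[OF adj_dopU[OF _ coeffsD(1)[OF assms(2)]] _ formsD(2)[OF assms(3,1)]]) (rule chart_props(2)[OF assms(1)])+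

text \<open>Paired with any bump form, both adjoints give the same integral in \<open>c'\<close>,
  one by \<open>adj_lf_integral\<close> and the other by \<open>adj_integral\<close>; their
  difference is continuous, hence zero at \<open>x\<close>.\<close>

lemma adj_independent:
  assumes top: "p \<noteq> 0" and D: "D \<in> diff_ops A k p" and g: "g \<in> forms A p"
    and c: "c \<in> A" "x \<in> chart_dom c" and a: "coeffs k c D a" and c': "c' \<in> A" "x \<in> chart_dom c'" and a': "coeffs k c' D a'"
  shows "adj (Suc k) a (co c g) (chart_map c x) = adj (Suc k) a' (co c' g) (chart_map c' x)"
proof -
  let ?W = "chart_dom c \<inter> chart_dom c'"
  have W: "open ?W" "x \<in> ?W" using chart_props(1)[OF c(1)] chart_props(1)[OF c'(1)] c c' by auto
  obtain R kap where l: "loc A p c (chart_map c x) R kap" "chart_inv c ` cball (chart_map c x) R \<subseteq> ?W"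
    using loc_exists[OF c W] by blast
  interpret L: loc A p c "chart_map c x" R kap by (rule l(1))
  have K': "L.K \<subseteq> chart_dom c'" using l(2) unfolding L.K_def by blast
  let ?\<phi>1 = "\<lambda>z. adj (Suc k) a (co c g) (chart_map c z)" and ?\<phi>2 = "\<lambda>z. adj (Suc k) a' (co c' g) (chart_map c' z)"
  let ?\<phi> = "\<lambda>z. ?\<phi>1 z - ?\<phi>2 z"
  have s: "smooth_on (cset c (chart_dom c)) (adj (Suc k) a (co c g))" "smooth_on (cset c' (chart_dom c')) (adj (Suc k) a' (co c' g))"
    using smooth_on_subset[OF smooth_adj[OF c(1) a g] cset_subset] smooth_on_subset[OF smooth_adj[OF c'(1) a' g] cset_subset] by auto
  note s' = smooth_on_tr_compose[OF c(1) c'(1) chart_props(1)[OF c(1)] subset_refl s(1)] smooth_on_tr_compose[OF c'(1) c(1) chart_props(1)[OF c'(1)] subset_refl s(2)]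
  have t: "chart_map b (chart_inv b y) = y" if "b \<in> A" "y \<in> cset b N" for b y N using chart_props(6)[OF that(1) csetD(1)[OF that(2)]] .
  have c1: "continuous_on (cset c' (chart_dom c)) (\<lambda>y. ?\<phi>1 (chart_inv c' y))" by (rule smooth_on_imp_continuous_on[OF s'(1)])
  have c2: "continuous_on (cset c' (chart_dom c)) (\<lambda>y. ?\<phi>2 (chart_inv c' y))"
    by (rule continuous_on_eq[OF continuous_on_subset[OF smooth_on_imp_continuous_on[OF smooth_adj[OF c'(1) a' g]] cset_subset]])
      (simp add: t[OF c'(1)])
  have c3: "continuous_on (cset c (chart_dom c')) (\<lambda>y. ?\<phi>2 (chart_inv c y))" by (rule smooth_on_imp_continuous_on[OF s'(2)])
  have c4: "continuous_on (cset c (chart_dom c')) (\<lambda>y. ?\<phi>1 (chart_inv c y))"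
    by (rule continuous_on_eq[OF continuous_on_subset[OF smooth_on_imp_continuous_on[OF smooth_adj[OF c(1) a g]] cset_subset]])
      (simp add: t[OF c(1)])
  have "?\<phi> (chart_inv c (chart_map c x)) = 0"
  proof (rule L.test_zero[where \<phi>="?\<phi>", OF c'(1) K' continuous_on_diff[OF c4 c3] continuous_on_diff[OF c1 c2]])
    fix u assume u: "L.small u"
    let ?F = "co c' (L.lf u)" and ?U = "chart_img c'"
    have U': "open ?U" by (rule chart_props(2)[OF c'(1)])
    have "(LINT y:?U|lborel. ?F y * ?\<phi> (chart_inv c' y)) = (LINT y:?U|lborel. ?F y * ?\<phi>1 (chart_inv c' y) - ?F y * ?\<phi>2 (chart_inv c' y))"
      by (simp only: right_diff_distrib)
    also have "\<dots> = (LINT y:?U|lborel. ?F y * ?\<phi>1 (chart_inv c' y)) - (LINT y:?U|lborel. ?F y * ?\<phi>2 (chart_inv c' y))"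
      by (rule set_integral_diff(2)) (rule L.lf_integrable[where \<phi>="?\<phi>1", OF c'(1) K' c1 u], rule L.lf_integrable[where \<phi>="?\<phi>2", OF c'(1) K' c2 u])
    also have "(LINT y:?U|lborel. ?F y * ?\<phi>1 (chart_inv c' y)) = (LINT y:?U|lborel. D (L.lf u) (chart_inv c' y) * co c' g y)"
      by (rule L.adj_lf_integral[OF top D g c'(1) K' coeffsD[OF a] u, symmetric])
    also have "\<dots> = (LINT y:?U|lborel. (\<Sum>\<alpha>\<in>mi (Suc k). a' \<alpha> y * iter_deriv \<alpha> ?F y) * co c' g y)"
      by (rule set_lebesgue_integral_cong) (use U' coeffsD(2)[OF a' L.lf_forms] in auto)
    also have "\<dots> = (LINT y:?U|lborel. ?F y * adj (Suc k) a' (co c' g) y)"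
      by (rule adj_integral[OF U' formsD(2)[OF L.lf_forms c'(1)] L.support_compact[OF c'(1) K'] L.co_lf_outside[OF u c'(1)] coeffsD(1)[OF a'] formsD(2)[OF g c'(1)]])
    also have "\<dots> = (LINT y:?U|lborel. ?F y * ?\<phi>2 (chart_inv c' y))"
      by (rule set_lebesgue_integral_cong) (use U' chart_props(6)[OF c'(1)] in auto)
    finally show "(LINT y:?U|lborel. ?F y * ?\<phi> (chart_inv c' y)) = 0" by simp
  qed
  then show ?thesis using chart_props(5)[OF c] by simp
qed

text \<open>Chart and coefficients are chosen arbitrarily; in top degree the value does not depend
  on the choice, by \<open>adj_independent\<close>.\<close>

definition conjf :: "nat => ('a, 'e) diffop => ('a, 'e) diffop" where
  "conjf k D g x = (if g \<in> forms A p
     then adj (Suc k) (SOME a. coeffs k (at_chart x) D a) (co (at_chart x) g) (chart_map (at_chart x) x) else 0)"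

lemma conjf_eq:
  assumes top: "p \<noteq> 0" and D: "D \<in> diff_ops A k p" and g: "g \<in> forms A p" and c: "c \<in> A" "y \<in> chart_img c" and a: "coeffs k c D a"
  shows "conjf k D g (chart_inv c y) = adj (Suc k) a (co c g) y"
proof -
  let ?x = "chart_inv c y"
  have x: "?x \<in> chart_dom c" by (rule chart_props(7)[OF c])
  have "coeffs k (at_chart ?x) D (SOME a. coeffs k (at_chart ?x) D a)"
    by (rule someI_ex[OF coeffs_exist[OF D chart_at(1)]])
  from adj_independent[OF top D g c(1) x a chart_at this] show ?thesis
    using g chart_props(6)[OF c] by (simp add: conjf_def)
qed

lemma conjf_diff_ops:
  assumes top: "p \<noteq> 0" and D: "D \<in> diff_ops A k p"
  shows "conjf k D \<in> diff_ops A k p"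
proof (rule diff_opsI)
  fix c assume c: "c \<in> A"
  obtain a where a: "coeffs k c D a" using coeffs_exist[OF D c] by blast
  show "\<exists>Q\<in>dopU (chart_img c) (Suc k). in_chart c (conjf k D) Q"
    by (rule bexI[OF _ adj_dopU[of _ a, OF chart_props(2)[OF c], OF coeffsD(1)[OF a]]]) (intro ballI conjf_eq[OF top D _ c _ a])
qed (simp add: conjf_def[abs_def] fun_eq_iff)

section \<open>Existence and uniqueness of the conjugate\<close>

lemma forms_compactD:
  assumes "f \<in> forms_compact_in A p (chart_dom c)" "c \<in> A"
  shows "f \<in> forms A p" "compact (chart_map c ` closure {x. f x \<noteq> 0})" "chart_map c ` closure {x. f x \<noteq> 0} \<subseteq> chart_img c"
    "y \<in> chart_img c ==> y \<notin> chart_map c ` closure {x. f x \<noteq> 0} ==> co c f y = 0"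
proof -
  let ?S = "closure {x. f x \<noteq> 0}"
  have f: "f \<in> forms A p" "compact ?S" "?S \<subseteq> chart_dom c" using assms(1) by (auto simp: forms_compact_in_def)
  show "f \<in> forms A p" "chart_map c ` ?S \<subseteq> chart_img c" using f by auto
  show "compact (chart_map c ` ?S)"
    by (rule compact_continuous_image[OF continuous_on_subset[OF chart_props(4)[OF assms(2)] f(3)] f(2)])
  assume y: "y \<in> chart_img c" "y \<notin> chart_map c ` ?S"
  have "chart_inv c y \<notin> ?S" using y chart_props(6)[OF assms(2) y(1)] by (metis image_eqI)
  then have "f (chart_inv c y) = 0" using closure_subset[of "{x. f x \<noteq> 0}"] by blast
  then show "co c f y = 0" by (simp add: co_def form_in_chart_eq)
qed

lemma is_conjugate_iff:
  assumes "p \<noteq> 0"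
  shows "is_conjugate A D E \<longleftrightarrow> (\<forall>c\<in>A. \<forall>f\<in>forms_compact_in A p (chart_dom c). \<forall>g\<in>forms_compact_in A p (chart_dom c).
    (LINT y:chart_img c|lborel. D f (chart_inv c y) * co c g y) = (LINT y:chart_img c|lborel. E g (chart_inv c y) * co c f y))"
proof -
  have "form_in_chart A c (\<lambda>x. D f x *\<^sub>R g x) y basis_frame = D f (chart_inv c y) * co c g y" for c f g y and D :: "('a, 'e) diffop"
    using assms by (simp add: co_def form_in_chart_eq frame_def)
  then show ?thesis using p assms by (simp add: is_conjugate_def chart_integral_def)
qed

lemma is_conjugateD:
  assumes "p \<noteq> 0" "is_conjugate A D E" "c \<in> A" "f \<in> forms_compact_in A p (chart_dom c)" "g \<in> forms_compact_in A p (chart_dom c)"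
  shows "(LINT y:chart_img c|lborel. D f (chart_inv c y) * co c g y) = (LINT y:chart_img c|lborel. E g (chart_inv c y) * co c f y)"
  using assms(2-) unfolding is_conjugate_iff[OF assms(1)] by blast

lemma conjf_conjugate:
  assumes top: "p \<noteq> 0" and D: "D \<in> diff_ops A k p"
  shows "is_conjugate A D (conjf k D)"
  unfolding is_conjugate_iff[OF top]
proof (intro ballI)
  fix c f g assume c: "c \<in> A" and f: "f \<in> forms_compact_in A p (chart_dom c)" and g: "g \<in> forms_compact_in A p (chart_dom c)"
  obtain a where a: "coeffs k c D a" using coeffs_exist[OF D c] by blast
  have U: "open (chart_img c)" by (rule chart_props(2)[OF c])
  note f' = forms_compactD[OF f c] and g' = forms_compactD[OF g c]
  have "(LINT y:chart_img c|lborel. D f (chart_inv c y) * co c g y) =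
      (LINT y:chart_img c|lborel. (\<Sum>\<alpha>\<in>mi (Suc k). a \<alpha> y * iter_deriv \<alpha> (co c f) y) * co c g y)"
    by (rule set_lebesgue_integral_cong) (use U coeffsD(2)[OF a f'(1)] in auto)
  also have "\<dots> = (LINT y:chart_img c|lborel. co c f y * adj (Suc k) a (co c g) y)"
    by (rule adj_integral[OF U formsD(2)[OF f'(1) c] f'(2-4) coeffsD(1)[OF a] formsD(2)[OF g'(1) c]])
  also have "\<dots> = (LINT y:chart_img c|lborel. conjf k D g (chart_inv c y) * co c f y)"
    by (rule set_lebesgue_integral_cong) (use U conjf_eq[OF top D g'(1) c _ a] in auto)
  finally show "(LINT y:chart_img c|lborel. D f (chart_inv c y) * co c g y) = (LINT y:chart_img c|lborel. conjf k D g (chart_inv c y) * co c f y)" .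
qed

lemma conj_integrable:
  assumes D: "D \<in> diff_ops A k p" and f: "f \<in> forms A p" and c: "c \<in> A" and g: "g \<in> forms_compact_in A p (chart_dom c)"
  shows "set_integrable lborel (chart_img c) (\<lambda>y. D f (chart_inv c y) * co c g y)"
proof -
  note g' = forms_compactD[OF g c]
  show ?thesis
    by (rule set_integrable_compact_support[OF smooth_on_imp_continuous_on[OF smooth_on_mult[OF chart_props(2)[OF c]
            smooth_functionsD[OF diff_ops_smooth[OF D f] c] formsD(2)[OF g'(1) c]]] g'(2,3)]) (simp add: g'(4))
qed

end

context loc
begin

lemma lf_compact: "lf f \<in> forms_compact_in A p (chart_dom c)"
proof -
  have "{x. lf f x \<noteq> 0} \<subseteq> K" using K(3) by (fastforce simp: lf_def mkform_def)
  then have s: "closure {x. lf f x \<noteq> 0} \<subseteq> K" using compact_imp_closed[OF K(1)] by (rule closure_minimal)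
  have "compact (K \<inter> closure {x. lf f x \<noteq> 0})" by (rule compact_Int_closed[OF K(1) closed_closure])
  then show ?thesis using s K(2) lf_forms by (simp add: forms_compact_in_def Int_absorb1 order_trans[OF s])
qed

end

context mfdp
begin

lemma conjugate_unique:
  assumes top: "p \<noteq> 0" and E: "E \<in> diff_ops A k p" "is_conjugate A D E" and E': "E' \<in> diff_ops A k p" "is_conjugate A D E'"
  shows "E = E'"
proof (intro ext)
  fix \<omega> x
  show "E \<omega> x = E' \<omega> x"
  proof (cases "\<omega> \<in> forms A p")
    case w: True
    let ?c = "at_chart x" let ?y = "chart_map ?c x"
    obtain R kap where l: "loc A p ?c ?y R kap" using loc_exists[OF chart_at open_UNIV UNIV_I] by blast
    interpret L: loc A p ?c ?y R kap by (rule l)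
    have ci: "chart_inv ?c ?y = x" by (rule chart_props(5)[OF chart_at])
    have yU: "?y \<in> chart_img ?c" using chart_at(2) by blast
    \<comment> \<open>\<open>is_conjugate\<close> speaks of compactly supported forms only, so
      \<open>\<omega>\<close> is replaced by such a form with the same germ at
      \<open>x\<close>.\<close>
    define g where "g = L.lf (germ (co ?c \<omega>) ?y)"
    have g: "g \<in> forms_compact_in A p (chart_dom ?c)" "g \<in> forms A p" unfolding g_def by (rule L.lf_compact, rule L.lf_forms)
    let ?\<phi> = "\<lambda>z. E g z - E' g z"
    have cont: "continuous_on (cset ?c (chart_dom ?c)) (\<lambda>z. ?\<phi> (chart_inv ?c z))"
      by (rule continuous_on_subset[OF smooth_on_imp_continuous_on[OF smooth_functionsD[OF smooth_functions_minus[OF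
                diff_ops_smooth[OF E(1) g(2)] diff_ops_smooth[OF E'(1) g(2)]] chart_at(1)]] cset_subset])
    have "?\<phi> (chart_inv ?c ?y) = 0"
    proof (rule L.test_zero[where \<phi>="?\<phi>", OF chart_at(1) L.K(2) cont cont])
      fix u assume u: "L.small u"
      let ?F = "co ?c (L.lf u)" and ?U = "chart_img ?c"
      have "(LINT y:?U|lborel. ?F y * ?\<phi> (chart_inv ?c y)) = (LINT y:?U|lborel. E g (chart_inv ?c y) * ?F y - E' g (chart_inv ?c y) * ?F y)"
        by (simp only: right_diff_distrib mult.commute)
      also have "\<dots> = (LINT y:?U|lborel. E g (chart_inv ?c y) * ?F y) - (LINT y:?U|lborel. E' g (chart_inv ?c y) * ?F y)"
        by (rule set_integral_diff(2)) (rule conj_integrable[OF E(1) g(2) chart_at(1) L.lf_compact], rule conj_integrable[OF E'(1) g(2) chart_at(1) L.lf_compact])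
      also have "\<dots> = 0"
        using is_conjugateD[OF top E(2) chart_at(1) L.lf_compact g(1)] is_conjugateD[OF top E'(2) chart_at(1) L.lf_compact g(1)] by simp
      finally show "(LINT y:?U|lborel. ?F y * ?\<phi> (chart_inv ?c y)) = 0" .
    qed
    then have eq: "E g x = E' g x" using ci by simp
    obtain N where N: "open N" "?y \<in> N" "\<And>z. z \<in> N ==> ev (germ (co ?c \<omega>) ?y) z = co ?c \<omega> z"
      using germ_exists[OF chart_props(2)[OF chart_at(1)] formsD(2)[OF w chart_at(1)] yU] by blast
    have N': "open (N \<inter> L.V)" "?y \<in> N \<inter> L.V" "\<And>z. z \<in> N \<inter> L.V ==> co ?c \<omega> z = co ?c g z"
      using N L.V L.co_lf_V by (auto simp: g_def)
    have "E \<omega> x = E g x" "E' \<omega> x = E' g x"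
      using diff_ops_local[OF E(1) w g(2) chart_at N'(1,2)] diff_ops_local[OF E'(1) w g(2) chart_at N'(1,2)] N'(3) by blast+
    then show ?thesis using eq by simp
  qed (simp add: diff_ops_off[OF E(1)] diff_ops_off[OF E'(1)])
qed

lemma conj_map_props:
  assumes top: "p \<noteq> 0" and D: "D \<in> diff_ops A k p"
  shows "conj_map A k D = conjf k D" "conj_map A k D \<in> diff_ops A k p" "is_conjugate A D (conj_map A k D)"
proof -
  have pn: "DIM('e) = p" using p top by simp
  show 1: "conj_map A k D = conjf k D"
    unfolding conj_map_def pn using D conjf_diff_ops[OF top D] conjf_conjugate[OF top D] conjugate_unique[OF top]
    by (simp, intro the_equality) blast+
  show "conj_map A k D \<in> diff_ops A k p" "is_conjugate A D (conj_map A k D)"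
    unfolding 1 by (rule conjf_diff_ops[OF top D], rule conjf_conjugate[OF top D])
qed

lemma conj_map_eqI: "p \<noteq> 0 ==> D \<in> diff_ops A k p ==> E \<in> diff_ops A k p ==> is_conjugate A D E ==> conj_map A k D = E"
  using conjugate_unique conj_map_props by blast

section \<open>Invariance of the conjugation\<close>

lemma lie_parts:
  assumes top: "p \<noteq> 0" and \<phi>: "\<phi> \<in> smooth_functions A" and X: "X \<in> vector_fields A" and c: "c \<in> A" and g: "g \<in> forms_compact_in A p (chart_dom c)"
  shows "(LINT y:chart_img c|lborel. lie_function A X \<phi> (chart_inv c y) * co c g y) = - (LINT y:chart_img c|lborel. \<phi> (chart_inv c y) * co c (lie_form A X g) y)"
proof -
  let ?U = "chart_img c" and ?X = "vf_in_chart A c X" and ?f = "\<lambda>y. \<phi> (chart_inv c y)" and ?D = "\<lambda>f y. fd f y"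
  note g' = forms_compactD[OF g c]
  have U: "open ?U" by (rule chart_props(2)[OF c])
  have "(LINT y:?U|lborel. lie_function A X \<phi> (chart_inv c y) * co c g y) = (LINT y:?U|lborel. ?D ?f y (?X y) * co c g y)"
    by (rule set_lebesgue_integral_cong) (use U lie_function_chart[OF \<phi> c] in auto)
  also have "\<dots> = - (LINT y:?U|lborel. ?f y * (?D (co c g) y (?X y) + (\<Sum>b\<in>Basis. ?D ?X y b \<bullet> b) * co c g y))"
    by (rule integrate_by_parts[OF U smooth_functionsD[OF \<phi> c] vector_fieldsD[OF X c] formsD(2)[OF g'(1) c] g'(2-4)])
  also have "(LINT y:?U|lborel. ?f y * (?D (co c g) y (?X y) + (\<Sum>b\<in>Basis. ?D ?X y b \<bullet> b) * co c g y)) =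
      (LINT y:?U|lborel. ?f y * co c (lie_form A X g) y)"
  proof (rule set_lebesgue_integral_cong)
    show "\<forall>y. y \<in> ?U \<longrightarrow> ?f y * (?D (co c g) y (?X y) + (\<Sum>b\<in>Basis. ?D ?X y b \<bullet> b) * co c g y) = ?f y * co c (lie_form A X g) y"
    proof (intro allI impI)
      fix y assume "y \<in> ?U"
      from co_lie_form[OF g'(1) X c this]
      show "?f y * (?D (co c g) y (?X y) + (\<Sum>b\<in>Basis. ?D ?X y b \<bullet> b) * co c g y) = ?f y * co c (lie_form A X g) y"
        using p top dvg_top[of "?D ?X y"] by (simp add: lco_def)
    qed
  qed (use U in simp)
  finally show ?thesis .
qed

lemma lie_form_support:
  assumes \<omega>: "\<omega> \<in> forms A p" and X: "X \<in> vector_fields A" and N: "open N" "\<And>x. x \<in> N ==> \<omega> x = 0" and x: "x \<in> N"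
  shows "lie_form A X \<omega> x = 0"
proof
  fix vs
  let ?b = "at_chart x" let ?y = "chart_map ?b x" and ?S = "cset ?b N"
  have S: "open ?S" "?y \<in> ?S" using cset_open[OF chart_at(1) N(1)] cset_cm[OF chart_at x] by auto
  have z: "co ?b \<omega> y = 0" if "y \<in> ?S" for y using N(2)[OF csetD(2)[OF that]] by (simp add: co_def form_in_chart_eq)
  have "fd (co ?b \<omega>) ?y = fd (\<lambda>_. 0) ?y"
    by (rule fd_cong[OF S]) (rule z)
  then show "lie_form A X \<omega> x vs = 0 vs" using z[OF S(2)] by (simp add: lie_form_at[OF \<omega> X] lco_def)
qed

lemma lie_form_compact:
  assumes f: "f \<in> forms_compact_in A p U" and X: "X \<in> vector_fields A"
  shows "lie_form A X f \<in> forms_compact_in A p U"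
proof -
  let ?S = "closure {x. f x \<noteq> 0}" and ?T = "{x. lie_form A X f x \<noteq> 0}"
  have f': "f \<in> forms A p" "compact ?S" "?S \<subseteq> U" using f by (auto simp: forms_compact_in_def)
  have o: "open (- ?S)" by (rule open_Compl[OF closed_closure])
  have z: "f x = 0" if "x \<in> - ?S" for x using that closure_subset[of "{x. f x \<noteq> 0}"] by blast
  have "?T \<subseteq> ?S" using lie_form_support[OF f'(1) X o z] by blast
  then have T: "closure ?T \<subseteq> ?S" by (rule closure_minimal[OF _ closed_closure])
  have "compact (?S \<inter> closure ?T)" by (rule compact_Int_closed[OF f'(2) closed_closure])
  then show ?thesis using T f' lie_form_forms[OF f'(1) X] by (simp add: forms_compact_in_def Int_absorb1 order_trans[OF T])
qed

text \<open>By parts, the integral of (L_X D)(f) g is minus the sum of the integrals of D(f) L_X g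
  and D(L_X f) g. Conjugation of \<open>D\<close> turns these two into the corresponding terms for
  \<open>E\<close>.\<close>

lemma conjugate_lie:
  assumes top: "p \<noteq> 0" and D: "D \<in> diff_ops A k p" and E: "E \<in> diff_ops A k p" and X: "X \<in> vector_fields A" and DE: "is_conjugate A D E"
  shows "is_conjugate A (lie_op A p X D) (lie_op A p X E)"
  unfolding is_conjugate_iff[OF top]
proof (intro ballI)
  fix c f g assume c: "c \<in> A" and f: "f \<in> forms_compact_in A p (chart_dom c)" and g: "g \<in> forms_compact_in A p (chart_dom c)"
  have f': "f \<in> forms A p" and g': "g \<in> forms A p" using f g by (auto simp: forms_compact_in_def)
  have *: "(LINT y:chart_img c|lborel. lie_op A p X D f (chart_inv c y) * co c g y) =
      - (LINT y:chart_img c|lborel. D f (chart_inv c y) * co c (lie_form A X g) y) - (LINT y:chart_img c|lborel. D (lie_form A X f) (chart_inv c y) * co c g y)"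
    if D: "D \<in> diff_ops A k p" and f: "f \<in> forms A p" and g: "g \<in> forms_compact_in A p (chart_dom c)" for D f g
  proof -
    have L: "lie_form A X f \<in> forms A p" by (rule lie_form_forms[OF f X])
    have i: "set_integrable lborel (chart_img c) (\<lambda>y. D (lie_form A X f) (chart_inv c y) * co c g y)" by (rule conj_integrable[OF D L c g])
    have "set_integrable lborel (chart_img c) (\<lambda>y. lie_op A p X D f (chart_inv c y) * co c g y)"
      by (rule conj_integrable[OF lie_op_diff_ops[OF D X] f c g])
    then have "set_integrable lborel (chart_img c) (\<lambda>y. lie_op A p X D f (chart_inv c y) * co c g y + D (lie_form A X f) (chart_inv c y) * co c g y)"
      by (rule set_integral_add(1)[OF _ i])
    then have j: "set_integrable lborel (chart_img c) (\<lambda>y. lie_function A X (D f) (chart_inv c y) * co c g y)"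
      using f by (simp add: lie_op_def left_diff_distrib)
    have "(LINT y:chart_img c|lborel. lie_op A p X D f (chart_inv c y) * co c g y) =
       (LINT y:chart_img c|lborel. lie_function A X (D f) (chart_inv c y) * co c g y - D (lie_form A X f) (chart_inv c y) * co c g y)"
      using f by (simp add: lie_op_def left_diff_distrib)
    also have "\<dots> = (LINT y:chart_img c|lborel. lie_function A X (D f) (chart_inv c y) * co c g y) - (LINT y:chart_img c|lborel. D (lie_form A X f) (chart_inv c y) * co c g y)"
      by (rule set_integral_diff(2)[OF j i])
    finally show ?thesis unfolding lie_parts[OF top diff_ops_smooth[OF D f] X c g] .
  qed
  show "(LINT y:chart_img c|lborel. lie_op A p X D f (chart_inv c y) * co c g y) = (LINT y:chart_img c|lborel. lie_op A p X E g (chart_inv c y) * co c f y)"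
    unfolding *[OF D f' g] *[OF E g' f]
    using is_conjugateD[OF top DE c f lie_form_compact[OF g X]] is_conjugateD[OF top DE c lie_form_compact[OF f X] g] by simp
qed

lemma conjugate_add:
  assumes top: "p \<noteq> 0" and D: "D \<in> diff_ops A k p" "D' \<in> diff_ops A k p" and E: "E \<in> diff_ops A k p" "E' \<in> diff_ops A k p"
    and DE: "is_conjugate A D E" "is_conjugate A D' E'"
  shows "is_conjugate A (D + D') (E + E')"
  unfolding is_conjugate_iff[OF top]
proof (intro ballI)
  fix c f g assume c: "c \<in> A" and f: "f \<in> forms_compact_in A p (chart_dom c)" and g: "g \<in> forms_compact_in A p (chart_dom c)"
  have f': "f \<in> forms A p" and g': "g \<in> forms A p" using f g by (auto simp: forms_compact_in_def)
  have *: "(LINT y:chart_img c|lborel. (D + D') f (chart_inv c y) * co c g y) =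
      (LINT y:chart_img c|lborel. D f (chart_inv c y) * co c g y) + (LINT y:chart_img c|lborel. D' f (chart_inv c y) * co c g y)"
    if "D \<in> diff_ops A k p" "D' \<in> diff_ops A k p" "f \<in> forms A p" "g \<in> forms_compact_in A p (chart_dom c)" for D D' f g
    using set_integral_add(2)[OF conj_integrable[OF that(1,3) c that(4)] conj_integrable[OF that(2,3) c that(4)]]
    by (simp add: distrib_right)
  show "(LINT y:chart_img c|lborel. (D + D') f (chart_inv c y) * co c g y) = (LINT y:chart_img c|lborel. (E + E') g (chart_inv c y) * co c f y)"
    unfolding *[OF D f' g] *[OF E g' f] is_conjugateD[OF top DE(1) c f g] is_conjugateD[OF top DE(2) c f g] by (rule refl)
qed

lemma conjugate_scaleR:
  assumes top: "p \<noteq> 0" and DE: "is_conjugate A D E"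
  shows "is_conjugate A (r *\<^sub>R D) (r *\<^sub>R E)"
  unfolding is_conjugate_iff[OF top]
proof (intro ballI)
  fix c f g assume c: "c \<in> A" and f: "f \<in> forms_compact_in A p (chart_dom c)" and g: "g \<in> forms_compact_in A p (chart_dom c)"
  show "(LINT y:chart_img c|lborel. (r *\<^sub>R D) f (chart_inv c y) * co c g y) = (LINT y:chart_img c|lborel. (r *\<^sub>R E) g (chart_inv c y) * co c f y)"
    using is_conjugateD[OF top DE c f g] by (simp add: mult.assoc)
qed

lemma conj_map_invariant:
  assumes top: "p \<noteq> 0"
  shows "conj_map A k \<in> invariant_maps A k p p"
  unfolding invariant_maps_def mem_Collect_eq
proof (intro conjI ballI allI impI)
  note P = conj_map_props[OF top]
  fix D assume D: "D \<in> diff_ops A k p"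
  show "conj_map A k D \<in> all_diff_ops A p" using P(2)[OF D] unfolding all_diff_ops_def by blast
  show "conj_map A k (D + E) = conj_map A k D + conj_map A k E" if E: "E \<in> diff_ops A k p" for E
    by (rule conj_map_eqI[OF top diff_ops_plus[OF D E] diff_ops_plus[OF P(2)[OF D] P(2)[OF E]]
          conjugate_add[OF top D E P(2)[OF D] P(2)[OF E] P(3)[OF D] P(3)[OF E]]])
  show "conj_map A k (r *\<^sub>R D) = r *\<^sub>R conj_map A k D" for r
    by (rule conj_map_eqI[OF top diff_ops_scaleR[OF D] diff_ops_scaleR[OF P(2)[OF D]] conjugate_scaleR[OF top P(3)[OF D]]])
  show "conj_map A k (lie_op A p X D) = lie_op A p X (conj_map A k D)" if X: "X \<in> vector_fields A" for X
    by (rule conj_map_eqI[OF top lie_op_diff_ops[OF D X] lie_op_diff_ops[OF P(2)[OF D] X] conjugate_lie[OF top D P(2)[OF D] X P(3)[OF D]]])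
next
  fix D assume "D \<notin> diff_ops A k p"
  then show "conj_map A k D = 0" using p top by (simp add: conj_map_def)
qed

end

context loc
begin

lemma ds_in_dopl: "set \<alpha> \<subseteq> Basis ==> length \<alpha> < k ==> ds \<alpha> \<in> dopl k"
  using dopl.monom[of \<alpha> k 1] by simp

lemma hat_ds:
  assumes "set \<alpha> \<subseteq> Basis" "smooth_on (chart_img c) f" "y \<in> chart_img c"
  shows "hat (ds \<alpha>) f y = iter_deriv \<alpha> f y"
proof -
  obtain N where N: "open N" "y \<in> N" "\<And>z. z \<in> N ==> ev (germ f y) z = f z" using germ_exists[OF U assms(2,3)] by blast
  have "hat (ds \<alpha>) f y = iter_deriv \<alpha> (ev (germ f y)) y" by (simp add: hat_def ev_ds)
  also have "\<dots> = iter_deriv \<alpha> f y" by (rule iter_deriv_cong[OF N(1,3,2)])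
  finally show ?thesis .
qed

text \<open>Applied to the lists \<open>[]\<close> and \<open>[i]\<close>, which are their own
  reversals; it gives the eigenvalues 1 and -1 of the conjugation.\<close>

lemma conj_lop:
  assumes top: "p \<noteq> 0" and \<alpha>: "set \<alpha> \<subseteq> Basis" "length \<alpha> \<le> k" "rev \<alpha> = \<alpha>"
  shows "eqN NV (conj_map A k (lop (ds \<alpha>))) ((-1) ^ length \<alpha> *\<^sub>R lop (ds \<alpha>))"
  unfolding eqN_def
proof (intro ballI)
  fix \<omega> x assume w: "\<omega> \<in> forms A p" and x: "x \<in> NV"
  let ?D = "lop (ds \<alpha>)" and ?a = "\<lambda>\<beta>. if \<beta> = \<alpha> then ev kap else (\<lambda>_. 0)"
  have D: "?D \<in> diff_ops A k p" by (rule lop_diff_ops[OF ds_in_dopl]) (use \<alpha> in auto)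
  have Dw: "?D \<omega> (chart_inv c y) = ev kap y * iter_deriv \<alpha> (co c \<omega>) y" if "\<omega> \<in> forms A p" "y \<in> chart_img c" for \<omega> y
    using that c hat_ds[OF \<alpha>(1) formsD(2)[OF that(1) c] that(2)] by (simp add: lop_def liftop_def kp_ci chart_props)
  have S: "\<alpha> \<in> mi (Suc k)" using \<alpha> by auto
  have pick: "(\<Sum>\<beta>\<in>mi (Suc k). if \<beta> = \<alpha> then t \<beta> else 0) = t \<alpha>" for t :: "'e list => real"
    using S by (simp add: sum.delta[OF finite_multi_indices])
  have a: "coeffs k c ?D ?a"
    unfolding coeffs_def
  proof (intro conjI allI ballI)
    show "smooth_on (chart_img c) (?a \<beta>)" for \<beta> using smooth_ev[of _ kap] by (simp add: smooth_on_const)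
    fix \<omega> y assume *: "\<omega> \<in> forms A p" "y \<in> chart_img c"
    have "(\<Sum>\<beta>\<in>mi (Suc k). ?a \<beta> y * iter_deriv \<beta> (co c \<omega>) y) =
        (\<Sum>\<beta>\<in>mi (Suc k). if \<beta> = \<alpha> then ev kap y * iter_deriv \<beta> (co c \<omega>) y else 0)"
      by (rule sum.cong) auto
    then show "?D \<omega> (chart_inv c y) = (\<Sum>\<beta>\<in>mi (Suc k). ?a \<beta> y * iter_deriv \<beta> (co c \<omega>) y)"
      using Dw[OF *] pick by simp
  qed
  obtain y where y: "y \<in> V" "x = chart_inv c y" using x NV_iff by blast
  then have yU: "y \<in> chart_img c" using V(4) by blast
  have z: "iter_deriv \<beta> (\<lambda>z. 0 * co c \<omega> z) y = 0" for \<beta>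
    using iter_deriv_scale[OF U formsD(2)[OF w c] yU, of \<beta> 0] by simp
  have "conj_map A k ?D \<omega> x = adj (Suc k) ?a (co c \<omega>) y"
    unfolding conj_map_props(1)[OF top D] y(2) by (rule conjf_eq[OF top D w c yU a])
  also have "\<dots> = (\<Sum>\<beta>\<in>mi (Suc k). if \<beta> = \<alpha> then (-1) ^ length \<beta> * iter_deriv (rev \<beta>) (\<lambda>z. ev kap z * co c \<omega> z) y else 0)"
    unfolding adj_def by (rule sum.cong) (use z in auto)
  also have "\<dots> = (-1) ^ length \<alpha> * iter_deriv \<alpha> (\<lambda>z. ev kap z * co c \<omega> z) y" by (simp add: pick \<alpha>(3))
  also have "iter_deriv \<alpha> (\<lambda>z. ev kap z * co c \<omega> z) y = iter_deriv \<alpha> (co c \<omega>) y"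
    by (rule iter_deriv_cong[OF V(1) _ y(1)]) (simp add: kap_V)
  also have "\<dots> = ?D \<omega> x" using Dw[OF w yU] kap_V[OF y(1)] y(2) by simp
  finally show "conj_map A k ?D \<omega> x = ((-1) ^ length \<alpha> *\<^sub>R ?D) \<omega> x" by simp
qed

end

context mfdp
begin

theorem classification_top:
  assumes top: "p \<noteq> 0" and T: "T \<in> invariant_maps A k p p" and dim: "DIM('e) \<ge> 2" and k: "k \<ge> 1"
  shows "\<exists>a b. \<forall>D\<in>diff_ops A k p. T D = a *\<^sub>R D + b *\<^sub>R conj_map A k D"
proof (rule global_classification[OF T local_map_top[OF T top] dim k conj_map_invariant[OF top] local_map_top[OF conj_map_invariant[OF top] top], of "-1"])
  fix c y0 R kap assume l: "loc A p c y0 R kap"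
  interpret loc A p c y0 R kap by (rule l)
  have 0: "ds [] = (\<lambda>f :: 'e sfun. f)" by (simp add: fun_eq_iff)
  show "eqN NV (conj_map A k (lop (\<lambda>f. f))) (lop (\<lambda>f. f))"
    using conj_lop[OF top, of "[]" k] by (simp add: 0)
  fix i :: 'e assume i: "i \<in> Basis"
  have 1: "ds [i] = dv i" by (simp add: fun_eq_iff)
  show "eqN NV (conj_map A k (lop (dv i))) (-1 *\<^sub>R lop (dv i))"
    using conj_lop[OF top, of "[i]" k] i k by (simp add: 1)
qed simp

end

section \<open>Operators on functions\<close>

context mfdp
begin

lemma co_0:
  assumes p0: "p = 0"
  shows "co c \<omega> y = \<omega> (chart_inv c y) []"
proof -
  have "(frame p :: 'e list) = []" unfolding frame_def by (rule if_P[OF p0])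
  then show ?thesis by (simp add: co_def form_in_chart_eq)
qed

lemma form0_smooth:
  assumes p0: "p = 0" and w: "\<omega> \<in> forms A p"
  shows "(\<lambda>x. \<omega> x []) \<in> smooth_functions A"
proof -
  have "(\<lambda>y. \<omega> (chart_inv c y) []) = co c \<omega>" for c by (rule ext) (rule co_0[OF p0, symmetric])
  then show ?thesis unfolding smooth_functions_iff using formsD(2)[OF w] by simp
qed

lemma form0_eqI:
  assumes "p = 0" "\<omega> \<in> forms A p" "\<omega>' \<in> forms A p" "\<And>x. \<omega> x [] = \<omega>' x []"
  shows "\<omega> = \<omega>'"
proof (intro ext)
  fix x vs
  show "\<omega> x vs = \<omega>' x vs"
    using assms alternating_length[OF formsD(1)[OF assms(2), of x], of vs] alternating_length[OF formsD(1)[OF assms(3), of x], of vs]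
    by (cases vs) auto
qed

lemma lie_form_0: "lie_form A X \<omega> x [] = lie_function A X (\<lambda>x. \<omega> x []) x"
  by (simp add: lie_form_def lie_function_def Let_def form_in_chart_eq o_def)

lemma lie_function_smooth:
  assumes X: "X \<in> vector_fields A" and f: "f \<in> smooth_functions A"
  shows "lie_function A X f \<in> smooth_functions A"
  unfolding smooth_functions_iff
proof
  fix c assume c: "c \<in> A"
  have "smooth_on (chart_img c) (\<lambda>y. fd (\<lambda>y. f (chart_inv c y)) y (vf_in_chart A c X y))"
    by (rule smooth_on_fd_apply[OF chart_props(2)[OF c] smooth_functionsD[OF f c] vector_fieldsD[OF X c]])
  then show "smooth_on (chart_img c) (\<lambda>y. lie_function A X f (chart_inv c y))"
    by (rule smooth_on_cong[OF chart_props(2)[OF c], rotated]) (simp add: lie_function_chart[OF f c])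
qed

lemma lie_function_mult:
  assumes f: "f \<in> smooth_functions A" and g: "g \<in> smooth_functions A"
  shows "lie_function A X (\<lambda>x. f x * g x) x = lie_function A X f x * g x + f x * lie_function A X g x"
proof -
  let ?c = "at_chart x" let ?y = "chart_map ?c x"
  have y: "?y \<in> chart_img ?c" using chart_at(2)[of x] by blast
  have x: "chart_inv ?c ?y = x" by (rule chart_props(5)[OF chart_at])
  show ?thesis
    using lie_function_chart[OF smooth_functions_mult[OF f g] chart_at(1) y, of X] lie_function_chart[OF f chart_at(1) y, of X]
      lie_function_chart[OF g chart_at(1) y, of X]
      fd_mult[OF smooth_functionsD[OF f chart_at(1)] smooth_functionsD[OF g chart_at(1)] y, of "vf_in_chart A ?c X ?y"]
    by (simp add: x)
qed

lemma vf_in_chart_scale: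
  assumes c: "c \<in> A" "y \<in> chart_img c"
  shows "vf_in_chart A c (\<lambda>x. g x *\<^sub>R X x) y = g (chart_inv c y) *\<^sub>R vf_in_chart A c X y"
proof -
  let ?x = "chart_inv c y"
  have "linear (TT (at_chart ?x) c (chart_map (at_chart ?x) ?x))"
    by (rule TT_linear[OF chart_at(1) c(1) cset_cm[OF chart_at chart_props(7)[OF c]]])
  from linear_scale[OF this] show ?thesis by (simp add: vf_in_chart_eq)
qed

lemma vector_field_scale:
  assumes g: "g \<in> smooth_functions A" and X: "X \<in> vector_fields A"
  shows "(\<lambda>x. g x *\<^sub>R X x) \<in> vector_fields A"
  unfolding vector_fields_def mem_Collect_eq
proof
  fix c assume c: "c \<in> A"
  show "smooth_on (chart_img c) (vf_in_chart A c (\<lambda>x. g x *\<^sub>R X x))"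
    by (rule smooth_on_cong[OF chart_props(2)[OF c] _ smooth_on_scaleR[OF chart_props(2)[OF c] smooth_functionsD[OF g c] vector_fieldsD[OF X c]]])
      (simp add: vf_in_chart_scale[OF c])
qed

lemma lie_function_scale:
  assumes f: "f \<in> smooth_functions A"
  shows "lie_function A (\<lambda>x. g x *\<^sub>R X x) f x = g x * lie_function A X f x"
proof -
  let ?c = "at_chart x" let ?y = "chart_map ?c x"
  have y: "?y \<in> chart_img ?c" using chart_at(2)[of x] by blast
  have "linear (fd (\<lambda>y. f (chart_inv ?c y)) ?y)"
    by (rule linear_fd[OF smooth_functionsD[OF f chart_at(1)] y])
  from linear_scale[OF this] show ?thesis by (simp add: lie_function_def Let_def o_def)
qed

definition mulf :: "('a => real) => ('a, 'e) form => ('a, 'e) form" where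
  "mulf g \<omega> = (\<lambda>x vs. g x * \<omega> x vs)"

lemma co_mulf: "co c (mulf g \<omega>) y = g (chart_inv c y) * co c \<omega> y"
  by (simp add: co_def form_in_chart_eq mulf_def)

lemma mulf_forms:
  assumes g: "g \<in> smooth_functions A" and w: "\<omega> \<in> forms A p"
  shows "mulf g \<omega> \<in> forms A p"
proof (rule formsI)
  show "alternating_multilinear p (mulf g \<omega> x)" for x
    unfolding mulf_def by (rule alternating_mult[OF formsD(1)[OF w]])
  fix x
  have "smooth_on (chart_img (at_chart x)) (co (at_chart x) (mulf g \<omega>))"
    unfolding co_mulf[abs_def]
    by (rule smooth_on_mult[OF chart_props(2)[OF chart_at(1)] smooth_functionsD[OF g chart_at(1)] formsD(2)[OF w chart_at(1)]])
  then show "\<exists>c\<in>A. \<exists>N. open N \<and> x \<in> N \<and> N \<subseteq> chart_dom c \<and> smooth_on (cset c N) (co c (mulf g \<omega>))"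
    by (intro bexI[OF _ chart_at(1)[of x]] exI[of _ "chart_dom (at_chart x)"] conjI chart_props(1)[OF chart_at(1)] chart_at(2) subset_refl)
      (rule smooth_on_subset[OF _ cset_subset])
qed

text \<open>The commutator [D, g] with multiplication by \<open>g\<close>.\<close>

definition cm :: "('a => real) => ('a, 'e) diffop => ('a, 'e) diffop" where
  "cm g D = (\<lambda>\<omega> x. if \<omega> \<in> forms A p then D (mulf g \<omega>) x - g x * D \<omega> x else 0)"

text \<open>The composition D X, in which the field acts first.\<close>

definition rx :: "('a => 'e) => ('a, 'e) diffop => ('a, 'e) diffop" where
  "rx X D = (\<lambda>\<omega> x. if \<omega> \<in> forms A p then D (lie_form A X \<omega>) x else 0)"

section \<open>Orders of commutators and compositions\<close>

lemma dlt_0: "D \<in> dlt 0 ==> D = 0"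
proof (intro ext)
  fix \<omega> x assume D: "D \<in> dlt 0"
  show "D \<omega> x = 0 \<omega> x"
  proof (cases "\<omega> \<in> forms A p")
    case w: True
    let ?c = "at_chart x" let ?y = "chart_map ?c x"
    have y: "?y \<in> chart_img ?c" using chart_at(2)[of x] by blast
    obtain Q where Q: "Q \<in> dopU (chart_img ?c) 0" "D \<omega> (chart_inv ?c ?y) = Q (co ?c \<omega>) ?y"
      using dltD(2)[OF D chart_at(1)] w y by blast
    then have "Q (co ?c \<omega>) ?y = 0"
      using dopU_coeffs[OF Q(1) chart_props(2)[OF chart_at(1)]] formsD(2)[OF w chart_at(1)] y by auto
    then show ?thesis using Q(2) by (simp add: chart_props(5)[OF chart_at])
  qed (simp add: dltD(1)[OF D])
qed

lemma dlt_cm: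
  assumes D: "D \<in> dlt (Suc k)" and g: "g \<in> smooth_functions A"
  shows "cm g D \<in> dlt k"
proof (rule dltI)
  fix c assume c: "c \<in> A"
  let ?U = "chart_img c"
  obtain P where P: "P \<in> dopU ?U (Suc k)" "\<And>\<omega> y. \<omega>\<in>forms A p ==> y\<in>?U ==> D \<omega> (chart_inv c y) = P (co c \<omega>) y"
    using dltD(2)[OF D c] by blast
  have "cm g D \<omega> (chart_inv c y) = P (\<lambda>z. g (chart_inv c z) * co c \<omega> z) y - g (chart_inv c y) * P (co c \<omega>) y"
    if w: "\<omega> \<in> forms A p" and y: "y \<in> ?U" for \<omega> y
    using w P(2)[OF mulf_forms[OF g w] y] P(2)[OF w y] by (simp add: cm_def co_mulf[abs_def])
  then show "\<exists>Q\<in>dopU ?U k. in_chart c (cm g D) Q"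
    by (intro bexI[OF _ dopU_ad[OF P(1) chart_props(2)[OF c] smooth_functionsD[OF g c]]]) auto
qed (simp add: cm_def fun_eq_iff)

lemma dlt_rx:
  assumes p0: "p = 0" and D: "D \<in> dlt k" and X: "X \<in> vector_fields A"
  shows "rx X D \<in> dlt (Suc k)"
proof (rule dltI)
  fix c assume c: "c \<in> A"
  let ?U = "chart_img c" and ?X = "vf_in_chart A c X"
  have U: "open ?U" and sX: "smooth_on ?U ?X" using chart_props(2)[OF c] vector_fieldsD[OF X c] by auto
  obtain P where P: "P \<in> dopU ?U k" "\<And>\<omega> y. \<omega>\<in>forms A p ==> y\<in>?U ==> D \<omega> (chart_inv c y) = P (co c \<omega>) y"
    using dltD(2)[OF D c] by blast
  \<comment> \<open>D X is X D minus the Lie derivative of \<open>D\<close>; the latter keeps the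
    order, and X D raises it by one.\<close>
  define L where "L f y = fd (P f) y (?X y) - P (\<lambda>z. fd f z (?X z) + 0 * f z) y" for f y
  have L: "L \<in> dopU ?U k" unfolding L_def[abs_def] by (rule dopU_lie[OF P(1) U sX smooth_on_const])
  define S where "S f y = (\<Sum>b\<in>Basis. (?X y \<bullet> b) * fd (P f) y b)" for f y
  have "S \<in> dopU ?U (Suc k)" unfolding S_def[abs_def]
    by (intro dopU_sum dopU_mult dopU_dv_left P U smooth_on_inner sX smooth_on_const) auto
  then have SL: "(\<lambda>f y. S f y - L f y) \<in> dopU ?U (Suc k)" by (rule dopU_minus[OF _ dopU_mono[OF L] U]) simp
  have "rx X D \<omega> (chart_inv c y) = S (co c \<omega>) y - L (co c \<omega>) y" if w: "\<omega> \<in> forms A p" and y: "y \<in> ?U" for \<omega> y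
  proof -
    have "rx X D \<omega> (chart_inv c y) = P (co c (lie_form A X \<omega>)) y" using w P(2)[OF lie_form_forms[OF w X] y] by (simp add: rx_def)
    also have "\<dots> = P (\<lambda>z. fd (co c \<omega>) z (?X z) + 0 * co c \<omega> z) y"
    proof (rule dopU_local[OF P(1) _ _ U _ y y])
      show "smooth_on ?U (co c (lie_form A X \<omega>))" by (rule formsD(2)[OF lie_form_forms[OF w X] c])
      show "smooth_on ?U (\<lambda>z. fd (co c \<omega>) z (?X z) + 0 * co c \<omega> z)"
        by (intro smooth_on_add smooth_on_fd_apply smooth_on_mult smooth_on_const U sX formsD(2)[OF w c])
      have "dvg p M = 0" for M :: "'e => 'e" by (simp only: p0 dvg_0)
      then show "co c (lie_form A X \<omega>) z = fd (co c \<omega>) z (?X z) + 0 * co c \<omega> z" if "z \<in> ?U" for z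
        using co_lie_form[OF w X c that] by (simp add: lco_def)
    qed
    also have "\<dots> = S (co c \<omega>) y - L (co c \<omega>) y"
      using fd_apply_sum[OF dopU_smooth[OF P(1) U formsD(2)[OF w c]] y, of "?X y"] by (simp add: S_def L_def)
    finally show ?thesis .
  qed
  then show "\<exists>Q\<in>dopU ?U (Suc k). in_chart c (rx X D) Q"
    by (intro bexI[OF _ SL]) auto
qed (simp add: rx_def fun_eq_iff)

lemma dlt_rx_iter:
  assumes "p = 0" "D \<in> dlt k" "X \<in> vector_fields A"
  shows "(rx X ^^ j) D \<in> dlt (k + j)"
proof (induction j)
  case (Suc j)
  then show ?case using dlt_rx[OF assms(1) _ assms(3)] by simp
qed (simp add: assms(2))

lemma rx_simps: "rx X (D + E) = rx X D + rx X E" "rx X (lm g D) = lm g (rx X D)" "rx X 0 = 0" "rx X (r *\<^sub>R D) = r *\<^sub>R rx X D"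
  by (simp_all add: rx_def lm_def fun_eq_iff)

lemma lm_simps: "lm g (D + E) = lm g D + lm g E" "lm g (lm h D) = lm (\<lambda>x. g x * h x) D" "lm g 0 = 0" "lm g (r *\<^sub>R D) = r *\<^sub>R lm g D"
  by (simp_all add: lm_def fun_eq_iff algebra_simps)

lemma rx_iter_simps: "(rx X ^^ j) (D + E) = (rx X ^^ j) D + (rx X ^^ j) E" "(rx X ^^ j) (lm g D) = lm g ((rx X ^^ j) D)" "(rx X ^^ j) 0 = 0"
proof -
  show "(rx X ^^ j) (D + E) = (rx X ^^ j) D + (rx X ^^ j) E" by (induction j) (simp_all only: funpow.simps id_apply o_apply rx_simps)
  show "(rx X ^^ j) (lm g D) = lm g ((rx X ^^ j) D)" by (induction j) (simp_all add: rx_simps)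
  show "(rx X ^^ j) 0 = 0" by (induction j) (simp_all only: funpow.simps id_apply o_apply rx_simps)
qed

lemma cm_lm: "cm g (lm h D) = lm h (cm g D)"
  by (simp add: cm_def lm_def fun_eq_iff algebra_simps)

lemma dlt_form_add:
  assumes D: "D \<in> dlt k" and w: "\<omega> \<in> forms A p" "\<omega>' \<in> forms A p" "\<omega>'' \<in> forms A p" and s: "\<And>x. \<omega>'' x = (\<lambda>vs. \<omega> x vs + \<omega>' x vs)"
  shows "D \<omega>'' x = D \<omega> x + D \<omega>' x"
proof -
  let ?c = "at_chart x" let ?y = "chart_map ?c x" let ?U = "chart_img ?c"
  have y: "?y \<in> ?U" using chart_at(2)[of x] by blast
  have x: "chart_inv ?c ?y = x" by (rule chart_props(5)[OF chart_at])
  have "co ?c \<omega>'' = (\<lambda>y. co ?c \<omega> y + co ?c \<omega>' y)" by (simp add: co_def form_in_chart_eq s fun_eq_iff)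
  moreover obtain P where P: "P \<in> dopU ?U k" "\<And>\<omega> y. \<omega>\<in>forms A p ==> y\<in>?U ==> D \<omega> (chart_inv ?c y) = P (co ?c \<omega>) y"
    using dltD(2)[OF D chart_at(1)] by blast
  ultimately show ?thesis
    using dopU_plus[OF P(1) chart_props(2)[OF chart_at(1)] formsD(2)[OF w(1) chart_at(1)] formsD(2)[OF w(2) chart_at(1)] y]
      P(2)[OF w(1) y] P(2)[OF w(2) y] P(2)[OF w(3) y] by (simp add: x)
qed

text \<open>Follows from X g = g X + X(g), as operators on functions, by applying \<open>D\<close>
  from the left.\<close>

lemma cm_rx:
  assumes p0: "p = 0" and D: "D \<in> dlt k" and X: "X \<in> vector_fields A" and g: "g \<in> smooth_functions A"
  shows "cm g (rx X D) = rx X (cm g D) + cm (lie_function A X g) D + lm (lie_function A X g) D"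
proof (intro ext)
  fix \<omega> x
  let ?r = "lie_function A X g"
  show "cm g (rx X D) \<omega> x = (rx X (cm g D) + cm ?r D + lm ?r D) \<omega> x"
  proof (cases "\<omega> \<in> forms A p")
    case w: True
    have r: "?r \<in> smooth_functions A" by (rule lie_function_smooth[OF X g])
    have Lw: "lie_form A X \<omega> \<in> forms A p" by (rule lie_form_forms[OF w X])
    have L: "lie_form A X (mulf g \<omega>) \<in> forms A p" by (rule lie_form_forms[OF mulf_forms[OF g w] X])
    have m: "mulf ?r \<omega> \<in> forms A p" "mulf g (lie_form A X \<omega>) \<in> forms A p" by (rule mulf_forms[OF r w], rule mulf_forms[OF g Lw])
    have "lie_form A X (mulf g \<omega>) x vs = mulf ?r \<omega> x vs + mulf g (lie_form A X \<omega>) x vs" for x vs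
    proof (cases vs)
      case Nil
      then show ?thesis using lie_function_mult[OF g form0_smooth[OF p0 w], of X x] by (simp add: lie_form_0 mulf_def)
    next
      case Cons
      then show ?thesis using p0 alternating_length[OF formsD(1)[OF L, of x], of vs]
          alternating_length[OF formsD(1)[OF m(1), of x], of vs] alternating_length[OF formsD(1)[OF m(2), of x], of vs] by simp
    qed
    from dlt_form_add[OF D m L, of x] this
    have "D (lie_form A X (mulf g \<omega>)) x = D (mulf ?r \<omega>) x + D (mulf g (lie_form A X \<omega>)) x" by (simp add: fun_eq_iff)
    then show ?thesis using w Lw mulf_forms[OF g w] by (simp add: cm_def rx_def lm_def)
  qed (simp add: cm_def rx_def lm_def dltD(1)[OF D])
qed

text \<open>In operator notation [E X^j, g] X = [E, g] X^(j+1) + j X(g) E X^j + L: pulling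
  \<open>g\<close> through X^j releases X(g) once for each factor. The remainder \<open>L\<close>
  has lower order and vanishes wherever \<open>E\<close> does.\<close>

lemma leading_commutator:
  assumes p0: "p = 0" and X: "X \<in> vector_fields A" and g: "g \<in> smooth_functions A"
  shows "E \<in> dlt (Suc i) ==> \<exists>L\<in>dlt (i + (j::nat)). rx X (cm g ((rx X ^^ j) E)) =
    L + (rx X ^^ Suc j) (cm g E) + real j *\<^sub>R lm (lie_function A X g) ((rx X ^^ j) E) \<and> (\<forall>N. eqN N E 0 \<longrightarrow> eqN N L 0)"
proof -
  \<comment> \<open>Quantified over \<open>i\<close> and \<open>E\<close>, because the induction on
    \<open>j\<close> passes from \<open>E\<close> to \<open>rx X E\<close>.\<close>
  define P where "P j \<longleftrightarrow> (\<forall>i. \<forall>E\<in>dlt (Suc i). \<exists>L\<in>dlt (i + j). rx X (cm g ((rx X ^^ j) E)) =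
    L + (rx X ^^ Suc j) (cm g E) + real j *\<^sub>R lm (lie_function A X g) ((rx X ^^ j) E) \<and> (\<forall>N. eqN N E 0 \<longrightarrow> eqN N L 0))" for j
  have "P j"
  proof (induction j)
  case 0
  show ?case unfolding P_def by (intro allI ballI bexI[OF _ dlt_zero]) (simp add: eqN_def)
next
  case (Suc j)
  show ?case unfolding P_def
  proof (intro allI ballI)
  fix i E assume E: "E \<in> dlt (Suc i)"
  let ?r = "lie_function A X g"
  have r: "?r \<in> smooth_functions A" by (rule lie_function_smooth[OF X g])
  obtain L where L: "L \<in> dlt (Suc i + j)" "rx X (cm g ((rx X ^^ j) (rx X E))) =
      L + (rx X ^^ Suc j) (cm g (rx X E)) + real j *\<^sub>R lm ?r ((rx X ^^ j) (rx X E))" "\<And>N. eqN N (rx X E) 0 ==> eqN N L 0"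
    using Suc[unfolded P_def] dlt_rx[OF p0 E X] by blast
  let ?M = "(rx X ^^ Suc j) (cm ?r E)"
  have M: "?M \<in> dlt (i + Suc j)" by (rule dlt_rx_iter[OF p0 dlt_cm[OF E r] X])
  have z: "eqN N (L + ?M) 0" if N: "eqN N E 0" for N
  proof -
    have "eqN N (rx X D) 0" if "eqN N D 0" for D using that lie_form_forms[OF _ X] by (simp add: eqN_def rx_def)
    then have it: "eqN N ((rx X ^^ j) D) 0" if "eqN N D 0" for D j using that by (induction j) simp_all
    have "eqN N (cm ?r E) 0" using N mulf_forms[OF r] by (simp add: eqN_def cm_def)
    from it[OF this, of "Suc j"] L(3)[of N] it[OF N, of 1] show ?thesis by (simp add: eqN_def)
  qed
  have c: "(rx X ^^ Suc j) (cm g (rx X E)) = (rx X ^^ Suc (Suc j)) (cm g E) + ?M + lm ?r ((rx X ^^ Suc j) E)"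
    unfolding cm_rx[OF p0 E X g] rx_iter_simps by (simp only: funpow_Suc_right o_apply)
  have s: "(rx X ^^ Suc j) E = (rx X ^^ j) (rx X E)" by (simp only: funpow_Suc_right o_apply)
  have "rx X (cm g ((rx X ^^ Suc j) E)) = (L + ?M) + (rx X ^^ Suc (Suc j)) (cm g E) + real (Suc j) *\<^sub>R lm ?r ((rx X ^^ Suc j) E)"
    using L(2) unfolding c by (simp only: s[symmetric] of_nat_Suc scaleR_left_distrib scaleR_one ac_simps)
  moreover have "L + ?M \<in> dlt (i + Suc j)" using dlt_add[OF _ M, of L] L(1) by simp
  ultimately show "\<exists>L\<in>dlt (i + Suc j). rx X (cm g ((rx X ^^ Suc j) E)) =
    L + (rx X ^^ Suc (Suc j)) (cm g E) + real (Suc j) *\<^sub>R lm (lie_function A X g) ((rx X ^^ Suc j) E) \<and> (\<forall>N. eqN N E 0 \<longrightarrow> eqN N L 0)"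
    using z by blast
  qed
  qed
  then show "E \<in> dlt (Suc i) ==> \<exists>L\<in>dlt (i + j). rx X (cm g ((rx X ^^ j) E)) =
    L + (rx X ^^ Suc j) (cm g E) + real j *\<^sub>R lm (lie_function A X g) ((rx X ^^ j) E) \<and> (\<forall>N. eqN N E 0 \<longrightarrow> eqN N L 0)"
    unfolding P_def by blast
qed

lemma commutator_identity:
  assumes p0: "p = 0" and X: "X \<in> vector_fields A" and g: "g \<in> smooth_functions A" and G: "G \<in> diff_ops A k p"
  shows "lie_op A p X (lm g G) = lie_op A p (\<lambda>x. g x *\<^sub>R X x) G + (lm (lie_function A X g) G + rx X (cm g G))"
proof (intro ext)
  fix \<omega> x
  show "lie_op A p X (lm g G) \<omega> x = (lie_op A p (\<lambda>x. g x *\<^sub>R X x) G + (lm (lie_function A X g) G + rx X (cm g G))) \<omega> x"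
  proof (cases "\<omega> \<in> forms A p")
    case w: True
    have Lw: "lie_form A X \<omega> \<in> forms A p" by (rule lie_form_forms[OF w X])
    have "lie_form A (\<lambda>x. g x *\<^sub>R X x) \<omega> = mulf g (lie_form A X \<omega>)"
      by (rule form0_eqI[OF p0 lie_form_forms[OF w vector_field_scale[OF g X]] mulf_forms[OF g Lw]])
        (simp add: lie_form_0 mulf_def lie_function_scale[OF form0_smooth[OF p0 w]])
    then show ?thesis using w Lw
      by (simp add: lie_op_def lm_def rx_def cm_def lie_function_mult[OF g diff_ops_smooth[OF G w]] lie_function_scale[OF diff_ops_smooth[OF G w]])
  qed (simp add: lie_op_def lm_def rx_def diff_ops_off[OF G])
qed

text \<open>A functional \<open>\<tau>\<close> annihilating all operators of the form \<open>X(g) G + [G, g] X\<close> annihilates \<open>X(g)\<^sup>m D\<close> for large \<open>m\<close>: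
  modulo lower order, it maps \<open>(j + 1) X(g) E X\<^sup>j\<close> and \<open>- [E, g] X\<^sup>j\<^sup>+\<^sup>1\<close> to the same value, and iterated commutators with \<open>g\<close> vanish.\<close>

lemma power_annihilated:
  assumes p0: "p = 0" and X: "X \<in> vector_fields A" and g: "g \<in> smooth_functions A"
    and add: "\<And>D E. D \<in> dlt (Suc k) ==> eqN N D 0 ==> E \<in> dlt (Suc k) ==> eqN N E 0 ==> \<tau> (D + E) = \<tau> D + (\<tau> E :: real)"
    and scale: "\<And>D r. D \<in> dlt (Suc k) ==> \<tau> (r *\<^sub>R D) = r * \<tau> D"
    and H: "\<And>G. G \<in> dlt (Suc k) ==> eqN N G 0 ==> \<tau> (lm (lie_function A X g) G + rx X (cm g G)) = 0"
  shows "l \<le> Suc k ==> \<exists>m. \<forall>D\<in>dlt l. eqN N D 0 \<longrightarrow> \<tau> (lm (\<lambda>x. lie_function A X g x ^ m) D) = 0"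
proof (induction l)
  case 0
  have "\<tau> 0 = 0" using scale[OF dlt_zero, of 0] by simp
  then show ?case using dlt_0 lm_simps(3) by (intro exI[of _ 0]) metis
next
  case (Suc l)
  let ?r = "lie_function A X g" let ?P = "\<lambda>m D. lm (\<lambda>x. ?r x ^ m) D"
  obtain m0 where m0: "\<forall>D\<in>dlt l. eqN N D 0 \<longrightarrow> \<tau> (?P m0 D) = 0" using Suc.IH[OF Suc_leD[OF Suc.prems]] by blast
  have r: "?r \<in> smooth_functions A" by (rule lie_function_smooth[OF X g])
  have rm: "(\<lambda>x. ?r x ^ m) \<in> smooth_functions A" for m
    by (induction m) (simp_all add: smooth_functions_const smooth_functions_mult[OF r])
  have Z: "eqN N (lm h D) 0" "eqN N (rx X D) 0" "h \<in> smooth_functions A ==> eqN N (cm h D) 0" "eqN N ((rx X ^^ j) D) 0" "eqN N (s *\<^sub>R D) 0"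
    if D: "eqN N D 0" for D h j s
  proof -
    have *: "eqN N (rx X D) 0" if "eqN N D 0" for D using that lie_form_forms[OF _ X] by (simp add: eqN_def rx_def)
    show "eqN N (lm h D) 0" "eqN N (rx X D) 0" "h \<in> smooth_functions A ==> eqN N (cm h D) 0" "eqN N (s *\<^sub>R D) 0"
      using D *[OF D] mulf_forms[of h] by (simp_all add: eqN_def lm_def cm_def)
    show "eqN N ((rx X ^^ j) D) 0" using D by (induction j) (simp_all add: *)
  qed
  have Zadd: "eqN N D 0 ==> eqN N E 0 ==> eqN N (D + E) 0" for D E by (simp add: eqN_def)
  have scaleS: "s *\<^sub>R D \<in> dlt (Suc k)" if "D \<in> dlt (Suc k)" for s D using that diff_ops_scaleR by (simp add: dlt_Suc)
  \<comment> \<open>\<open>H\<close> is applied to r^m0 E X^j, where r = X(g). The lower order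
    remainder is annihilated by the choice of \<open>m0\<close>, and the terms r^(m0+1) E X^j add up
    to the factor \<open>j + 1\<close>.\<close>
  have key: "real (Suc j) * \<tau> (?P (Suc m0) ((rx X ^^ j) E)) = - \<tau> (?P m0 ((rx X ^^ Suc j) (cm g E)))"
    if E: "E \<in> dlt (Suc i)" "eqN N E 0" and ij: "i + j \<le> l" for E i j
  proof -
    let ?E = "(rx X ^^ j) E"
    have le: "i + Suc j \<le> Suc k" "Suc i + j \<le> Suc k" using ij Suc.prems by auto
    have F: "?E \<in> dlt (Suc k)" "eqN N ?E 0" by (rule dlt_mono[OF dlt_rx_iter[OF p0 E(1) X] le(2)], rule Z(4)[OF E(2)])
    obtain L where L: "L \<in> dlt (i + j)" "rx X (cm g ?E) = L + (rx X ^^ Suc j) (cm g E) + real j *\<^sub>R lm ?r ?E" "eqN N L 0"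
      using leading_commutator[OF p0 X g E(1), of j] E(2) by blast
    have L': "L \<in> dlt l" "L \<in> dlt (Suc k)" using dlt_mono[OF L(1) ij] dlt_mono[OF L(1)] ij Suc.prems by auto
    have C: "(rx X ^^ Suc j) (cm g E) \<in> dlt (Suc k)" "eqN N ((rx X ^^ Suc j) (cm g E)) 0"
      by (rule dlt_mono[OF dlt_rx_iter[OF p0 dlt_cm[OF E(1) g] X] le(1)], rule Z(4)[OF Z(3)[OF E(2) g]])
    have e1: "lm ?r (?P m0 ?E) = ?P (Suc m0) ?E" by (simp add: lm_simps)
    have e2: "?P m0 (lm ?r ?E) = ?P (Suc m0) ?E" by (simp add: lm_simps mult.commute)
    have "rx X (cm g (?P m0 ?E)) = ?P m0 (L + (rx X ^^ Suc j) (cm g E) + real j *\<^sub>R lm ?r ?E)"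
      by (simp only: cm_lm rx_simps(2) L(2))
    then have "0 = \<tau> (?P (Suc m0) ?E + (?P m0 L + ?P m0 ((rx X ^^ Suc j) (cm g E)) + real j *\<^sub>R ?P (Suc m0) ?E))"
      using H[OF dlt_lm[OF F(1) rm] Z(1)[OF F(2)], of m0] by (simp only: e1 lm_simps(1,4) e2)
    also have "\<dots> = \<tau> (?P (Suc m0) ?E) + (\<tau> (?P m0 L) + \<tau> (?P m0 ((rx X ^^ Suc j) (cm g E))) + real j * \<tau> (?P (Suc m0) ?E))"
      by (simp only: add scale dlt_add dlt_lm[OF _ rm] scaleS Zadd Z(1) Z(5) F C L'(2) L(3))
    also have "\<tau> (?P m0 L) = 0" using m0 L'(1) L(3) by blast
    finally show ?thesis by (simp add: algebra_simps)
  qed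
  \<comment> \<open>Each use of \<open>key\<close> replaces \<open>E\<close> by [E, g], of lower
    order, at the price of one more factor X(g); after \<open>i + 1\<close> uses the commutator is
    zero.\<close>
  have R: "\<tau> (?P (m0 + Suc i) ((rx X ^^ j) E)) = 0" if "E \<in> dlt (Suc i)" "eqN N E 0" "i + j \<le> l" for E i j
    using that
  proof (induction i arbitrary: E j)
    case 0
    have "cm g E = 0" by (rule dlt_0[OF dlt_cm[OF 0(1) g]])
    then have "(rx X ^^ Suc j) (cm g E) = 0" by (simp only: rx_iter_simps)
    moreover have "\<tau> 0 = 0" using scale[OF dlt_zero, of 0] by simp
    ultimately have "real (Suc j) * \<tau> (?P (Suc m0) ((rx X ^^ j) E)) = 0" using key[OF 0] lm_simps(3) by simp
    then show ?case by (simp del: of_nat_Suc)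
  next
    case (Suc i)
    let ?E = "?P (Suc i) E"
    have *: "?P a (?P b D) = ?P (a + b) D" for a b D by (simp add: lm_simps power_add)
    have "real (Suc j) * \<tau> (?P (Suc m0) ((rx X ^^ j) ?E)) = - \<tau> (?P m0 ((rx X ^^ Suc j) (cm g ?E)))"
      by (rule key[OF dlt_lm[OF Suc.prems(1) rm] Z(1)[OF Suc.prems(2)] Suc.prems(3)])
    also have "?P m0 ((rx X ^^ Suc j) (cm g ?E)) = ?P (m0 + Suc i) ((rx X ^^ Suc j) (cm g E))"
      by (simp only: cm_lm rx_iter_simps(2) *)
    also have "\<tau> \<dots> = 0" by (rule Suc.IH[OF dlt_cm[OF Suc.prems(1) g] Z(3)[OF Suc.prems(2) g]]) (use Suc.prems(3) in simp)
    finally have "\<tau> (?P (Suc m0) ((rx X ^^ j) ?E)) = 0" by (simp del: of_nat_Suc)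
    also have "?P (Suc m0) ((rx X ^^ j) ?E) = ?P (m0 + Suc (Suc i)) ((rx X ^^ j) E)"
      by (simp only: rx_iter_simps(2) *) simp
    finally show ?case .
  qed
  show ?case
    by (rule exI[of _ "m0 + Suc l"], intro ballI impI) (rule R[of _ l 0, unfolded funpow_0], simp_all only: add_0_right order_refl)
qed

end

section \<open>Two functions without common critical points\<close>

text \<open>The Euclidean gradient, taken in one chart at a time; no metric on the manifold is
  involved.\<close>

definition grad :: "('e::euclidean_space => real) => 'e => 'e" where
  "grad f y = (\<Sum>b\<in>Basis. fd f y b *\<^sub>R b)"

lemma grad_inner: "b \<in> Basis ==> grad f y \<bullet> b = fd f y b"
  by (simp add: grad_def inner_sum_left inner_Basis if_distrib sum.delta cong: if_cong)

lemma smooth_on_grad: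
  assumes "open U" "smooth_on U f"
  shows "smooth_on U (grad f)"
  unfolding grad_def[abs_def]
  by (intro smooth_on_sum smooth_on_scaleR smooth_on_fd smooth_on_const assms)

lemma fd_grad:
  assumes "smooth_on U f" "y \<in> U"
  shows "fd f y v = v \<bullet> grad f y"
  using fd_apply_sum[OF assms, of v] by (simp add: grad_def inner_sum_right mult.commute)

lemma grad_cong: "open U ==> y \<in> U ==> (\<And>z. z \<in> U ==> f z = g z) ==> grad f y = grad g y"
  using fd_cong[of U y f g] by (simp add: grad_def)

lemma grad_add:
  assumes "smooth_on U f" "smooth_on U g" "y \<in> U"
  shows "grad (\<lambda>y. f y + g y) y = grad f y + grad g y"
  by (simp add: grad_def fd_add[OF assms] scaleR_left_distrib sum.distrib)

lemma grad_mult: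
  assumes "smooth_on U f" "smooth_on U g" "y \<in> U"
  shows "grad (\<lambda>y. f y * g y) y = f y *\<^sub>R grad g y + g y *\<^sub>R grad f y"
  by (simp add: grad_def fd_mult[OF assms] scaleR_left_distrib sum.distrib scaleR_sum_right mult.commute)

lemma grad_sum:
  assumes "open U" "\<And>i. i \<in> I ==> smooth_on U (f i)" "y \<in> U" "finite I"
  shows "grad (\<lambda>y. \<Sum>i\<in>I. f i y) y = (\<Sum>i\<in>I. grad (f i) y)"
  using assms(4,2)
proof (induction I)
  case empty
  then show ?case by (simp add: grad_def)
next
  case (insert i I)
  then show ?case using grad_add[OF _ _ assms(3), of "f i" "\<lambda>y. \<Sum>i\<in>I. f i y"] smooth_on_sum[OF assms(1), of I f] by simp
qed

text \<open>An affine function encoded by its linear part and its constant term, so that these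
  functions form a Euclidean space of dimension \<open>n + 1\<close>, in which negligible sets make
  sense.\<close>

definition aff :: "'e::euclidean_space \<times> real => 'e => real" where
  "aff a y = fst a \<bullet> y + snd a"

lemma smooth_on_aff: "open U ==> smooth_on U (aff a)"
  unfolding aff_def[abs_def] by (intro smooth_on_add smooth_on_inner smooth_on_const smooth_on_id)

lemma grad_aff: "grad (aff a) y = fst a"
proof (rule euclidean_eqI)
  fix b :: 'a assume b: "b \<in> Basis"
  have "(aff a has_derivative (\<lambda>v. fst a \<bullet> v)) (at y)" unfolding aff_def[abs_def] by (auto intro!: derivative_eq_intros)
  then show "grad (aff a) y \<bullet> b = fst a \<bullet> b" using b by (simp add: grad_inner fd_eqI)
qed

lemma differentiable_pair:
  assumes "f differentiable (at x within S)" "g differentiable (at x within S)"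
  shows "(\<lambda>q. (f q, g q)) differentiable (at x within S)"
  by (rule differentiableI[OF has_derivative_Pair[OF assms[unfolded frechet_derivative_works]]])

text \<open>
  For fixed \<open>y\<close> and fixed values \<open>\<kappa>, \<kappa>'\<close> of the affine functions at \<open>y\<close>, the vanishing of the gradients
  determines \<open>a\<close> and \<open>a'\<close>. The bad pairs thus form the image of a space of dimension \<open>n + 2 < 2 (n + 1)\<close>.
\<close>

lemma generic_affine:
  fixes \<theta> G G' :: "'e::euclidean_space => real"
  assumes W: "open W" and s: "smooth_on W \<theta>" "smooth_on W G" "smooth_on W G'" and n: "\<And>y. y \<in> W ==> \<theta> y \<noteq> 0"
  shows "\<exists>a a'. \<forall>y\<in>W. grad (\<lambda>z. G z + \<theta> z * aff a z) y \<noteq> 0 \<or> grad (\<lambda>z. G' z + \<theta> z * aff a' z) y \<noteq> 0"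
proof -
  \<comment> \<open>The linear part a, solved from grad H + \<kappa> grad \<theta> + \<theta> a = 0
    with \<kappa> the prescribed value of the affine function; \<open>F\<close> adds the constant
    term.\<close>
  define S where "S H q = (- inverse (\<theta> (fst q))) *\<^sub>R (grad H (fst q) + snd q *\<^sub>R grad \<theta> (fst q))" for H and q :: "'e \<times> real"
  define F where "F H q = (S H q, snd q - S H q \<bullet> fst q)" for H and q :: "'e \<times> real"
  define \<Phi> where "\<Phi> q = (F G (fst q, fst (snd q)), F G' (fst q, snd (snd q)))" for q :: "'e \<times> real \<times> real"
  have W2: "open (W \<times> (UNIV :: real set))" by (intro open_Times W open_UNIV)
  have f: "smooth_on (W \<times> (UNIV :: real set)) (\<lambda>q. h (fst q))" if "smooth_on W h" for h :: "'e => 'f::euclidean_space"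
    using smooth_on_compose[where f=h and g="fst :: 'e \<times> real => 'e", OF W2 W _ that smooth_on_linear[OF bounded_linear_fst]] by auto
  have sS: "smooth_on (W \<times> UNIV) (S H)" if "smooth_on W H" for H
    unfolding S_def[abs_def]
    by (intro smooth_on_scaleR smooth_on_minus smooth_on_inverse smooth_on_add f smooth_on_grad W W2 s that smooth_on_linear[OF bounded_linear_snd])
      (use n in auto)
  have dF: "F H differentiable (at q)" if "smooth_on W H" "q \<in> W \<times> UNIV" for H q
  proof -
    have "smooth_on (W \<times> UNIV) (\<lambda>q. snd q - S H q \<bullet> fst q)"
      by (intro smooth_on_diff smooth_on_inner sS[OF that(1)] W2 smooth_on_linear[OF bounded_linear_snd] smooth_on_linear[OF bounded_linear_fst])
    from smooth_on_imp_differentiable[OF this that(2)] smooth_on_imp_differentiable[OF sS[OF that(1)] that(2)]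
    show ?thesis unfolding F_def[abs_def] by (intro differentiable_pair)
  qed
  have "\<Phi> differentiable (at q)" if q: "q \<in> W \<times> UNIV" for q
  proof -
    have l1: "(\<lambda>q::'e \<times> real \<times> real. (fst q, fst (snd q))) differentiable (at q)"
      and l2: "(\<lambda>q::'e \<times> real \<times> real. (fst q, snd (snd q))) differentiable (at q)"
      by (intro differentiable_pair linear_imp_differentiable bounded_linear.linear bounded_linear_intros)+
    have "(F G \<circ> (\<lambda>q. (fst q, fst (snd q)))) differentiable (at q)"
      by (rule differentiable_chain_at[OF l1 dF[OF s(2)]]) (use q in auto)
    moreover have "(F G' \<circ> (\<lambda>q. (fst q, snd (snd q)))) differentiable (at q)"
      by (rule differentiable_chain_at[OF l2 dF[OF s(3)]]) (use q in auto)
    ultimately show ?thesis unfolding \<Phi>_def[abs_def] o_def by (intro differentiable_pair)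
  qed
  then have "\<Phi> differentiable_on (W \<times> UNIV)" unfolding differentiable_on_def by (blast intro: differentiable_at_withinI)
  then have "negligible (\<Phi> ` (W \<times> UNIV))"
    by (rule negligible_differentiable_image_lowdim[rotated]) simp
  then obtain a a' where a: "(a, a') \<notin> \<Phi> ` (W \<times> UNIV)" using non_negligible_UNIV by (metis surj_pair UNIV_eq_I)
  have crit: "a = F H (y, aff a y)" if y: "y \<in> W" and H: "smooth_on W H" and z: "grad (\<lambda>z. H z + \<theta> z * aff a z) y = 0" for H a y
  proof -
    have "0 = grad H y + (\<theta> y *\<^sub>R fst a + aff a y *\<^sub>R grad \<theta> y)"
      using z grad_add[OF H smooth_on_mult[OF W s(1) smooth_on_aff[OF W]] y] grad_mult[OF s(1) smooth_on_aff[OF W] y] by (simp add: grad_aff)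
    then have "\<theta> y *\<^sub>R fst a = - (grad H y + aff a y *\<^sub>R grad \<theta> y)" by (simp add: eq_neg_iff_add_eq_0 algebra_simps)
    then have "inverse (\<theta> y) *\<^sub>R (\<theta> y *\<^sub>R fst a) = inverse (\<theta> y) *\<^sub>R (- (grad H y + aff a y *\<^sub>R grad \<theta> y))" by (simp only:)
    then have "fst a = S H (y, aff a y)"
      by (simp only: S_def fst_conv snd_conv scaleR_minus_left scaleR_minus_right scaleR_scaleR left_inverse[OF n[OF y]] scaleR_one)
    then show ?thesis by (simp add: F_def prod_eq_iff) (simp add: aff_def)
  qed
  have "grad (\<lambda>z. G z + \<theta> z * aff a z) y \<noteq> 0 \<or> grad (\<lambda>z. G' z + \<theta> z * aff a' z) y \<noteq> 0" if y: "y \<in> W" for y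
  proof (rule ccontr)
    assume "\<not> ?thesis"
    then have "(a, a') = \<Phi> (y, aff a y, aff a' y)" using crit[OF y s(2)] crit[OF y s(3)] by (simp add: \<Phi>_def)
    then show False using a y by blast
  qed
  then show ?thesis by blast
qed

text \<open>A partition of unity without the normalisation; numbering the bumps by naturals lets the
  generic functions be built one bump at a time.\<close>

locale bumps = mfd A for A :: "('a::{second_countable_topology, t2_space}, 'e::euclidean_space) chart set" +
  fixes c :: "nat => ('a, 'e) chart" and \<eta> :: "nat => 'a => real"
  assumes c: "c j \<in> A" and eta: "\<eta> j \<in> smooth_functions A"
    and supp: "\<exists>K. compact K \<and> K \<subseteq> chart_dom (c j) \<and> (\<forall>x. x \<notin> K \<longrightarrow> \<eta> j x = 0)"
    and fin: "\<exists>N m. open N \<and> x \<in> N \<and> (\<forall>z\<in>N. \<forall>j\<ge>m. \<eta> j z = 0)"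
    and cover: "\<exists>j. \<eta> j x \<noteq> 0"
begin

lemma supp_dom: "\<eta> j x \<noteq> 0 ==> x \<in> chart_dom (c j)"
  using supp[of j] by blast

lemma supp_smooth:
  assumes h: "smooth_on (chart_img (c j)) h"
  shows "(\<lambda>x. \<eta> j x * h (chart_map (c j) x)) \<in> smooth_functions A"
proof -
  obtain K where K: "compact K" "K \<subseteq> chart_dom (c j)" "\<forall>x. x \<notin> K \<longrightarrow> \<eta> j x = 0" using supp[of j] by blast
  show ?thesis
  proof (rule smooth_functions_supported[OF c K(1,2)])
    show "smooth_on (chart_img (c j)) (\<lambda>y. \<eta> j (chart_inv (c j) y) * h (chart_map (c j) (chart_inv (c j) y)))"
      by (rule smooth_on_cong[OF chart_props(2)[OF c] _ smooth_on_mult[OF chart_props(2)[OF c] smooth_functionsD[OF eta[of j] c[of j]] h]])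
        (simp add: chart_props(6)[OF c])
  qed (use K(3) in simp)
qed

lemma fin_sum:
  assumes "\<And>j. \<eta> j z = 0 ==> t j = 0" "\<forall>j\<ge>m. \<eta> j z = 0"
  shows "(\<Sum>j\<in>{j. \<eta> j z \<noteq> 0}. t j) = (\<Sum>j<m. t j)"
  by (rule sum.mono_neutral_left) (use assms in \<open>auto simp: not_le[symmetric]\<close>)

lemma fin_at: "finite {j. \<eta> j x \<noteq> 0}"
proof -
  obtain m where "\<forall>j\<ge>m. \<eta> j x = 0" using fin[of x] by blast
  then have "{j. \<eta> j x \<noteq> 0} \<subseteq> {..<m}" by (auto simp: not_le[symmetric])
  then show ?thesis using finite_subset by blast
qed

text \<open>Keeping one factor \<open>\<eta> j\<close> apart makes both factors smooth on all of the manifold.\<close>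

definition tm :: "nat => 'e \<times> real => 'a => real" where
  "tm j a x = \<eta> j x * (\<eta> j x * aff a (chart_map (c j) x))"

lemma tm_factor: "(\<lambda>x. \<eta> j x * aff a (chart_map (c j) x)) \<in> smooth_functions A"
  by (rule supp_smooth[OF smooth_on_aff[OF chart_props(2)[OF c]]])

lemma tm_smooth: "tm j a \<in> smooth_functions A"
  unfolding tm_def[abs_def] by (rule smooth_functions_mult[OF eta tm_factor])

lemma sum_smooth:
  assumes "\<And>j. j \<in> I ==> f j \<in> smooth_functions A"
  shows "(\<lambda>x. \<Sum>j\<in>I. f j x) \<in> smooth_functions A"
  using assms by (induction I rule: infinite_finite_induct) (simp_all add: smooth_functions_const smooth_functions_add)

definition gf :: "(nat => 'e \<times> real) => 'a => real" where
  "gf a x = (\<Sum>j\<in>{j. \<eta> j x \<noteq> 0}. tm j (a j) x)"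

lemma gf_fin: "\<forall>j\<ge>m. \<eta> j z = 0 ==> gf a z = (\<Sum>j<m. tm j (a j) z)"
  unfolding gf_def by (rule fin_sum) (simp_all add: tm_def)

lemma gf_smooth: "gf a \<in> smooth_functions A"
proof (rule smooth_functionsI)
  fix x
  let ?b = "at_chart x"
  obtain N m where N: "open N" "x \<in> N" "\<forall>z\<in>N. \<forall>j\<ge>m. \<eta> j z = 0" using fin[of x] by blast
  let ?N = "N \<inter> chart_dom ?b"
  have o: "open ?N" by (rule open_Int[OF N(1) chart_props(1)[OF chart_at(1)]])
  have "smooth_on (cset ?b ?N) (\<lambda>y. gf a (chart_inv ?b y))"
  proof (rule smooth_on_cong[OF cset_open[OF chart_at(1) o]])
    show "smooth_on (cset ?b ?N) (\<lambda>y. \<Sum>j<m. tm j (a j) (chart_inv ?b y))"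
      by (rule smooth_on_subset[OF smooth_functionsD[OF sum_smooth[OF tm_smooth] chart_at(1)] cset_subset])
    show "(\<Sum>j<m. tm j (a j) (chart_inv ?b y)) = gf a (chart_inv ?b y)" if "y \<in> cset ?b ?N" for y
      by (rule gf_fin[symmetric]) (use that N(3) in \<open>simp add: cset_def\<close>)
  qed
  then show "\<exists>b\<in>A. \<exists>N. open N \<and> x \<in> N \<and> N \<subseteq> chart_dom b \<and> smooth_on (cset b N) (\<lambda>y. gf a (chart_inv b y))"
    using o N(2) chart_at(2) by (intro bexI[OF _ chart_at(1)[of x]] exI[of _ ?N]) blast
qed

abbreviation lgrad :: "nat => ('a => real) => 'e => 'e" where
  "lgrad j f \<equiv> grad (\<lambda>z. f (chart_inv (c j) z))"

text \<open>
  Squares have vanishing derivative where they vanish, so that at \<open>x\<close> the summands after the last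
  \<open>\<eta> J x \<noteq> 0\<close> do not matter. This permits the choice of the affine functions one by one.
\<close>

lemma lgrad_last:
  assumes J: "\<eta> J x \<noteq> 0" "\<And>j. j > J ==> \<eta> j x = 0"
  shows "lgrad J (gf a) (chart_map (c J) x) =
    grad (\<lambda>z. (\<Sum>j<J. tm j (a j) (chart_inv (c J) z)) + (\<eta> J (chart_inv (c J) z))\<^sup>2 * aff (a J) z) (chart_map (c J) x)"
proof -
  let ?y = "chart_map (c J) x" and ?U = "chart_img (c J)" and ?ci = "chart_inv (c J)"
  have x: "x \<in> chart_dom (c J)" by (rule supp_dom[OF J(1)])
  have y: "?y \<in> ?U" "?ci ?y = x" using x chart_props(5)[OF c x] by auto
  have U: "open ?U" by (rule chart_props(2)[OF c])
  obtain N m where N: "open N" "x \<in> N" "\<forall>z\<in>N. \<forall>j\<ge>m. \<eta> j z = 0" using fin[of x] by blast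
  have Jm: "J < m" using J(1) N by (metis not_le)
  let ?t = "\<lambda>j z. tm j (a j) (?ci z)"
  have t: "smooth_on ?U (?t j)" for j by (rule smooth_functionsD[OF tm_smooth c])
  have "lgrad J (gf a) ?y = grad (\<lambda>z. \<Sum>j<m. ?t j z) ?y"
    by (rule grad_cong[OF cset_open[OF c N(1)] cset_cm[OF c x N(2)]]) (rule gf_fin, use N(3) in \<open>simp add: cset_def\<close>)
  also have "\<dots> = (\<Sum>j<m. grad (?t j) ?y)" by (rule grad_sum[OF U t y(1)]) simp
  also have "\<dots> = (\<Sum>j<Suc J. grad (?t j) ?y)"
  proof (rule sum.mono_neutral_right)
    show "\<forall>j\<in>{..<m} - {..<Suc J}. grad (?t j) ?y = 0"
    proof
      fix j assume "j \<in> {..<m} - {..<Suc J}"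
      then have "\<eta> j (?ci ?y) = 0" using J(2) y(2) by simp
      then show "grad (?t j) ?y = 0"
        using grad_mult[OF smooth_functionsD[OF eta c] smooth_functionsD[OF tm_factor c] y(1), of j j "a j"] by (simp add: tm_def)
    qed
  qed (use Jm in auto)
  also have "\<dots> = grad (\<lambda>z. \<Sum>j<Suc J. ?t j z) ?y" by (rule grad_sum[OF U t y(1), symmetric]) simp
  also have "\<dots> = grad (\<lambda>z. (\<Sum>j<J. ?t j z) + (\<eta> J (?ci z))\<^sup>2 * aff (a J) z) ?y"
    by (rule grad_cong[OF U y(1)]) (simp add: tm_def chart_props(6)[OF c] power2_eq_square)
  finally show ?thesis .
qed

lemma generic_functions: "\<exists>a a'. \<forall>x. \<exists>J. \<eta> J x \<noteq> 0 \<and> (lgrad J (gf a) (chart_map (c J) x) \<noteq> 0 \<or> lgrad J (gf a') (chart_map (c J) x) \<noteq> 0)"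
proof -
  let ?W = "\<lambda>J. {y \<in> chart_img (c J). \<eta> J (chart_inv (c J) y) \<noteq> 0}"
  let ?g = "\<lambda>f J b y. grad (\<lambda>z. (\<Sum>j<J. tm j (f j) (chart_inv (c J) z)) + (\<eta> J (chart_inv (c J) z))\<^sup>2 * aff b z) y"
  let ?P = "\<lambda>f J (b :: ('e \<times> real) \<times> ('e \<times> real)). \<forall>y\<in>?W J. ?g (\<lambda>j. fst (f j)) J (fst b) y \<noteq> 0 \<or> ?g (\<lambda>j. snd (f j)) J (snd b) y \<noteq> 0"
  \<comment> \<open>The pair of affine functions at stage \<open>J\<close> is chosen with regard to
    the earlier stages only: \<open>generic_affine\<close> is used where \<open>\<eta> J\<close>
    does not vanish, with the square of \<open>\<eta> J\<close> as \<open>\<theta>\<close> and the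
    earlier sums as \<open>G\<close> and \<open>G'\<close>.\<close>
  have "\<exists>f. \<forall>J. ?P f J (f J)"
  proof (rule dependent_wellorder_choice)
    fix b f g and J :: nat assume "\<And>i. i < J ==> f i = (g i :: ('e \<times> real) \<times> ('e \<times> real))"
    then show "?P f J b = ?P g J b" by (simp cong: sum.cong_simp)
  next
    fix J :: nat and f :: "nat => ('e \<times> real) \<times> ('e \<times> real)"
    have U: "open (chart_img (c J))" by (rule chart_props(2)[OF c])
    have W: "open (?W J)"
      using continuous_open_preimage[OF smooth_on_imp_continuous_on[OF smooth_functionsD[OF eta[of J] c[of J]]] U, of "- {0}"]
      by (simp add: vimage_def Int_def open_Compl)
    have sub: "?W J \<subseteq> chart_img (c J)" by auto
    have "\<exists>b b'. \<forall>y\<in>?W J. ?g (\<lambda>j. fst (f j)) J b y \<noteq> 0 \<or> ?g (\<lambda>j. snd (f j)) J b' y \<noteq> 0"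
      by (rule generic_affine[OF W])
        (auto intro!: smooth_on_subset[OF _ sub] smooth_on_power U smooth_functionsD[OF eta c] smooth_functionsD[OF sum_smooth[OF tm_smooth] c])
    then show "\<exists>b. ?P f J b" by auto
  qed
  then obtain f where f: "\<And>J. ?P f J (f J)" by blast
  have "\<exists>J. \<eta> J x \<noteq> 0 \<and> (lgrad J (gf (\<lambda>j. fst (f j))) (chart_map (c J) x) \<noteq> 0 \<or> lgrad J (gf (\<lambda>j. snd (f j))) (chart_map (c J) x) \<noteq> 0)" for x
  proof -
    \<comment> \<open>The last bump that does not vanish at \<open>x\<close>: there
      \<open>lgrad_last\<close> removes all later terms from the gradient.\<close>
    let ?J = "Max {j. \<eta> j x \<noteq> 0}"
    have ne: "{j. \<eta> j x \<noteq> 0} \<noteq> {}" using cover[of x] by blast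
    have J: "\<eta> ?J x \<noteq> 0" using Max_in[OF fin_at ne] by simp
    have J': "\<eta> j x = 0" if "j > ?J" for j using Max_ge[OF fin_at, of j x] that by auto
    have x: "x \<in> chart_dom (c ?J)" by (rule supp_dom[OF J])
    have "chart_map (c ?J) x \<in> ?W ?J" using J x chart_props(5)[OF c x] by simp
    have L: "lgrad ?J (gf a) (chart_map (c ?J) x) = ?g a ?J (a ?J) (chart_map (c ?J) x)" for a
      by (rule lgrad_last[OF J J'])
    from f[rule_format, OF \<open>chart_map (c ?J) x \<in> ?W ?J\<close>] have "lgrad ?J (gf (\<lambda>j. fst (f j))) (chart_map (c ?J) x) \<noteq> 0 \<or> lgrad ?J (gf (\<lambda>j. snd (f j))) (chart_map (c ?J) x) \<noteq> 0"
      unfolding L .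
    with J show ?thesis by (intro exI[of _ ?J] conjI)
  qed
  then show ?thesis by blast
qed

text \<open>The gradient of \<open>g\<close> in one chart, weighted with a bump. Summed over
  \<open>j\<close> these fields give X(g) as a sum of nonnegative terms, positive wherever
  \<open>g\<close> has no critical point.\<close>

definition Yf :: "('a => real) => nat => 'a => 'e" where
  "Yf g j = mkfield (c j) (\<lambda>x. (\<eta> j x)\<^sup>2 *\<^sub>R lgrad j g (chart_map (c j) x))"

definition Xf :: "('a => real) => 'a => 'e" where
  "Xf g x = (\<Sum>j\<in>{j. \<eta> j x \<noteq> 0}. Yf g j x)"

lemma Yf_zero: "\<eta> j x = 0 ==> Yf g j x = 0"
proof (cases "x \<in> chart_dom (c j)")
  case True
  have "linear (TT (c j) (at_chart x) (chart_map (c j) x))"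
    by (rule TT_linear[OF c chart_at(1) cset_cm[OF c True chart_at(2)]])
  then show "\<eta> j x = 0 ==> Yf g j x = 0" by (simp add: Yf_def mkfield_def linear_0)
qed (simp add: Yf_def mkfield_def)

lemma Yf_field:
  assumes g: "g \<in> smooth_functions A"
  shows "Yf g j \<in> vector_fields A"
proof -
  obtain K where K: "compact K" "K \<subseteq> chart_dom (c j)" "\<forall>x. x \<notin> K \<longrightarrow> \<eta> j x = 0" using supp[of j] by blast
  have U: "open (chart_img (c j))" by (rule chart_props(2)[OF c])
  show ?thesis unfolding Yf_def
  proof (rule mkfield_vector_field[OF c K(1,2)])
    show "smooth_on (chart_img (c j)) (\<lambda>y. (\<eta> j (chart_inv (c j) y))\<^sup>2 *\<^sub>R lgrad j g (chart_map (c j) (chart_inv (c j) y)))"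
      by (rule smooth_on_cong[OF U _ smooth_on_scaleR[OF U smooth_on_power[where m=2, OF U smooth_functionsD[OF eta[of j] c[of j]]]
              smooth_on_grad[OF U smooth_functionsD[OF g c]]]]) (simp add: chart_props(6)[OF c])
  qed (use K(3) in simp)
qed

lemma vf_in_chart_sum:
  assumes b: "b \<in> A" "y \<in> chart_img b" and X: "X (chart_inv b y) = (\<Sum>j\<in>I. Y j (chart_inv b y))"
  shows "vf_in_chart A b X y = (\<Sum>j\<in>I. vf_in_chart A b (Y j) y)"
proof -
  let ?x = "chart_inv b y"
  have "linear (TT (at_chart ?x) b (chart_map (at_chart ?x) ?x))"
    by (rule TT_linear[OF chart_at(1) b(1) cset_cm[OF chart_at chart_props(7)[OF b]]])
  from linear_sum[OF this] show ?thesis by (simp add: vf_in_chart_eq X)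
qed

lemma Xf_field:
  assumes g: "g \<in> smooth_functions A"
  shows "Xf g \<in> vector_fields A"
proof (rule vector_fieldsI)
  fix x
  let ?b = "at_chart x"
  obtain N m where N: "open N" "x \<in> N" "\<forall>z\<in>N. \<forall>j\<ge>m. \<eta> j z = 0" using fin[of x] by blast
  let ?N = "N \<inter> chart_dom ?b"
  have o: "open ?N" by (rule open_Int[OF N(1) chart_props(1)[OF chart_at(1)]])
  have S: "open (cset ?b ?N)" by (rule cset_open[OF chart_at(1) o])
  have "smooth_on (cset ?b ?N) (vf_in_chart A ?b (Xf g))"
  proof (rule smooth_on_cong[OF S])
    show "smooth_on (cset ?b ?N) (\<lambda>y. \<Sum>j<m. vf_in_chart A ?b (Yf g j) y)"
      by (rule smooth_on_sum[OF S]) (rule smooth_on_subset[OF vector_fieldsD[OF Yf_field[OF g] chart_at(1)] cset_subset])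
    fix y assume y: "y \<in> cset ?b ?N"
    have "Xf g (chart_inv ?b y) = (\<Sum>j<m. Yf g j (chart_inv ?b y))"
      unfolding Xf_def by (rule fin_sum) (use y N(3) in \<open>auto simp: cset_def intro: Yf_zero\<close>)
    from vf_in_chart_sum[where X="Xf g" and Y="Yf g", OF chart_at(1) csetD(1)[OF y] this]
    show "(\<Sum>j<m. vf_in_chart A ?b (Yf g j) y) = vf_in_chart A ?b (Xf g) y" by (rule sym)
  qed
  then show "\<exists>b\<in>A. \<exists>N. open N \<and> x \<in> N \<and> N \<subseteq> chart_dom b \<and> smooth_on (cset b N) (vf_in_chart A b (Xf g))"
    using o N(2) chart_at(2) by (intro bexI[OF _ chart_at(1)[of x]] exI[of _ ?N]) blast
qed

lemma Xf_derivative: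
  assumes g: "g \<in> smooth_functions A"
  shows "lie_function A (Xf g) g x = (\<Sum>j\<in>{j. \<eta> j x \<noteq> 0}. (\<eta> j x)\<^sup>2 * (lgrad j g (chart_map (c j) x) \<bullet> lgrad j g (chart_map (c j) x)))"
proof -
  let ?b = "at_chart x"
  have y: "chart_map ?b x \<in> chart_img ?b" using chart_at(2)[of x] by blast
  have "linear (fd (\<lambda>z. g (chart_inv ?b z)) (chart_map ?b x))"
    by (rule linear_fd[OF smooth_functionsD[OF g chart_at(1)] y])
  from linear_sum[OF this] have "lie_function A (Xf g) g x = (\<Sum>j\<in>{j. \<eta> j x \<noteq> 0}. lie_function A (Yf g j) g x)"
    by (simp add: lie_function_def Let_def o_def Xf_def)
  also have "\<dots> = (\<Sum>j\<in>{j. \<eta> j x \<noteq> 0}. (\<eta> j x)\<^sup>2 * (lgrad j g (chart_map (c j) x) \<bullet> lgrad j g (chart_map (c j) x)))"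
  proof (rule sum.cong[OF refl])
    fix j assume "j \<in> {j. \<eta> j x \<noteq> 0}"
    then have x: "x \<in> chart_dom (c j)" using supp_dom by simp
    let ?y = "chart_map (c j) x"
    have y: "?y \<in> chart_img (c j)" "chart_inv (c j) ?y = x" using x chart_props(5)[OF c x] by auto
    have "lie_function A (Yf g j) g (chart_inv (c j) ?y) = fd (\<lambda>z. g (chart_inv (c j) z)) ?y ((\<eta> j x)\<^sup>2 *\<^sub>R lgrad j g ?y)"
      unfolding lie_function_chart[OF g c y(1)] by (simp add: Yf_def vf_mkfield[OF c y(1)] y(2))
    then show "lie_function A (Yf g j) g x = (\<eta> j x)\<^sup>2 * (lgrad j g ?y \<bullet> lgrad j g ?y)"
      using fd_grad[OF smooth_functionsD[OF g c] y(1)] y(2) by simp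
  qed
  finally show ?thesis .
qed

lemma gradient_pair:
  "\<exists>X\<in>vector_fields A. \<exists>g\<in>smooth_functions A. \<exists>X'\<in>vector_fields A. \<exists>g'\<in>smooth_functions A.
    \<forall>x. lie_function A X g x \<ge> 0 \<and> lie_function A X' g' x \<ge> 0 \<and> lie_function A X g x + lie_function A X' g' x > 0"
proof -
  obtain a a' where a: "\<And>x. \<exists>J. \<eta> J x \<noteq> 0 \<and> (lgrad J (gf a) (chart_map (c J) x) \<noteq> 0 \<or> lgrad J (gf a') (chart_map (c J) x) \<noteq> 0)"
    using generic_functions by blast
  have nn: "lie_function A (Xf g) g x \<ge> 0" if "g \<in> smooth_functions A" for g x
    unfolding Xf_derivative[OF that] by (intro sum_nonneg mult_nonneg_nonneg) auto
  have pos: "lie_function A (Xf g) g x > 0" if "g \<in> smooth_functions A" "\<eta> J x \<noteq> 0" "lgrad J g (chart_map (c J) x) \<noteq> 0" for g x J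
    unfolding Xf_derivative[OF that(1)] by (rule sum_pos2[OF fin_at, of J]) (use that in auto)
  have "lie_function A (Xf (gf a)) (gf a) x + lie_function A (Xf (gf a')) (gf a') x > 0" for x
    using a[of x] pos[OF gf_smooth] nn[OF gf_smooth] by (metis add_nonneg_pos add_pos_nonneg)
  then show ?thesis using nn[OF gf_smooth]
    by (intro bexI[OF _ Xf_field[OF gf_smooth[of a]]] bexI[OF _ gf_smooth[of a]] bexI[OF _ Xf_field[OF gf_smooth[of a']]] bexI[OF _ gf_smooth[of a']]) blast
qed

end

context mfdp
begin

text \<open>Second countability gives countably many open sets \<open>Nx (pt j)\<close> that cover
  the manifold and on which \<open>\<psi> j\<close> is 1.\<close>

lemma bumps_exist: "\<exists>c \<eta>. bumps A c \<eta>"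
proof -
  define Q where "Q x c \<psi> N \<longleftrightarrow> c \<in> A \<and> \<psi> \<in> smooth_functions A \<and> (\<exists>K. compact K \<and> K \<subseteq> chart_dom c \<and> (\<forall>x. x \<notin> K \<longrightarrow> \<psi> x = 0)) \<and>
      open N \<and> x \<in> N \<and> (\<forall>z\<in>N. \<psi> z = (1::real))" for x c \<psi> N
  have "\<exists>c \<psi> N. Q x c \<psi> N" for x
  proof -
    obtain c y0 R kap where l: "loc A p c y0 R kap" "x = chart_inv c y0" using point_loc[of UNIV x] by auto
    interpret loc A p c y0 R kap by (rule l)
    have 1: "\<forall>z\<in>NV. lfun 1 z = 1" using kap_V by (auto simp: NV_def lfun_def kp_def)
    have 2: "\<exists>K. compact K \<and> K \<subseteq> chart_dom c \<and> (\<forall>x. x \<notin> K \<longrightarrow> lfun 1 x = 0)"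
      using K by (intro exI[of _ K]) (simp add: lfun_def)
    show ?thesis
      unfolding Q_def
      by (rule exI[of _ c], rule exI[of _ "lfun 1"], rule exI[of _ NV], intro conjI c smooth_lfun 2 NV_open 1) (simp only: l(2) NV_y0)
  qed
  then obtain cx \<psi>x Nx where Q: "\<And>x. Q x (cx x) (\<psi>x x) (Nx x)" by metis
  note C = Q[unfolded Q_def]
  note x = C[THEN conjunct1] C[THEN conjunct2, THEN conjunct1] C[THEN conjunct2, THEN conjunct2, THEN conjunct1]
    C[THEN conjunct2, THEN conjunct2, THEN conjunct2, THEN conjunct1] C[THEN conjunct2, THEN conjunct2, THEN conjunct2, THEN conjunct2, THEN conjunct1]
    C[THEN conjunct2, THEN conjunct2, THEN conjunct2, THEN conjunct2, THEN conjunct2, rule_format]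
  obtain F where F: "F \<subseteq> range Nx" "countable F" "\<Union>F = \<Union>(range Nx)"
    using Lindelof[of "range Nx"] x(4) by blast
  have U: "\<Union>F = UNIV" using F(3) x(5) by auto
  then have ne: "F \<noteq> {}" by auto
  have "\<exists>pt. from_nat_into F j = Nx pt" for j using from_nat_into[OF ne, of j] F(1) by auto
  then obtain pt where pt: "\<And>j. from_nat_into F j = Nx (pt j)" by metis
  have cov: "\<exists>j. z \<in> Nx (pt j)" for z
  proof -
    have "z \<in> \<Union>F" unfolding U by (rule UNIV_I)
    then obtain S where S: "S \<in> F" "z \<in> S" by (rule UnionE)
    obtain n where "from_nat_into F n = S" using from_nat_into_surj[OF F(2) S(1)] by (rule exE)
    then show ?thesis using S(2) by (intro exI[of _ n]) (simp only: pt[symmetric])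
  qed
  define \<psi> where "\<psi> j = \<psi>x (pt j)" for j
  \<comment> \<open>The product kills all later bumps where \<open>\<psi> j\<close> is 1, which
    gives local finiteness; at a point \<open>z\<close> the first index with
    \<open>\<psi> i z = 1\<close> has a nonzero bump.\<close>
  define \<eta> where "\<eta> j x = \<psi> j x * (\<Prod>i<j. (1 - \<psi> i x))" for j x
  have "bumps A (\<lambda>j. cx (pt j)) \<eta>"
  proof (unfold_locales)
    show "cx (pt j) \<in> A" for j by (rule x(1))
    have "(\<lambda>x. \<Prod>i<j. (1 - \<psi> i x)) \<in> smooth_functions A" for j
      by (induction j) (auto simp: \<psi>_def smooth_functions_const intro!: smooth_functions_mult smooth_functions_minus x(2))
    then show "\<eta> j \<in> smooth_functions A" for j
      unfolding \<eta>_def[abs_def] by (intro smooth_functions_mult) (simp_all add: \<psi>_def x(2))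
    show "\<exists>K. compact K \<and> K \<subseteq> chart_dom (cx (pt j)) \<and> (\<forall>x. x \<notin> K \<longrightarrow> \<eta> j x = 0)" for j
      using x(3)[of "pt j"] by (auto simp: \<eta>_def \<psi>_def)
    fix z
    obtain j where j: "z \<in> Nx (pt j)" using cov by blast
    have "\<eta> i y = 0" if "y \<in> Nx (pt j)" "i \<ge> Suc j" for i y
    proof -
      have "1 - \<psi> j y = 0" using x(6)[OF that(1)] by (simp add: \<psi>_def)
      then show ?thesis using that(2) unfolding \<eta>_def by (intro mult_eq_0_iff[THEN iffD2] disjI2 prod_zero) auto
    qed
    then show "\<exists>N m. open N \<and> z \<in> N \<and> (\<forall>y\<in>N. \<forall>i\<ge>m. \<eta> i y = 0)"
      by (intro exI[of _ "Nx (pt j)"] exI[of _ "Suc j"]) (use x(4) j in blast)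
    define i where "i = (LEAST i. \<psi> i z = 1)"
    have ex: "\<psi> j z = 1" using x(6)[OF j] by (simp add: \<psi>_def)
    have "\<psi> i z = 1" unfolding i_def by (rule LeastI[of "\<lambda>i. \<psi> i z = 1", OF ex])
    moreover have "\<psi> i' z \<noteq> 1" if "i' < i" for i' using not_less_Least[OF that[unfolded i_def]] .
    ultimately have "\<eta> i z \<noteq> 0" by (simp add: \<eta>_def)
    then show "\<exists>i. \<eta> i z \<noteq> 0" by blast
  qed
  then show ?thesis by blast
qed

end

section \<open>Locality on functions\<close>

context mfdp
begin

lemma one_form0: "p = 0 ==> one_form0 \<in> forms A p"
  unfolding forms_def one_form0_def form_in_chart_def alternating_multilinear_def Let_def
  by (auto simp: smooth_on_const)

lemma lie_one_form0:
  assumes p0: "p = 0" and X: "X \<in> vector_fields A"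
  shows "lie_form A X one_form0 x vs = 0"
proof (cases vs)
  case Nil
  have "fd (\<lambda>_. 1 :: real) y = (\<lambda>_. 0)" for y :: 'e by simp
  then show ?thesis by (simp add: Nil lie_form_0 lie_function_def Let_def o_def one_form0_def)
next
  case Cons
  then show ?thesis using p0 alternating_length[OF formsD(1)[OF lie_form_forms[OF one_form0[OF p0] X]], of vs x] by simp
qed

end

context loc
begin

lemma lop_ds:
  assumes "set \<alpha> \<subseteq> Basis" "\<omega> \<in> forms A p" "x \<in> NV"
  shows "lop (ds \<alpha>) \<omega> x = iter_deriv \<alpha> (co c \<omega>) (chart_map c x)"
proof -
  have x: "x \<in> chart_dom c" "chart_map c x \<in> V" using assms(3) by (auto simp: NV_def)
  then show ?thesis using assms hat_ds[OF assms(1) formsD(2)[OF assms(2) c], of "chart_map c x"] kap_V[OF x(2)]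
    by (simp add: lop_def liftop_def kp_def)
qed

lemma ds_Nil: "ds [] = (\<lambda>f :: 'e sfun. f)"
  by (rule ext) simp

lemma lop_id: "\<omega> \<in> forms A p ==> x \<in> NV ==> lop (\<lambda>f. f) \<omega> x = co c \<omega> (chart_map c x)"
  using lop_ds[of "[]" \<omega> x, unfolded ds_Nil] by simp

end

context mfdp
begin

lemma local_map_0:
  assumes T: "T \<in> invariant_maps A k p p" and p0: "p = 0"
  shows "local_map k T"
proof (rule local_mapI[OF T])
  fix D N x assume D: "D \<in> diff_ops A k p" and N: "open N" "eqN N D 0" and x: "x \<in> N"
  obtain c y0 R kap where l: "loc A p c y0 R kap" "x = chart_inv c y0" "chart_inv c ` cball y0 R \<subseteq> N" using point_loc[OF N(1) x] by auto
  interpret loc A p c y0 R kap by (rule l)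
  have KN: "K \<subseteq> N" using l by (simp add: K_def)
  have w0: "w = 0" unfolding w_def by (rule if_P[OF p0])
  let ?I = "lop (\<lambda>f. f)"
  have id: "(\<lambda>f :: 'e sfun. f) \<in> dopl (Suc m)" for m using ds_in_dopl[of "[] :: 'e list" "Suc m", unfolded ds_Nil] by simp
  have I: "?I \<in> diff_ops A m p" for m by (rule lop_diff_ops[OF id])
  have one: "one_form0 \<in> forms A p" by (rule one_form0[OF p0])
  have xNV: "x \<in> NV" using NV_y0 l(2) by simp
  have scalar: "\<exists>a. eqN NV (T G) (a *\<^sub>R ?I)" if G: "G \<in> diff_ops A k p" "eqN N G 0" for G
  proof -
    obtain m where TG: "T G \<in> diff_ops A m p" using invariantD(1)[OF T G(1)] by blast
    have "\<exists>a. eqop V (rep (T G)) (\<lambda>f. a *\<^sub>R f)"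
      by (rule invariant_operator_w0[OF V(2,1,3) rep_dopl[OF TG]]) (use vanishing_rep_invariant[OF T G(1) N(1) G(2) KN] w0 in simp)
    then obtain a where a: "eqop V (rep (T G)) (\<lambda>f. a *\<^sub>R f)" by blast
    have "eqop V (rep (T G)) (rep (a *\<^sub>R ?I))"
    proof (rule eqopI)
      fix f y assume y: "y \<in> V"
      show "ev (rep (T G) f) y = ev (rep (a *\<^sub>R ?I) f) y"
        using eqopD[OF a y, of f] eqopD[OF rep_lop[OF id[of 0]] y, of f] ev_rep_V[OF I[of 0] y, of f]
          ev_rep_V[OF diff_ops_scaleR[OF I[of 0], of a] y, of f] by simp
    qed
    then show ?thesis using rep_eqN[OF TG diff_ops_scaleR[OF I[of 0]]] by blast
  qed
  have const: "T G one_form0 z = a" if a: "eqN NV (T G) (a *\<^sub>R ?I)" and z: "z \<in> NV" for G a z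
  proof -
    have "T G one_form0 z = a * ?I one_form0 z" using a one z by (simp add: eqN_def)
    also have "?I one_form0 z = 1" unfolding lop_id[OF one z] co_0[OF p0] by (simp add: one_form0_def)
    finally show ?thesis by simp
  qed
  \<comment> \<open>For \<open>G\<close> vanishing on \<open>N\<close>, the operator
    \<open>T G\<close> is multiplication by a constant near \<open>x\<close>, which is read off on
    the function 1.\<close>
  define \<tau> where "\<tau> G = T G one_form0 x" for G
  \<comment> \<open>The field is arbitrary here, not only one supported near \<open>x\<close>: as
    \<open>T G\<close> is a constant near \<open>x\<close>, its Lie derivative, evaluated on the
    function 1 at \<open>x\<close>, is zero.\<close>
  have lie0: "\<tau> (lie_op A p X G) = 0" if G: "G \<in> diff_ops A k p" "eqN N G 0" and X: "X \<in> vector_fields A" for X G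
  proof -
    obtain m where TG: "T G \<in> diff_ops A m p" using invariantD(1)[OF T G(1)] by blast
    obtain a where a: "eqN NV (T G) (a *\<^sub>R ?I)" using scalar[OF G] by blast
    have y: "y0 \<in> chart_img c" using V by blast
    have "fd (\<lambda>y. T G one_form0 (chart_inv c y)) y0 = fd (\<lambda>_. a) y0"
      by (rule fd_cong[OF V(1,5)]) (rule const[OF a], use NV_iff in blast)
    then have "lie_function A X (T G one_form0) x = 0"
      unfolding l(2) lie_function_chart[OF diff_ops_smooth[OF TG one] c y] by simp
    moreover have "T G (lie_form A X one_form0) x = 0"
      by (rule diff_ops_zero_form[OF TG lie_form_forms[OF one X] open_UNIV UNIV_I]) (rule lie_one_form0[OF p0 X])
    ultimately show ?thesis unfolding \<tau>_def invariantD(4)[OF T X G(1)] using one by (simp add: lie_op_def)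
  qed
  have add: "\<tau> (G + G') = \<tau> G + \<tau> G'" if "G \<in> dlt (Suc k)" "G' \<in> dlt (Suc k)" for G G'
    using invariantD(2)[OF T] that by (simp add: \<tau>_def dlt_Suc)
  have scale: "\<tau> (r *\<^sub>R G) = r * \<tau> G" if "G \<in> dlt (Suc k)" for r G
    using invariantD(3)[OF T] that by (simp add: \<tau>_def dlt_Suc)
  have power: "\<exists>m. \<forall>G\<in>dlt (Suc k). eqN N G 0 \<longrightarrow> \<tau> (lm (\<lambda>x. lie_function A X g x ^ m) G) = 0"
    if X: "X \<in> vector_fields A" and g: "g \<in> smooth_functions A" for X g
  proof (rule power_annihilated[OF p0 X g _ _ _ order_refl])
    fix G assume G: "G \<in> dlt (Suc k)" "eqN N G 0"
    let ?S = "lm (lie_function A X g) G + rx X (cm g G)"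
    have G': "G \<in> diff_ops A k p" "lm g G \<in> diff_ops A k p" "eqN N (lm g G) 0"
      using G dlt_lm[OF G(1) g] by (simp_all add: dlt_Suc eqN_def lm_def)
    have Y: "(\<lambda>x. g x *\<^sub>R X x) \<in> vector_fields A" by (rule vector_field_scale[OF g X])
    have S: "?S \<in> dlt (Suc k)" by (rule dlt_add[OF dlt_lm[OF G(1) lie_function_smooth[OF X g]] dlt_rx[OF p0 dlt_cm[OF G(1) g] X]])
    have "\<tau> (lie_op A p (\<lambda>x. g x *\<^sub>R X x) G + ?S) = 0"
      using lie0[OF G'(2,3) X] unfolding commutator_identity[OF p0 X g G'(1)] .
    moreover have "lie_op A p (\<lambda>x. g x *\<^sub>R X x) G \<in> dlt (Suc k)" unfolding dlt_Suc by (rule lie_op_diff_ops[OF G'(1) Y])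
    ultimately show "\<tau> ?S = 0" using add[OF _ S] lie0[OF G'(1) G(2) Y] by simp
  qed (rule add, assumption+, rule scale)
  obtain c' \<eta> where b: "bumps A c' \<eta>" using bumps_exist by blast
  obtain X g X' g' where X: "X \<in> vector_fields A" "g \<in> smooth_functions A" "X' \<in> vector_fields A" "g' \<in> smooth_functions A"
    and pos: "\<And>x. lie_function A X g x \<ge> 0" "\<And>x. lie_function A X' g' x \<ge> 0" "\<And>x. lie_function A X g x + lie_function A X' g' x > 0"
    using bumps.gradient_pair[OF b] by blast
  let ?r = "lie_function A X g" and ?r' = "lie_function A X' g'"
  obtain m m' where m: "\<And>G. G \<in> dlt (Suc k) ==> eqN N G 0 ==> \<tau> (lm (\<lambda>x. ?r x ^ m) G) = 0"
    "\<And>G. G \<in> dlt (Suc k) ==> eqN N G 0 ==> \<tau> (lm (\<lambda>x. ?r' x ^ m') G) = 0"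
    using power[OF X(1,2)] power[OF X(3,4)] by blast
  \<comment> \<open>A nowhere vanishing function by which \<open>D\<close> is divided: the products
    of the quotient with the two powers vanish on \<open>N\<close> and under \<open>\<tau>\<close>,
    and their sum is \<open>D\<close>.\<close>
  define \<sigma> where "\<sigma> x = ?r x ^ m + ?r' x ^ m'" for x
  have pw: "(\<lambda>x. f x ^ n) \<in> smooth_functions A" if "f \<in> smooth_functions A" for f and n :: nat
    by (induction n) (simp_all add: smooth_functions_const smooth_functions_mult[OF that])
  have r: "(\<lambda>x. ?r x ^ m) \<in> smooth_functions A" "(\<lambda>x. ?r' x ^ m') \<in> smooth_functions A"
    by (intro pw lie_function_smooth X)+
  have s0: "\<sigma> x \<noteq> 0" for x
  proof -
    have "?r x > 0 \<or> ?r' x > 0" using pos(1)[of x] pos(2)[of x] pos(3)[of x] by linarith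
    then have "\<sigma> x > 0" unfolding \<sigma>_def
      using zero_less_power[of "?r x" m] zero_less_power[of "?r' x" m'] zero_le_power[OF pos(1), of x m] zero_le_power[OF pos(2), of x m'] by linarith
    then show ?thesis by simp
  qed
  have s: "(\<lambda>x. inverse (\<sigma> x)) \<in> smooth_functions A"
    unfolding smooth_functions_iff
  proof
    fix b assume b: "b \<in> A"
    have "\<sigma> \<in> smooth_functions A" unfolding \<sigma>_def[abs_def] by (intro smooth_functions_add r)
    from smooth_on_inverse[OF chart_props(2)[OF b] _ smooth_functionsD[OF this b]] s0
    show "smooth_on (chart_img b) (\<lambda>y. inverse (\<sigma> (chart_inv b y)))" by blast
  qed
  let ?D = "lm (\<lambda>x. inverse (\<sigma> x)) D"
  have D': "?D \<in> dlt (Suc k)" by (rule dlt_lm[OF _ s]) (simp add: dlt_Suc D)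
  have DN: "eqN N ?D 0" using N(2) by (simp add: eqN_def lm_def)
  have "lm (\<lambda>x. ?r x ^ m) ?D + lm (\<lambda>x. ?r' x ^ m') ?D = D"
  proof (intro ext)
    fix \<omega> x
    have "?r x ^ m * (inverse (\<sigma> x) * D \<omega> x) + ?r' x ^ m' * (inverse (\<sigma> x) * D \<omega> x) = \<sigma> x * inverse (\<sigma> x) * D \<omega> x"
      by (simp add: \<sigma>_def algebra_simps)
    then show "(lm (\<lambda>x. ?r x ^ m) ?D + lm (\<lambda>x. ?r' x ^ m') ?D) \<omega> x = D \<omega> x" using s0[of x] by (simp add: lm_def)
  qed
  then have t0: "\<tau> D = 0" using add[OF dlt_lm[OF D' r(1)] dlt_lm[OF D' r(2)]] m(1)[OF D' DN] m(2)[OF D' DN] by simp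
  obtain a where a: "eqN NV (T D) (a *\<^sub>R ?I)" using scalar[OF D N(2)] by blast
  then have "a = 0" using const[OF a xNV] t0 by (simp add: \<tau>_def)
  then have "eqN NV (T D) 0" using a by (simp add: eqN_def)
  then show "\<exists>N'. x \<in> N' \<and> eqN N' (T D) 0" using xNV by blast
qed

section \<open>The operator \<open>I\<^sub>0\<close>\<close>

lemma I0_eq: "p = 0 ==> D \<in> diff_ops A k p ==> \<omega> \<in> forms A p ==> I0_map A k D \<omega> x = D one_form0 x * \<omega> x []"
  by (simp add: I0_map_def)

lemma I0_diff_ops:
  assumes p0: "p = 0" and D: "D \<in> diff_ops A k p"
  shows "I0_map A k D \<in> diff_ops A 0 p"
proof (rule diff_opsI)
  show "I0_map A k D \<omega> = 0" if "\<omega> \<notin> forms A p" for \<omega> using that D by (simp add: I0_map_def p0)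
  fix c assume c: "c \<in> A"
  have s: "smooth_on (chart_img c) (\<lambda>y. D one_form0 (chart_inv c y))"
    by (rule smooth_functionsD[OF diff_ops_smooth[OF D one_form0[OF p0]] c])
  have "(\<lambda>f y. D one_form0 (chart_inv c y) * iter_deriv [] f y) \<in> dopU (chart_img c) (Suc 0)"
    by (rule dopU.monom[OF _ _ s]) auto
  then show "\<exists>Q\<in>dopU (chart_img c) (Suc 0). in_chart c (I0_map A k D) Q"
    by (rule bexI[rotated]) (simp add: I0_eq[OF p0 D] co_0[OF p0])
qed

lemma I0_invariant:
  assumes p0: "p = 0"
  shows "I0_map A k \<in> invariant_maps A k p p"
  unfolding invariant_maps_def mem_Collect_eq
proof (intro conjI ballI allI impI)
  fix D assume D: "D \<in> diff_ops A k p"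
  show "I0_map A k D \<in> all_diff_ops A p" using I0_diff_ops[OF p0 D] unfolding all_diff_ops_def by blast
  have off: "I0_map A k E \<omega> = 0" if "\<omega> \<notin> forms A p" "E \<in> diff_ops A k p" for E \<omega>
    using diff_ops_off[OF I0_diff_ops[OF p0 that(2)] that(1)] .
  show "I0_map A k (D + E) = I0_map A k D + I0_map A k E" if E: "E \<in> diff_ops A k p" for E
  proof (intro ext)
    fix \<omega> x
    show "I0_map A k (D + E) \<omega> x = (I0_map A k D + I0_map A k E) \<omega> x"
      by (cases "\<omega> \<in> forms A p") (simp_all add: I0_eq[OF p0] D E diff_ops_plus off distrib_right)
  qed
  show "I0_map A k (r *\<^sub>R D) = r *\<^sub>R I0_map A k D" for r
  proof (intro ext)
    fix \<omega> x
    show "I0_map A k (r *\<^sub>R D) \<omega> x = (r *\<^sub>R I0_map A k D) \<omega> x"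
      by (cases "\<omega> \<in> forms A p") (simp_all add: I0_eq[OF p0] D diff_ops_scaleR off)
  qed
  show "I0_map A k (lie_op A p X D) = lie_op A p X (I0_map A k D)" if X: "X \<in> vector_fields A" for X
  proof (intro ext)
    fix \<omega> x
    show "I0_map A k (lie_op A p X D) \<omega> x = lie_op A p X (I0_map A k D) \<omega> x"
    proof (cases "\<omega> \<in> forms A p")
      case w: True
      have one: "one_form0 \<in> forms A p" by (rule one_form0[OF p0])
      have "D (lie_form A X one_form0) x = 0"
        by (rule diff_ops_zero_form[OF D lie_form_forms[OF one X] open_UNIV UNIV_I]) (rule lie_one_form0[OF p0 X])
      then have 1: "I0_map A k (lie_op A p X D) \<omega> x = lie_function A X (D one_form0) x * \<omega> x []"
        unfolding I0_eq[OF p0 lie_op_diff_ops[OF D X] w] using one by (simp add: lie_op_def)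
      have 2: "I0_map A k D \<omega> = (\<lambda>x. D one_form0 x * \<omega> x [])" by (rule ext) (rule I0_eq[OF p0 D w])
      show ?thesis unfolding 1 using w I0_eq[OF p0 D lie_form_forms[OF w X], of x]
          lie_function_mult[OF diff_ops_smooth[OF D one] form0_smooth[OF p0 w], of X x]
        by (simp add: lie_op_def 2 lie_form_0)
    next
      case False
      then have "lie_op A p X (I0_map A k D) \<omega> = 0" by (simp add: lie_op_def zero_fun_def)
      then show ?thesis by (simp only: off[OF False lie_op_diff_ops[OF D X]])
    qed
  qed
next
  fix D assume "D \<notin> diff_ops A k p"
  then show "I0_map A k D = 0" by (simp add: I0_map_def p0)
qed

theorem classification_0:
  assumes p0: "p = 0" and T: "T \<in> invariant_maps A k p p" and dim: "DIM('e) \<ge> 2" and k: "k \<ge> 1"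
  shows "\<exists>a b. \<forall>D\<in>diff_ops A k p. T D = a *\<^sub>R D + b *\<^sub>R I0_map A k D"
proof (rule global_classification[OF T local_map_0[OF T p0] dim k I0_invariant[OF p0] local_map_0[OF I0_invariant[OF p0] p0], of 0])
  fix c y0 R kap assume l: "loc A p c y0 R kap"
  interpret loc A p c y0 R kap by (rule l)
  have one: "one_form0 \<in> forms A p" by (rule one_form0[OF p0])
  have co1: "co c one_form0 = (\<lambda>_. 1)" by (rule ext) (simp add: co_0[OF p0] one_form0_def)
  have D: "lop (ds \<alpha>) \<in> diff_ops A k p" if "set \<alpha> \<subseteq> Basis" "length \<alpha> \<le> k" for \<alpha>
    by (rule lop_diff_ops[OF ds_in_dopl]) (use that in auto)
  show "eqN NV (I0_map A k (lop (\<lambda>f. f))) (lop (\<lambda>f. f))"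
    unfolding eqN_def
  proof (intro ballI)
    fix \<omega> x assume w: "\<omega> \<in> forms A p" and x: "x \<in> NV"
    have "chart_inv c (chart_map c x) = x" using x by (intro chart_props(5)[OF c]) (simp add: NV_def)
    then show "I0_map A k (lop (\<lambda>f. f)) \<omega> x = lop (\<lambda>f. f) \<omega> x"
      using I0_eq[OF p0 D[of "[]"] w, of x] by (simp add: ds_Nil lop_id[OF _ x] one w co1) (simp add: co_0[OF p0])
  qed
  fix i :: 'e assume i: "i \<in> Basis"
  have 1: "ds [i] = dv i" by (simp add: fun_eq_iff)
  show "eqN NV (I0_map A k (lop (dv i))) (0 *\<^sub>R lop (dv i))"
    unfolding eqN_def
  proof (intro ballI)
    fix \<omega> x assume w: "\<omega> \<in> forms A p" and x: "x \<in> NV"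
    have "lop (ds [i]) one_form0 x = 0" using i lop_ds[of "[i]", OF _ one x] by (simp add: co1)
    then show "I0_map A k (lop (dv i)) \<omega> x = (0 *\<^sub>R lop (dv i)) \<omega> x"
      using I0_eq[OF p0 D[of "[i]"] w, of x] i k by (simp add: 1)
  qed
qed simp

section \<open>The invariant maps as a span\<close>

lemma subspace_invariant_maps: "subspace (invariant_maps A k p p)"
  unfolding subspace_def
proof (intro conjI ballI allI)
  have all: "D + E \<in> all_diff_ops A p" if D: "D \<in> all_diff_ops A p" and E: "E \<in> all_diff_ops A p" for D E :: "('a, 'e) diffop"
  proof -
    obtain l m where "D \<in> diff_ops A l p" "E \<in> diff_ops A m p" using D E unfolding all_diff_ops_def by blast
    then have "D + E \<in> diff_ops A (max l m) p" by (intro diff_ops_plus) (auto intro: diff_ops_mono)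
    then show ?thesis unfolding all_diff_ops_def by blast
  qed
  have all': "r *\<^sub>R D \<in> all_diff_ops A p" if D: "D \<in> all_diff_ops A p" for r and D :: "('a, 'e) diffop"
    using that diff_ops_scaleR unfolding all_diff_ops_def by blast
  have lp: "lie_op A p X (D + E) = lie_op A p X D + lie_op A p X E"
    if X: "X \<in> vector_fields A" and DE: "D \<in> all_diff_ops A p" "E \<in> all_diff_ops A p" for X and D E :: "('a, 'e) diffop"
  proof (intro ext)
    fix \<omega> x
    obtain l m where l: "D \<in> diff_ops A l p" "E \<in> diff_ops A m p" using DE unfolding all_diff_ops_def by blast
    show "lie_op A p X (D + E) \<omega> x = (lie_op A p X D + lie_op A p X E) \<omega> x"
    proof (cases "\<omega> \<in> forms A p")
      case w: True
      let ?c = "at_chart x" let ?y = "chart_map ?c x"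
      have y: "?y \<in> chart_img ?c" using chart_at(2)[of x] by blast
      have ci: "chart_inv ?c ?y = x" by (rule chart_props(5)[OF chart_at])
      note s = diff_ops_smooth[OF l(1) w] diff_ops_smooth[OF l(2) w]
      have "lie_function A X (\<lambda>z. D \<omega> z + E \<omega> z) x = lie_function A X (D \<omega>) x + lie_function A X (E \<omega>) x"
        using lie_function_chart[OF smooth_functions_add[OF s] chart_at(1) y, of X] lie_function_chart[OF s(1) chart_at(1) y, of X]
          lie_function_chart[OF s(2) chart_at(1) y, of X] fd_add[OF smooth_functionsD[OF s(1) chart_at(1)] smooth_functionsD[OF s(2) chart_at(1)] y]
        by (simp add: ci)
      then show ?thesis using w by (simp add: lie_op_def plus_fun_def)
    qed (simp add: lie_op_def)
  qed
  have ls: "lie_op A p X (r *\<^sub>R D) = r *\<^sub>R lie_op A p X D" if X: "X \<in> vector_fields A" and D: "D \<in> all_diff_ops A p" for X r and D :: "('a, 'e) diffop"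
  proof (intro ext)
    fix \<omega> x
    obtain l where l: "D \<in> diff_ops A l p" using D unfolding all_diff_ops_def by blast
    show "lie_op A p X (r *\<^sub>R D) \<omega> x = (r *\<^sub>R lie_op A p X D) \<omega> x"
    proof (cases "\<omega> \<in> forms A p")
      case w: True
      let ?c = "at_chart x" let ?y = "chart_map ?c x"
      have y: "?y \<in> chart_img ?c" using chart_at(2)[of x] by blast
      have "lie_function A X (r *\<^sub>R D \<omega>) x = r * lie_function A X (D \<omega>) x"
        using lie_function_mult[OF smooth_functions_const[of r] diff_ops_smooth[OF l w], of X x]
        by (simp add: lie_function_def Let_def o_def scaleR_fun_def)
      then show ?thesis using w by (simp add: lie_op_def right_diff_distrib)
    qed (simp add: lie_op_def)
  qed
  show "0 \<in> invariant_maps A k p p"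
  proof -
    have z: "(0 :: ('a, 'e) diffop) \<in> all_diff_ops A p" using diff_ops_zero[of 0] unfolding all_diff_ops_def by blast
    have l: "lie_op A p X 0 = 0" if "X \<in> vector_fields A" for X
      using ls[OF that z, of 0] by (simp only: scaleR_zero_left)
    have 0: "(0 :: ('a, 'e) diffop => ('a, 'e) diffop) D = 0" for D by (rule zero_fun_apply)
    show ?thesis unfolding invariant_maps_def mem_Collect_eq
      by (intro conjI ballI allI impI) (simp_all only: 0 z l add_0_left scaleR_zero_right)
  qed
  fix S T assume S: "S \<in> invariant_maps A k p p" and T: "T \<in> invariant_maps A k p p"
  have a: "S D \<in> all_diff_ops A p" "T D \<in> all_diff_ops A p" if "D \<in> diff_ops A k p" for D
    using S T that unfolding invariant_maps_def by blast+
  show "S + T \<in> invariant_maps A k p p"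
    unfolding invariant_maps_def mem_Collect_eq
    by (intro conjI ballI allI impI)
      (simp_all add: invariantD[OF S] invariantD[OF T] all a lp scaleR_add_right)
  fix r
  have a: "T D \<in> all_diff_ops A p" if "D \<in> diff_ops A k p" for D using T that unfolding invariant_maps_def by blast
  show "r *\<^sub>R T \<in> invariant_maps A k p p"
    unfolding invariant_maps_def mem_Collect_eq
    by (intro conjI ballI allI impI) (simp_all add: invariantD[OF T] all' a ls scaleR_add_right scaleR_left_commute)
qed

lemma id_map_invariant: "id_map A k p \<in> invariant_maps A k p p"
  unfolding invariant_maps_def mem_Collect_eq id_map_def
  by (auto simp: all_diff_ops_def diff_ops_plus diff_ops_scaleR lie_op_diff_ops)

lemma invariant_maps_eq_span:
  assumes U: "U \<in> invariant_maps A k p p"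
    and T: "\<And>T. T \<in> invariant_maps A k p p ==> \<exists>a b. \<forall>D\<in>diff_ops A k p. T D = a *\<^sub>R D + b *\<^sub>R U D"
  shows "invariant_maps A k p p = span {id_map A k p, U}"
proof
  show "span {id_map A k p, U} \<subseteq> invariant_maps A k p p"
    by (rule span_minimal[OF _ subspace_invariant_maps]) (simp add: id_map_invariant U)
  show "invariant_maps A k p p \<subseteq> span {id_map A k p, U}"
  proof
    fix S assume S: "S \<in> invariant_maps A k p p"
    obtain a b where ab: "\<forall>D\<in>diff_ops A k p. S D = a *\<^sub>R D + b *\<^sub>R U D" using T[OF S] by blast
    have "S = a *\<^sub>R id_map A k p + b *\<^sub>R U"
    proof
      fix D
      show "S D = (a *\<^sub>R id_map A k p + b *\<^sub>R U) D"
        using ab by (cases "D \<in> diff_ops A k p") (simp_all add: id_map_def invariantD(5)[OF S] invariantD(5)[OF U])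
    qed
    then show "S \<in> span {id_map A k p, U}" by (simp add: span_add span_scale span_base)
  qed
qed

lemma invariant_maps_0:
  assumes L: "\<And>T. T \<in> invariant_maps A 0 p p ==> local_map 0 T" and dim: "DIM('e) \<ge> 2"
  shows "invariant_maps A 0 p p = span {id_map A 0 p}"
proof -
  \<comment> \<open>The general span lemma, with the identity as both generators.\<close>
  have "invariant_maps A 0 p p = span {id_map A 0 p, id_map A 0 p}"
  proof (rule invariant_maps_eq_span[OF id_map_invariant])
    fix T assume T: "T \<in> invariant_maps A 0 p p"
    obtain a where "\<forall>D\<in>diff_ops A 0 p. T D = a *\<^sub>R D" using global_classification_0[OF T L[OF T] dim] by blast
    then show "\<exists>a b. \<forall>D\<in>diff_ops A 0 p. T D = a *\<^sub>R D + b *\<^sub>R id_map A 0 p D"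
      by (intro exI[of _ a] exI[of _ 0]) simp
  qed
  then show ?thesis by simp
qed

end

theorem theorem12:
  fixes A :: "('a::{second_countable_topology, t2_space}, 'e::euclidean_space) chart set"
    and k :: nat
  assumes "smooth_manifold A"
    and "DIM('e) \<ge> 2"
  shows "invariant_maps A 0 0 0 = span {id_map A 0 0} \<and>
    invariant_maps A 0 DIM('e) DIM('e) = span {id_map A 0 DIM('e)} \<and>
    (k \<noteq> 0 \<longrightarrow>
      invariant_maps A k 0 0 = span {id_map A k 0, I0_map A k} \<and>
      invariant_maps A k DIM('e) DIM('e) = span {id_map A k DIM('e), conj_map A k})"
proof (intro conjI impI)
  interpret F: mfdp A 0 using assms(1) by unfold_locales auto
  interpret T: mfdp A "DIM('e)" using assms(1) by unfold_locales auto
  have top: "DIM('e) \<noteq> 0" using assms(2) by simp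
  show "invariant_maps A 0 0 0 = span {id_map A 0 0}"
    by (rule F.invariant_maps_0[OF F.local_map_0[OF _ refl] assms(2)])
  show "invariant_maps A 0 DIM('e) DIM('e) = span {id_map A 0 DIM('e)}"
    by (rule T.invariant_maps_0[OF T.local_map_top[OF _ top] assms(2)])
  assume "k \<noteq> 0"
  then have k: "k \<ge> 1" by simp
  show "invariant_maps A k 0 0 = span {id_map A k 0, I0_map A k}"
    by (rule F.invariant_maps_eq_span[OF F.I0_invariant[OF refl] F.classification_0[OF refl _ assms(2) k]])
  show "invariant_maps A k DIM('e) DIM('e) = span {id_map A k DIM('e), conj_map A k}"
    by (rule T.invariant_maps_eq_span[OF T.conj_map_invariant[OF top] T.classification_top[OF top _ assms(2) k]])
qed

end
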